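(* Let $d\ge2$ and let $T\in\mathcal X^3_d$ be a GIET satisfying the Regular Diophantine Condition (RDC), with associated sequences $(n_k)_{k\in\mathbb N}$, $(k_m)_{m\in\mathbb N}$. Assume that the shape log-slope vectors $\omega_n=\omega(\mathcal Z^n(T))$ are bounded along the times $n_{k_m}$, i.e. $\sup_m\|\omega_{n_{k_m}}\|<\infty$, and that the boundary of $T$ vanishes, $\mathcal B(T)=0$. Then the orbit of $T$ under renormalization converges exponentially fast to the space $\mathcal I_d$ of standard IETs in the $\mathcal C^1$-distance: there exist $K_1=K_1(T)>0$ and $0<\alpha=\alpha(T)<1$ such that $$d_{\mathcal C^1}(\mathcal Z^n(T),\mathcal I_d)\le K_1\,\alpha^n\qquad\text{for all }n\in\mathbb N.$$
   Context: GIETs. A $\mathcal C^r$ generalized interval exchange transformation (GIET) on $d\ge 2$ intervals is a map $T$ of $[0,1]$ (defined up to finitely many points) together with two partitions, up to finitely many points, of $[0,1]$ into open intervals $I^t_1,\dots,I^t_d$ (top) and $I^b_1,\dots,I^b_d$ (bottom), such that for each $i$ the map $T$ restricts to an orientation-preserving $\mathcal C^r$-diffeomorphism $I^t_i\to I^b_i$ extending to a $\mathcal C^r$-diffeomorphism of the closures. Its combinatorial datum is the pair $\pi=(\pi_t,\pi_b)$ of permutations of $\{1,\dots,d\}$ such that, from left to right, the top intervals are $I^t_{\pi_t(1)},\dots,I^t_{\pi_t(d)}$ and the bottom ones $I^b_{\pi_b(1)},\dots,I^b_{\pi_b(d)}$; $\pi$ is irreducible if $\pi_t\{1,\dots,k\}\neq\pi_b\{1,\dots,k\}$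 for $1\le k<d$. $\mathcal X^r_d$ is the set of $\mathcal C^r$ GIETs on $d$ intervals with irreducible datum. A standard IET is a GIET whose branches are translations; $\mathcal I_d\subset\mathcal X^r_d$ is the set of standard IETs. The shape log-slope vector of $T$ is $\omega(T)=\big(\log(|I^b_j|/|I^t_j|)\big)_{1\le j\le d}$. Distance. The shape $A_T$ of $T$ is the unique GIET with the same top and bottom partitions all of whose branches are affine; it is parametrised by $\pi$, the lengths $\lambda_i=|I^t_i|$ and the slopes $\rho_i=|I^b_i|/|I^t_i|$. The profile is $\varphi_T=(\varphi_T^1,\dots,\varphi_T^d)$, where $\varphi_T^i\in\mathrm{Diff}^r([0,1])$ is the branch $T|_{I^t_i}$ pre- and post-composed with the orientation-preserving affine maps $[0,1]\to I^t_i$ and $I^b_i\to[0,1]$. The distance $d_{\mathcal C^1}$ on $\mathcal X^r_d$ is the product distance in the coordinates $(\pi,A_T,\varphi_T)$ built from the discrete distance on $\pi$, the Euclidean distance on $(\lambda,\rho)$, and $\sum_i(\|\varphi^i-\psi^i\|_\infty+\|D\varphi^i-D\psi^i\|_\infty)$ on profiles; $d_{\mathcal C^1}(T,\mathcal I_d)$ is the infimum of the distances from $T$ to elements of $\mathcal I_d$. Boundary. Let $0=u_0<u_1<\dots<u_d=1$ be the endpoints of the top intervals. Consider the $2d$-element set of symbols $\{U_0=V_0,U_1,V_1,\dots,U_{d-1},V_{d-1},U_d=V_d\}$ and its permutation $\sigma$ given by $\sigma(U_i)=V_j$ if $\pi_b(j+1)=\pi_t(i+1)$ (for $0\le i<d$)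 and $\sigma(V_k)=U_\ell$ if $\pi_t(\ell)=\pi_b(k)$ (for $0<k\le d$), with cycles $C_1,\dots,C_\kappa$. For $f$ continuous on each $I^t_i$ and extending continuously to its closure, with left and right limits $f^l(u_i),f^r(u_i)$ and convention $f^l(u_0)=0=f^r(u_d)$, put $B(f)=(b_s)_{s=1}^\kappa$, $b_s=\sum_{0\le i\le d,\,U_i\in C_s}(f^r(u_i)-f^l(u_i))$. Then $\mathcal B(T)=B(\log DT)$. Renormalization. Let $I^t_\alpha,I^b_\beta$ ($\alpha=\pi_t(d)$, $\beta=\pi_b(d)$) be the rightmost top and bottom intervals. If their lengths differ, the label of the longer one is the winner and the other the loser; the elementary Rauzy–Veech step $\mathcal V(T)$ is the first return map of $T$ to $[0,1]$ minus the shorter of the two, rescaled affinely to $[0,1]$. It is a GIET on $d$ intervals, where points with first return time $2$ get the loser's label and other points keep their label. $T$ is infinitely renormalizable if all $\mathcal V^n(T)$ are defined; its rotation number $\gamma(T)$ is the infinite sequence of combinatorial data and types (top or bottom winner) of the steps; it is irrational if every label wins infinitely often. The Zorich acceleration $\mathcal Z$ performs together a maximal block of consecutive steps of the same type. $\mathcal Z^n(T)$ is the affine rescaling of the first return map $T_n$ of $T$ to some interval $I^{(n)}=[0,\lambda_n]$, with continuity intervals $I^{(n)}_j$ and first return times $q^{(n)}_j$. For $m\le n$, $Q(m,n)\in SL(d,\mathbb Z)$ is the matrix whose $(i,j)$ entry is the number of visits to $I^{(m)}_j$ of the $T_m$-orbit of a point of $I^{(n)}_i$ (starting point included) before its first return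 to $I^{(n)}$; thus $q^{(n)}=Q(m,n)q^{(m)}$ and $Q(m,p)=Q(n,p)Q(m,n)$. These matrices depend only on $\gamma(T)$. RDC. Let $g$ be the genus of the surface obtained by suspending $T$ (determined by $\pi$). An Oseledets generic extension is a sequence of splittings $\mathbb R^d=\Gamma^{(n)}_s\oplus\Gamma^{(n)}_c\oplus\Gamma^{(n)}_u$, $n\ge0$, with $Q(m,n)\Gamma_x^{(m)}=\Gamma_x^{(n)}$, $\dim\Gamma_s^{(n)}=\dim\Gamma_u^{(n)}=g$, such that for some $\theta,C>0$ and all $n$: $\|Q(0,n)v\|\le Ce^{-\theta n}\|v\|$ for $v\in\Gamma_s^{(0)}$; $\|Q(0,n)^{-1}v\|\le Ce^{-\theta n}\|v\|$ for $v\in\Gamma_u^{(n)}$; $\lim_n\frac1n\log\|Q(0,n)v\|=0$ for $0\ne v\in\Gamma_c^{(0)}$; and for every $\epsilon>0$ there is $c(\epsilon)>0$ with $|\sin\angle(\Gamma^{(n)}_x,\Gamma^{(n)}_y)|\ge c(\epsilon)e^{-\epsilon n}$ for distinct $x,y\in\{s,c,u\}$ ($\angle$ is the minimal angle between nonzero vectors). $P_x^{(n)}$ denotes the projection onto $\Gamma_x^{(n)}$ along the splitting. A sequence $(n_k)$ is a sequence of good return times if there are $p\ge1$ and a matrix $A$ with strictly positive entries, a product of $p$ successive Zorich cocycle matrices ($A=Q(0,p)$ for some standard IET), with $Q(n_k,n_k+2p)=AA$ and $n_{k+1}-n_k\ge2p$ for all $k$. Write $\widetilde Q(k,k')=Q(n_k,n_{k'})$,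 $\widetilde Z_k=\widetilde Q(k,k+1)$, $\widetilde\Gamma^{(k)}_x=\Gamma^{(n_k)}_x$, $\widetilde P^{(k)}_x=P^{(n_k)}_x$ (with the convention $n_0=0$). A standard IET, and its rotation number, satisfies the RDC if (i) it has an Oseledets generic extension; (ii) there is a sequence $(n_k)$ of good return times with $\lim n_k/k<\infty$; (iii) there are constants $K^{\pm},\delta>0$ and an increasing sequence $(k_m)$ with $\limsup k_m/m<\infty$ such that for all $m$: [B] $\sum_{k=1}^{k_m}\|\widetilde Q(k,k_m)|_{\widetilde\Gamma_s^{(k)}}\|\,\|\widetilde P_s^{(k)}\|\,\|\widetilde Z_{k-1}\|\le K^-$; [F] $\sum_{k=k_m+1}^{\infty}\|\widetilde Q(k_m,k)^{-1}|_{\widetilde\Gamma_u^{(k)}}\|\,\|\widetilde P_u^{(k)}\|\,\|\widetilde Z_{k-1}\|\le K^+$; [S] $\lim_{m\to\infty}\frac1m\log\|\widetilde Q(k_m,k_{m+1})\|=0$; [A] $\angle(\widetilde\Gamma^{(k_m)}_{x},\widetilde\Gamma^{(k_m)}_{y})>\delta$ for distinct $x,y\in\{s,c,u\}$. A GIET satisfies the RDC if it is infinitely renormalizable, its rotation number is irrational, and its rotation number satisfies the RDC. *)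

theory Defs
  imports "HOL-Analysis.Analysis" "HOL-Combinatorics.Orbits"
begin

section \<open>Generalized interval exchange transformations\<close>

text \<open>
  The \<open>d\<close> labels are the elements of a finite type \<open>'n\<close>, so \<open>d = CARD('n)\<close>.  A row of the
  combinatorial datum is the list of labels from left to right:
  \<open>\<pi>\<^sub>t(k) = top_row T ! (k - 1)\<close> and \<open>\<pi>\<^sub>b(k) = bot_row T ! (k - 1)\<close>.
  A GIET is a map up to finitely many points: only the values of \<open>gmap T\<close> on the open top
  intervals are constrained, and no notion below depends on its other values.
\<close>

record ('n::finite) giet =
  top_row :: "'n list"
  bot_row :: "'n list"
  top_len :: "real ^ 'n"
  bot_len :: "real ^ 'n"
  gmap :: "real \<Rightarrow> real"

text \<open>0-based position of a label in a row.\<close>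

definition pos :: "'a list \<Rightarrow> 'a \<Rightarrow> nat" where
  "pos xs a = length (takeWhile (\<lambda>x. x \<noteq> a) xs)"

definition endpoint :: "'n::finite list \<Rightarrow> real ^ 'n \<Rightarrow> nat \<Rightarrow> real" where
  "endpoint xs len i = (\<Sum>a\<leftarrow>take i xs. len $ a)"

definition left_end :: "'n::finite list \<Rightarrow> real ^ 'n \<Rightarrow> 'n \<Rightarrow> real" where
  "left_end xs len a = endpoint xs len (pos xs a)"

definition top_left :: "'n::finite giet \<Rightarrow> 'n \<Rightarrow> real" where
  "top_left T a = left_end (top_row T) (top_len T) a"

definition bot_left :: "'n::finite giet \<Rightarrow> 'n \<Rightarrow> real" where
  "bot_left T a = left_end (bot_row T) (bot_len T) a"

definition top_int :: "'n::finite giet \<Rightarrow> 'n \<Rightarrow> real set" where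
  "top_int T a = {top_left T a <..< top_left T a + top_len T $ a}"

definition bot_int :: "'n::finite giet \<Rightarrow> 'n \<Rightarrow> real set" where
  "bot_int T a = {bot_left T a <..< bot_left T a + bot_len T $ a}"

definition two_partitions :: "'n::finite giet \<Rightarrow> bool" where
  "two_partitions T \<longleftrightarrow>
     distinct (top_row T) \<and> set (top_row T) = UNIV \<and>
     distinct (bot_row T) \<and> set (bot_row T) = UNIV \<and>
     (\<forall>a. top_len T $ a > 0) \<and> (\<Sum>a\<in>UNIV. top_len T $ a) = 1 \<and>
     (\<forall>a. bot_len T $ a > 0) \<and> (\<Sum>a\<in>UNIV. bot_len T $ a) = 1"

text \<open>\<open>C\<^sup>r\<close> regularity on a (closed) interval \<open>A\<close>, with one-sided derivatives at its endpoints;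
  \<open>F i\<close> is the \<open>i\<close>-th derivative.\<close>

definition Cr_on :: "nat \<Rightarrow> (real \<Rightarrow> real) \<Rightarrow> real set \<Rightarrow> bool" where
  "Cr_on r f A \<longleftrightarrow>
     (\<exists>F :: nat \<Rightarrow> real \<Rightarrow> real. (\<forall>x\<in>A. F 0 x = f x) \<and>
        (\<forall>i<r. \<forall>x\<in>A. (F i has_real_derivative F (Suc i) x) (at x within A)) \<and>
        continuous_on A (F r))"

definition Cr_diffeo_pos :: "nat \<Rightarrow> (real \<Rightarrow> real) \<Rightarrow> real set \<Rightarrow> real set \<Rightarrow> bool" where
  "Cr_diffeo_pos r f A B \<longleftrightarrow>
     bij_betw f A B \<and> strict_mono_on A f \<and> Cr_on r f A \<and> Cr_on r (inv_into A f) B"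

definition is_giet :: "nat \<Rightarrow> 'n::finite giet \<Rightarrow> bool" where
  "is_giet r T \<longleftrightarrow> two_partitions T \<and>
     (\<forall>a. bij_betw (gmap T) (top_int T a) (bot_int T a) \<and>
          (\<exists>f. (\<forall>x\<in>top_int T a. f x = gmap T x) \<and>
               Cr_diffeo_pos r f (closure (top_int T a)) (closure (bot_int T a))))"

definition irreducible_datum :: "'n::finite giet \<Rightarrow> bool" where
  "irreducible_datum T \<longleftrightarrow>
     (\<forall>k. 1 \<le> k \<and> k < CARD('n) \<longrightarrow> set (take k (top_row T)) \<noteq> set (take k (bot_row T)))"

definition GIETs :: "nat \<Rightarrow> 'n::finite giet set" where
  "GIETs r = {T. is_giet r T \<and> irreducible_datum T}"

text \<open>Translations are smooth, so the choice of the regularity class is immaterial here.\<close>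

definition standard_IETs :: "'n::finite giet set" where
  "standard_IETs = {T \<in> GIETs 1. \<forall>a. \<exists>c. \<forall>x\<in>top_int T a. gmap T x = x + c}"

definition slopes :: "'n::finite giet \<Rightarrow> real ^ 'n" where
  "slopes T = (\<chi> a. bot_len T $ a / top_len T $ a)"

definition log_slopes :: "'n::finite giet \<Rightarrow> real ^ 'n" where
  "log_slopes T = (\<chi> a. ln (bot_len T $ a / top_len T $ a))"


section \<open>The \<open>C\<^sup>1\<close> distance\<close>

text \<open>The branch over \<open>a\<close>, extended to the closed top interval.\<close>

definition branch :: "'n::finite giet \<Rightarrow> 'n \<Rightarrow> real \<Rightarrow> real" where
  "branch T a x =
     (if x = top_left T a then bot_left T a
      else if x = top_left T a + top_len T $ a then bot_left T a + bot_len T $ a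
      else gmap T x)"

definition profile :: "'n::finite giet \<Rightarrow> 'n \<Rightarrow> real \<Rightarrow> real" where
  "profile T a s =
     (branch T a (top_left T a + s * top_len T $ a) - bot_left T a) / bot_len T $ a"

definition unit_deriv :: "(real \<Rightarrow> real) \<Rightarrow> real \<Rightarrow> real" where
  "unit_deriv f x = vector_derivative f (at x within {0..1})"

definition unit_sup :: "(real \<Rightarrow> real) \<Rightarrow> real" where
  "unit_sup f = (SUP x\<in>{0..1}. \<bar>f x\<bar>)"

definition dist_C1 :: "'n::finite giet \<Rightarrow> 'n giet \<Rightarrow> real" where
  "dist_C1 T S =
     (if (top_row T, bot_row T) = (top_row S, bot_row S) then 0 else 1)
     + dist (top_len T, slopes T) (top_len S, slopes S)
     + (\<Sum>a\<in>UNIV. unit_sup (\<lambda>x. profile T a x - profile S a x)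
                  + unit_sup (\<lambda>x. unit_deriv (profile T a) x - unit_deriv (profile S a) x))"

definition dist_C1_standard :: "'n::finite giet \<Rightarrow> real" where
  "dist_C1_standard T = (INF S\<in>standard_IETs. dist_C1 T S)"


section \<open>The boundary operator\<close>

text \<open>The symbols \<open>V\<^sub>0\<close> and \<open>V\<^sub>d\<close>, identified with \<open>U\<^sub>0\<close> and \<open>U\<^sub>d\<close>, are written \<open>SymU 0\<close> and
  \<open>SymU d\<close>; \<open>symV d j\<close> is the symbol \<open>V\<^sub>j\<close>.\<close>

datatype bsym = SymU nat | SymV nat

definition symV :: "nat \<Rightarrow> nat \<Rightarrow> bsym" where
  "symV d j = (if j = 0 \<or> j = d then SymU j else SymV j)"

definition symbols :: "nat \<Rightarrow> bsym set" where
  "symbols d = SymU ` {0..d} \<union> symV d ` {0..d}"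

fun bsigma :: "'a list \<Rightarrow> 'a list \<Rightarrow> bsym \<Rightarrow> bsym" where
  "bsigma pt pb (SymU i) =
     (if i < length pt then symV (length pt) (pos pb (pt ! i))
      else SymU (Suc (pos pt (pb ! (i - 1)))))"
| "bsigma pt pb (SymV k) = SymU (Suc (pos pt (pb ! (k - 1))))"

definition bcycles :: "'n::finite giet \<Rightarrow> bsym set set" where
  "bcycles T = orbit (bsigma (top_row T) (bot_row T)) ` symbols CARD('n)"

definition top_endpoint :: "'n::finite giet \<Rightarrow> nat \<Rightarrow> real" where
  "top_endpoint T i = endpoint (top_row T) (top_len T) i"

definition right_limit :: "'n::finite giet \<Rightarrow> (real \<Rightarrow> real) \<Rightarrow> nat \<Rightarrow> real" where
  "right_limit T f i = (if i = CARD('n) then 0 else Lim (at_right (top_endpoint T i)) f)"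

definition left_limit :: "'n::finite giet \<Rightarrow> (real \<Rightarrow> real) \<Rightarrow> nat \<Rightarrow> real" where
  "left_limit T f i = (if i = 0 then 0 else Lim (at_left (top_endpoint T i)) f)"

definition boundary_op :: "'n::finite giet \<Rightarrow> (real \<Rightarrow> real) \<Rightarrow> bsym set \<Rightarrow> real" where
  "boundary_op T f C =
     (\<Sum>i | i \<le> CARD('n) \<and> SymU i \<in> C. right_limit T f i - left_limit T f i)"

definition boundary :: "'n::finite giet \<Rightarrow> bsym set \<Rightarrow> real" where
  "boundary T C = boundary_op T (\<lambda>x. ln (deriv (gmap T) x)) C"

text \<open>A suspension of \<open>T\<close> glues the \<open>2d\<close> sides of a polygon in pairs: one face, \<open>d\<close> edges, and
  one vertex for each cycle of \<open>bsigma\<close>, so \<open>2 - 2g = \<kappa> - d + 1\<close>.\<close>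

definition genus :: "'n::finite giet \<Rightarrow> nat" where
  "genus T = (CARD('n) + 1 - card (bcycles T)) div 2"


section \<open>Renormalization\<close>

definition return_time :: "(real \<Rightarrow> real) \<Rightarrow> real set \<Rightarrow> real \<Rightarrow> nat" where
  "return_time f A x = (LEAST k. k > 0 \<and> (f ^^ k) x \<in> A)"

definition return_map :: "(real \<Rightarrow> real) \<Rightarrow> real set \<Rightarrow> real \<Rightarrow> real" where
  "return_map f A x = (f ^^ return_time f A x) x"

definition rv_defined :: "'n::finite giet \<Rightarrow> bool" where
  "rv_defined T \<longleftrightarrow> top_len T $ last (top_row T) \<noteq> bot_len T $ last (bot_row T)"

definition top_wins :: "'n::finite giet \<Rightarrow> bool" where
  "top_wins T \<longleftrightarrow> top_len T $ last (top_row T) > bot_len T $ last (bot_row T)"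

definition loser :: "'n::finite giet \<Rightarrow> 'n" where
  "loser T = (if top_wins T then last (bot_row T) else last (top_row T))"

definition rv_length :: "'n::finite giet \<Rightarrow> real" where
  "rv_length T = 1 - min (top_len T $ last (top_row T)) (bot_len T $ last (bot_row T))"

text \<open>\<open>S\<close> is the first return map of \<open>T\<close> to \<open>[0, rv_length T]\<close>, rescaled to \<open>[0,1]\<close>, with the
  loser's label where the return time is \<open>2\<close> and the old label elsewhere.  This determines both
  partitions of \<open>S\<close>, their labels, and \<open>gmap S\<close> on the open top intervals.\<close>

definition is_rv_step :: "'n::finite giet \<Rightarrow> 'n giet \<Rightarrow> bool" where
  "is_rv_step T S \<longleftrightarrow> two_partitions S \<and>
     (\<forall>a. gmap S ` top_int S a = bot_int S a \<and>
        (\<forall>y\<in>top_int S a.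
           let x = rv_length T * y; J = {0..rv_length T} in
             gmap S y = return_map (gmap T) J x / rv_length T \<and>
             (if return_time (gmap T) J x = 2 then a = loser T else x \<in> top_int T a)))"

definition rv :: "'n::finite giet \<Rightarrow> 'n giet" where
  "rv T = (SOME S. is_rv_step T S)"

definition infinitely_renormalizable :: "'n::finite giet \<Rightarrow> bool" where
  "infinitely_renormalizable T \<longleftrightarrow> (\<forall>n. rv_defined ((rv ^^ n) T))"

type_synonym 'a rotation = "nat \<Rightarrow> ('a list \<times> 'a list) \<times> bool"

text \<open>The type of a step is recorded by whether the top interval wins.\<close>

definition rotation_number :: "'n::finite giet \<Rightarrow> 'n rotation" where
  "rotation_number T n =
     (let S = (rv ^^ n) T in ((top_row S, bot_row S), top_wins S))"

fun step_winner :: "('a list \<times> 'a list) \<times> bool \<Rightarrow> 'a" where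
  "step_winner ((pt, pb), ty) = (if ty then last pt else last pb)"

definition irrational_rotation :: "'n::finite rotation \<Rightarrow> bool" where
  "irrational_rotation \<gamma> \<longleftrightarrow> (\<forall>a. \<exists>\<^sub>\<infinity>n. step_winner (\<gamma> n) = a)"

text \<open>Number of elementary steps performed by the first \<open>n\<close> Zorich steps.\<close>

primrec zorich_time :: "'n::finite giet \<Rightarrow> nat \<Rightarrow> nat" where
  "zorich_time T 0 = 0"
| "zorich_time T (Suc n) =
     (LEAST m. m > zorich_time T n \<and>
        top_wins ((rv ^^ m) T) \<noteq> top_wins ((rv ^^ zorich_time T n) T))"

definition zorich :: "nat \<Rightarrow> 'n::finite giet \<Rightarrow> 'n giet" where
  "zorich n T = (rv ^^ zorich_time T n) T"

definition zorich_length :: "'n::finite giet \<Rightarrow> nat \<Rightarrow> real" where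
  "zorich_length T n = (\<Prod>i<zorich_time T n. rv_length ((rv ^^ i) T))"

definition zorich_interval :: "'n::finite giet \<Rightarrow> nat \<Rightarrow> real set" where
  "zorich_interval T n = {0..zorich_length T n}"

definition zorich_piece :: "'n::finite giet \<Rightarrow> nat \<Rightarrow> 'n \<Rightarrow> real set" where
  "zorich_piece T n a = (\<lambda>y. zorich_length T n * y) ` top_int (zorich n T) a"

definition zorich_return :: "'n::finite giet \<Rightarrow> nat \<Rightarrow> real \<Rightarrow> real" where
  "zorich_return T n = return_map (gmap T) (zorich_interval T n)"

definition cocycle :: "'n::finite giet \<Rightarrow> nat \<Rightarrow> nat \<Rightarrow> real ^ 'n ^ 'n" where
  "cocycle T m n = (\<chi> i j.
     let x = (SOME x. x \<in> zorich_piece T n i); f = zorich_return T m in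
       real (card {k. k < return_time f (zorich_interval T n) x \<and> (f ^^ k) x \<in> zorich_piece T m j}))"


section \<open>The Regular Diophantine Condition\<close>

definition vec_angle :: "'v::real_inner \<Rightarrow> 'v \<Rightarrow> real" where
  "vec_angle v w = arccos (v \<bullet> w / (norm v * norm w))"

definition min_angle :: "'v::real_inner set \<Rightarrow> 'v set \<Rightarrow> real" where
  "min_angle X Y = Inf {vec_angle v w | v w. v \<in> X \<and> w \<in> Y \<and> v \<noteq> 0 \<and> w \<noteq> 0}"

definition matrix_norm :: "real ^ 'n ^ 'n \<Rightarrow> real" where
  "matrix_norm A = onorm (\<lambda>v. A *v v)"

definition matrix_norm_on :: "real ^ 'n ^ 'n \<Rightarrow> (real ^ 'n) set \<Rightarrow> real" where
  "matrix_norm_on A X = (SUP v\<in>{v \<in> X. norm v \<le> 1}. norm (A *v v))"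

datatype osel = Stable | Central | Unstable

type_synonym 'n splitting = "osel \<Rightarrow> nat \<Rightarrow> (real ^ 'n) set"

definition splits :: "'n::finite splitting \<Rightarrow> nat \<Rightarrow> real ^ 'n \<Rightarrow> (osel \<Rightarrow> real ^ 'n) \<Rightarrow> bool" where
  "splits G n v f \<longleftrightarrow> (\<forall>x. f x \<in> G x n) \<and> v = f Stable + f Central + f Unstable"

definition split_proj :: "'n::finite splitting \<Rightarrow> osel \<Rightarrow> nat \<Rightarrow> real ^ 'n \<Rightarrow> real ^ 'n" where
  "split_proj G x n v = (THE f. splits G n v f) x"

text \<open>The central spaces may be trivial; the angle conditions then say nothing about them.\<close>

definition oseledets_extension :: "'n::finite giet \<Rightarrow> 'n splitting \<Rightarrow> bool" where
  "oseledets_extension T G \<longleftrightarrow>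
     (\<forall>n. (\<forall>x. subspace (G x n)) \<and> (\<forall>v. \<exists>!f. splits G n v f) \<and>
          dim (G Stable n) = genus T \<and> dim (G Unstable n) = genus T) \<and>
     (\<forall>x m n. m \<le> n \<longrightarrow> (\<lambda>v. cocycle T m n *v v) ` G x m = G x n) \<and>
     (\<exists>\<theta> C. \<theta> > 0 \<and> C > 0 \<and>
        (\<forall>n. (\<forall>v\<in>G Stable 0.
                norm (cocycle T 0 n *v v) \<le> C * exp (- \<theta> * real n) * norm v) \<and>
             (\<forall>v\<in>G Unstable n.
                norm (matrix_inv (cocycle T 0 n) *v v) \<le> C * exp (- \<theta> * real n) * norm v))) \<and>
     (\<forall>v\<in>G Central 0. v \<noteq> 0 \<longrightarrow>
        (\<lambda>n. ln (norm (cocycle T 0 n *v v)) / real n) \<longlonglongrightarrow> 0) \<and>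
     (\<forall>\<epsilon>>0. \<exists>c>0. \<forall>n x y. x \<noteq> y \<and> G x n \<noteq> {0} \<and> G y n \<noteq> {0} \<longrightarrow>
        \<bar>sin (min_angle (G x n) (G y n))\<bar> \<ge> c * exp (- \<epsilon> * real n))"

text \<open>The good return times are \<open>n\<^sub>1, n\<^sub>2, \<dots>\<close>; \<open>n\<^sub>0 = 0\<close> is a convention and need not be one.\<close>

definition good_return_times :: "'n::finite giet \<Rightarrow> (nat \<Rightarrow> nat) \<Rightarrow> bool" where
  "good_return_times T n \<longleftrightarrow> n 0 = 0 \<and>
     (\<exists>p\<ge>1. \<exists>A. (\<forall>i j. A $ i $ j > 0) \<and>
        (\<exists>S :: 'n giet. S \<in> standard_IETs \<and> infinitely_renormalizable S \<and>
             irrational_rotation (rotation_number S) \<and> A = cocycle S 0 p) \<and>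
        (\<forall>k\<ge>1. cocycle T (n k) (n k + 2 * p) = A ** A \<and> n k + 2 * p \<le> n (Suc k)))"

text \<open>In \<open>IET_RDC T n k\<close>, the sequence \<open>n\<close> is that of the good return times and \<open>k\<close> is the
  sequence \<open>(k\<^sub>m)\<close>.\<close>

definition IET_RDC :: "'n::finite giet \<Rightarrow> (nat \<Rightarrow> nat) \<Rightarrow> (nat \<Rightarrow> nat) \<Rightarrow> bool" where
  "IET_RDC T n k \<longleftrightarrow>
     (\<exists>G. oseledets_extension T G \<and>
        good_return_times T n \<and> convergent (\<lambda>j. real (n j) / real j) \<and>
        strict_mono k \<and> limsup (\<lambda>m. ereal (real (k m) / real m)) < \<infinity> \<and>
        (let Q = (\<lambda>i j. cocycle T (n i) (n j)); Z = (\<lambda>i. Q i (Suc i));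
             \<Gamma> = (\<lambda>x i. G x (n i)); P = (\<lambda>x i. split_proj G x (n i)) in
         \<exists>Kminus>0. \<exists>Kplus>0. \<exists>\<delta>>0.
           (\<forall>m. (\<Sum>j = 1..k m. matrix_norm_on (Q j (k m)) (\<Gamma> Stable j)
                    * onorm (P Stable j) * matrix_norm (Z (j - 1))) \<le> Kminus) \<and>
           (\<forall>m. let F = (\<lambda>j. matrix_norm_on (matrix_inv (Q (k m) j)) (\<Gamma> Unstable j)
                               * onorm (P Unstable j) * matrix_norm (Z (j - 1))) in
                summable (\<lambda>i. F (k m + 1 + i)) \<and> (\<Sum>i. F (k m + 1 + i)) \<le> Kplus) \<and>
           ((\<lambda>m. ln (matrix_norm (Q (k m) (k (Suc m)))) / real m) \<longlonglongrightarrow> 0) \<and>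
           (\<forall>m x y. x \<noteq> y \<and> \<Gamma> x (k m) \<noteq> {0} \<and> \<Gamma> y (k m) \<noteq> {0} \<longrightarrow>
              min_angle (\<Gamma> x (k m)) (\<Gamma> y (k m)) > \<delta>)))"

definition rotation_RDC :: "'n::finite rotation \<Rightarrow> (nat \<Rightarrow> nat) \<Rightarrow> (nat \<Rightarrow> nat) \<Rightarrow> bool" where
  "rotation_RDC \<gamma> n k \<longleftrightarrow>
     (\<exists>S \<in> standard_IETs. infinitely_renormalizable S \<and> rotation_number S = \<gamma> \<and> IET_RDC S n k)"

definition GIET_RDC :: "'n::finite giet \<Rightarrow> (nat \<Rightarrow> nat) \<Rightarrow> (nat \<Rightarrow> nat) \<Rightarrow> bool" where
  "GIET_RDC T n k \<longleftrightarrow>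
     infinitely_renormalizable T \<and> irrational_rotation (rotation_number T) \<and>
     rotation_RDC (rotation_number T) n k"

end

theory Submission
  imports Defs
begin

text \<open>
  Let \<open>f n a\<close> be the logarithm of the derivative of the \<open>n\<close>-th induced map on its closed
  continuity interval labelled \<open>a\<close>.  The shape and the profile of the \<open>n\<close>-th renormalization are
  close to those of the standard exchange with the same top partition as soon as \<open>f n\<close> is small, so
  it suffices that \<open>f n\<close> is exponentially small.

  The nonlinearities, divided by the heights of the towers, give functions \<open>psi n\<close> on which inducing
  acts by averaging.  At a good return time with bounded slopes the averaging mixes all towers
  by a definite amount, so the oscillation of \<open>psi\<close> shrinks by a definite factor; since the
  boundary vanishes, the mean nonlinearity is zero, and the oscillation of each \<open>f n a\<close> becomes
  exponentially small.

  Consequently the log-slope vectors \<open>u\<^sub>k\<close> at the times \<open>n\<^sub>k\<close> satisfy \<open>u\<^sub>k\<^sub>+\<^sub>1 = Z\<^sub>k u\<^sub>k + e\<^sub>k\<close> with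
  \<open>\<parallel>e\<^sub>k\<parallel> \<le> \<epsilon>\<^sub>k \<parallel>Z\<^sub>k\<parallel>\<close> and \<open>\<epsilon>\<close> exponentially small along \<open>(k\<^sub>m)\<close>.  Condition [B] with
  submultiplicativity makes the stable component decay; the unstable component of the bounded
  vectors \<open>u\<close> is a sum of future errors, controlled by [F].  For the central component, the
  vanishing of the boundary says that \<open>f n\<close> pairs to zero with every function on the cycles of
  \<open>bsigma\<close>.  Transported back to time \<open>0\<close>, this bounds the pairing of the central component with
  the kernel of the intersection form \<open>\<Omega>\<close>.  The stable space is Lagrangian in the range of \<open>\<Omega>\<close>, so
  no central vector is orthogonal to that kernel; hence the central component at time \<open>0\<close> is
  exponentially small, and it grows subexponentially.  Condition [S] fills the gaps between the
  times \<open>n\<^bsub>k\<^sub>m\<^esub>\<close>.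
\<close>

section \<open>Sums and products along words\<close>

text \<open>No stage is rescaled until the very end: each induced map stays in the coordinates of
  \<open>T\<close> and is a composition of branches along a word of labels. Derivatives, Birkhoff
  sums, incidence matrices and boundary values are then all sums over the same words. The words
  depend only on the rotation number, so the matrices of the standard exchange in the RDC are also
  those of \<open>T\<close>. The slopes are bounded only at the times \<open>n (k m)\<close>. Two
  monotonicity facts bridge the gaps: averaging never increases the oscillation of
  \<open>psi\<close>, and floors never become wider relative to the intervals that contain them. The
  block after a good time has matrix \<open>A ** A\<close> with \<open>A\<close> a positive integer
  matrix, so its entries are at least \<open>CARD('n)\<close>, hence at least 2; therefore no floor
  can fill the interval containing it. [B] and [F] bound sums and give no rate by themselves. The
  rate of the stable part comes from submultiplicativity, those of the other two parts from the
  exponential decay of the errors.\<close>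

primrec run :: "('a \<Rightarrow> real \<Rightarrow> real) \<Rightarrow> 'a list \<Rightarrow> real \<Rightarrow> real" where
  "run R [] x = x"
| "run R (b # w) x = run R w (R b x)"

primrec dchain :: "('a \<Rightarrow> real \<Rightarrow> real) \<Rightarrow> ('a \<Rightarrow> real \<Rightarrow> real) \<Rightarrow> 'a list \<Rightarrow> real \<Rightarrow> real" where
  "dchain R D [] x = 1"
| "dchain R D (b # w) x = D b x * dchain R D w (R b x)"

primrec bsum :: "('a \<Rightarrow> real \<Rightarrow> real) \<Rightarrow> ('a \<Rightarrow> real \<Rightarrow> real) \<Rightarrow> 'a list \<Rightarrow> real \<Rightarrow> real" where
  "bsum R g [] x = 0"
| "bsum R g (b # w) x = g b x + bsum R g w (R b x)"

text \<open>The weights are the derivatives of the partial compositions. This is how a density on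
  the floors of a tower is pulled back to its base, and also how a Birkhoff sum is
  differentiated.\<close>

primrec wsum :: "('a \<Rightarrow> real \<Rightarrow> real) \<Rightarrow> ('a \<Rightarrow> real \<Rightarrow> real) \<Rightarrow> ('a \<Rightarrow> real \<Rightarrow> real)
    \<Rightarrow> 'a list \<Rightarrow> real \<Rightarrow> real" where
  "wsum R D g [] x = 0"
| "wsum R D g (b # w) x = g b x + D b x * wsum R D g w (R b x)"

text \<open>The branches are total functions; this records that the orbit along the word stays in
  the intervals where they are meaningful.\<close>

primrec adm :: "('a \<Rightarrow> real set) \<Rightarrow> ('a \<Rightarrow> real \<Rightarrow> real) \<Rightarrow> 'a list \<Rightarrow> real \<Rightarrow> bool" where
  "adm J R [] x \<longleftrightarrow> True"
| "adm J R (b # w) x \<longleftrightarrow> x \<in> J b \<and> adm J R w (R b x)"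

lemma run_append: "run R (u @ v) x = run R v (run R u x)"
  by (induction u arbitrary: x) auto

lemma dchain_append: "dchain R D (u @ v) x = dchain R D u x * dchain R D v (run R u x)"
  by (induction u arbitrary: x) auto

lemma bsum_append: "bsum R g (u @ v) x = bsum R g u x + bsum R g v (run R u x)"
  by (induction u arbitrary: x) auto

lemma wsum_append:
  "wsum R D g (u @ v) x = wsum R D g u x + dchain R D u x * wsum R D g v (run R u x)"
  by (induction u arbitrary: x) (auto simp: algebra_simps)

lemma adm_append: "adm J R (u @ v) x \<longleftrightarrow> adm J R u x \<and> adm J R v (run R u x)"
  by (induction u arbitrary: x) auto

text \<open>Substituting a word for each letter is functorial: this lemma and the next four turn the
  nesting of induced maps into identities for compositions, derivatives, sums and
  admissibility.\<close>

lemma run_concat: "run R (concat (map V w)) x = run (\<lambda>b. run R (V b)) w x"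
  by (induction w arbitrary: x) (auto simp: run_append)

lemma dchain_concat:
  "dchain R D (concat (map V w)) x = dchain (\<lambda>b. run R (V b)) (\<lambda>b. dchain R D (V b)) w x"
  by (induction w arbitrary: x) (auto simp: dchain_append)

lemma bsum_concat:
  "bsum R g (concat (map V w)) x = bsum (\<lambda>b. run R (V b)) (\<lambda>b. bsum R g (V b)) w x"
  by (induction w arbitrary: x) (auto simp: bsum_append)

lemma wsum_concat:
  "wsum R D g (concat (map V w)) x =
   wsum (\<lambda>b. run R (V b)) (\<lambda>b. dchain R D (V b)) (\<lambda>b. wsum R D g (V b)) w x"
  by (induction w arbitrary: x) (auto simp: wsum_append)

lemma adm_concat:
  assumes "\<And>b y. y \<in> J' b \<Longrightarrow> adm J R (V b) y"
  shows "adm J' (\<lambda>b. run R (V b)) w x \<Longrightarrow> adm J R (concat (map V w)) x"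
  using assms by (induction w arbitrary: x) (auto simp: adm_append)

lemma adm_nth: "adm J R w x \<Longrightarrow> s < length w \<Longrightarrow> run R (take s w) x \<in> J (w ! s)"
proof (induction w arbitrary: x s)
  case (Cons b w) then show ?case by (cases s) auto
qed auto

lemma wsum_eq_sum:
  "wsum R D g w x = (\<Sum>s<length w. dchain R D (take s w) x * g (w ! s) (run R (take s w) x))"
proof (induction w arbitrary: x)
  case (Cons b w)
  then show ?case
    by (simp del: sum.lessThan_Suc add: sum.lessThan_Suc_shift sum_distrib_left mult.assoc)
qed simp

lemma bsum_eq_sum: "bsum R g w x = (\<Sum>s<length w. g (w ! s) (run R (take s w) x))"
  by (induction w arbitrary: x) (simp_all del: sum.lessThan_Suc add: sum.lessThan_Suc_shift)

lemma dchain_exp: "dchain R (\<lambda>b x. exp (f b x)) w x = exp (bsum R f w x)"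
  by (induction w arbitrary: x) (auto simp: exp_add)

lemma wsum_pos_mono:
  assumes "\<And>b y. y \<in> J b \<Longrightarrow> D b y \<ge> 0" "\<And>b y. y \<in> J b \<Longrightarrow> g b y \<le> h b y"
  shows "adm J R w x \<Longrightarrow> wsum R D g w x \<le> wsum R D h w x"
  using assms by (induction w arbitrary: x) (auto intro!: add_mono mult_left_mono)

lemma wsum_0 [simp]: "wsum R D (\<lambda>b x. 0) w x = (0::real)"
  by (induction w arbitrary: x) auto

lemma wsum_nonneg:
  assumes "\<And>b y. y \<in> J b \<Longrightarrow> D b y \<ge> 0" "\<And>b y. y \<in> J b \<Longrightarrow> 0 \<le> h b y" "adm J R w x"
  shows "0 \<le> wsum R D h w x"
  using wsum_pos_mono[where J = J and R = R and D = D and w = w and x = x and g = "\<lambda>b x. 0" and h = h] assms by auto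

lemma dchain_pos:
  assumes "\<And>b y. y \<in> J b \<Longrightarrow> D b y > 0"
  shows "adm J R w x \<Longrightarrow> dchain R D w x > 0"
  using assms by (induction w arbitrary: x) auto

lemma wsum_cmult: "wsum R D (\<lambda>b x. c * g b x) w x = c * wsum R D g w x"
  by (induction w arbitrary: x) (auto simp: algebra_simps)

lemma wsum_abs_le:
  assumes "\<And>b y. y \<in> J b \<Longrightarrow> D b y \<ge> 0"
  shows "adm J R w x \<Longrightarrow> \<bar>wsum R D g w x\<bar> \<le> wsum R D (\<lambda>b y. \<bar>g b y\<bar>) w x"
  using assms
proof (induction w arbitrary: x)
  case (Cons b w)
  then have "\<bar>D b x * wsum R D g w (R b x)\<bar> \<le> D b x * wsum R D (\<lambda>b y. \<bar>g b y\<bar>) w (R b x)"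
    by (auto simp: abs_mult intro!: mult_mono)
  then show ?case by simp
qed auto

lemma run_image_adm:
  assumes "\<And>b. continuous_on (J b) (R b)" "\<And>x. x \<in> A \<Longrightarrow> adm J R w x"
  shows "continuous_on A (run R w)"
  using assms(2)
proof (induction w arbitrary: A)
  case (Cons b w)
  have "continuous_on A (R b)"
    by (rule continuous_on_subset[OF assms(1)[of b]]) (use Cons.prems in auto)
  moreover have "continuous_on (R b ` A) (run R w)"
    by (rule Cons.IH) (use Cons.prems in auto)
  ultimately show ?case
    using continuous_on_compose2[of "R b ` A" "run R w" A "R b"] by auto
qed simp

lemma wsum_continuous:
  assumes "\<And>b. continuous_on (J b) (R b)" "\<And>b. continuous_on (J b) (D b)"
    "\<And>b. continuous_on (J b) (g b)" "\<And>x. x \<in> A \<Longrightarrow> adm J R w x"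
  shows "continuous_on A (wsum R D g w)"
  using assms(4)
proof (induction w arbitrary: A)
  case (Cons b w)
  have s: "A \<subseteq> J b" using Cons.prems by auto
  have "continuous_on (R b ` A) (wsum R D g w)"
    by (rule Cons.IH) (use Cons.prems in auto)
  then have "continuous_on A (\<lambda>x. wsum R D g w (R b x))"
    using continuous_on_compose2[of "R b ` A" "wsum R D g w" A "R b"]
      continuous_on_subset[OF assms(1) s] by auto
  then show ?case
    using continuous_on_subset[OF assms(2) s] continuous_on_subset[OF assms(3) s]
    by (auto intro!: continuous_intros)
qed simp

lemma run_strict_mono:
  assumes "\<And>b. strict_mono_on (J b) (R b)"
  shows "adm J R w x \<Longrightarrow> adm J R w y \<Longrightarrow> x < y \<Longrightarrow> run R w x < run R w y"
proof (induction w arbitrary: x y)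
  case (Cons b w)
  then have "R b x < R b y" using assms[of b] by (auto simp: strict_mono_on_def)
  with Cons show ?case by auto
qed simp

lemma run_deriv:
  assumes "\<And>b x. x \<in> J b \<Longrightarrow> (R b has_real_derivative D b x) (at x within J b)"
    "\<And>x. x \<in> A \<Longrightarrow> adm J R w x" "x \<in> A"
  shows "(run R w has_real_derivative dchain R D w x) (at x within A)"
  using assms(2,3)
proof (induction w arbitrary: A x)
  case (Cons b w)
  have 1: "(R b has_real_derivative D b x) (at x within A)"
    by (rule DERIV_subset[OF assms(1)]) (use Cons.prems in auto)
  have 2: "(run R w has_real_derivative dchain R D w (R b x)) (at (R b x) within R b ` A)"
    by (rule Cons.IH) (use Cons.prems in auto)
  have "((run R w \<circ> R b) has_real_derivative dchain R D w (R b x) * D b x) (at x within A)"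
    by (rule DERIV_image_chain[OF 2 1])
  then show ?case by (simp add: o_def mult.commute)
next
  case Nil
  have "run R [] = (\<lambda>x. x)" by auto
  then show ?case by simp
qed

text \<open>By the chain rule each summand contributes its derivative times that of the partial
  composition. With \<open>f\<close> a log-derivative, the nonlinearity of an induced map is a
  weighted sum of nonlinearities.\<close>

lemma bsum_deriv:
  assumes "\<And>b x. x \<in> J b \<Longrightarrow> (R b has_real_derivative D b x) (at x within J b)"
    "\<And>b x. x \<in> J b \<Longrightarrow> (f b has_real_derivative g b x) (at x within J b)"
    "\<And>x. x \<in> A \<Longrightarrow> adm J R w x" "x \<in> A"
  shows "(bsum R f w has_real_derivative wsum R D g w x) (at x within A)"
  using assms(3,4)
proof (induction w arbitrary: A x)
  case (Cons b w)
  have 1: "(R b has_real_derivative D b x) (at x within A)"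
    "(f b has_real_derivative g b x) (at x within A)"
    by (rule DERIV_subset[OF assms(1)] DERIV_subset[OF assms(2)]; use Cons.prems in auto)+
  have 2: "(bsum R f w has_real_derivative wsum R D g w (R b x)) (at (R b x) within R b ` A)"
    by (rule Cons.IH) (use Cons.prems in auto)
  have "((bsum R f w \<circ> R b) has_real_derivative wsum R D g w (R b x) * D b x) (at x within A)"
    by (rule DERIV_image_chain[OF 2 1(1)])
  from DERIV_add[OF 1(2) this] show ?case by (simp add: o_def mult.commute)
next
  case Nil
  have "bsum R f [] = (\<lambda>x. 0)" by auto
  then show ?case by simp
qed

section \<open>Induced maps and their towers\<close>

lemma wsum_single [simp]: "wsum R D g [b] = g b"
  by (rule ext) simp

text \<open>In both types the points that return after two steps start over \<open>be\<close>, whose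
  image is the rightmost bottom interval, and continue over \<open>al\<close>. Only the label given
  to them, that of the loser, depends on the type.\<close>

definition rv_word :: "'a \<Rightarrow> 'a \<Rightarrow> bool \<Rightarrow> 'a \<Rightarrow> 'a list" where
  "rv_word al be tw a = (if a = (if tw then be else al) then [be, al] else [a])"

text \<open>The itinerary, in stage-\<open>m\<close> labels, of a point of the
  stage-\<open>n\<close> interval \<open>a\<close> until its return. For \<open>n < m\<close> the
  value \<open>[a]\<close> is a default.\<close>

primrec return_word :: "(nat \<Rightarrow> 'a) \<Rightarrow> (nat \<Rightarrow> 'a) \<Rightarrow> (nat \<Rightarrow> bool) \<Rightarrow> nat \<Rightarrow> nat \<Rightarrow> 'a \<Rightarrow> 'a list" where
  "return_word al be tw m 0 a = [a]"
| "return_word al be tw m (Suc n) a =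
     (if n < m then [a]
      else concat (map (return_word al be tw m n) (rv_word (al n) (be n) (tw n) a)))"

lemma return_word_le: "n \<le> m \<Longrightarrow> return_word al be tw m n a = [a]"
  by (cases n) auto

lemma concat_map_comp: "concat (map f (concat (map g w))) = concat (map (\<lambda>b. concat (map f (g b))) w)"
  by (induction w) auto

lemma return_word_trans:
  assumes "m \<le> n" "n \<le> p"
  shows "return_word al be tw m p a =
    concat (map (return_word al be tw m n) (return_word al be tw n p a))"
  using assms(2)
proof (induction p arbitrary: a rule: dec_induct)
  case base
  then show ?case by (simp add: return_word_le)
next
  case (step p)
  have "return_word al be tw m p =
      (\<lambda>b. concat (map (return_word al be tw m n) (return_word al be tw n p b)))"
    using step.IH by auto
  then show ?case using assms(1) step.hyps by (simp add: concat_map_comp)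
qed

lemma return_word_nonempty: "return_word al be tw m n a \<noteq> []"
  by (induction n arbitrary: a) (auto simp: rv_word_def)

text \<open>A Rauzy-Veech step described by the ends of the intervals alone, in unscaled
  coordinates. If the top wins, \<open>al\<close> is cut at the left end of the image of
  \<open>be\<close>; otherwise \<open>be\<close> is cut at the preimage of the left end of
  \<open>al\<close>, and its right part receives the label \<open>al\<close>.\<close>

locale rauzy_towers =
  fixes al be :: "nat \<Rightarrow> 'n::finite" and tw :: "nat \<Rightarrow> bool"
    and lo hi :: "nat \<Rightarrow> 'n \<Rightarrow> real" and R0 :: "'n \<Rightarrow> real \<Rightarrow> real"
  fixes R :: "nat \<Rightarrow> 'n \<Rightarrow> real \<Rightarrow> real"
  defines "R \<equiv> \<lambda>n a. run R0 (return_word al be tw 0 n a)"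
  assumes lo_hi: "\<And>n a. lo n a < hi n a"
    and al_be: "\<And>n. al n \<noteq> be n"
    and R0_cont: "\<And>a. continuous_on {lo 0 a..hi 0 a} (R0 a)"
    and R0_mono: "\<And>a. strict_mono_on {lo 0 a..hi 0 a} (R0 a)"
    and lo_top: "\<And>n a. tw n \<Longrightarrow> lo (Suc n) a = lo n a"
    and hi_top: "\<And>n a. tw n \<Longrightarrow> a \<noteq> al n \<Longrightarrow> hi (Suc n) a = hi n a"
    and hi_top_al: "\<And>n. tw n \<Longrightarrow> hi (Suc n) (al n) = R n (be n) (lo n (be n))"
    and hi_al_top: "\<And>n. tw n \<Longrightarrow> hi n (al n) = R n (be n) (hi n (be n))"
    and lo_bot: "\<And>n a. \<not> tw n \<Longrightarrow> a \<noteq> al n \<Longrightarrow> lo (Suc n) a = lo n a"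
    and hi_bot: "\<And>n a. \<not> tw n \<Longrightarrow> a \<noteq> al n \<Longrightarrow> a \<noteq> be n \<Longrightarrow> hi (Suc n) a = hi n a"
    and lo_bot_al: "\<And>n. \<not> tw n \<Longrightarrow> lo (Suc n) (al n) = hi (Suc n) (be n)"
    and hi_bot_al: "\<And>n. \<not> tw n \<Longrightarrow> hi (Suc n) (al n) = hi n (be n)"
    and R_cut_bot: "\<And>n. \<not> tw n \<Longrightarrow> R n (be n) (hi (Suc n) (be n)) = lo n (al n)"
    and R_hi_bot: "\<And>n. \<not> tw n \<Longrightarrow> R n (be n) (hi n (be n)) = hi n (al n)"
begin

abbreviation w :: "nat \<Rightarrow> nat \<Rightarrow> 'n \<Rightarrow> 'n list" where
  "w m n a \<equiv> return_word al be tw m n a"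

abbreviation step_word :: "nat \<Rightarrow> 'n \<Rightarrow> 'n list" where
  "step_word n a \<equiv> rv_word (al n) (be n) (tw n) a"

definition J :: "nat \<Rightarrow> 'n \<Rightarrow> real set" where
  "J n a = {lo n a..hi n a}"

lemma J_iff: "x \<in> J n a \<longleftrightarrow> lo n a \<le> x \<and> x \<le> hi n a"
  by (simp add: J_def)

lemma R_0: "R 0 = R0"
  by (rule ext, rule ext) (simp add: R_def)

lemma R_run: "m \<le> n \<Longrightarrow> R n a = run (R m) (w m n a)"
  by (rule ext) (simp add: R_def return_word_trans[of 0 m n] run_concat)

text \<open>Monotonicity of the stage-\<open>n\<close> maps locates the image of \<open>be\<close>
  from the images of its ends, which the locale assumptions prescribe.\<close>

lemma step_adm:
  assumes mono: "\<And>a. strict_mono_on (J n a) (R n a)" and x: "x \<in> J (Suc n) a"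
  shows "adm (J n) (R n) (step_word n a) x"
proof -
  have mono': "R n b u \<le> R n b v" if "u \<in> J n b" "v \<in> J n b" "u \<le> v" for b u v
    using mono[of b] that by (cases "u = v") (auto simp: strict_mono_on_def less_imp_le)
  note l = lo_hi[of n] lo_hi[of "Suc n"]
  show ?thesis
  proof (cases "tw n")
    case True
    have sub: "J (Suc n) b \<subseteq> J n b" for b
    proof (cases "b = al n")
      case b: True
      have "hi (Suc n) b \<le> hi n b"
        using hi_top_al[OF True] hi_al_top[OF True] l(1)[of "be n"] b
          mono'[of "lo n (be n)" "be n" "hi n (be n)"] by (auto simp: J_iff)
      then show ?thesis using lo_top[OF True, of b] by (auto simp: J_iff)
    next
      case False then show ?thesis using lo_top[OF True] hi_top[OF True] by (auto simp: J_iff)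
    qed
    show ?thesis
    proof (cases "a = be n")
      case a: True
      have xb: "x \<in> J n (be n)" using sub x a by auto
      have "R n (be n) (lo n (be n)) \<le> R n (be n) x" "R n (be n) x \<le> R n (be n) (hi n (be n))"
        using xb l(1)[of "be n"] by (auto intro!: mono' simp: J_iff)
      then have "R n (be n) x \<in> J n (al n)"
        using hi_top_al[OF True] hi_al_top[OF True] l(2)[of "al n"] lo_top[OF True, of "al n"]
        by (auto simp: J_iff)
      then show ?thesis using xb a True by (auto simp: rv_word_def)
    next
      case False then show ?thesis using sub x True by (auto simp: rv_word_def)
    qed
  next
    case False
    note f = lo_bot[OF False] hi_bot[OF False] lo_bot_al[OF False] hi_bot_al[OF False]
      R_cut_bot[OF False] R_hi_bot[OF False]
    have z: "lo n (be n) < hi (Suc n) (be n)" "hi (Suc n) (be n) < hi n (be n)"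
      using l(2)[of "be n"] l(2)[of "al n"] f al_be[of n] by auto
    show ?thesis
    proof (cases "a = al n")
      case a: True
      have xb: "x \<in> J n (be n)" using x a f z by (auto simp: J_iff)
      have "R n (be n) (hi (Suc n) (be n)) \<le> R n (be n) x" "R n (be n) x \<le> R n (be n) (hi n (be n))"
        using xb x a z f(3,4) by (auto intro!: mono' simp: J_iff)
      then have "R n (be n) x \<in> J n (al n)"
        using f by (auto simp: J_iff)
      then show ?thesis using xb a False by (auto simp: rv_word_def)
    next
      case a: False
      then have "x \<in> J n a"
        using x f(1)[OF a] f(2)[OF a] z al_be[of n] by (cases "a = be n") (auto simp: J_iff)
      then show ?thesis using a False by (auto simp: rv_word_def)
    qed
  qed
qed

text \<open>The three facts need a joint induction: admissibility at the next stage uses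
  monotonicity at the present one, and monotonicity and continuity of a composition use
  admissibility of its word.\<close>

lemma adm_and_mono:
  "(\<forall>a. \<forall>x\<in>J n a. adm (J 0) R0 (w 0 n a) x) \<and> (\<forall>a. strict_mono_on (J n a) (R n a))
   \<and> (\<forall>a. continuous_on (J n a) (R n a))"
proof (induction n)
  case 0
  then show ?case using R0_mono R0_cont by (auto simp: R_0 J_def)
next
  case (Suc n)
  have adm: "adm (J 0) R0 (w 0 (Suc n) a) x" if "x \<in> J (Suc n) a" for a x
  proof -
    have "adm (J n) (R n) (step_word n a) x" by (rule step_adm) (use Suc that in auto)
    then have "adm (J n) (\<lambda>b. run R0 (w 0 n b)) (step_word n a) x" by (simp add: R_def)
    then show ?thesis using adm_concat[of "J n" "J 0" R0 "w 0 n" "step_word n a" x] Suc by auto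
  qed
  have "strict_mono_on (J (Suc n) a) (R (Suc n) a)" for a
  proof -
    have "R (Suc n) a x < R (Suc n) a y" if "x \<in> J (Suc n) a" "y \<in> J (Suc n) a" "x < y" for x y
      unfolding R_def by (rule run_strict_mono[where J = "J 0"]) (use that adm R0_mono in \<open>auto simp: J_def\<close>)
    then show ?thesis by (auto simp: strict_mono_on_def)
  qed
  moreover have "continuous_on (J (Suc n) a) (R (Suc n) a)" for a
    unfolding R_def by (rule run_image_adm[where J = "J 0"]) (use adm R0_cont in \<open>auto simp: J_def\<close>)
  ultimately show ?case using adm by auto
qed

lemma R_mono: "strict_mono_on (J n a) (R n a)"
  and R_cont: "continuous_on (J n a) (R n a)"
  using adm_and_mono by auto

lemma R_le: "x \<in> J n a \<Longrightarrow> y \<in> J n a \<Longrightarrow> x \<le> y \<Longrightarrow> R n a x \<le> R n a y"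
  using R_mono[of n a] by (cases "x = y") (auto simp: strict_mono_on_def less_imp_le)

lemma adm_w:
  assumes "m \<le> n" "x \<in> J n a"
  shows "adm (J m) (R m) (w m n a) x"
  using assms
proof (induction n arbitrary: a x rule: dec_induct)
  case base
  then show ?case by (simp add: return_word_le)
next
  case (step n)
  have "adm (J n) (R n) (step_word n a) x" by (rule step_adm) (use R_mono step in auto)
  moreover have "R n = (\<lambda>b. run (R m) (w m n b))" using R_run[OF step(1)] by (auto intro!: ext)
  ultimately show ?case using adm_concat[of "J n" "J m" "R m" "w m n" "step_word n a" x] step by auto
qed

lemma lo_in [simp]: "lo n a \<in> J n a" and hi_in [simp]: "hi n a \<in> J n a"
  using lo_hi[of n a] by (auto simp: J_iff)

lemma step_interval_sub:
  assumes "\<not> tw n"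
  shows "lo n (be n) < hi (Suc n) (be n)" "hi (Suc n) (be n) < hi n (be n)"
  using assms lo_hi[of "Suc n" "be n"] lo_hi[of "Suc n" "al n"] lo_bot[of n "be n"]
    lo_bot_al[of n] hi_bot_al[of n] al_be[of n] by auto

lemma step_interval_top:
  assumes "tw n"
  shows "lo n (al n) < hi (Suc n) (al n)" "hi (Suc n) (al n) < hi n (al n)"
  using assms lo_hi[of "Suc n" "al n"] lo_top[of n "al n"] hi_al_top[of n] hi_top_al[of n]
    R_mono[of n "be n"] lo_hi[of n "be n"] by (auto simp: strict_mono_on_def J_iff)

end

text \<open>\<open>f0\<close> is the log-derivative of the branches and \<open>eta\<close> its
  derivative, the nonlinearity. \<open>total_jump\<close> says that the nonlinearity has mean zero;
  for a GIET this is the boundary summed over all cycles.\<close>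

locale smooth_towers = rauzy_towers al be tw lo hi R0 R
  for al be :: "nat \<Rightarrow> 'n::finite" and tw lo hi R0 R +
  fixes f0 eta :: "'n \<Rightarrow> real \<Rightarrow> real" and K :: real
  fixes D :: "nat \<Rightarrow> 'n \<Rightarrow> real \<Rightarrow> real" and f :: "nat \<Rightarrow> 'n \<Rightarrow> real \<Rightarrow> real"
  defines "D \<equiv> \<lambda>n a. dchain R0 (\<lambda>b x. exp (f0 b x)) (return_word al be tw 0 n a)"
    and "f \<equiv> \<lambda>n a. bsum R0 f0 (return_word al be tw 0 n a)"
  assumes R0_deriv: "\<And>b x. x \<in> {lo 0 b..hi 0 b} \<Longrightarrow>
      (R0 b has_real_derivative exp (f0 b x)) (at x within {lo 0 b..hi 0 b})"
    and f0_deriv: "\<And>b x. x \<in> {lo 0 b..hi 0 b} \<Longrightarrow>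
      (f0 b has_real_derivative eta b x) (at x within {lo 0 b..hi 0 b})"
    and eta_lip: "\<And>b x y. x \<in> {lo 0 b..hi 0 b} \<Longrightarrow> y \<in> {lo 0 b..hi 0 b} \<Longrightarrow>
      \<bar>eta b x - eta b y\<bar> \<le> K * \<bar>x - y\<bar>"
    and total_length: "(\<Sum>b\<in>UNIV. hi 0 b - lo 0 b) = 1"
    and total_jump: "(\<Sum>b\<in>UNIV. f0 b (hi 0 b) - f0 b (lo 0 b)) = 0"
begin

lemma D_exp: "D n a x = exp (f n a x)"
  by (simp add: D_def f_def dchain_exp)

lemma D_pos [simp]: "D n a x > 0" and D_nonneg [simp]: "D n a x \<ge> 0"
  by (simp_all add: D_exp)

lemma D_run: "m \<le> n \<Longrightarrow> D n a = dchain (R m) (D m) (w m n a)"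
  by (rule ext) (simp add: D_def R_def return_word_trans[of 0 m n] dchain_concat)

lemma f_run: "m \<le> n \<Longrightarrow> f n a = bsum (R m) (f m) (w m n a)"
  by (rule ext) (simp add: f_def R_def return_word_trans[of 0 m n] bsum_concat)

lemma D_0: "D 0 = (\<lambda>b x. exp (f0 b x))" and f_0: "f 0 = f0"
  by (auto simp: D_def f_def intro!: ext)

text \<open>For \<open>g = eta\<close> this is the nonlinearity of the induced maps, for
  \<open>g = 1\<close> a height of the towers in which each floor counts by its relative
  width.\<close>

definition trans :: "('n \<Rightarrow> real \<Rightarrow> real) \<Rightarrow> nat \<Rightarrow> 'n \<Rightarrow> real \<Rightarrow> real" where
  "trans g n a = wsum R0 (D 0) g (w 0 n a)"

lemma trans_run: "m \<le> n \<Longrightarrow> trans g n a = wsum (R m) (D m) (trans g m) (w m n a)"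

proof -
  assume "m \<le> n"
  moreover have "(\<lambda>b. run R0 (w 0 m b)) = R m" by (simp add: R_def)
  moreover have "(\<lambda>b. dchain R0 (D 0) (w 0 m b)) = D m"
    by (rule ext) (simp only: D_run[of 0 m, OF le0] R_0)
  ultimately show ?thesis
    by (intro ext) (simp add: trans_def[abs_def] return_word_trans[of 0 m n] wsum_concat)
qed

lemma R_deriv: "x \<in> J n a \<Longrightarrow> (R n a has_real_derivative D n a x) (at x within J n a)"
  using run_deriv[of "J 0" R0 "D 0" "J n a" "w 0 n a" x] R0_deriv adm_w[of 0 n]
  by (auto simp: D_0 R_0 J_def D_run[of 0 n] R_run[of 0 n])

lemma f_deriv: "x \<in> J n a \<Longrightarrow> (f n a has_real_derivative trans eta n a x) (at x within J n a)"
  using bsum_deriv[of "J 0" R0 "D 0" f0 eta "J n a" "w 0 n a" x] R0_deriv f0_deriv adm_w[of 0 n]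
  by (auto simp: D_0 f_0 R_0 J_def trans_def f_run[of 0 n])

lemma f_cont: "continuous_on (J n a) (f n a)"
  using f_deriv DERIV_continuous_on by blast

lemma D_cont: "continuous_on (J n a) (D n a)"
  unfolding D_exp by (intro continuous_intros f_cont)

lemma wsum_cont:
  assumes "m \<le> n" "\<And>b. continuous_on (J m b) (g b)"
  shows "continuous_on (J n a) (wsum (R m) (D m) g (w m n a))"
  by (rule wsum_continuous[where J = "J m"]) (use assms R_cont D_cont adm_w in auto)

text \<open>The floors of the new towers tile the old intervals. Only \<open>al\<close> and
  \<open>be\<close> are affected: one of them keeps a one-letter word on a shortened interval or
  keeps its interval, and the integrals over the cut pieces are recovered from the two-letter word
  by a change of variables.\<close>

lemma step_integral:
  assumes "\<And>b. continuous_on (J n b) (g b)"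
  shows "(\<Sum>a\<in>UNIV. integral (J (Suc n) a) (wsum (R n) (D n) g (step_word n a)))
       = (\<Sum>b\<in>UNIV. integral (J n b) (g b))"
proof -
  let ?a = "al n" and ?b = "be n"
  let ?G = "\<lambda>a. integral (J (Suc n) a) (wsum (R n) (D n) g (step_word n a))"
  have split: "(\<Sum>a\<in>UNIV. F a) = F ?a + F ?b + (\<Sum>a\<in>UNIV - {?a, ?b}. F a)" for F :: "'n \<Rightarrow> real"
  proof -
    have "UNIV = insert ?a (insert ?b (UNIV - {?a, ?b}))" by auto
    then have "(\<Sum>a\<in>UNIV. F a) = (\<Sum>a\<in>insert ?a (insert ?b (UNIV - {?a, ?b})). F a)" by simp
    also have "\<dots> = F ?a + F ?b + (\<Sum>a\<in>UNIV - {?a, ?b}. F a)"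
      using al_be[of n] by (subst sum.insert; simp)
    finally show ?thesis .
  qed
  have int: "g b integrable_on {u..v}" if "{u..v} \<subseteq> J n b" for u v b
    using continuous_on_subset[OF assms[of b] that] integrable_continuous_real by auto
  \<comment> \<open>Substitution along the branch over \<open>be\<close> turns the second letter of
    the loser's word into an integral over part of \<open>al\<close>.\<close>
  have subst: "((\<lambda>x. D n ?b x * g ?a (R n ?b x)) has_integral
      integral {R n ?b u..R n ?b v} (g ?a)) {u..v}"
    if "u \<le> v" "{u..v} \<subseteq> J n ?b" "R n ?b u \<ge> lo n ?a" "R n ?b v \<le> hi n ?a" for u v
  proof -
    have uv: "u \<in> J n ?b" "v \<in> J n ?b" using that by (auto simp: J_iff)
    have "((\<lambda>x. D n ?b x *\<^sub>R g ?a (R n ?b x)) has_integral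
      integral {R n ?b u..R n ?b v} (g ?a)) {u..v}"
    proof (rule has_integral_substitution[where c = "lo n ?a" and d = "hi n ?a"])
      show "R n ?b u \<le> R n ?b v" using uv that R_le by auto
      show "R n ?b ` {u..v} \<subseteq> {lo n ?a..hi n ?a}"
      proof
        fix y assume "y \<in> R n ?b ` {u..v}"
        then obtain x where x: "y = R n ?b x" "x \<in> {u..v}" by auto
        then have "R n ?b u \<le> y" "y \<le> R n ?b v" using uv that(2) by (auto intro!: R_le)
        then show "y \<in> {lo n ?a..hi n ?a}" using that by auto
      qed
      show "continuous_on {lo n ?a..hi n ?a} (g ?a)" using assms[of ?a] by (simp add: J_def)
      show "(R n ?b has_real_derivative D n ?b x) (at x within {u..v})" if "x \<in> {u..v}" for x
        by (rule DERIV_subset[OF R_deriv]) (use that \<open>{u..v} \<subseteq> J n ?b\<close> in auto)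
    qed (use that in auto)
    then show ?thesis by simp
  qed
  show ?thesis
  proof (cases "tw n")
    case True
    note t = step_interval_top[OF True] lo_top[OF True] hi_top[OF True] hi_top_al[OF True]
      hi_al_top[OF True]
    have rest: "?G a = integral (J n a) (g a)" if "a \<noteq> ?a" "a \<noteq> ?b" for a
    proof -
      have "step_word n a = [a]" using that True by (auto simp: rv_word_def)
      then show ?thesis using that t by (simp add: J_def)
    qed
    have "step_word n ?a = [?a]" using True al_be[of n] by (auto simp: rv_word_def)
    then have A: "?G ?a = integral {lo n ?a..hi (Suc n) ?a} (g ?a)" using t by (simp add: J_def)
    have wb: "wsum (R n) (D n) g (step_word n ?b) = (\<lambda>x. g ?b x + D n ?b x * g ?a (R n ?b x))"
      using True by (auto simp: rv_word_def)
    have Jb: "J (Suc n) ?b = J n ?b" using t al_be[of n] by (auto simp: J_def)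
    have "((\<lambda>x. D n ?b x * g ?a (R n ?b x)) has_integral
      integral {hi (Suc n) ?a..hi n ?a} (g ?a)) {lo n ?b..hi n ?b}"
      using subst[of "lo n ?b" "hi n ?b"] t lo_hi[of n ?b] by (auto simp: J_def)
    then have B: "?G ?b = integral (J n ?b) (g ?b) + integral {hi (Suc n) ?a..hi n ?a} (g ?a)"
      unfolding wb Jb using int[of "lo n ?b" "hi n ?b" ?b]
      by (intro integral_unique has_integral_add integrable_integral) (auto simp: J_def)
    have "integral {lo n ?a..hi (Suc n) ?a} (g ?a) + integral {hi (Suc n) ?a..hi n ?a} (g ?a)
       = integral (J n ?a) (g ?a)"
      using t int[of "lo n ?a" "hi n ?a" ?a]
      by (subst Henstock_Kurzweil_Integration.integral_combine) (auto simp: J_def)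
    then show ?thesis using A B rest by (simp add: split)
  next
    case False
    note t = step_interval_sub[OF False] lo_bot[OF False] hi_bot[OF False] lo_bot_al[OF False]
      hi_bot_al[OF False] R_cut_bot[OF False] R_hi_bot[OF False]
    have rest: "?G a = integral (J n a) (g a)" if "a \<noteq> ?a" "a \<noteq> ?b" for a
    proof -
      have "step_word n a = [a]" using that False by (auto simp: rv_word_def)
      then show ?thesis using that t by (simp add: J_def)
    qed
    have "step_word n ?b = [?b]" using False al_be[of n] by (auto simp: rv_word_def)
    then have B: "?G ?b = integral {lo n ?b..hi (Suc n) ?b} (g ?b)"
      using t al_be[of n] by (simp add: J_def)
    have wa: "wsum (R n) (D n) g (step_word n ?a) = (\<lambda>x. g ?b x + D n ?b x * g ?a (R n ?b x))"
      using False by (auto simp: rv_word_def)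
    have Ja: "J (Suc n) ?a = {hi (Suc n) ?b..hi n ?b}" using t by (auto simp: J_def)
    have "((\<lambda>x. D n ?b x * g ?a (R n ?b x)) has_integral
      integral (J n ?a) (g ?a)) {hi (Suc n) ?b..hi n ?b}"
      using subst[of "hi (Suc n) ?b" "hi n ?b"] t lo_hi[of n ?b] by (auto simp: J_def)
    then have A: "?G ?a = integral {hi (Suc n) ?b..hi n ?b} (g ?b) + integral (J n ?a) (g ?a)"
      unfolding wa Ja using int[of "hi (Suc n) ?b" "hi n ?b" ?b] t
      by (intro integral_unique has_integral_add integrable_integral) (auto simp: J_def)
    have "integral {lo n ?b..hi (Suc n) ?b} (g ?b) + integral {hi (Suc n) ?b..hi n ?b} (g ?b)
       = integral (J n ?b) (g ?b)"
      using t int[of "lo n ?b" "hi n ?b" ?b]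
      by (subst Henstock_Kurzweil_Integration.integral_combine) (auto simp: J_def)
    then show ?thesis using A B rest by (simp add: split)
  qed
qed

text \<open>Conservation of mass. With \<open>g = 1\<close> it preserves the total length, with
  \<open>g = eta\<close> the mean nonlinearity, and with the indicator of a label it measures one
  interval by the floors inside it.\<close>

lemma word_integral:
  assumes "m \<le> n" "\<And>b. continuous_on (J m b) (g b)"
  shows "(\<Sum>a\<in>UNIV. integral (J n a) (wsum (R m) (D m) g (w m n a)))
       = (\<Sum>b\<in>UNIV. integral (J m b) (g b))"
  using assms(1)
proof (induction n rule: dec_induct)
  case base
  have "wsum (R m) (D m) g (w m m a) = g a" for a by (auto simp: return_word_le)
  then show ?case by simp
next
  case (step n)
  have 1: "wsum (R m) (D m) g (w m (Suc n) a)
      = wsum (R n) (D n) (\<lambda>b. wsum (R m) (D m) g (w m n b)) (step_word n a)" for a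
  proof -
    have "(\<lambda>b. run (R m) (w m n b)) = R n" "(\<lambda>b. dchain (R m) (D m) (w m n b)) = D n"
      using R_run[OF step(1)] D_run[OF step(1)] by auto
    then show ?thesis
      using step(1) wsum_concat[of "R m" "D m" g "w m n" "step_word n a"] by (auto intro!: ext)
  qed
  show ?case
    unfolding 1 using step.IH
    by (subst step_integral) (auto intro!: wsum_cont step assms)
qed

end

section \<open>Distortion\<close>

lemma take_concat_nth:
  "s < length (concat xss) \<Longrightarrow> \<exists>i j. i < length xss \<and> j < length (xss ! i) \<and>
     take s (concat xss) = concat (take i xss) @ take j (xss ! i) \<and> concat xss ! s = xss ! i ! j"
proof (induction xss arbitrary: s)
  case (Cons xs xss)
  show ?case
  proof (cases "s < length xs")
    case True
    then show ?thesis by (intro exI[of _ 0] exI[of _ s]) (auto simp: nth_append)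
  next
    case False
    then have "s - length xs < length (concat xss)" using Cons.prems by auto
    then obtain i j where "i < length xss" "j < length (xss ! i)"
      "take (s - length xs) (concat xss) = concat (take i xss) @ take j (xss ! i)"
      "concat xss ! (s - length xs) = xss ! i ! j" using Cons.IH by blast
    then show ?thesis using False by (intro exI[of _ "Suc i"] exI[of _ j]) (auto simp: nth_append)
  qed
qed simp

lemma mvt_within:
  fixes g :: "real \<Rightarrow> real"
  assumes "\<And>x. x \<in> {a..b} \<Longrightarrow> (g has_real_derivative g' x) (at x within {a..b})" "a \<le> b"
  obtains z where "z \<in> {a..b}" "g b - g a = g' z * (b - a)"
  using mvt_very_simple[of a b g "\<lambda>x h. g' x * h"] assms
  by (force simp: has_field_derivative_def)

text \<open>Convexity makes a distortion factor at relative distance \<open>t\<close> linear in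
  \<open>t\<close>.\<close>

lemma exp_chord:
  fixes t c :: real
  assumes "0 \<le> t" "t \<le> 1"
  shows "exp (c * t) - 1 \<le> t * (exp c - 1)"
  using convex_onD[OF exp_convex, of t "0::real" c] assms by (simp add: algebra_simps)

text \<open>A coupling of two averages: on each label \<open>l\<close> a common mass
  \<open>\<nu> l\<close> is matched, where the values differ by at most \<open>Mx l - mn l\<close>,
  and only the remaining mass \<open>1 - sum \<nu> L\<close> pays the full gap
  \<open>M - \<mu>\<close>.\<close>

lemma coupling_bound:
  fixes p F :: "'s \<Rightarrow> real" and q G :: "'t \<Rightarrow> real" and \<nu> Mx mn :: "'l \<Rightarrow> real"
  assumes fin: "finite A" "finite B" "finite L"
    and lab: "\<And>s. s \<in> A \<Longrightarrow> lab s \<in> L" "\<And>t. t \<in> B \<Longrightarrow> lab' t \<in> L"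
    and p: "\<And>s. s \<in> A \<Longrightarrow> 0 \<le> p s" "sum p A = 1"
    and q: "\<And>t. t \<in> B \<Longrightarrow> 0 \<le> q t" "sum q B = 1"
    and \<nu>: "\<And>l. l \<in> L \<Longrightarrow> \<nu> l \<le> (\<Sum>s | s \<in> A \<and> lab s = l. p s)"
       "\<And>l. l \<in> L \<Longrightarrow> \<nu> l \<le> (\<Sum>t | t \<in> B \<and> lab' t = l. q t)"
    and F: "\<And>s. s \<in> A \<Longrightarrow> F s \<le> Mx (lab s)" "\<And>l. l \<in> L \<Longrightarrow> Mx l \<le> M"
    and G: "\<And>t. t \<in> B \<Longrightarrow> mn (lab' t) \<le> G t" "\<And>l. l \<in> L \<Longrightarrow> \<mu> \<le> mn l"
  shows "(\<Sum>s\<in>A. p s * F s) - (\<Sum>t\<in>B. q t * G t)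
    \<le> (1 - sum \<nu> L) * (M - \<mu>) + (\<Sum>l\<in>L. \<nu> l * (Mx l - mn l))"
proof -
  define P where "P l = (\<Sum>s | s \<in> A \<and> lab s = l. p s)" for l
  define Q where "Q l = (\<Sum>t | t \<in> B \<and> lab' t = l. q t)" for l
  have gp: "(\<Sum>l\<in>L. \<Sum>s | s \<in> A \<and> lab s = l. f s) = sum f A" for f :: "'s \<Rightarrow> real"
    using sum.group[of A L lab f] fin lab by auto
  have gq: "(\<Sum>l\<in>L. \<Sum>t | t \<in> B \<and> lab' t = l. f t) = sum f B" for f :: "'t \<Rightarrow> real"
    using sum.group[of B L lab' f] fin lab by auto
  have "(\<Sum>s\<in>A. p s * F s) \<le> (\<Sum>s\<in>A. p s * Mx (lab s))"
    by (intro sum_mono mult_left_mono F p)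
  also have "\<dots> = (\<Sum>l\<in>L. P l * Mx l)"
    unfolding gp[symmetric] P_def by (intro sum.cong refl) (auto simp: sum_distrib_right)
  also have "\<dots> = (\<Sum>l\<in>L. \<nu> l * Mx l) + (\<Sum>l\<in>L. (P l - \<nu> l) * Mx l)"
    by (simp add: sum.distrib[symmetric] algebra_simps)
  also have "(\<Sum>l\<in>L. (P l - \<nu> l) * Mx l) \<le> (\<Sum>l\<in>L. (P l - \<nu> l) * M)"
    using \<nu> F by (intro sum_mono mult_left_mono) (auto simp: P_def)
  also have "\<dots> = (1 - sum \<nu> L) * M"
    using gp[of p] p(2) by (simp add: sum_distrib_right[symmetric] sum_subtractf P_def)
  finally have 1: "(\<Sum>s\<in>A. p s * F s) \<le> (\<Sum>l\<in>L. \<nu> l * Mx l) + (1 - sum \<nu> L) * M" by simp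
  have "(1 - sum \<nu> L) * \<mu> = (\<Sum>l\<in>L. (Q l - \<nu> l) * \<mu>)"
    using gq[of q] q(2) by (simp add: sum_distrib_right[symmetric] sum_subtractf Q_def)
  also have "\<dots> \<le> (\<Sum>l\<in>L. (Q l - \<nu> l) * mn l)"
    using \<nu> G by (intro sum_mono mult_left_mono) (auto simp: Q_def)
  finally have "(\<Sum>l\<in>L. \<nu> l * mn l) + (1 - sum \<nu> L) * \<mu>
      \<le> (\<Sum>l\<in>L. \<nu> l * mn l) + (\<Sum>l\<in>L. (Q l - \<nu> l) * mn l)" by simp
  also have "\<dots> = (\<Sum>l\<in>L. Q l * mn l)"
    by (simp add: sum.distrib[symmetric] algebra_simps)
  also have "\<dots> = (\<Sum>t\<in>B. q t * mn (lab' t))"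
    unfolding gq[symmetric] Q_def by (intro sum.cong refl) (auto simp: sum_distrib_right)
  also have "\<dots> \<le> (\<Sum>t\<in>B. q t * G t)"
    by (intro sum_mono mult_left_mono G q)
  finally have 2: "(\<Sum>l\<in>L. \<nu> l * mn l) + (1 - sum \<nu> L) * \<mu> \<le> (\<Sum>t\<in>B. q t * G t)" .
  have 3: "(\<Sum>l\<in>L. \<nu> l * (Mx l - mn l)) = (\<Sum>l\<in>L. \<nu> l * Mx l) - (\<Sum>l\<in>L. \<nu> l * mn l)"
    by (simp add: algebra_simps sum_subtractf)
  have 4: "(1 - sum \<nu> L) * (M - \<mu>) = (1 - sum \<nu> L) * M - (1 - sum \<nu> L) * \<mu>"
    by (simp add: algebra_simps)
  show ?thesis using 1 2 3 4 by linarith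
qed

section \<open>Bounded distortion of the towers and the averaging weights\<close>

context smooth_towers
begin

definition len :: "nat \<Rightarrow> 'n \<Rightarrow> real" where "len n a = hi n a - lo n a"

text \<open>The total variation of the log-derivative on the intervals, Denjoy's distortion
  constant.\<close>

definition N :: real where "N = (\<Sum>b\<in>UNIV. integral (J 0 b) (\<lambda>x. \<bar>eta b x\<bar>))"

text \<open>A bound for \<open>eta\<close>: a value at a left end plus the Lipschitz constant, as
  the intervals have length at most 1.\<close>

definition H :: real where "H = (\<Sum>b\<in>UNIV. \<bar>eta b (lo 0 b)\<bar>) + \<bar>K\<bar>"

definition C1 :: real where "C1 = H * exp N"

definition h :: "nat \<Rightarrow> 'n \<Rightarrow> real \<Rightarrow> real" where "h n a = trans (\<lambda>b x. 1) n a"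

text \<open>Numerator and denominator are weighted sums over the same floors with the same weights,
  so the quotient at a later stage is an average of quotients at an earlier one.\<close>

definition psi :: "nat \<Rightarrow> 'n \<Rightarrow> real \<Rightarrow> real" where "psi n a x = trans eta n a x / h n a x"

lemma len_pos [simp]: "len n a > 0" and len_nonneg [simp]: "len n a \<ge> 0"
  using lo_hi[of n a] by (auto simp: len_def)

lemma eta_cont: "continuous_on (J 0 b) (eta b)"
proof -
  have "K-lipschitz_on (J 0 b) (eta b)" if "K \<ge> 0"
    using that eta_lip by (auto intro!: lipschitz_onI simp: dist_real_def J_def)
  moreover have "K \<ge> 0"
  proof -
    have "0 \<le> K * \<bar>lo 0 b - hi 0 b\<bar>"
      using eta_lip[of "lo 0 b" b "hi 0 b"] lo_hi[of 0 b] by (smt (verit) atLeastAtMost_iff)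
    moreover have "\<bar>lo 0 b - hi 0 b\<bar> > 0" using lo_hi[of 0 b] by auto
    ultimately show ?thesis by (simp add: zero_le_mult_iff)
  qed
  ultimately show ?thesis using lipschitz_on_continuous_on by blast
qed

lemma len0_le: "len 0 b \<le> 1"
  using total_length member_le_sum[of b UNIV "\<lambda>b. len 0 b"] by (auto simp: len_def[symmetric])

lemma eta_bound: "x \<in> J 0 b \<Longrightarrow> \<bar>eta b x\<bar> \<le> H"
proof -
  assume x: "x \<in> J 0 b"
  have "\<bar>eta b x - eta b (lo 0 b)\<bar> \<le> K * \<bar>x - lo 0 b\<bar>"
    using eta_lip[of x b "lo 0 b"] x lo_hi[of 0 b] by (auto simp: J_iff)
  also have "\<dots> \<le> \<bar>K\<bar> * 1"
    using x len0_le[of b] by (intro mult_mono) (auto simp: J_iff len_def)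
  finally have "\<bar>eta b x\<bar> \<le> \<bar>eta b (lo 0 b)\<bar> + \<bar>K\<bar>" by linarith
  moreover have "\<bar>eta b (lo 0 b)\<bar> \<le> (\<Sum>b\<in>UNIV. \<bar>eta b (lo 0 b)\<bar>)"
    by (rule member_le_sum) auto
  ultimately show ?thesis by (simp add: H_def)
qed

lemma H_nonneg: "H \<ge> 0"
  by (simp add: H_def sum_nonneg)

lemma C1_nonneg: "C1 \<ge> 0"
  using H_nonneg by (simp add: C1_def)

lemma N_nonneg: "N \<ge> 0"
  unfolding N_def J_def by (intro sum_nonneg integral_nonneg integrable_continuous_real)
    (auto intro!: continuous_intros eta_cont simp: J_def[symmetric])

lemma adm0: "x \<in> J n a \<Longrightarrow> adm (J 0) R0 (w 0 n a) x"
  using adm_w[of 0 n x a] by (simp add: R_0)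

lemma adm_prefix: "w m n a = u @ v \<Longrightarrow> m \<le> n \<Longrightarrow> x \<in> J n a \<Longrightarrow> adm (J m) (R m) u x"
  using adm_w[of m n x a] by (simp add: adm_append)

lemma wsum_prefix_le:
  assumes "w 0 n a = u @ v" "x \<in> J n a" "\<And>b y. y \<in> J 0 b \<Longrightarrow> 0 \<le> g b y"
  shows "wsum R0 (D 0) g u x \<le> wsum R0 (D 0) g (w 0 n a) x"
proof -
  have "adm (J 0) R0 v (run R0 u x)" "adm (J 0) R0 u x"
    using adm0[OF assms(2)] assms(1) by (auto simp: adm_append)
  then have "0 \<le> dchain R0 (D 0) u x * wsum R0 (D 0) g v (run R0 u x)"
    using wsum_nonneg[of "J 0" "D 0" g R0 v] dchain_pos[of "J 0" "D 0" R0 u x] assms(3)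
    by (intro mult_nonneg_nonneg) (auto simp: less_imp_le)
  then show ?thesis using assms(1) by (simp add: wsum_append)
qed

lemma integral_trans_le:
  assumes "\<And>b. continuous_on (J 0 b) (g b)" "\<And>b y. y \<in> J 0 b \<Longrightarrow> 0 \<le> g b y"
  shows "integral (J n a) (trans g n a) \<le> (\<Sum>b\<in>UNIV. integral (J 0 b) (g b))"
proof -
  have c: "continuous_on (J n a) (trans g n a)" for a
    using wsum_cont[of 0 n g a] assms by (simp add: trans_def R_0)
  have "integral (J n a) (trans g n a) \<le> (\<Sum>a\<in>UNIV. integral (J n a) (trans g n a))"
  proof (rule member_le_sum)
    show "0 \<le> integral (J n a) (trans g n a)" for a
    proof (rule integral_nonneg)
      show "trans g n a integrable_on J n a"
        using c[of a] unfolding J_def by (rule integrable_continuous_real)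
      show "0 \<le> trans g n a x" if "x \<in> J n a" for x
        unfolding trans_def by (rule wsum_nonneg[where J = "J 0"]) (use assms adm0 that in auto)
    qed
  qed auto
  also have "\<dots> = (\<Sum>b\<in>UNIV. integral (J 0 b) (g b))"
    using word_integral[of 0 n g] assms by (simp add: trans_def[abs_def] R_0)
  finally show ?thesis .
qed

lemma prefix_f_deriv:
  assumes "w 0 n a = u @ v" "x \<in> J n a"
  shows "(bsum R0 f0 u has_real_derivative wsum R0 (D 0) eta u x) (at x within J n a)"
  by (rule bsum_deriv[where J = "J 0"])
    (use assms R0_deriv f0_deriv adm_prefix[OF assms(1)] in \<open>auto simp: D_0 J_def R_0\<close>)

text \<open>Denjoy's argument: the floors of a tower are disjoint, so a Birkhoff sum varies by at
  most the total variation \<open>N\<close>. Prefixes are allowed because the weights of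
  intermediate floors must be compared as well.\<close>

lemma prefix_distortion:
  assumes u: "w 0 n a = u @ v" and xy: "x \<in> J n a" "y \<in> J n a"
  shows "\<bar>bsum R0 f0 u x - bsum R0 f0 u y\<bar> \<le> N"
  using xy
proof (induction x y rule: linorder_wlog)
  case (sym x y) then show ?case by (simp add: abs_minus_commute)
next
  case (le x y)
  have sub: "{x..y} \<subseteq> J n a" using le by (auto simp: J_iff)
  have "((wsum R0 (D 0) eta u) has_integral (bsum R0 f0 u y - bsum R0 f0 u x)) {x..y}"
  proof (rule fundamental_theorem_of_calculus[OF le(1)])
    fix z assume "z \<in> {x..y}"
    then show "(bsum R0 f0 u has_vector_derivative wsum R0 (D 0) eta u z) (at z within {x..y})"
      using DERIV_subset[OF prefix_f_deriv[OF u] sub] sub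
      by (auto simp: has_real_derivative_iff_has_vector_derivative[symmetric])
  qed
  then have e: "bsum R0 f0 u y - bsum R0 f0 u x = integral {x..y} (wsum R0 (D 0) eta u)"
    and i: "wsum R0 (D 0) eta u integrable_on {x..y}"
    by (auto simp: integral_unique)
  let ?g = "trans (\<lambda>b y. \<bar>eta b y\<bar>) n a"
  have c: "continuous_on (J n a) ?g"
    using wsum_cont[of 0 n "\<lambda>b y. \<bar>eta b y\<bar>" a] eta_cont
    by (auto simp: trans_def R_0 intro!: continuous_intros)
  have gi: "?g integrable_on {x..y}"
    by (rule integrable_continuous_real[OF continuous_on_subset[OF c sub]])
  have "norm (integral {x..y} (wsum R0 (D 0) eta u)) \<le> integral {x..y} ?g"
  proof (rule integral_norm_bound_integral[OF i gi])
    fix z assume "z \<in> {x..y}"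
    then have z: "z \<in> J n a" using sub by auto
    have "\<bar>wsum R0 (D 0) eta u z\<bar> \<le> wsum R0 (D 0) (\<lambda>b y. \<bar>eta b y\<bar>) u z"
      by (rule wsum_abs_le[where J = "J 0"]) (use adm_prefix[OF u _ z] in \<open>auto simp: R_0\<close>)
    also have "\<dots> \<le> ?g z"
      unfolding trans_def by (rule wsum_prefix_le[OF u z]) auto
    finally show "norm (wsum R0 (D 0) eta u z) \<le> ?g z" by simp
  qed
  also have "\<dots> \<le> integral (J n a) ?g"
    using c unfolding J_def
    by (intro integral_subset_le integrable_continuous_real gi)
       (use sub in \<open>auto simp: J_def trans_def intro!: wsum_nonneg[where J = "J 0"] adm0\<close>)
  also have "\<dots> \<le> N"
    unfolding N_def by (rule integral_trans_le) (auto intro!: continuous_intros eta_cont)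
  finally show ?case using e by simp
qed

lemma prefix_dchain_le:
  assumes "w 0 n a = u @ v" "x \<in> J n a" "y \<in> J n a"
  shows "dchain R0 (D 0) u x \<le> exp N * dchain R0 (D 0) u y"
proof -
  have "bsum R0 f0 u x \<le> N + bsum R0 f0 u y" using prefix_distortion[OF assms] by linarith
  then show ?thesis by (simp add: D_0 dchain_exp exp_add[symmetric])
qed

lemma h_pos: "x \<in> J n a \<Longrightarrow> h n a x \<ge> 1"
proof -
  assume x: "x \<in> J n a"
  obtain b v where v: "w 0 n a = b # v" using return_word_nonempty[of al be tw 0 n a]
    by (cases "w 0 n a") auto
  have "wsum R0 (D 0) (\<lambda>b x. 1) [b] x \<le> h n a x"
    unfolding h_def trans_def by (rule wsum_prefix_le[of n a "[b]" v]) (use v x in auto)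
  then show ?thesis by simp
qed

lemma h_distortion:
  assumes "x \<in> J n a" "y \<in> J n a"
  shows "h n a x \<le> exp N * h n a y"
proof -
  let ?w = "w 0 n a"
  have "dchain R0 (D 0) (take s ?w) x \<le> exp N * dchain R0 (D 0) (take s ?w) y" for s
    by (rule prefix_dchain_le[of n a _ "drop s ?w"]) (use assms in auto)
  then show ?thesis
    by (auto simp: h_def trans_def wsum_eq_sum sum_distrib_left intro!: sum_mono)
qed

lemma h_cont: "continuous_on (J n a) (h n a)"
  using wsum_cont[of 0 n "\<lambda>b x. 1" a] by (simp add: h_def trans_def R_0)

lemma trans_eta_cont: "continuous_on (J n a) (trans eta n a)"
  using wsum_cont[of 0 n eta a] eta_cont by (simp add: trans_def R_0)

lemma integral_h: "(\<Sum>a\<in>UNIV. integral (J n a) (h n a)) = 1"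
  using word_integral[of 0 n "\<lambda>b x. 1"] total_length lo_hi
  by (simp add: h_def trans_def[abs_def] R_0 J_def less_imp_le)

text \<open>The integral of \<open>h n a\<close> is the mass of a single tower, at most 1, and
  distortion compares any value of \<open>h n a\<close> with the average one.\<close>

lemma h_len_le: "x \<in> J n a \<Longrightarrow> h n a x * len n a \<le> exp N"
proof -
  assume x: "x \<in> J n a"
  have "h n a x * len n a = integral (J n a) (\<lambda>y. h n a x)"
    using lo_hi[of n a] by (simp add: J_def len_def less_imp_le)
  also have "\<dots> \<le> integral (J n a) (\<lambda>y. exp N * h n a y)"
    unfolding J_def by (intro integral_le integrable_continuous_real)
      (auto simp: J_def[symmetric] intro!: continuous_intros h_cont h_distortion x)
  also have "\<dots> = exp N * integral (J n a) (h n a)" by simp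
  also have "integral (J n a) (h n a) \<le> (\<Sum>b\<in>UNIV. integral (J 0 b) (\<lambda>x. 1))"
    unfolding h_def by (rule integral_trans_le) auto
  also have "\<dots> = 1" using total_length lo_hi by (simp add: J_def less_imp_le)
  finally show ?thesis by simp
qed

lemma h_len_le': "x \<in> J n a \<Longrightarrow> h n a x \<le> exp N / len n a"
  using h_len_le[of x n a] by (simp add: field_simps)

text \<open>Unlike the uniform factor \<open>exp N\<close>, this one tends to 1 as the points
  approach each other. The derivative of the Birkhoff sum is at most \<open>H\<close> times the
  height, and the height is at most \<open>exp N / len n a\<close>; this produces
  \<open>C1\<close>.\<close>

lemma prefix_dchain_lipschitz:
  assumes u: "w 0 n a = u @ v" and xy: "x \<in> J n a" "y \<in> J n a"
  shows "dchain R0 (D 0) u x \<le> exp (C1 * (\<bar>x - y\<bar> / len n a)) * dchain R0 (D 0) u y"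
proof -
  have "\<bar>bsum R0 f0 u x - bsum R0 f0 u y\<bar> \<le> C1 / len n a * \<bar>x - y\<bar>"
  proof -
    have "norm (bsum R0 f0 u x - bsum R0 f0 u y) \<le> C1 / len n a * norm (x - y)"
    proof (rule field_differentiable_bound[of "J n a" "bsum R0 f0 u" "wsum R0 (D 0) eta u"])
      show "convex (J n a)" by (simp add: J_def)
      show "(bsum R0 f0 u has_real_derivative wsum R0 (D 0) eta u z) (at z within J n a)"
        if "z \<in> J n a" for z using prefix_f_deriv[OF u that] .
      show "norm (wsum R0 (D 0) eta u z) \<le> C1 / len n a" if z: "z \<in> J n a" for z
      proof -
        have "\<bar>wsum R0 (D 0) eta u z\<bar> \<le> wsum R0 (D 0) (\<lambda>b y. \<bar>eta b y\<bar>) u z"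
          by (rule wsum_abs_le[where J = "J 0"]) (use adm_prefix[OF u _ z] in \<open>auto simp: R_0\<close>)
        also have "\<dots> \<le> wsum R0 (D 0) (\<lambda>b y. \<bar>eta b y\<bar>) (w 0 n a) z"
          by (rule wsum_prefix_le[OF u z]) auto
        also have "\<dots> \<le> wsum R0 (D 0) (\<lambda>b y. H * 1) (w 0 n a) z"
          by (rule wsum_pos_mono[where J = "J 0"]) (use eta_bound adm0[OF z] in auto)
        also have "\<dots> = H * h n a z" by (subst wsum_cmult) (simp add: h_def trans_def)
        also have "\<dots> \<le> H * (exp N / len n a)"
          by (intro mult_left_mono h_len_le' z H_nonneg)
        finally show ?thesis by (simp add: C1_def)
      qed
    qed (use xy in auto)
    then show ?thesis by simp
  qed
  then have "bsum R0 f0 u x \<le> C1 * (\<bar>x - y\<bar> / len n a) + bsum R0 f0 u y" by simp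
  then show ?thesis by (simp add: D_0 dchain_exp exp_add[symmetric])
qed

text \<open>The weight that \<open>psi n a x\<close> gives to the value of \<open>psi m\<close> at the \<open>s\<close>-th point of the orbit
  of \<open>x\<close> under the stage-\<open>m\<close> maps.\<close>

definition wt :: "nat \<Rightarrow> nat \<Rightarrow> 'n \<Rightarrow> nat \<Rightarrow> real \<Rightarrow> real" where
  "wt m n a s x = dchain (R m) (D m) (take s (w m n a)) x
     * h m (w m n a ! s) (run (R m) (take s (w m n a)) x)"

abbreviation pt :: "nat \<Rightarrow> nat \<Rightarrow> 'n \<Rightarrow> nat \<Rightarrow> real \<Rightarrow> real" where
  "pt m n a s x \<equiv> run (R m) (take s (w m n a)) x"

lemma pt_in: "m \<le> n \<Longrightarrow> x \<in> J n a \<Longrightarrow> s < length (w m n a) \<Longrightarrow> pt m n a s x \<in> J m (w m n a ! s)"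
  using adm_nth[OF adm_w] .

lemma prefix_split:
  assumes "m \<le> n" "s < length (w m n a)" "i < length (w 0 m (w m n a ! s))"
  shows "\<exists>v. w 0 n a = concat (map (w 0 m) (take s (w m n a))) @ take i (w 0 m (w m n a ! s)) @ v"
proof -
  let ?W = "w m n a" and ?b = "w m n a ! s"
  have "w 0 n a = concat (map (w 0 m) (take s ?W @ ?W ! s # drop (Suc s) ?W))"
    using assms return_word_trans[of 0 m n al be tw a] by (simp add: id_take_nth_drop[symmetric])
  also have "\<dots> = concat (map (w 0 m) (take s ?W)) @ (take i (w 0 m ?b) @ drop i (w 0 m ?b))
      @ concat (map (w 0 m) (drop (Suc s) ?W))"
    by simp
  finally show ?thesis by (metis append.assoc)
qed

lemma prefix_split':
  assumes "m \<le> n"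
  shows "\<exists>v. w 0 n a = concat (map (w 0 m) (take s (w m n a))) @ v"
proof -
  have "w 0 n a = concat (map (w 0 m) (take s (w m n a) @ drop s (w m n a)))"
    using assms return_word_trans[of 0 m n al be tw a] by simp
  then show ?thesis by (metis map_append concat_append)
qed

lemma dchain_pt:
  "m \<le> n \<Longrightarrow> dchain (R m) (D m) (take s (w m n a)) x
     = dchain R0 (D 0) (concat (map (w 0 m) (take s (w m n a)))) x"
proof -
  have "(\<lambda>b. run R0 (w 0 m b)) = R m" by (simp add: R_def)
  moreover have "(\<lambda>b. dchain R0 (D 0) (w 0 m b)) = D m"
    by (rule ext) (simp only: D_run[of 0 m, OF le0] R_0)
  ultimately show ?thesis by (simp add: dchain_concat)
qed

lemma run_pt:
  "run (R m) (take s (w m n a)) x = run R0 (concat (map (w 0 m) (take s (w m n a)))) x"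
  by (simp add: run_concat R_def)

lemma dchain_pt_le:
  assumes "m \<le> n" "x \<in> J n a" "y \<in> J n a"
  shows "dchain (R m) (D m) (take s (w m n a)) x \<le> exp N * dchain (R m) (D m) (take s (w m n a)) y"
proof -
  obtain v where "w 0 n a = concat (map (w 0 m) (take s (w m n a))) @ v"
    using prefix_split'[OF assms(1)] by blast
  from prefix_dchain_le[OF this assms(2,3)] show ?thesis by (simp add: dchain_pt assms)
qed

text \<open>Expanding the height of the visited tower shows that the weight is a sum of derivatives
  along prefixes of the stage-0 word, to which the prefix estimates apply.\<close>

lemma wt_eq:
  assumes "m \<le> n" "s < length (w m n a)"
  shows "wt m n a s x = (\<Sum>i<length (w 0 m (w m n a ! s)).
    dchain R0 (D 0) (concat (map (w 0 m) (take s (w m n a))) @ take i (w 0 m (w m n a ! s))) x)"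
  by (simp add: wt_def dchain_pt[OF assms(1)] run_pt h_def trans_def wsum_eq_sum sum_distrib_left
      dchain_append)

lemma wt_lipschitz:
  assumes "m \<le> n" "s < length (w m n a)" "x \<in> J n a" "y \<in> J n a"
  shows "wt m n a s x \<le> exp (C1 * (\<bar>x - y\<bar> / len n a)) * wt m n a s y"
  unfolding wt_eq[OF assms(1,2)] sum_distrib_left
proof (rule sum_mono)
  fix i assume "i \<in> {..<length (w 0 m (w m n a ! s))}"
  then obtain v where "w 0 n a = (concat (map (w 0 m) (take s (w m n a)))
      @ take i (w 0 m (w m n a ! s))) @ v"
    using prefix_split[OF assms(1,2), of i] by auto
  from prefix_dchain_lipschitz[OF this assms(3,4)]
  show "dchain R0 (D 0) (concat (map (w 0 m) (take s (w m n a))) @ take i (w 0 m (w m n a ! s))) x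
    \<le> exp (C1 * (\<bar>x - y\<bar> / len n a)) *
      dchain R0 (D 0) (concat (map (w 0 m) (take s (w m n a))) @ take i (w 0 m (w m n a ! s))) y" .
qed

lemma dchain_pt_pos: "m \<le> n \<Longrightarrow> x \<in> J n a \<Longrightarrow> dchain (R m) (D m) (take s (w m n a)) x > 0"
  by (rule dchain_pos[where J = "J m"])
    (use adm_prefix[of m n a "take s (w m n a)" "drop s (w m n a)"] in auto)

lemma wt_pos: "m \<le> n \<Longrightarrow> x \<in> J n a \<Longrightarrow> s < length (w m n a) \<Longrightarrow> wt m n a s x > 0"
  unfolding wt_def using dchain_pt_pos[of m n x a s] h_pos[OF pt_in, of m n x a s]
  by (intro mult_pos_pos) auto

lemma sum_wt: "m \<le> n \<Longrightarrow> (\<Sum>s<length (w m n a). wt m n a s x) = h n a x"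
  using trans_run[of m n "\<lambda>b x. 1" a] by (simp add: wt_def h_def wsum_eq_sum)

lemma sum_wt_psi:
  assumes "m \<le> n" "x \<in> J n a"
  shows "(\<Sum>s<length (w m n a). wt m n a s x * psi m (w m n a ! s) (pt m n a s x)) = trans eta n a x"
proof -
  have "wt m n a s x * psi m (w m n a ! s) (pt m n a s x) =
    dchain (R m) (D m) (take s (w m n a)) x * trans eta m (w m n a ! s) (pt m n a s x)"
    if "s < length (w m n a)" for s
    using h_pos[OF pt_in[OF assms that]] by (simp add: wt_def psi_def)
  then show ?thesis using trans_run[OF assms(1), of eta a] by (simp add: wsum_eq_sum)
qed

text \<open>The weights normalized to a probability on the steps \<open>s\<close>;
  \<open>psi n a x\<close> is the expectation of \<open>psi m\<close> under it.\<close>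

definition pr :: "nat \<Rightarrow> nat \<Rightarrow> 'n \<Rightarrow> nat \<Rightarrow> real \<Rightarrow> real" where
  "pr m n a s x = wt m n a s x / h n a x"

lemma pr_nonneg: "m \<le> n \<Longrightarrow> x \<in> J n a \<Longrightarrow> s < length (w m n a) \<Longrightarrow> pr m n a s x \<ge> 0"
  using wt_pos[of m n x a s] h_pos[of x n a] by (auto simp: pr_def)

lemma sum_pr: "m \<le> n \<Longrightarrow> x \<in> J n a \<Longrightarrow> (\<Sum>s<length (w m n a). pr m n a s x) = 1"
  using sum_wt[of m n a x] h_pos[of x n a] by (simp add: pr_def sum_divide_distrib[symmetric])

lemma psi_average:
  "m \<le> n \<Longrightarrow> x \<in> J n a \<Longrightarrow>
    psi n a x = (\<Sum>s<length (w m n a). pr m n a s x * psi m (w m n a ! s) (pt m n a s x))"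
  using sum_wt_psi[of m n x a] by (simp add: pr_def psi_def[of n] sum_divide_distrib[symmetric])

text \<open>The factor 2 in the exponent arises because both the weight and the normalizing height
  are compared.\<close>

lemma pr_ratio:
  assumes "m \<le> n" "x \<in> J n a" "y \<in> J n a" "s < length (w m n a)"
  shows "pr m n a s x \<le> exp (2 * C1 * (\<bar>x - y\<bar> / len n a)) * pr m n a s y"
proof -
  define e where "e = exp (C1 * (\<bar>x - y\<bar> / len n a))"
  have 1: "wt m n a s x \<le> e * wt m n a s y"
    unfolding e_def by (rule wt_lipschitz) (use assms in auto)
  have "h n a y \<le> e * h n a x"
    unfolding sum_wt[OF assms(1), symmetric] sum_distrib_left e_def
    using wt_lipschitz[OF assms(1) _ assms(3,2)]
    by (intro sum_mono) (simp add: abs_minus_commute)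
  then have 2: "1 / h n a x \<le> e / h n a y"
    using h_pos[OF assms(2)] h_pos[OF assms(3)] by (simp add: field_simps)
  have "wt m n a s x * (1 / h n a x) \<le> (e * wt m n a s y) * (e / h n a y)"
    using 1 2 h_pos[OF assms(2)] wt_pos[OF assms(1,2,4)] by (intro mult_mono) auto
  moreover have "exp (2 * C1 * (\<bar>x - y\<bar> / len n a)) = e * e"
    by (simp add: e_def exp_add[symmetric])
  ultimately show ?thesis by (simp only: pr_def) (simp add: mult_ac)
qed

end

section \<open>Contraction of the mean nonlinearity\<close>

text \<open>A contraction once in every \<open>p\<close> steps is a geometric rate in single steps,
  with ratio the \<open>p\<close>-th root and one factor \<open>\<mu>\<close> lost for the
  incomplete block.\<close>

lemma power_div_le_geometric:
  fixes \<mu> :: real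
  assumes "0 < \<mu>" "\<mu> < 1" "p \<ge> (1::nat)"
  obtains \<rho> C where "0 < \<rho>" "\<rho> < 1" "C > 0" "\<And>l. \<mu> ^ (l div p) \<le> C * \<rho> ^ l"
proof
  define \<rho> where "\<rho> = root p \<mu>"
  have rp: "\<rho> ^ p = \<mu>" using assms by (simp add: \<rho>_def)
  show r: "0 < \<rho>" "\<rho> < 1" using assms by (auto simp: \<rho>_def)
  show "1 / \<mu> > 0" using assms by simp
  fix l
  have "\<rho> ^ l = \<rho> ^ (p * (l div p) + l mod p)" by simp
  also have "\<dots> = \<mu> ^ (l div p) * \<rho> ^ (l mod p)"
    by (simp only: power_add power_mult rp)
  finally have e: "\<rho> ^ l = \<mu> ^ (l div p) * \<rho> ^ (l mod p)" .
  have "l mod p \<le> p" using assms by (simp add: less_imp_le)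
  then have "\<rho> ^ p \<le> \<rho> ^ (l mod p)" using r by (intro power_decreasing) auto
  then have "\<mu> ^ (l div p) * \<mu> \<le> \<rho> ^ l" unfolding e rp using assms by (intro mult_left_mono) auto
  then show "\<mu> ^ (l div p) \<le> 1 / \<mu> * \<rho> ^ l" using assms by (simp add: field_simps)
qed

lemma abs_sum_prod_le:
  fixes d e G :: "'s \<Rightarrow> real"
  assumes "\<And>s. s \<in> A \<Longrightarrow> \<bar>d s\<bar> \<le> e s" "\<And>s. s \<in> A \<Longrightarrow> \<bar>G s\<bar> \<le> c"
  shows "\<bar>\<Sum>s\<in>A. d s * G s\<bar> \<le> (\<Sum>s\<in>A. e s) * c"
proof -
  have "\<bar>d s * G s\<bar> \<le> e s * c" if "s \<in> A" for s
    unfolding abs_mult using assms[OF that] by (intro mult_mono) auto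
  then have "(\<Sum>s\<in>A. \<bar>d s * G s\<bar>) \<le> (\<Sum>s\<in>A. e s * c)" by (rule sum_mono)
  then show ?thesis unfolding sum_distrib_right by (rule order_trans[OF sum_abs])
qed

context smooth_towers
begin

lemma len_neq_0 [simp]: "len n a \<noteq> 0"
  using len_pos[of n a] by linarith

definition osc_le :: "nat \<Rightarrow> real \<Rightarrow> bool" where
  "osc_le n c \<longleftrightarrow> (\<forall>a b. \<forall>x\<in>J n a. \<forall>y\<in>J n b. psi n a x - psi n b y \<le> c)"

text \<open>A Lipschitz bound in the coordinate that rescales each interval to unit length.\<close>

definition lip_le :: "nat \<Rightarrow> real \<Rightarrow> bool" where
  "lip_le n L \<longleftrightarrow> (\<forall>a. \<forall>x\<in>J n a. \<forall>y\<in>J n a. \<bar>psi n a x - psi n a y\<bar> * len n a \<le> L * \<bar>x - y\<bar>)"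

text \<open>The width of floor \<open>s\<close> of the tower over \<open>a\<close>, inside a
  stage-\<open>m\<close> interval.\<close>

definition fl :: "nat \<Rightarrow> nat \<Rightarrow> 'n \<Rightarrow> nat \<Rightarrow> real" where
  "fl m n a s = pt m n a s (hi n a) - pt m n a s (lo n a)"

definition mesh_le :: "nat \<Rightarrow> nat \<Rightarrow> real \<Rightarrow> bool" where
  "mesh_le m n \<theta> \<longleftrightarrow> (\<forall>a. \<forall>s<length (w m n a). fl m n a s \<le> \<theta> * len m (w m n a ! s))"

text \<open>A Doeblin condition: the probability of visiting a label has a lower bound independent
  of the starting point.\<close>

definition minorized :: "nat \<Rightarrow> nat \<Rightarrow> ('n \<Rightarrow> real) \<Rightarrow> bool" where
  "minorized m n \<nu> \<longleftrightarrow> (\<forall>j. 0 \<le> \<nu> j) \<and>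
     (\<forall>a. \<forall>x\<in>J n a. \<forall>j. \<nu> j \<le> (\<Sum>s | s < length (w m n a) \<and> w m n a ! s = j. pr m n a s x))"

lemma osc_leD: "osc_le n c \<Longrightarrow> x \<in> J n a \<Longrightarrow> y \<in> J n b \<Longrightarrow> psi n a x - psi n b y \<le> c"
  by (auto simp: osc_le_def)

lemma osc_le_nonneg: "osc_le n c \<Longrightarrow> 0 \<le> c"
  using osc_leD[OF _ lo_in lo_in, of n c undefined undefined] by simp

lemma psi_cont: "continuous_on (J n a) (psi n a)"
  unfolding psi_def[abs_def] using h_pos[of _ n a]
  by (intro continuous_on_divide trans_eta_cont h_cont) force

lemma psi_extremes:
  obtains xM xm where "\<And>j. xM j \<in> J m j" "\<And>j. xm j \<in> J m j"
    "\<And>j x. x \<in> J m j \<Longrightarrow> psi m j x \<le> psi m j (xM j)"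
    "\<And>j x. x \<in> J m j \<Longrightarrow> psi m j (xm j) \<le> psi m j x"
proof -
  have "\<forall>j. \<exists>z\<in>J m j. \<forall>x\<in>J m j. psi m j x \<le> psi m j z"
    using psi_cont[of m] lo_in[of m] by (intro allI continuous_attains_sup) (auto simp: J_def)
  moreover have "\<forall>j. \<exists>z\<in>J m j. \<forall>x\<in>J m j. psi m j z \<le> psi m j x"
    using psi_cont[of m] lo_in[of m] by (intro allI continuous_attains_inf) (auto simp: J_def)
  ultimately show thesis using that by metis
qed

lemma psi_bounds:
  assumes "osc_le m c"
  obtains M \<mu> where "M - \<mu> \<le> c" "\<And>j x. x \<in> J m j \<Longrightarrow> psi m j x \<le> M" "\<And>j x. x \<in> J m j \<Longrightarrow> \<mu> \<le> psi m j x"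
proof -
  obtain xM xm where x: "\<And>j. xM j \<in> J m j" "\<And>j. xm j \<in> J m j"
    "\<And>j x. x \<in> J m j \<Longrightarrow> psi m j x \<le> psi m j (xM j)"
    "\<And>j x. x \<in> J m j \<Longrightarrow> psi m j (xm j) \<le> psi m j x" by (rule psi_extremes[of m]) blast
  let ?M = "MAX j. psi m j (xM j)" and ?m = "MIN j. psi m j (xm j)"
  have "?M \<in> range (\<lambda>j. psi m j (xM j))" by (rule Max_in) auto
  then obtain i where "?M = psi m i (xM i)" by (rule rangeE)
  moreover have "?m \<in> range (\<lambda>j. psi m j (xm j))" by (rule Min_in) auto
  then obtain j where "?m = psi m j (xm j)" by (rule rangeE)
  ultimately have "?M - ?m \<le> c" using osc_leD[OF assms x(1) x(2)] by simp
  moreover have "psi m j y \<le> ?M" if "y \<in> J m j" for j y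
    using x(3)[OF that] by (rule order_trans) (simp add: Max_ge)
  moreover have "?m \<le> psi m j y" if "y \<in> J m j" for j y
    using _ x(4)[OF that] by (rule order_trans) (simp add: Min_le)
  ultimately show thesis using that by blast
qed

lemma minorized_sum_le:
  assumes "m \<le> n" "minorized m n \<nu>"
  shows "sum \<nu> UNIV \<le> 1"
proof -
  fix a
  have "sum \<nu> UNIV \<le> (\<Sum>j\<in>UNIV. \<Sum>s | s \<in> {..<length (w m n a)} \<and> w m n a ! s = j. pr m n a s (lo n a))"
    using assms(2) by (intro sum_mono) (auto simp: minorized_def)
  also have "\<dots> = 1" using sum_pr[OF assms(1) lo_in, of a] by (subst sum.group) auto
  finally show "sum \<nu> UNIV \<le> 1" .
qed

text \<open>Doeblin contraction: the common mass is coupled inside single intervals, where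
  \<open>psi m\<close> varies by at most \<open>l\<close>, and the rest pays the full oscillation
  \<open>c\<close>.\<close>

lemma osc_minorized:
  assumes mn: "m \<le> n" and o: "osc_le m c" and \<nu>: "minorized m n \<nu>"
    and l: "\<And>j x y. x \<in> J m j \<Longrightarrow> y \<in> J m j \<Longrightarrow> psi m j x - psi m j y \<le> l"
  shows "osc_le n ((1 - sum \<nu> UNIV) * c + sum \<nu> UNIV * l)"
  unfolding osc_le_def
proof (intro allI ballI)
  fix a b x y assume x: "x \<in> J n a" and y: "y \<in> J n b"
  obtain xM xm where e: "\<And>j. xM j \<in> J m j" "\<And>j. xm j \<in> J m j"
    "\<And>j x. x \<in> J m j \<Longrightarrow> psi m j x \<le> psi m j (xM j)"
    "\<And>j x. x \<in> J m j \<Longrightarrow> psi m j (xm j) \<le> psi m j x" by (rule psi_extremes[of m]) blast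
  obtain M \<mu> where M: "M - \<mu> \<le> c" "\<And>j x. x \<in> J m j \<Longrightarrow> psi m j x \<le> M"
    "\<And>j x. x \<in> J m j \<Longrightarrow> \<mu> \<le> psi m j x" using psi_bounds[OF o] by metis
  have "psi n a x - psi n b y \<le> (1 - sum \<nu> UNIV) * (M - \<mu>)
      + (\<Sum>j\<in>UNIV. \<nu> j * (psi m j (xM j) - psi m j (xm j)))"
    unfolding psi_average[OF mn x] psi_average[OF mn y]
  proof (rule coupling_bound[where lab = "\<lambda>s. w m n a ! s" and lab' = "\<lambda>s. w m n b ! s"])
    show "\<nu> j \<le> (\<Sum>s | s \<in> {..<length (w m n a)} \<and> w m n a ! s = j. pr m n a s x)" for j
      using \<nu> x by (auto simp: minorized_def)
    show "\<nu> j \<le> (\<Sum>s | s \<in> {..<length (w m n b)} \<and> w m n b ! s = j. pr m n b s y)" for j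
      using \<nu> y by (auto simp: minorized_def)
  qed (use e M pt_in[OF mn x] pt_in[OF mn y] sum_pr[OF mn x] sum_pr[OF mn y]
      pr_nonneg[OF mn x] pr_nonneg[OF mn y] in auto)
  also have "\<dots> \<le> (1 - sum \<nu> UNIV) * c + (\<Sum>j\<in>UNIV. \<nu> j * l)"
    using minorized_sum_le[OF mn \<nu>] M(1) \<nu> l e
    by (intro add_mono mult_left_mono sum_mono) (auto simp: minorized_def)
  finally show "psi n a x - psi n b y \<le> (1 - sum \<nu> UNIV) * c + sum \<nu> UNIV * l"
    by (simp add: sum_distrib_right)
qed

text \<open>With zero minorization only the maximum principle for averages remains.\<close>

lemma osc_mono:
  assumes "m \<le> n" "osc_le m c"
  shows "osc_le n c"
proof -
  have "minorized m n (\<lambda>j. 0)"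
    using pr_nonneg[OF assms(1)] by (auto simp: minorized_def intro!: sum_nonneg)
  from osc_minorized[OF assms this, of c] show ?thesis
    using osc_leD[OF assms(2)] by simp
qed

lemma pt_deriv:
  assumes "m \<le> n" "x \<in> J n a"
  shows "((\<lambda>x. pt m n a s x) has_real_derivative dchain (R m) (D m) (take s (w m n a)) x) (at x within J n a)"
  by (rule run_deriv[where J = "J m"])
    (use assms R_deriv adm_prefix[of m n a "take s (w m n a)" "drop s (w m n a)"] in auto)

lemma pt_diff:
  assumes "m \<le> n" "x \<in> J n a" "y \<in> J n a" "x \<le> y"
  obtains z where "z \<in> J n a" "pt m n a s y - pt m n a s x = dchain (R m) (D m) (take s (w m n a)) z * (y - x)"
proof (rule mvt_within[of x y "\<lambda>x. pt m n a s x" "dchain (R m) (D m) (take s (w m n a))"])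
  have sub: "{x..y} \<subseteq> J n a" using assms by (auto simp: J_iff)
  show "((\<lambda>x. pt m n a s x) has_real_derivative dchain (R m) (D m) (take s (w m n a)) z) (at z within {x..y})"
    if "z \<in> {x..y}" for z using DERIV_subset[OF pt_deriv[OF assms(1)] sub] that sub by auto
  show "x \<le> y" by fact
  show thesis if "z \<in> {x..y}"
    "pt m n a s y - pt m n a s x = dchain (R m) (D m) (take s (w m n a)) z * (y - x)" for z
    using that sub \<open>\<And>z. z \<in> J n a \<Longrightarrow> _ \<Longrightarrow> thesis\<close> by blast
qed

lemma pt_le:
  assumes "m \<le> n" "x \<in> J n a" "y \<in> J n a" "x \<le> y"
  shows "pt m n a s x \<le> pt m n a s y"
proof -
  obtain z where z: "z \<in> J n a" "pt m n a s y - pt m n a s x = dchain (R m) (D m) (take s (w m n a)) z * (y - x)"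
    using pt_diff[OF assms] by blast
  have "0 \<le> dchain (R m) (D m) (take s (w m n a)) z * (y - x)"
    using dchain_pt_pos[OF assms(1) z(1), of s] assms(4) by (intro mult_nonneg_nonneg) auto
  then show ?thesis unfolding z(2)[symmetric] by simp
qed

lemma fl_eq:
  assumes "m \<le> n"
  obtains z where "z \<in> J n a" "fl m n a s = dchain (R m) (D m) (take s (w m n a)) z * len n a"
  using pt_diff[OF assms lo_in hi_in, of a s] lo_hi[of n a] by (auto simp: fl_def len_def less_imp_le)

lemma pt_diff_le:
  assumes mn: "m \<le> n" and "x \<in> J n a" "y \<in> J n a"
  shows "\<bar>pt m n a s x - pt m n a s y\<bar> \<le> exp N * (\<bar>x - y\<bar> / len n a) * fl m n a s"
    and "\<bar>pt m n a s x - pt m n a s y\<bar> \<le> fl m n a s"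
proof -
  show "\<bar>pt m n a s x - pt m n a s y\<bar> \<le> exp N * (\<bar>x - y\<bar> / len n a) * fl m n a s"
    using assms(2,3)
  proof (induction x y rule: linorder_wlog)
    case (sym x y) then show ?case by (simp add: abs_minus_commute)
  next
    case (le x y)
    obtain z where z: "z \<in> J n a" "pt m n a s y - pt m n a s x = dchain (R m) (D m) (take s (w m n a)) z * (y - x)"
      using pt_diff[OF mn le(2,3,1)] by blast
    obtain z' where z': "z' \<in> J n a" "fl m n a s = dchain (R m) (D m) (take s (w m n a)) z' * len n a"
      using fl_eq[OF mn] by blast
    have "dchain (R m) (D m) (take s (w m n a)) z * (y - x) \<le>
        (exp N * dchain (R m) (D m) (take s (w m n a)) z') * (y - x)"
      using dchain_pt_le[OF mn z(1) z'(1)] le by (intro mult_right_mono) auto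
    also have "\<dots> = exp N * ((y - x) / len n a) * fl m n a s"
      by (simp add: z'(2))
    finally show ?case using z(2) pt_le[OF mn le(2,3,1), of s] le(1) by simp
  qed
  have "pt m n a s (lo n a) \<le> pt m n a s u \<and> pt m n a s u \<le> pt m n a s (hi n a)" if "u \<in> J n a" for u
    using that by (auto intro!: pt_le[OF mn] simp: J_iff)
  from this[OF assms(2)] this[OF assms(3)]
  show "\<bar>pt m n a s x - pt m n a s y\<bar> \<le> fl m n a s"
    unfolding fl_def abs_le_iff by linarith
qed

lemma fl_pos: "m \<le> n \<Longrightarrow> fl m n a s > 0"
proof -
  assume mn: "m \<le> n"
  obtain z' where z': "z' \<in> J n a" "fl m n a s = dchain (R m) (D m) (take s (w m n a)) z' * len n a"
    using fl_eq[OF mn] by blast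
  then show ?thesis using dchain_pt_pos[OF mn z'(1)] by simp
qed

text \<open>The 2 is the total mass of the two probability vectors compared in
  \<open>pr_abs_diff\<close>; the other factor is their relative change across a whole
  interval.\<close>

definition C2 :: real where "C2 = 2 * (exp (2 * C1) - 1)"

text \<open>A lower bound for the ratio of the weights of one floor at any two points of the same
  base.\<close>

definition rho :: real where "rho = exp (- (2 * C1))"

lemma rel_dist: "x \<in> J n a \<Longrightarrow> y \<in> J n a \<Longrightarrow> 0 \<le> \<bar>x - y\<bar> / len n a \<and> \<bar>x - y\<bar> / len n a \<le> 1"
  using len_pos[of n a] by (auto simp: J_iff len_def abs_le_iff)

lemma psi_pt_diff:
  assumes mn: "m \<le> n" and L: "lip_le m L" "L \<ge> 0" and th: "mesh_le m n \<theta>"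
    and xy: "x \<in> J n a" "y \<in> J n a" and s: "s < length (w m n a)"
  shows "\<bar>psi m (w m n a ! s) (pt m n a s x) - psi m (w m n a ! s) (pt m n a s y)\<bar>
      \<le> exp N * (\<bar>x - y\<bar> / len n a) * (\<theta> * L)" (is "?d \<le> ?t * _")
    and "\<bar>psi m (w m n a ! s) (pt m n a s x) - psi m (w m n a ! s) (pt m n a s y)\<bar> \<le> \<theta> * L"
proof -
  let ?l = "len m (w m n a ! s)" and ?q = "\<bar>pt m n a s x - pt m n a s y\<bar>"
  have t: "?t \<ge> 0" using rel_dist[OF xy] by (auto intro!: mult_nonneg_nonneg)
  have 1: "?d * ?l \<le> L * ?q"
    using L pt_in[OF mn xy(1) s] pt_in[OF mn xy(2) s] by (auto simp: lip_le_def)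
  have fl: "fl m n a s \<le> \<theta> * ?l" using th s by (auto simp: mesh_le_def)
  have "?q \<le> ?t * (\<theta> * ?l)"
    using pt_diff_le(1)[OF mn xy, of s] mult_left_mono[OF fl t] by linarith
  then have "?d * ?l \<le> (?t * (\<theta> * L)) * ?l"
    using 1 mult_left_mono[of ?q "?t * (\<theta> * ?l)" L] L(2) by (simp add: mult_ac)
  then show "?d \<le> ?t * (\<theta> * L)" using len_pos by (rule mult_right_le_imp_le)
  have "?q \<le> \<theta> * ?l" using pt_diff_le(2)[OF mn xy, of s] fl by linarith
  then have "L * ?q \<le> L * (\<theta> * ?l)" using L(2) by (rule mult_left_mono)
  then have "?d * ?l \<le> L * (\<theta> * ?l)" using 1 by (rule order_trans[rotated])
  also have "\<dots> = (\<theta> * L) * ?l" by (simp only: mult_ac)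
  finally have "?d * ?l \<le> (\<theta> * L) * ?l" .
  then show "?d \<le> \<theta> * L" using len_pos by (rule mult_right_le_imp_le)
qed

lemma pr_abs_diff:
  assumes mn: "m \<le> n" and xy: "x \<in> J n a" "y \<in> J n a" and s: "s < length (w m n a)"
  shows "\<bar>pr m n a s x - pr m n a s y\<bar>
    \<le> (\<bar>x - y\<bar> / len n a) * (exp (2 * C1) - 1) * (pr m n a s x + pr m n a s y)"
proof -
  let ?t = "\<bar>x - y\<bar> / len n a"
  let ?E = "exp (2 * C1 * ?t)"
  have E: "0 \<le> ?E - 1" "?E - 1 \<le> ?t * (exp (2 * C1) - 1)"
    using exp_chord[of ?t "2 * C1"] rel_dist[OF xy] C1_nonneg by simp_all
  note p = pr_nonneg[OF mn xy(1) s] pr_nonneg[OF mn xy(2) s]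
  have "pr m n a s x - pr m n a s y \<le> (?E - 1) * pr m n a s y"
    using pr_ratio[OF mn xy s] by (simp add: algebra_simps)
  moreover have "pr m n a s y - pr m n a s x \<le> (?E - 1) * pr m n a s x"
    using pr_ratio[OF mn xy(2,1) s] by (simp add: algebra_simps abs_minus_commute)
  moreover have "0 \<le> (?E - 1) * pr m n a s y" "0 \<le> (?E - 1) * pr m n a s x"
    by (rule mult_nonneg_nonneg[OF E(1) p(2)], rule mult_nonneg_nonneg[OF E(1) p(1)])
  ultimately have "\<bar>pr m n a s x - pr m n a s y\<bar> \<le> (?E - 1) * (pr m n a s x + pr m n a s y)"
    unfolding distrib_left by linarith
  also have "\<dots> \<le> (?t * (exp (2 * C1) - 1)) * (pr m n a s x + pr m n a s y)"
    using E p by (intro mult_right_mono) auto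
  finally show ?thesis .
qed

text \<open>A Lasota-Yorke inequality: the old Lipschitz constant is multiplied by a factor
  proportional to the mesh, at the price of a multiple of the oscillation.\<close>

lemma lip_step:
  assumes mn: "m \<le> n" and o: "osc_le m c" and L: "lip_le m L" "L \<ge> 0" and th: "mesh_le m n \<theta>"
  shows "lip_le n (exp N * \<theta> * L + C2 * c)"
  unfolding lip_le_def
proof (intro allI ballI)
  fix a x y assume xy: "x \<in> J n a" "y \<in> J n a"
  let ?W = "w m n a"
  let ?A = "{..<length ?W}"
  let ?X = "\<lambda>s. psi m (?W ! s) (pt m n a s x)" and ?Y = "\<lambda>s. psi m (?W ! s) (pt m n a s y)"
  define t where "t = \<bar>x - y\<bar> / len n a"
  have t: "0 \<le> t" using rel_dist[OF xy] by (simp add: t_def)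
  have c: "c \<ge> 0" using osc_le_nonneg[OF o] .
  \<comment> \<open>Change of the values at fixed weights plus change of the weights. Both families
    of weights sum to 1, so a constant may be subtracted in the second sum; with \<open>?Y 0\<close>
    only differences of \<open>psi m\<close> occur.\<close>
  have e: "psi n a x - psi n a y
    = (\<Sum>s\<in>?A. pr m n a s x * (?X s - ?Y s)) + (\<Sum>s\<in>?A. (pr m n a s x - pr m n a s y) * (?Y s - ?Y 0))"
  proof -
    have "(\<Sum>s\<in>?A. (pr m n a s x - pr m n a s y) * ?Y 0) = 0"
      using sum_pr[OF mn xy(1)] sum_pr[OF mn xy(2)] by (simp add: sum_distrib_right[symmetric] sum_subtractf)
    moreover have "(\<Sum>s\<in>?A. pr m n a s x * (?X s - ?Y s)) + (\<Sum>s\<in>?A. (pr m n a s x - pr m n a s y) * (?Y s - ?Y 0))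
      = (\<Sum>s\<in>?A. pr m n a s x * ?X s - pr m n a s y * ?Y s - (pr m n a s x - pr m n a s y) * ?Y 0)"
      unfolding sum.distrib[symmetric] by (rule sum.cong[OF refl]) (simp add: algebra_simps)
    ultimately show ?thesis
      unfolding psi_average[OF mn xy(1)] psi_average[OF mn xy(2)] sum_subtractf by simp
  qed
  have 1: "\<bar>\<Sum>s\<in>?A. pr m n a s x * (?X s - ?Y s)\<bar> \<le> (\<Sum>s\<in>?A. pr m n a s x) * (exp N * t * (\<theta> * L))"
    using psi_pt_diff(1)[OF mn L th xy] pr_nonneg[OF mn xy(1)]
    by (intro abs_sum_prod_le) (auto simp: t_def)
  have ne: "0 < length ?W" using return_word_nonempty[of al be tw m n a] by auto
  have 2: "\<bar>\<Sum>s\<in>?A. (pr m n a s x - pr m n a s y) * (?Y s - ?Y 0)\<bar>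
    \<le> (\<Sum>s\<in>?A. t * (exp (2 * C1) - 1) * (pr m n a s x + pr m n a s y)) * c"
  proof (rule abs_sum_prod_le)
    fix s assume s: "s \<in> ?A"
    show "\<bar>?Y s - ?Y 0\<bar> \<le> c"
      using osc_leD[OF o pt_in[OF mn xy(2)] pt_in[OF mn xy(2)], of s 0]
        osc_leD[OF o pt_in[OF mn xy(2)] pt_in[OF mn xy(2)], of 0 s] s ne by auto
    show "\<bar>pr m n a s x - pr m n a s y\<bar> \<le> t * (exp (2 * C1) - 1) * (pr m n a s x + pr m n a s y)"
      unfolding t_def using pr_abs_diff[OF mn xy, of s] s by auto
  qed
  have 3: "(\<Sum>s\<in>?A. t * (exp (2 * C1) - 1) * (pr m n a s x + pr m n a s y)) = t * C2"
    unfolding sum_distrib_left[symmetric] sum.distrib sum_pr[OF mn xy(1)] sum_pr[OF mn xy(2)]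
    by (simp add: C2_def)
  have "\<bar>psi n a x - psi n a y\<bar> \<le> t * (exp N * \<theta> * L + C2 * c)"
    using 1 2 unfolding e 3 sum_pr[OF mn xy(1)] by (simp add: algebra_simps)
  then have "\<bar>psi n a x - psi n a y\<bar> * len n a \<le> t * (exp N * \<theta> * L + C2 * c) * len n a"
    by (intro mult_right_mono) auto
  then show "\<bar>psi n a x - psi n a y\<bar> * len n a \<le> (exp N * \<theta> * L + C2 * c) * \<bar>x - y\<bar>"
    using len_pos[of n a] by (simp add: t_def mult_ac)
qed

lemma rho: "0 < rho" "rho \<le> 1"
  using C1_nonneg by (auto simp: rho_def)

text \<open>Two points of one interval follow the same word, so floor \<open>s\<close> is coupled
  with floor \<open>s\<close>. Its two weights agree up to the factor \<open>rho\<close>, and the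
  values differ by at most the mesh times the Lipschitz constant.\<close>

lemma cell_osc:
  assumes mn: "m \<le> n" and o: "osc_le m c" and L: "lip_le m L" "L \<ge> 0" and th: "mesh_le m n \<theta>"
    and xy: "x \<in> J n a" "y \<in> J n a"
  shows "psi n a x - psi n a y \<le> (1 - rho) * c + rho * (\<theta> * L)"
proof -
  let ?W = "w m n a"
  let ?A = "{..<length ?W}"
  let ?X = "\<lambda>s. psi m (?W ! s) (pt m n a s x)" and ?Y = "\<lambda>s. psi m (?W ! s) (pt m n a s y)"
  obtain M \<mu> where M: "M - \<mu> \<le> c" "\<And>j x. x \<in> J m j \<Longrightarrow> psi m j x \<le> M"
    "\<And>j x. x \<in> J m j \<Longrightarrow> \<mu> \<le> psi m j x" using psi_bounds[OF o] by metis
  have single: "(\<Sum>s' | s' \<in> ?A \<and> s' = s. g s') = g s" if "s \<in> ?A" for s and g :: "nat \<Rightarrow> real"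
  proof -
    have "{s'. s' \<in> ?A \<and> s' = s} = {s}" using that by auto
    then show ?thesis by simp
  qed
  have "psi n a x - psi n a y \<le> (1 - (\<Sum>s\<in>?A. rho * pr m n a s x)) * (M - \<mu>)
      + (\<Sum>s\<in>?A. (rho * pr m n a s x) * (?X s - ?Y s))"
    unfolding psi_average[OF mn xy(1)] psi_average[OF mn xy(2)]
  proof (rule coupling_bound[where lab = "\<lambda>s. s" and lab' = "\<lambda>s. s"])
    fix s assume s: "s \<in> ?A"
    have p: "0 \<le> pr m n a s x" "0 \<le> pr m n a s y" using pr_nonneg[OF mn] xy s by auto
    show "rho * pr m n a s x \<le> (\<Sum>s' | s' \<in> ?A \<and> s' = s. pr m n a s' x)"
      unfolding single[OF s] using rho p mult_right_mono[of rho 1] by auto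
    have "pr m n a s x \<le> exp (2 * C1 * (\<bar>x - y\<bar> / len n a)) * pr m n a s y"
      using pr_ratio[OF mn xy] s by auto
    also have "\<dots> \<le> exp (2 * C1) * pr m n a s y"
      using rel_dist[OF xy] C1_nonneg p mult_left_mono[of "\<bar>x - y\<bar> / len n a" 1 "2 * C1"]
      by (intro mult_right_mono) auto
    finally show "rho * pr m n a s x \<le> (\<Sum>s' | s' \<in> ?A \<and> s' = s. pr m n a s' y)"
      unfolding single[OF s] by (simp add: rho_def exp_minus field_simps)
  qed (use M pt_in[OF mn xy(1)] pt_in[OF mn xy(2)] sum_pr[OF mn xy(1)] sum_pr[OF mn xy(2)]
      pr_nonneg[OF mn xy(1)] pr_nonneg[OF mn xy(2)] in auto)
  also have "(\<Sum>s\<in>?A. rho * pr m n a s x) = rho"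
    using sum_pr[OF mn xy(1)] by (simp add: sum_distrib_left[symmetric])
  also have "(\<Sum>s\<in>?A. (rho * pr m n a s x) * (?X s - ?Y s)) \<le> (\<Sum>s\<in>?A. (rho * pr m n a s x) * (\<theta> * L))"
  proof (intro sum_mono mult_left_mono)
    fix s assume s: "s \<in> ?A"
    then show "?X s - ?Y s \<le> \<theta> * L" using psi_pt_diff(2)[OF mn L th xy, of s] by auto
    show "0 \<le> rho * pr m n a s x" using rho pr_nonneg[OF mn xy(1), of s] s by auto
  qed
  also have "\<dots> = rho * (\<theta> * L)"
    using sum_pr[OF mn xy(1)] by (simp add: sum_distrib_left[symmetric] sum_distrib_right[symmetric])
  also have "(1 - rho) * (M - \<mu>) \<le> (1 - rho) * c" using M(1) rho by (intro mult_left_mono) auto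
  finally show ?thesis by simp
qed

end

section \<open>Shrinking of the floors and mixing of the towers in a good block\<close>

context smooth_towers
begin

text \<open>A floor of stage \<open>n\<close> in a stage-\<open>k\<close> interval is the image of a
  floor that misses at least the proportion \<open>\<kappa>\<close> of its stage-\<open>m\<close>
  interval. The map between them has distortion \<open>exp N\<close>, so at least the proportion
  \<open>\<kappa> * exp (- N)\<close> of the enclosing floor is lost.\<close>

lemma mesh_compose:
  assumes km: "k \<le> m" and mn: "m \<le> n" and th: "mesh_le k m \<theta>" "\<theta> \<ge> 0" and \<kappa>: "\<kappa> \<ge> 0"
    and G: "\<And>a s. s < length (w m n a) \<Longrightarrow> fl m n a s \<le> (1 - \<kappa>) * len m (w m n a ! s)"
  shows "mesh_le k n ((1 - \<kappa> * exp (- N)) * \<theta>)"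
  unfolding mesh_le_def
proof (intro allI impI)
  fix a s assume s: "s < length (w k n a)"
  let ?W = "w m n a"
  have W: "w k n a = concat (map (w k m) ?W)" by (rule return_word_trans[OF km mn])
  obtain i j where i: "i < length ?W" "j < length (w k m (?W ! i))"
    and t: "take s (w k n a) = concat (take i (map (w k m) ?W)) @ take j (w k m (?W ! i))"
    and nth: "w k n a ! s = w k m (?W ! i) ! j"
    using take_concat_nth[of s "map (w k m) ?W"] s unfolding W by auto
  let ?b = "?W ! i"
  have Rm: "R m = (\<lambda>b. run (R k) (w k m b))" using R_run[OF km] by auto
  have pt: "pt k n a s x = pt k m ?b j (pt m n a i x)" for x
    unfolding t run_append take_map run_concat by (simp add: Rm)
  let ?u = "pt m n a i (lo n a)" and ?v = "pt m n a i (hi n a)"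
  have uv: "?u \<in> J m ?b" "?v \<in> J m ?b" "?u \<le> ?v"
    using pt_in[OF mn lo_in i(1)] pt_in[OF mn hi_in i(1)] pt_le[OF mn lo_in hi_in] lo_hi[of n a]
    by (auto simp: less_imp_le)
  let ?l = "lo m ?b" and ?h = "hi m ?b"
  have ub: "?l \<le> ?u" "?v \<le> ?h" using uv by (auto simp: J_iff)
  let ?P = "\<lambda>x. pt k m ?b j x"
  let ?dc = "dchain (R k) (D k) (take j (w k m ?b))"
  obtain z where z: "z \<in> J m ?b" "fl k m ?b j = ?dc z * len m ?b" using fl_eq[OF km] by blast
  obtain z1 where z1: "z1 \<in> J m ?b" "?P ?u - ?P ?l = ?dc z1 * (?u - ?l)"
    using pt_diff[OF km lo_in uv(1) ub(1)] by blast
  obtain z2 where z2: "z2 \<in> J m ?b" "?P ?h - ?P ?v = ?dc z2 * (?h - ?v)"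
    using pt_diff[OF km uv(2) hi_in ub(2)] by blast
  \<comment> \<open>\<open>?dc z\<close> is the mean derivative over the whole interval. Elsewhere
    the derivative is smaller by at most the distortion factor, so the gaps on the two sides of the
    floor keep their proportion.\<close>
  have low: "exp (- N) * ?dc z \<le> ?dc z'" if "z' \<in> J m ?b" for z'
    using dchain_pt_le[OF km z(1) that, of j] by (simp add: exp_minus field_simps)
  have "exp (- N) * ?dc z * (?u - ?l) \<le> ?P ?u - ?P ?l"
    unfolding z1(2) using low[OF z1(1)] ub by (intro mult_right_mono) auto
  moreover have "exp (- N) * ?dc z * (?h - ?v) \<le> ?P ?h - ?P ?v"
    unfolding z2(2) using low[OF z2(1)] ub by (intro mult_right_mono) auto
  ultimately have "exp (- N) * ?dc z * (?u - ?l) + exp (- N) * ?dc z * (?h - ?v)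
      \<le> fl k m ?b j - fl k n a s"
    unfolding fl_def pt by linarith
  then have 1: "exp (- N) * ?dc z * (len m ?b - fl m n a i) \<le> fl k m ?b j - fl k n a s"
    by (simp add: fl_def len_def algebra_simps)
  have "exp (- N) * ?dc z * (\<kappa> * len m ?b) \<le> exp (- N) * ?dc z * (len m ?b - fl m n a i)"
    using G[OF i(1)] dchain_pt_pos[OF km z(1), of j]
    by (intro mult_left_mono) (auto simp: algebra_simps)
  then have "fl k n a s \<le> (1 - \<kappa> * exp (- N)) * fl k m ?b j"
    using 1 unfolding z(2) by (simp add: algebra_simps)
  also have "\<dots> \<le> (1 - \<kappa> * exp (- N)) * (\<theta> * len k (w k m ?b ! j))"
  proof (rule mult_left_mono)
    show "fl k m ?b j \<le> \<theta> * len k (w k m ?b ! j)" using th(1) i(2) by (auto simp: mesh_le_def)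
    have "0 < (1 - \<kappa>) * len m ?b" using G[OF i(1)] fl_pos[OF mn, of a i] by linarith
    then have "\<kappa> \<le> 1" using len_pos[of m ?b] unfolding zero_less_mult_iff by linarith
    moreover have "exp (- N) \<le> 1" using N_nonneg by simp
    ultimately have "\<kappa> * exp (- N) \<le> 1 * 1" using \<kappa> by (intro mult_mono) auto
    then show "0 \<le> 1 - \<kappa> * exp (- N)" by simp
  qed
  finally show "fl k n a s \<le> (1 - \<kappa> * exp (- N)) * \<theta> * len k (w k n a ! s)"
    by (simp add: nth mult.assoc)
qed

lemma mesh_refl: "mesh_le m m 1"
  by (auto simp: mesh_le_def return_word_le fl_def len_def)

lemma fl_le_len:
  assumes "m \<le> n" "s < length (w m n a)"
  shows "fl m n a s \<le> len m (w m n a ! s)"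
  using pt_in[OF assms(1) lo_in assms(2)] pt_in[OF assms(1) hi_in assms(2)]
  by (auto simp: fl_def len_def J_iff)

lemma mesh_mono:
  assumes "k \<le> m" "m \<le> n" "mesh_le k m \<theta>" "\<theta> \<ge> 0"
  shows "mesh_le k n \<theta>"
  using mesh_compose[OF assms, of 0] fl_le_len[OF assms(2)] by simp

lemma integral_wsum_floors:
  assumes mn: "m \<le> n"
  shows "integral (J n a) (wsum (R m) (D m) (\<lambda>b x. if b = j then 1 else 0) (w m n a))
       = (\<Sum>s | s < length (w m n a) \<and> w m n a ! s = j. fl m n a s)"
proof (rule integral_unique)
  let ?W = "w m n a"
  have "((\<lambda>x. dchain (R m) (D m) (take s ?W) x) has_integral fl m n a s) {lo n a..hi n a}" for s
    unfolding fl_def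
  proof (rule fundamental_theorem_of_calculus)
    show "(run (R m) (take s ?W) has_vector_derivative dchain (R m) (D m) (take s ?W) x)
        (at x within {lo n a..hi n a})" if "x \<in> {lo n a..hi n a}" for x
      using pt_deriv[OF mn, of x a s] that
      by (simp add: has_real_derivative_iff_has_vector_derivative J_def)
  qed (use lo_hi[of n a] in simp)
  then have "((\<lambda>x. \<Sum>s\<in>{s. s < length ?W \<and> ?W ! s = j}. dchain (R m) (D m) (take s ?W) x)
      has_integral (\<Sum>s\<in>{s. s < length ?W \<and> ?W ! s = j}. fl m n a s)) (J n a)"
    unfolding J_def by (intro has_integral_sum) auto
  moreover have "wsum (R m) (D m) (\<lambda>b x. if b = j then 1 else 0) ?W
      = (\<lambda>x. \<Sum>s\<in>{s. s < length ?W \<and> ?W ! s = j}. dchain (R m) (D m) (take s ?W) x)"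
    unfolding wsum_eq_sum by (intro ext sum.mono_neutral_cong_right) auto
  ultimately show "(wsum (R m) (D m) (\<lambda>b x. if b = j then 1 else 0) ?W has_integral
      (\<Sum>s | s < length ?W \<and> ?W ! s = j. fl m n a s)) (J n a)"
    by simp
qed

text \<open>Conservation of mass for the indicator of the label \<open>j\<close>.\<close>

lemma floors_sum:
  assumes "m \<le> n"
  shows "(\<Sum>a\<in>UNIV. \<Sum>s | s < length (w m n a) \<and> w m n a ! s = j. fl m n a s) = len m j"
proof -
  have "(\<Sum>a\<in>UNIV. \<Sum>s | s < length (w m n a) \<and> w m n a ! s = j. fl m n a s)
    = (\<Sum>b\<in>UNIV. integral (J m b) (\<lambda>x. if b = j then 1 else 0))"
    unfolding integral_wsum_floors[OF assms, symmetric]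
    by (rule word_integral[OF assms]) (auto intro!: continuous_intros)
  also have "\<dots> = (\<Sum>b\<in>UNIV. if b = j then len m b else 0)"
    using lo_hi[of m] by (intro sum.cong) (auto simp: J_def len_def less_imp_le)
  finally show ?thesis by simp
qed

text \<open>In a block with a bounded incidence matrix with entries at least 2, along which the slopes
  are bounded, every interval is cut into pieces of definite relative size and every tower visits
  each of the previous towers for a definite proportion of the time.\<close>

lemma good_block:
  fixes q :: nat and B E c :: real
  assumes mn: "m \<le> n" and B: "\<And>a x. x \<in> J m a \<Longrightarrow> \<bar>f m a x\<bar> \<le> B"
    and cnt: "\<And>a j. count_list (w m n a) j \<ge> 2" and q: "\<And>a. length (w m n a) \<le> q"
  defines "E \<equiv> exp (B * q)"
  defines "c \<equiv> 1 / (CARD('n) * q * E\<^sup>2)"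
  shows "\<And>a s. s < length (w m n a) \<Longrightarrow> fl m n a s \<le> (1 - c) * len m (w m n a ! s)"
    and "\<exists>\<nu>. minorized m n \<nu> \<and> sum \<nu> UNIV = c / (q * E\<^sup>2 * exp (2 * N))"
    and "c > 0" "q > 0"
proof -
  show q0: "q > 0" using q[of undefined] return_word_nonempty[of al be tw m n undefined]
    by (metis length_greater_0_conv less_le_trans)
  have E0: "E > 0" by (simp add: E_def)
  show c0: "c > 0" using q0 E0 by (simp add: c_def)
  have B0: "B \<ge> 0" using B[OF lo_in, of undefined] by linarith
  have bs: "\<bar>bsum (R m) (f m) u x\<bar> \<le> B * length u" if "adm (J m) (R m) u x" for u x
    using that
  proof (induction u arbitrary: x)
    case (Cons b u)
    then have "\<bar>f m b x\<bar> \<le> B" "\<bar>bsum (R m) (f m) u (R m b x)\<bar> \<le> B * length u" using B by auto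
    then show ?case by (simp add: algebra_simps abs_le_iff)
  qed simp
  \<comment> \<open>The logarithm of such a derivative is a sum of at most \<open>q\<close> terms
    bounded by \<open>B\<close>.\<close>
  have dch: "1 / E \<le> dchain (R m) (D m) (take s (w m n a)) x \<and> dchain (R m) (D m) (take s (w m n a)) x \<le> E"
    if x: "x \<in> J n a" for a s x
  proof -
    have "\<bar>bsum (R m) (f m) (take s (w m n a)) x\<bar> \<le> B * length (take s (w m n a))"
      by (rule bs) (use adm_prefix[of m n a "take s (w m n a)" "drop s (w m n a)"] mn x in auto)
    also have "\<dots> \<le> B * q" using q[of a] B0 by (intro mult_left_mono) (auto simp: min_def)
    finally have "\<bar>bsum (R m) (f m) (take s (w m n a)) x\<bar> \<le> B * q" .
    moreover have "dchain (R m) (D m) (take s (w m n a)) x = exp (bsum (R m) (f m) (take s (w m n a)) x)"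
      unfolding D_exp[abs_def] by (rule dchain_exp)
    ultimately show ?thesis by (auto simp: E_def exp_minus[symmetric] inverse_eq_divide[symmetric] abs_le_iff)
  qed
  have flE: "len n a / E \<le> fl m n a s \<and> fl m n a s \<le> E * len n a" for a s
  proof -
    obtain z where "z \<in> J n a" "fl m n a s = dchain (R m) (D m) (take s (w m n a)) z * len n a"
      using fl_eq[OF mn] by blast
    then show ?thesis using dch[of z a s]
      mult_right_mono[of "1 / E" "dchain (R m) (D m) (take s (w m n a)) z" "len n a"]
      mult_right_mono[of "dchain (R m) (D m) (take s (w m n a)) z" E "len n a"] by simp
  qed
  define L where "L = (\<Sum>j\<in>UNIV. len m j)"
  have L0: "L > 0" unfolding L_def by (intro sum_pos) auto
  have lenL: "len m j \<le> L" for j unfolding L_def by (rule member_le_sum) auto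
  \<comment> \<open>\<open>b\<close> is a longest new interval. At most \<open>CARD('n) * q\<close>
    floors, none wider than \<open>E * len n b\<close>, fill the total length \<open>L\<close>; so
    \<open>len n b\<close>, and up to another factor \<open>E\<close> every floor over
    \<open>b\<close>, is a definite part of \<open>L\<close>. This is the origin of
    \<open>c\<close>.\<close>
  obtain b where b: "\<And>a. len n a \<le> len n b"
  proof -
    have "Max (range (len n)) \<in> range (len n)" by (rule Max_in) auto
    then obtain b where "Max (range (len n)) = len n b" by (rule rangeE)
    then have "len n a \<le> len n b" for a by (metis Max_ge finite finite_imageI rangeI)
    then show thesis using that by blast
  qed
  have "L = (\<Sum>j\<in>UNIV. \<Sum>a\<in>UNIV. \<Sum>s | s < length (w m n a) \<and> w m n a ! s = j. fl m n a s)"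
    unfolding L_def floors_sum[OF mn] ..
  also have "\<dots> = (\<Sum>a\<in>UNIV. \<Sum>j\<in>UNIV. \<Sum>s | s \<in> {..<length (w m n a)} \<and> w m n a ! s = j. fl m n a s)"
    by (subst sum.swap) simp
  also have "\<dots> = (\<Sum>a\<in>UNIV. \<Sum>s<length (w m n a). fl m n a s)"
    by (intro sum.cong refl sum.group) auto
  also have "\<dots> \<le> (\<Sum>a\<in>(UNIV::'n set). q * (E * len n b))"
  proof (rule sum_mono)
    fix a
    have "(\<Sum>s<length (w m n a). fl m n a s) \<le> (\<Sum>s<length (w m n a). E * len n b)"
      using flE[of a] b[of a] E0 by (intro sum_mono) (meson mult_left_mono order_trans less_imp_le)
    also have "\<dots> \<le> q * (E * len n b)" using q[of a] E0 by (simp add: mult_right_mono)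
    finally show "(\<Sum>s<length (w m n a). fl m n a s) \<le> q * (E * len n b)" .
  qed
  finally have "L \<le> CARD('n) * (q * (E * len n b))" by simp
  then have flb: "c * L \<le> fl m n b s" for s
  proof -
    assume "L \<le> CARD('n) * (q * (E * len n b))"
    then have "c * L \<le> len n b / E" using q0 E0 by (simp add: c_def field_simps power2_eq_square)
    then show ?thesis using flE[of b s] by linarith
  qed
  let ?I = "\<lambda>a j. {s. s < length (w m n a) \<and> w m n a ! s = j}"
  have cardI: "card (?I a j) \<ge> 2" for a j
    using cnt[of a j]
    by (simp add: count_list_eq_length_filter length_filter_conv_card eq_commute[of j])
  have ex_pos: "\<exists>s. s \<in> ?I a j" for a j
    using cardI[of a j] by (metis card.empty ex_in_conv not_numeral_le_zero)
  have fl0: "fl m n a s \<ge> 0" for a s using fl_pos[OF mn, of a s] by simp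
  \<comment> \<open>The tower over \<open>b\<close> visits every label at least twice, so at least
    one of these visits is a floor other than \<open>(a, s)\<close> in the same interval.\<close>
  have two: "fl m n a s + c * L \<le> len m (w m n a ! s)" if s: "s < length (w m n a)" for a s
  proof -
    let ?j = "w m n a ! s"
    have "\<exists>s'\<in>?I b ?j. (b, s') \<noteq> (a, s)"
    proof (rule ccontr)
      assume "\<not> ?thesis"
      then have "?I b ?j \<subseteq> {s}" by auto
      then have "card (?I b ?j) \<le> 1" using card_mono[of "{s}"] by fastforce
      then show False using cardI[of b ?j] by linarith
    qed
    then obtain s' where s': "s' \<in> ?I b ?j" "(b, s') \<noteq> (a, s)" by blast
    have "(\<Sum>p\<in>{(a, s), (b, s')}. fl m n (fst p) (snd p)) \<le> (\<Sum>p\<in>Sigma UNIV (\<lambda>a. ?I a ?j). fl m n (fst p) (snd p))"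
      using s s' fl0 by (intro sum_mono2) auto
    also have "\<dots> = len m ?j"
      unfolding floors_sum[OF mn, symmetric] by (subst sum.Sigma) (auto simp: case_prod_beta)
    finally show ?thesis using s'(2) flb[of s'] by (auto simp: eq_commute)
  qed
  show "fl m n a s \<le> (1 - c) * len m (w m n a ! s)" if "s < length (w m n a)" for a s
    using two[OF that] mult_left_mono[OF lenL[of "w m n a ! s"] less_imp_le[OF c0]]
    unfolding left_diff_distrib by linarith
  have lenc: "c * L \<le> len m j" for j
  proof -
    obtain s where "s \<in> ?I b j" using ex_pos by blast
    then show ?thesis using two[of s b] fl0[of b s] by auto
  qed
  \<comment> \<open>The masses of the stage-\<open>m\<close> towers, which sum to 1; up to a
    constant they are the minorizing measure.\<close>
  define t where "t j = integral (J m j) (h m j)" for j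
  have hi: "h m j integrable_on J m j" for j
    using h_cont[of m j] unfolding J_def by (rule integrable_continuous_real)
  have t0: "t j \<ge> 0" for j
    unfolding t_def using h_pos[of _ m j] by (intro integral_nonneg hi) force
  have tsum: "(\<Sum>j\<in>UNIV. t j) = 1" using integral_h[of m] by (simp add: t_def)
  have const: "integral (J m j) (\<lambda>y. k) = k * len m j" for j k
    using lo_hi[of m j] by (simp add: J_def len_def less_imp_le)
  have h_low: "exp (- N) * t j / L \<le> h m j z" if z: "z \<in> J m j" for z j
  proof -
    have "t j \<le> integral (J m j) (\<lambda>y. exp N * h m j z)"
      unfolding t_def using h_distortion[OF _ z] integrable_const_ivl[of _ "lo m j" "hi m j"]
      by (intro integral_le hi) (auto simp: J_def)
    also have "\<dots> = exp N * h m j z * len m j" by (rule const)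
    also have "\<dots> \<le> exp N * h m j z * L"
      using lenL h_pos[OF z] by (intro mult_left_mono) auto
    finally show ?thesis using L0 by (simp add: exp_minus field_simps)
  qed
  have h_up: "h m j z \<le> exp N / (c * L)" if z: "z \<in> J m j" for z j
  proof -
    have "h m j z \<le> exp N / len m j" by (rule h_len_le'[OF z])
    also have "\<dots> \<le> exp N / (c * L)"
      using lenc[of j] c0 L0 by (intro divide_left_mono) auto
    finally show ?thesis .
  qed
  \<comment> \<open>The constant results from comparing the least weight of a floor over
    \<open>j\<close>, given by \<open>h_low\<close>, with the greatest normalizing height, given by
    \<open>h_up\<close>.\<close>
  define \<nu> where "\<nu> j = c / (q * E\<^sup>2 * exp (2 * N)) * t j" for j
  have "minorized m n \<nu>"
    unfolding minorized_def
  proof (intro conjI allI ballI)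
    show "0 \<le> \<nu> j" for j using t0 c0 q0 E0 by (simp add: \<nu>_def)
    fix a x j assume x: "x \<in> J n a"
    have wt_le: "wt m n a s x \<le> E * (exp N / (c * L))" if "s < length (w m n a)" for s
      unfolding wt_def using dch[OF x, of s] h_up[OF pt_in[OF mn x that]] h_pos[OF pt_in[OF mn x that]] E0
      by (intro mult_mono) auto
    have "h n a x = (\<Sum>s<length (w m n a). wt m n a s x)" using sum_wt[OF mn, of a x] by simp
    also have "\<dots> \<le> (\<Sum>s<length (w m n a). E * (exp N / (c * L)))"
      using wt_le by (intro sum_mono) auto
    also have "\<dots> \<le> q * (E * (exp N / (c * L)))"
      using q[of a] E0 c0 L0 by (simp add: mult_right_mono divide_right_mono)
    finally have hu: "h n a x \<le> q * (E * (exp N / (c * L)))" .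
    obtain s where s: "s \<in> ?I a j" using ex_pos by blast
    have "\<nu> j * h n a x \<le> \<nu> j * (q * (E * (exp N / (c * L))))"
      using hu t0 c0 q0 E0 by (intro mult_left_mono) (auto simp: \<nu>_def)
    also have "\<dots> = (1 / E) * (exp (- N) * t j / L)"
    proof -
      have alg: "c' / (q' * E'\<^sup>2 * (e * e)) * t' * (q' * (E' * (e / (c' * L')))) = (1 / E') * (1 / e * t' / L')"
        if "c' \<noteq> 0" "q' \<noteq> 0" "E' \<noteq> 0" "L' \<noteq> 0" "e \<noteq> 0" for c' q' E' L' e t' :: real
        using that by (simp add: power2_eq_square)
      have "exp (2 * N) = exp N * exp N" "exp (- N) = 1 / exp N"
        by (simp_all add: exp_add[symmetric] exp_minus inverse_eq_divide)
      then show ?thesis using alg[of c q E L "exp N" "t j"] q0 E0 c0 L0 by (simp only: \<nu>_def) simp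
    qed
    also have "\<dots> \<le> wt m n a s x"
      unfolding wt_def using dch[OF x, of s] h_low[OF pt_in[OF mn x]] s t0 L0 E0
        dchain_pt_pos[OF mn x, of s]
      by (intro mult_mono) auto
    finally have "\<nu> j \<le> pr m n a s x"
      using h_pos[OF x] by (simp add: pr_def field_simps)
    also have "\<dots> \<le> (\<Sum>s | s < length (w m n a) \<and> w m n a ! s = j. pr m n a s x)"
      using s pr_nonneg[OF mn x] by (intro member_le_sum) auto
    finally show "\<nu> j \<le> (\<Sum>s | s < length (w m n a) \<and> w m n a ! s = j. pr m n a s x)" .
  qed
  moreover have "sum \<nu> UNIV = c / (q * E\<^sup>2 * exp (2 * N))"
    unfolding \<nu>_def sum_distrib_left[symmetric] tsum by simp
  ultimately show "\<exists>\<nu>. minorized m n \<nu> \<and> sum \<nu> UNIV = c / (q * E\<^sup>2 * exp (2 * N))" by blast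
qed

end

section \<open>Exponential decay of the mean nonlinearity and of the oscillation of the
  log-derivative\<close>

context smooth_towers
begin

lemma initial_bounds: "osc_le 0 (2 * H)" "lip_le 0 \<bar>K\<bar>"
proof -
  have p: "psi 0 a x = eta a x" for a x by (simp add: psi_def h_def trans_def)
  show "osc_le 0 (2 * H)"
    unfolding osc_le_def p
  proof (intro allI ballI)
    fix a b x y assume "x \<in> J 0 a" "y \<in> J 0 b"
    then show "eta a x - eta b y \<le> 2 * H" using eta_bound[of x a] eta_bound[of y b] by linarith
  qed
  show "lip_le 0 \<bar>K\<bar>"
    unfolding lip_le_def p
  proof (intro allI ballI)
    fix a x y assume xy: "x \<in> J 0 a" "y \<in> J 0 a"
    have "\<bar>eta a x - eta a y\<bar> * len 0 a \<le> \<bar>eta a x - eta a y\<bar> * 1"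
      using len0_le by (intro mult_left_mono) auto
    also have "\<dots> \<le> K * \<bar>x - y\<bar>" using eta_lip[of x a y] xy by (simp add: J_def)
    also have "\<dots> \<le> \<bar>K\<bar> * \<bar>x - y\<bar>" by (intro mult_right_mono) auto
    finally show "\<bar>eta a x - eta a y\<bar> * len 0 a \<le> \<bar>K\<bar> * \<bar>x - y\<bar>" .
  qed
qed

lemma C2_nonneg: "C2 \<ge> 0"
  using C1_nonneg by (simp add: C2_def)

text \<open>The quantity \<open>o1 + \<epsilon> * L\<close>, oscillation plus a multiple of the
  Lipschitz constant, contracts over \<open>p\<close> blocks. Each part is contracted up to an error
  from the other: the mesh contracts \<open>L\<close> but the oscillation feeds it, and mixing
  contracts the oscillation only up to the variation inside one interval, which the mesh and
  \<open>L\<close> bound. A small \<open>\<epsilon>\<close> absorbs the first error, a long run of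
  blocks the second.\<close>

theorem osc_exponential:
  fixes \<tau> \<sigma> :: "nat \<Rightarrow> nat" and q :: nat and B :: real
  assumes ts: "\<And>l. \<tau> l \<le> \<sigma> l" "\<And>l. \<sigma> l \<le> \<tau> (Suc l)"
    and B: "\<And>l a x. x \<in> J (\<tau> l) a \<Longrightarrow> \<bar>f (\<tau> l) a x\<bar> \<le> B"
    and cnt: "\<And>l a j. count_list (w (\<tau> l) (\<sigma> l) a) j \<ge> 2"
    and q: "\<And>l a. length (w (\<tau> l) (\<sigma> l) a) \<le> q"
  obtains C \<alpha> where "C > 0" "0 < \<alpha>" "\<alpha> < 1" "\<And>l. osc_le (\<tau> l) (C * \<alpha> ^ l)"
proof -
  define E where "E = exp (B * q)"
  define c1 where "c1 = 1 / (CARD('n) * q * E\<^sup>2)"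
  define c where "c = c1 / (q * E\<^sup>2 * exp (2 * N))"
  have gb1: "fl (\<tau> l) (\<sigma> l) a s \<le> (1 - c1) * len (\<tau> l) (w (\<tau> l) (\<sigma> l) a ! s)"
    if "s < length (w (\<tau> l) (\<sigma> l) a)" for l a s
    unfolding c1_def E_def by (rule good_block(1)) (use ts B cnt q that in auto)
  have gb2: "\<exists>\<nu>. minorized (\<tau> l) (\<sigma> l) \<nu> \<and> sum \<nu> UNIV = c" for l
    unfolding c_def c1_def E_def by (rule good_block(2)) (use ts B cnt q in auto)
  have c1: "c1 > 0"
    unfolding c1_def E_def by (rule good_block(3)) (use ts[of 0] B[of _ 0] cnt[of 0] q[of 0] in auto)
  have q0: "q > 0"
    by (rule good_block(4)) (use ts[of 0] B[of _ 0] cnt[of 0] q[of 0] in auto)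
  have E0: "E > 0" by (simp add: E_def)
  have c0: "c > 0" using c1 q0 E0 by (simp add: c_def)
  have tau_mono: "\<tau> l \<le> \<tau> l'" if "l \<le> l'" for l l'
    using that by (rule lift_Suc_mono_le[rotated]) (use ts order_trans in blast)
  define \<Theta> where "\<Theta> = 1 - c1 * exp (- N)"
  have c1_less: "c1 < 1"
  proof -
    fix a
    have ne: "0 < length (w (\<tau> 0) (\<sigma> 0) a)" using return_word_nonempty[of al be tw "\<tau> 0" "\<sigma> 0" a] by auto
    have "0 < (1 - c1) * len (\<tau> 0) (w (\<tau> 0) (\<sigma> 0) a ! 0)"
      using gb1[OF ne] fl_pos[OF ts(1)[of 0], of a 0] by linarith
    then show ?thesis
      using len_pos[of "\<tau> 0" "w (\<tau> 0) (\<sigma> 0) a ! 0"] unfolding zero_less_mult_iff by linarith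
  qed
  have "c1 * exp (- N) < 1 * 1" using c1 c1_less N_nonneg by (intro mult_less_le_imp_less) auto
  then have \<Theta>: "0 < \<Theta>" "\<Theta> < 1" using c1 by (auto simp: \<Theta>_def)
  have mesh: "mesh_le (\<tau> l) (\<tau> (l + r)) (\<Theta> ^ r)" for l r
  proof (induction r)
    case 0 then show ?case by (simp add: mesh_refl)
  next
    case (Suc r)
    have "mesh_le (\<tau> l) (\<sigma> (l + r)) ((1 - c1 * exp (- N)) * \<Theta> ^ r)"
      by (rule mesh_compose[OF tau_mono ts(1) Suc]) (use gb1 \<Theta> c1 in auto)
    then have "mesh_le (\<tau> l) (\<sigma> (l + r)) (\<Theta> ^ Suc r)" by (simp add: \<Theta>_def)
    then show ?case
      using mesh_mono[of "\<tau> l" "\<sigma> (l + r)" "\<tau> (l + Suc r)" "\<Theta> ^ Suc r"] ts(2)[of "l + r"] \<Theta>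
        tau_mono[of l "l + r"] ts(1)[of "l + r"] by auto
  qed
  have csum: "c \<le> 1"
    using gb2[of 0] minorized_sum_le[OF ts(1)[of 0]] by auto
  define \<kappa> where "\<kappa> = c * rho"
  have \<kappa>: "0 < \<kappa>" "\<kappa> \<le> 1"
    using c0 csum rho mult_mono[of c 1 rho 1] by (auto simp: \<kappa>_def)
  \<comment> \<open>Small enough that feeding the oscillation into the Lipschitz constant costs at
    most half of the gain \<open>\<kappa>\<close>.\<close>
  define \<epsilon> where "\<epsilon> = \<kappa> / (2 * (C2 + 1))"
  have \<epsilon>: "\<epsilon> > 0" "\<epsilon> * C2 \<le> \<kappa> / 2"
    using \<kappa> C2_nonneg by (auto simp: \<epsilon>_def field_simps)
  define \<mu> where "\<mu> = 1 - \<kappa> / 2"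
  have \<mu>: "0 < \<mu>" "\<mu> < 1" using \<kappa> by (auto simp: \<mu>_def)
  \<comment> \<open>After \<open>r\<close> blocks the mesh is so fine that the Lipschitz terms of
    both inequalities together stay below \<open>\<mu> * (\<epsilon> * L)\<close>.\<close>
  have "(\<lambda>r. \<Theta> ^ r * (\<kappa> / \<epsilon> + exp N)) \<longlonglongrightarrow> 0 * (\<kappa> / \<epsilon> + exp N)"
    using \<Theta> by (intro tendsto_mult tendsto_const LIMSEQ_power_zero) auto
  then have "eventually (\<lambda>r. \<Theta> ^ r * (\<kappa> / \<epsilon> + exp N) < \<mu>) sequentially"
    using \<mu> by (intro order_tendstoD) auto
  then obtain r where r: "\<Theta> ^ r * (\<kappa> / \<epsilon> + exp N) < \<mu>"
    by (meson eventually_sequentially order_refl)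
  define p where "p = Suc r"
  \<comment> \<open>The first \<open>r\<close> blocks refine the floors, which makes
    \<open>cell_osc\<close> effective; the block starting at \<open>\<tau> (l + r)\<close> then
    mixes the towers.\<close>
  have step: "\<exists>o' L'. osc_le (\<tau> (l + p)) o' \<and> lip_le (\<tau> (l + p)) L' \<and> L' \<ge> 0 \<and> o' + \<epsilon> * L' \<le> \<mu> * (o1 + \<epsilon> * L)"
    if "osc_le (\<tau> l) o1" "lip_le (\<tau> l) L" "L \<ge> 0" for l o1 L
  proof -
    have o0: "o1 \<ge> 0" using osc_le_nonneg[OF that(1)] .
    have t1: "\<tau> l \<le> \<tau> (l + r)" "\<tau> l \<le> \<tau> (l + p)" using tau_mono by auto
    have om: "osc_le (\<tau> (l + r)) o1" by (rule osc_mono[OF t1(1) that(1)])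
    obtain \<nu> where \<nu>: "minorized (\<tau> (l + r)) (\<sigma> (l + r)) \<nu>" "sum \<nu> UNIV = c" using gb2 by blast
    have "osc_le (\<sigma> (l + r)) ((1 - c) * o1 + c * ((1 - rho) * o1 + rho * (\<Theta> ^ r * L)))"
      using osc_minorized[OF ts(1) om \<nu>(1) cell_osc[OF t1(1) that mesh]] \<nu>(2) by simp
    also have "(1 - c) * o1 + c * ((1 - rho) * o1 + rho * (\<Theta> ^ r * L)) = (1 - \<kappa>) * o1 + \<kappa> * \<Theta> ^ r * L"
      by (simp add: \<kappa>_def algebra_simps)
    finally have o': "osc_le (\<tau> (l + p)) ((1 - \<kappa>) * o1 + \<kappa> * \<Theta> ^ r * L)"
      using osc_mono[OF ts(2)[of "l + r"]] by (simp add: p_def)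
    have L': "lip_le (\<tau> (l + p)) (exp N * \<Theta> ^ p * L + C2 * o1)"
      by (rule lip_step[OF t1(2) that mesh])
    have "\<Theta> ^ p \<le> \<Theta> ^ r" using \<Theta> by (simp add: p_def mult_left_le_one_le)
    then have "\<epsilon> * (exp N * \<Theta> ^ p * L) \<le> \<epsilon> * (exp N * \<Theta> ^ r * L)"
      using \<epsilon> that(3) by (intro mult_left_mono mult_right_mono) auto
    moreover have "\<epsilon> * (C2 * o1) \<le> \<kappa> / 2 * o1"
      using mult_right_mono[OF \<epsilon>(2) o0] by (simp add: mult.assoc)
    moreover have "\<Theta> ^ r * (\<kappa> / \<epsilon> + exp N) * (\<epsilon> * L) \<le> \<mu> * (\<epsilon> * L)"
      using r \<epsilon> that(3) by (intro mult_right_mono) auto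
    moreover have "\<Theta> ^ r * (\<kappa> / \<epsilon> + exp N) * (\<epsilon> * L) = \<kappa> * \<Theta> ^ r * L + \<epsilon> * (exp N * \<Theta> ^ r * L)"
      using \<epsilon>(1) by (simp add: field_simps)
    ultimately have "(1 - \<kappa>) * o1 + \<kappa> * \<Theta> ^ r * L + \<epsilon> * (exp N * \<Theta> ^ p * L + C2 * o1)
       \<le> \<mu> * (o1 + \<epsilon> * L)"
    proof -
      have "(1 - \<kappa>) * o1 = o1 - \<kappa> * o1" "\<mu> * o1 = o1 - \<kappa> / 2 * o1" "\<kappa> * o1 = 2 * (\<kappa> / 2 * o1)"
        by (simp_all add: \<mu>_def algebra_simps)
      moreover assume "\<epsilon> * (exp N * \<Theta> ^ p * L) \<le> \<epsilon> * (exp N * \<Theta> ^ r * L)"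
        "\<epsilon> * (C2 * o1) \<le> \<kappa> / 2 * o1" "\<Theta> ^ r * (\<kappa> / \<epsilon> + exp N) * (\<epsilon> * L) \<le> \<mu> * (\<epsilon> * L)"
        "\<Theta> ^ r * (\<kappa> / \<epsilon> + exp N) * (\<epsilon> * L) = \<kappa> * \<Theta> ^ r * L + \<epsilon> * (exp N * \<Theta> ^ r * L)"
      ultimately show ?thesis unfolding distrib_left[of \<epsilon>] distrib_left[of \<mu>] by linarith
    qed
    moreover have "exp N * \<Theta> ^ p * L + C2 * o1 \<ge> 0" using \<Theta> that(3) C2_nonneg o0 by simp
    ultimately show ?thesis using o' L' by blast
  qed
  have m0: "mesh_le 0 (\<tau> 0) 1" using mesh_mono[OF le0 _ mesh_refl[of 0], of "\<tau> 0"] by simp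
  \<comment> \<open>A bound at time \<open>\<tau> 0\<close>, where \<open>lip_step\<close> is
    applied from stage 0 with the trivial mesh 1; the last summand makes it positive.\<close>
  define V where "V = 2 * H + \<epsilon> * (exp N * 1 * \<bar>K\<bar> + C2 * (2 * H)) + 1"
  have V0: "V > 0" using H_nonneg \<epsilon> C2_nonneg by (simp add: V_def add_nonneg_pos)
  have it: "\<exists>o1 L. osc_le (\<tau> (i * p)) o1 \<and> lip_le (\<tau> (i * p)) L \<and> L \<ge> 0 \<and> o1 + \<epsilon> * L \<le> \<mu> ^ i * V" for i
  proof (induction i)
    case 0
    have "osc_le (\<tau> 0) (2 * H)" by (rule osc_mono[OF le0 initial_bounds(1)])
    moreover have "lip_le (\<tau> 0) (exp N * 1 * \<bar>K\<bar> + C2 * (2 * H))"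
      by (rule lip_step[OF le0 initial_bounds(1,2) _ m0]) simp
    moreover have "exp N * 1 * \<bar>K\<bar> + C2 * (2 * H) \<ge> 0" using C2_nonneg H_nonneg by simp
    ultimately show ?case unfolding V_def by fastforce
  next
    case (Suc i)
    then obtain o1 L where oL: "osc_le (\<tau> (i * p)) o1" "lip_le (\<tau> (i * p)) L" "L \<ge> 0"
      "o1 + \<epsilon> * L \<le> \<mu> ^ i * V" by blast
    from step[OF oL(1-3)] obtain o' L' where "osc_le (\<tau> (i * p + p)) o'" "lip_le (\<tau> (i * p + p)) L'"
      "L' \<ge> 0" "o' + \<epsilon> * L' \<le> \<mu> * (o1 + \<epsilon> * L)" by blast
    moreover have "\<mu> * (o1 + \<epsilon> * L) \<le> \<mu> * (\<mu> ^ i * V)" using oL(4) \<mu> by (intro mult_left_mono) auto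
    ultimately show ?case by (auto simp: add.commute mult.assoc intro: order_trans)
  qed
  have osc: "osc_le (\<tau> l) (\<mu> ^ (l div p) * V)" for l
  proof -
    obtain o1 L where oL: "osc_le (\<tau> (l div p * p)) o1" "L \<ge> 0" "o1 + \<epsilon> * L \<le> \<mu> ^ (l div p) * V"
      using it[of "l div p"] by blast
    have "\<tau> (l div p * p) \<le> \<tau> l" by (rule tau_mono) simp
    then have "osc_le (\<tau> l) o1" using osc_mono oL(1) by blast
    moreover have "o1 \<le> \<mu> ^ (l div p) * V" using oL(2,3) \<epsilon>(1) mult_nonneg_nonneg[of \<epsilon> L] by linarith
    ultimately show ?thesis by (force simp: osc_le_def)
  qed
  obtain \<alpha> C where \<alpha>: "0 < \<alpha>" "\<alpha> < 1" "C > 0" "\<And>l. \<mu> ^ (l div p) \<le> C * \<alpha> ^ l"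
    using power_div_le_geometric[OF \<mu>, of p] by (auto simp: p_def)
  have "osc_le (\<tau> l) (C * V * \<alpha> ^ l)" for l
  proof -
    have "\<mu> ^ (l div p) * V \<le> C * \<alpha> ^ l * V" using \<alpha>(4) V0 by (intro mult_right_mono) auto
    then show ?thesis using osc[of l] unfolding osc_le_def by (force simp: mult_ac)
  qed
  then show thesis using that[of "C * V" \<alpha>] \<alpha> V0 by auto
qed

text \<open>The mean nonlinearity vanishes, so \<open>psi n\<close> is neither positive nor negative throughout.\<close>

lemma psi_le_osc:
  assumes o: "osc_le n c" and x: "x \<in> J n a"
  shows "\<bar>psi n a x\<bar> \<le> c"
proof -
  have teq: "trans eta n b y = psi n b y * h n b y" if "y \<in> J n b" for b y
    using h_pos[OF that] by (simp add: psi_def)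
  have int: "trans eta n b integrable_on J n b" for b
    using trans_eta_cont[of n b] unfolding J_def by (rule integrable_continuous_real)
  have "((eta b) has_integral f0 b (hi 0 b) - f0 b (lo 0 b)) {lo 0 b..hi 0 b}" for b
    by (rule fundamental_theorem_of_calculus)
      (use f0_deriv lo_hi[of 0 b] in \<open>auto simp: has_real_derivative_iff_has_vector_derivative\<close>)
  then have "integral (J 0 b) (eta b) = f0 b (hi 0 b) - f0 b (lo 0 b)" for b
    unfolding J_def by (rule integral_unique)
  then have "(\<Sum>b\<in>UNIV. integral (J 0 b) (eta b)) = 0"
    using total_jump by simp
  then have zero: "(\<Sum>b\<in>UNIV. integral (J n b) (trans eta n b)) = 0"
    using word_integral[of 0 n eta] eta_cont by (simp add: trans_def[abs_def] R_0)
  have const: "integral (J n j) (\<lambda>y. k) = k * len n j" for j k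
    using lo_hi[of n j] by (simp add: J_def len_def less_imp_le)
  have L: "(\<Sum>b\<in>UNIV. len n b) > 0" by (intro sum_pos) auto
  have False if k: "k > 0" "\<And>b y. y \<in> J n b \<Longrightarrow> k \<le> psi n b y" for k
  proof -
    have "(\<Sum>b\<in>UNIV. k * len n b) \<le> (\<Sum>b\<in>UNIV. integral (J n b) (trans eta n b))"
      unfolding const[symmetric]
    proof (intro sum_mono integral_le int)
      show "(\<lambda>y. k) integrable_on J n b" for b by (simp add: J_def integrable_const_ivl)
      show "k \<le> trans eta n b y" if "y \<in> J n b" for b y
        using k(2)[OF that] h_pos[OF that] k(1) mult_mono[of k "psi n b y" 1 "h n b y"]
        by (simp add: teq[OF that])
    qed
    then show False using mult_pos_pos[OF k(1) L] zero by (simp add: sum_distrib_left[symmetric])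
  qed
  note pos = this
  have False if k: "k > 0" "\<And>b y. y \<in> J n b \<Longrightarrow> psi n b y \<le> - k" for k
  proof -
    have "(\<Sum>b\<in>UNIV. integral (J n b) (trans eta n b)) \<le> (\<Sum>b\<in>UNIV. (- k) * len n b)"
      unfolding const[symmetric]
    proof (intro sum_mono integral_le int)
      show "(\<lambda>y. - k) integrable_on J n b" for b by (simp add: J_def integrable_const_ivl)
      show "trans eta n b y \<le> - k" if "y \<in> J n b" for b y
        using k(2)[OF that] h_pos[OF that] k(1) mult_mono[of k "- psi n b y" 1 "h n b y"]
        by (simp add: teq[OF that])
    qed
    then show False using mult_pos_pos[OF k(1) L] zero by (simp add: sum_negf sum_distrib_left[symmetric])
  qed
  note neg = this
  show ?thesis
  proof (rule ccontr)
    assume "\<not> ?thesis"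
    then consider "psi n a x > c" | "psi n a x < - c" by linarith
    then show False
    proof cases
      case 1 show False
        by (rule pos[of "psi n a x - c"]) (use 1 osc_leD[OF o x] in force)+
    next
      case 2 show False
        by (rule neg[of "- c - psi n a x"]) (use 2 osc_leD[OF o _ x] in force)+
    qed
  qed
qed

text \<open>The derivative of \<open>f n a\<close> is \<open>psi\<close> times the height, and the
  height is at most \<open>exp N\<close> over the length, so the variation over the interval does
  not depend on how short the interval is.\<close>

lemma f_osc:
  assumes o: "osc_le n c" and xy: "x \<in> J n a" "y \<in> J n a"
  shows "\<bar>f n a x - f n a y\<bar> \<le> exp N * c"
proof -
  have "norm (f n a x - f n a y) \<le> (c * (exp N / len n a)) * norm (x - y)"
  proof (rule field_differentiable_bound[of "J n a" "f n a" "trans eta n a"])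
    show "convex (J n a)" by (simp add: J_def)
    show "norm (trans eta n a z) \<le> c * (exp N / len n a)" if z: "z \<in> J n a" for z
    proof -
      have "trans eta n a z = psi n a z * h n a z" using h_pos[OF z] by (simp add: psi_def)
      then show ?thesis
        using mult_mono[OF psi_le_osc[OF o z] h_len_le'[OF z]] osc_le_nonneg[OF o] h_pos[OF z]
        by (simp add: abs_mult)
    qed
  qed (use xy f_deriv in auto)
  also have "\<dots> = c * exp N * (\<bar>x - y\<bar> / len n a)" by simp
  also have "\<dots> \<le> c * exp N * 1"
    using rel_dist[OF xy] osc_le_nonneg[OF o] by (intro mult_left_mono) auto
  finally show ?thesis by (simp add: mult.commute)
qed

end

section \<open>Elementary steps\<close>

abbreviation wsize :: "real ^ 'n::finite \<Rightarrow> 'n list \<Rightarrow> real" where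
  "wsize len us \<equiv> (\<Sum>b\<leftarrow>us. len $ b)"

lemma left_end_takeWhile: "left_end xs len a = wsize len (takeWhile (\<lambda>x. x \<noteq> a) xs)"
  by (simp add: left_end_def endpoint_def pos_def takeWhile_eq_take[symmetric])

lemma left_end_split: "a \<notin> set us \<Longrightarrow> left_end (us @ a # vs) len a = wsize len us"
proof -
  assume "a \<notin> set us"
  then have "takeWhile (\<lambda>x. x \<noteq> a) (us @ a # vs) = us" by (induction us) auto
  then show ?thesis by (simp add: left_end_takeWhile)
qed

lemma wsize_nonneg: "(\<And>a. 0 < len $ a) \<Longrightarrow> 0 \<le> wsize len us"
  by (induction us) (auto simp: less_imp_le intro: add_nonneg_nonneg)

lemma wsize_UNIV: "distinct xs \<Longrightarrow> set xs = UNIV \<Longrightarrow> wsize len xs = (\<Sum>a\<in>UNIV. len $ a)"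
  by (simp add: sum_list_distinct_conv_sum_set)

lemma left_end_nonneg: "(\<And>a. 0 < len $ a) \<Longrightarrow> 0 \<le> left_end xs len a"
  by (simp add: left_end_takeWhile wsize_nonneg)

lemma right_end_le:
  assumes "\<And>a. 0 < len $ a" "a \<in> set xs"
  shows "left_end xs len a + len $ a \<le> wsize len xs"
proof -
  obtain us vs where "xs = us @ a # vs" "a \<notin> set us" using split_list_first[OF assms(2)] by blast
  then show ?thesis using wsize_nonneg[of len vs] assms by (simp add: left_end_split)
qed

lemma cells_disjoint:
  assumes "\<And>a. 0 < len $ a" "a \<in> set xs" "b \<in> set xs" "a \<noteq> b" "distinct xs"
  shows "left_end xs len a + len $ a \<le> left_end xs len b \<or> left_end xs len b + len $ b \<le> left_end xs len a"
proof -
  obtain us vs where x: "xs = us @ a # vs" using split_list[OF assms(2)] by blast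
  then have a: "a \<notin> set us" using assms(5) by auto
  consider "b \<in> set us" | "b \<in> set vs" using x assms(3,4) by auto
  then show ?thesis
  proof cases
    case 1
    then obtain u1 u2 where u: "us = u1 @ b # u2" by (meson split_list)
    then have "b \<notin> set u1" using x assms(5) by auto
    then show ?thesis
      using left_end_split[of b u1 "u2 @ a # vs" len] left_end_split[OF a, of vs len] x u
        wsize_nonneg[of len u2] assms(1) by auto
  next
    case 2
    then obtain v1 v2 where v: "vs = v1 @ b # v2" by (meson split_list)
    then have "b \<notin> set (us @ a # v1)" using x assms(5) by auto
    then show ?thesis
      using left_end_split[of b "us @ a # v1" v2 len] left_end_split[OF a, of vs len] x v
        wsize_nonneg[of len v1] assms(1) by auto
  qed
qed

lemma cells_cover:
  assumes "0 \<le> x" "x < wsize len xs"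
  shows "\<exists>us a vs. xs = us @ a # vs \<and> wsize len us \<le> x \<and> x < wsize len us + len $ a"
  using assms
proof (induction xs arbitrary: x)
  case (Cons b xs)
  show ?case
  proof (cases "x < len $ b")
    case True then show ?thesis using Cons.prems by (intro exI[of _ "[]"] exI[of _ b] exI[of _ xs]) auto
  next
    case False
    then obtain us a vs where "xs = us @ a # vs" "wsize len us \<le> x - len $ b"
      "x - len $ b < wsize len us + len $ a" using Cons.IH[of "x - len $ b"] Cons.prems by auto
    then show ?thesis by (intro exI[of _ "b # us"] exI[of _ a] exI[of _ vs]) auto
  qed
qed simp

lemma left_end_cover:
  assumes "distinct xs" "0 \<le> x" "x < wsize len xs"
  shows "\<exists>a\<in>set xs. left_end xs len a \<le> x \<and> x < left_end xs len a + len $ a"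
proof -
  obtain us a vs where "xs = us @ a # vs" "wsize len us \<le> x" "x < wsize len us + len $ a"
    using cells_cover[OF assms(2,3)] by blast
  then show ?thesis using assms(1) left_end_split[of a us vs len] by auto
qed

text \<open>Left ends increase strictly along a row, so a row is the list of labels sorted by left
  end.\<close>

lemma row_unique:
  fixes len :: "real ^ 'n::finite"
  assumes "\<And>a. 0 < len $ a" "distinct xs" "distinct ys" "set xs = UNIV" "set ys = UNIV"
    and eq: "\<And>a. left_end xs len a = left_end ys len a"
  shows "xs = ys"
proof -
  have sorted: "sorted (map (left_end zs len) zs)" "distinct (map (left_end zs len) zs)"
    if "distinct zs" for zs
  proof -
    have lt: "left_end zs len (zs ! i) < left_end zs len (zs ! j)" if "i < j" "j < length zs" for i j
    proof -
      have zs: "left_end zs len (zs ! k) = wsize len (take k zs)" if k: "k < length zs" for k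
      proof -
        have "zs ! k \<notin> set (take k zs)"
          using \<open>distinct zs\<close> k by (auto simp: in_set_conv_nth nth_eq_iff_index_eq)
        then show ?thesis
          using left_end_split[of "zs ! k" "take k zs" "drop (Suc k) zs" len] k
          by (simp add: id_take_nth_drop[symmetric])
      qed
      have "take j zs = take (Suc i) zs @ drop (Suc i) (take j zs)"
        using append_take_drop_id[of "Suc i" "take j zs"] that by (simp add: min_def)
      from arg_cong[OF this, of "\<lambda>u. wsize len u"]
      have "wsize len (take j zs) = wsize len (take (Suc i) zs) + wsize len (drop (Suc i) (take j zs))"
        by (simp only: map_append sum_list.append)
      moreover have "wsize len (take (Suc i) zs) = wsize len (take i zs) + len $ (zs ! i)"
        using that by (simp add: take_Suc_conv_app_nth)
      ultimately have "wsize len (take i zs) < wsize len (take j zs)"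
        using assms(1)[of "zs ! i"] wsize_nonneg[OF assms(1), of "drop (Suc i) (take j zs)"]
        by linarith
      then show ?thesis using zs that by simp
    qed
    show "sorted (map (left_end zs len) zs)"
      using lt by (auto simp: sorted_iff_nth_mono_less intro: less_imp_le)
    show "distinct (map (left_end zs len) zs)"
      unfolding distinct_conv_nth using lt
      by (metis length_map less_irrefl linorder_neqE_nat nth_map)
  qed
  have "map (left_end xs len) xs = map (left_end xs len) ys"
  proof (rule sorted_distinct_set_unique)
    show "sorted (map (left_end xs len) ys)" "distinct (map (left_end xs len) ys)"
      using sorted[OF assms(3)] eq by (simp_all cong: map_cong)
  qed (use sorted[OF assms(2)] assms in auto)
  moreover have "inj_on (left_end xs len) UNIV"
    using sorted(2)[OF assms(2)] assms(4) by (simp add: distinct_map)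
  ultimately show ?thesis using map_inj_on[of "left_end xs len" xs ys] assms by auto
qed

definition top_right :: "'n::finite giet \<Rightarrow> 'n \<Rightarrow> real" where
  "top_right T a = top_left T a + top_len T $ a"

definition bot_right :: "'n::finite giet \<Rightarrow> 'n \<Rightarrow> real" where
  "bot_right T a = bot_left T a + bot_len T $ a"

lemma closure_ints:
  assumes "two_partitions T"
  shows "closure (top_int T a) = {top_left T a..top_right T a}"
    "closure (bot_int T a) = {bot_left T a..bot_right T a}"
  using assms by (simp_all add: top_int_def bot_int_def top_right_def bot_right_def two_partitions_def
      closure_greaterThanLessThan)

lemma left_less_right:
  assumes "two_partitions T"
  shows "top_left T a < top_right T a" "bot_left T a < bot_right T a"
  using assms by (simp_all add: top_right_def bot_right_def two_partitions_def)

definition is_branch :: "(real \<Rightarrow> real) \<Rightarrow> real \<Rightarrow> real \<Rightarrow> real \<Rightarrow> real \<Rightarrow> bool" where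
  "is_branch f l r bl br \<longleftrightarrow> continuous_on {l..r} f \<and> strict_mono_on {l..r} f \<and> f l = bl \<and> f r = br"

lemma is_branch_image:
  assumes "is_branch f l r bl br" "l < r"
  shows "bij_betw f {l..r} {bl..br}" "bij_betw f {l<..<r} {bl<..<br}"
proof -
  have c: "continuous_on {l..r} f" and m: "\<And>x y. x \<in> {l..r} \<Longrightarrow> y \<in> {l..r} \<Longrightarrow> x < y \<Longrightarrow> f x < f y"
    and e: "f l = bl" "f r = br"
    using assms by (auto simp: is_branch_def strict_mono_on_def)
  have inj: "inj_on f {l..r}" by (rule inj_onI) (metis linorder_neqE m order_less_irrefl)
  have surj: "\<exists>x\<in>{l..r}. f x = y" if "y \<in> {bl..br}" for y
    using IVT'[of f l y r] that e c assms(2) by auto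
  have le: "x \<in> {l..r} \<Longrightarrow> bl \<le> f x \<and> f x \<le> br" for x
    using m[of l x] m[of x r] e assms(2) by (cases "x = l"; cases "x = r") auto
  show "bij_betw f {l..r} {bl..br}" using inj surj le by (force simp: bij_betw_def)
  have lt: "x \<in> {l<..<r} \<Longrightarrow> bl < f x \<and> f x < br" for x
    using m[of l x] m[of x r] e by auto
  have "\<exists>x\<in>{l<..<r}. f x = y" if y: "y \<in> {bl<..<br}" for y
  proof -
    obtain x where x: "x \<in> {l..r}" "f x = y" using surj[of y] y by auto
    then show ?thesis using y e by (intro bexI[of _ x]) (cases "x = l"; cases "x = r"; auto)+
  qed
  then show "bij_betw f {l<..<r} {bl<..<br}"
    using inj_on_subset[OF inj, of "{l<..<r}"] lt by (force simp: bij_betw_def)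
qed

lemma is_branch_cong:
  "is_branch f l r bl br \<Longrightarrow> (\<And>x. x \<in> {l..r} \<Longrightarrow> f x = g x) \<Longrightarrow> l < r \<Longrightarrow> is_branch g l r bl br"
  using continuous_on_eq[of "{l..r}" f g] unfolding is_branch_def
  by (auto simp: strict_mono_on_def)

text \<open>At regularity 0 the condition on the inverse is continuity, automatic on a compact
  interval. The renormalized maps are treated in this class only; smoothness enters through the
  words.\<close>

lemma is_giet_0I:
  assumes "two_partitions T"
    and "\<And>a. is_branch (F a) (top_left T a) (top_right T a) (bot_left T a) (bot_right T a)"
    and "\<And>a x. x \<in> top_int T a \<Longrightarrow> gmap T x = F a x"
  shows "is_giet 0 T"
  unfolding is_giet_def
proof (intro conjI allI)
  fix a
  note l = left_less_right[OF assms(1), of a]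
  note b = is_branch_image[OF assms(2) l(1)]
  have ti: "top_int T a = {top_left T a<..<top_right T a}" "bot_int T a = {bot_left T a<..<bot_right T a}"
    by (simp_all add: top_int_def bot_int_def top_right_def bot_right_def)
  show "bij_betw (gmap T) (top_int T a) (bot_int T a)"
    using b(2) assms(3)[of _ a] unfolding ti by (subst bij_betw_cong[of _ _ "F a"]) auto
  have c: "continuous_on {top_left T a..top_right T a} (F a)"
    and m: "strict_mono_on {top_left T a..top_right T a} (F a)"
    using assms(2)[of a] by (auto simp: is_branch_def)
  have "continuous_on (F a ` {top_left T a..top_right T a}) (inv_into {top_left T a..top_right T a} (F a))"
    using b(1) by (intro continuous_on_inv c) (auto simp: bij_betw_def inv_into_f_f)
  then have "continuous_on {bot_left T a..bot_right T a} (inv_into {top_left T a..top_right T a} (F a))"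
    using b(1) by (simp add: bij_betw_def)
  then have "Cr_diffeo_pos 0 (F a) (closure (top_int T a)) (closure (bot_int T a))"
    using b(1) m c unfolding closure_ints[OF assms(1)] Cr_diffeo_pos_def Cr_on_def by auto
  then show "\<exists>f. (\<forall>x\<in>top_int T a. f x = gmap T x) \<and>
      Cr_diffeo_pos 0 f (closure (top_int T a)) (closure (bot_int T a))"
    using assms(3)[of _ a] by auto
qed (fact assms)

lemma bij_mono_endpoints:
  fixes f :: "real \<Rightarrow> real"
  assumes "bij_betw f {l..r} {p..q}" "strict_mono_on {l..r} f" "l < r"
  shows "f l = p" "f r = q"
proof -
  have m: "\<And>x y. x \<in> {l..r} \<Longrightarrow> y \<in> {l..r} \<Longrightarrow> x < y \<Longrightarrow> f x < f y"
    using assms by (auto simp: strict_mono_on_def)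
  have im: "f ` {l..r} = {p..q}" using assms by (simp add: bij_betw_def)
  have in1: "f l \<in> {p..q}" "f r \<in> {p..q}" unfolding im[symmetric] using assms(3) by auto
  then have "p \<in> f ` {l..r}" "q \<in> f ` {l..r}" unfolding im by auto
  then obtain x y where x: "x \<in> {l..r}" "f x = p" and y: "y \<in> {l..r}" "f y = q" by auto
  show "f l = p" using m[of l x] x in1 by (cases "x = l") auto
  show "f r = q" using m[of y r] y in1 by (cases "y = r") auto
qed

lemma Cr_on_mono: "Cr_on r f A \<Longrightarrow> s \<le> r \<Longrightarrow> Cr_on s f A"
proof -
  assume "Cr_on r f A" "s \<le> r"
  then obtain F where F: "\<forall>x\<in>A. F 0 x = f x"
    "\<forall>i<r. \<forall>x\<in>A. (F i has_real_derivative F (Suc i) x) (at x within A)" "continuous_on A (F r)"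
    by (auto simp: Cr_on_def)
  have "continuous_on A (F s)"
  proof (cases "s = r")
    case False
    then show ?thesis
      using F \<open>s \<le> r\<close> by (intro DERIV_continuous_on[of _ _ "F (Suc s)"]) auto
  qed (use F in auto)
  then show "Cr_on s f A" unfolding Cr_on_def using F \<open>s \<le> r\<close> by (intro exI[of _ F]) auto
qed

lemma is_giet_mono: "is_giet r T \<Longrightarrow> s \<le> r \<Longrightarrow> is_giet s T"
  unfolding is_giet_def Cr_diffeo_pos_def using Cr_on_mono by (metis (no_types, lifting))

lemma is_giet_branch:
  assumes "is_giet r T"
  shows "is_branch (branch T a) (top_left T a) (top_right T a) (bot_left T a) (bot_right T a)"
    and "x \<in> top_int T a \<Longrightarrow> branch T a x = gmap T x"
proof -
  have tp: "two_partitions T" using assms by (simp add: is_giet_def)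
  obtain f where f: "\<forall>x\<in>top_int T a. f x = gmap T x"
    "Cr_diffeo_pos 0 f {top_left T a..top_right T a} {bot_left T a..bot_right T a}"
    using is_giet_mono[OF assms le0] closure_ints[OF tp] unfolding is_giet_def by metis
  then have b: "bij_betw f {top_left T a..top_right T a} {bot_left T a..bot_right T a}"
    and m: "strict_mono_on {top_left T a..top_right T a} f"
    unfolding Cr_diffeo_pos_def by auto
  obtain F where "\<forall>x\<in>{top_left T a..top_right T a}. F (0::nat) x = f x"
    "continuous_on {top_left T a..top_right T a} (F 0)"
    using f(2) unfolding Cr_diffeo_pos_def Cr_on_def by blast
  then have c: "continuous_on {top_left T a..top_right T a} f"
    using continuous_on_eq by blast
  note l = left_less_right[OF tp, of a]
  have e: "f (top_left T a) = bot_left T a" "f (top_right T a) = bot_right T a"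
    using bij_mono_endpoints[OF b m l(1)] by auto
  have eq: "f x = branch T a x" if "x \<in> {top_left T a..top_right T a}" for x
    using that e f(1) by (auto simp: branch_def top_right_def[symmetric] bot_right_def[symmetric] top_int_def)
  show "is_branch (branch T a) (top_left T a) (top_right T a) (bot_left T a) (bot_right T a)"
    by (rule is_branch_cong[of f]) (use b m c e eq l in \<open>auto simp: is_branch_def\<close>)
  show "branch T a x = gmap T x" if "x \<in> top_int T a"
    using that by (auto simp: branch_def top_int_def)
qed

text \<open>Allows inclusions of intervals to be tested off the finitely many points where a GIET is
  arbitrary.\<close>

lemma open_minus_finite_sub:
  fixes u v :: real
  assumes "{u<..<v} - X \<subseteq> {p..q}" "finite X" "u < v"
  shows "p \<le> u" "v \<le> q"
proof -
  show "p \<le> u"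
  proof (rule ccontr)
    assume "\<not> p \<le> u"
    then have "{u<..<min p v} \<subseteq> X" using assms by auto
    then show False using finite_subset[OF _ assms(2)] assms(3) infinite_Ioo[of u "min p v"] \<open>\<not> p \<le> u\<close>
      by (metis min_less_iff_conj not_le)
  qed
  show "v \<le> q"
  proof (rule ccontr)
    assume "\<not> v \<le> q"
    then have "{max q u<..<v} \<subseteq> X" using assms by auto
    then show False using finite_subset[OF _ assms(2)] assms(3) infinite_Ioo[of "max q u" v] \<open>\<not> v \<le> q\<close>
      by (metis max_less_iff_conj not_le)
  qed
qed

lemma return_time_1: "f x \<in> A \<Longrightarrow> return_time f A x = 1 \<and> return_map f A x = f x"
proof -
  assume "f x \<in> A"
  then have "return_time f A x = 1"
    unfolding return_time_def by (intro Least_equality) auto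
  then show ?thesis by (simp add: return_map_def)
qed

lemma return_time_2: "f x \<notin> A \<Longrightarrow> f (f x) \<in> A \<Longrightarrow> return_time f A x = 2 \<and> return_map f A x = f (f x)"
proof -
  assume a: "f x \<notin> A" "f (f x) \<in> A"
  have "return_time f A x = 2"
    unfolding return_time_def
  proof (rule Least_equality)
    show "(0::nat) < 2 \<and> (f ^^ 2) x \<in> A" using a by (simp add: numeral_2_eq_2)
    fix k assume "0 < k \<and> (f ^^ k) x \<in> A"
    then show "2 \<le> k" using a by (cases "k = 1") auto
  qed
  then show ?thesis by (simp add: return_map_def numeral_2_eq_2)
qed

definition move_after :: "'a \<Rightarrow> 'a \<Rightarrow> 'a list \<Rightarrow> 'a list" where
  "move_after x y xs = concat (map (\<lambda>z. if z = x then [x, y] else if z = y then [] else [z]) xs)"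

lemma move_after_split:
  assumes "distinct (us @ x # vs @ [y])"
  shows "move_after x y (us @ x # vs @ [y]) = us @ x # y # vs"
proof -
  have id: "concat (map (\<lambda>z. if z = x then [x, y] else if z = y then [] else [z]) zs) = zs"
    if "x \<notin> set zs" "y \<notin> set zs" for zs using that by (induction zs) auto
  show ?thesis unfolding move_after_def using assms id[of us] id[of vs] by auto
qed

lemma split_at_last:
  assumes "x \<in> set ys" "x \<noteq> last ys"
  obtains us vs where "ys = us @ x # vs @ [last ys]"
proof -
  have ne: "ys \<noteq> []" using assms by auto
  then have "x \<in> set (butlast ys)" using assms
    by (metis append_butlast_last_id rotate1.simps(2) set_ConsD set_rotate1)
  then obtain us vs where "butlast ys = us @ x # vs" by (meson split_list)
  then have "ys = us @ x # vs @ [last ys]" using ne by (metis append.assoc append_Cons append_butlast_last_id)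
  then show thesis by (rule that)
qed

text \<open>Meaningful when the bottom wins: the point at which the top interval over the last
  bottom label is cut.\<close>

definition cut_point :: "'n::finite giet \<Rightarrow> real" where
  "cut_point T = (let b = last (bot_row T) in
     inv_into {top_left T b..top_right T b} (branch T b) (rv_length T))"

text \<open>\<open>rv\<close> is a choice from a specification. This explicit candidate satisfies it
  and is its only solution, up to the values of the map off the open top intervals.\<close>

definition rv_model :: "'n::finite giet \<Rightarrow> 'n giet" where
  "rv_model T = (let \<alpha> = last (top_row T); \<beta> = last (bot_row T); L = rv_length T; z = cut_point T in
     if top_wins T then
       \<lparr>top_row = top_row T, bot_row = move_after \<alpha> \<beta> (bot_row T),
        top_len = (\<chi> a. (if a = \<alpha> then top_len T $ \<alpha> - bot_len T $ \<beta> else top_len T $ a) / L),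
        bot_len = (\<chi> a. (if a = \<alpha> then branch T \<alpha> L - bot_left T \<alpha>
          else if a = \<beta> then bot_right T \<alpha> - branch T \<alpha> L else bot_len T $ a) / L),
        gmap = (\<lambda>y. return_map (gmap T) {0..L} (L * y) / L)\<rparr>
     else
       \<lparr>top_row = move_after \<beta> \<alpha> (top_row T), bot_row = bot_row T,
        top_len = (\<chi> a. (if a = \<beta> then z - top_left T \<beta>
          else if a = \<alpha> then top_right T \<beta> - z else top_len T $ a) / L),
        bot_len = (\<chi> a. (if a = \<beta> then bot_len T $ \<beta> - top_len T $ \<alpha> else bot_len T $ a) / L),
        gmap = (\<lambda>y. return_map (gmap T) {0..L} (L * y) / L)\<rparr>)"

section \<open>A single Rauzy-Veech step: cut, return times and new branches\<close>

locale rv_pre =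
  fixes T :: "'n::finite giet" and \<alpha> \<beta> :: 'n and L z :: real
  assumes giet: "is_giet 0 T" and ab: "last (top_row T) \<noteq> last (bot_row T)" and def: "rv_defined T"
  defines "\<alpha> \<equiv> last (top_row T)" and "\<beta> \<equiv> last (bot_row T)" and "L \<equiv> rv_length T" and "z \<equiv> cut_point T"
begin

lemma tp: "two_partitions T"
  using giet by (simp add: is_giet_def)

lemma pos: "0 < top_len T $ a" "0 < bot_len T $ a"
  and sums: "(\<Sum>a\<in>UNIV. top_len T $ a) = 1" "(\<Sum>a\<in>UNIV. bot_len T $ a) = 1"
  and rows: "distinct (top_row T)" "set (top_row T) = UNIV" "distinct (bot_row T)" "set (bot_row T) = UNIV"
  using tp by (auto simp: two_partitions_def)

lemma neq: "\<alpha> \<noteq> \<beta>" "\<beta> \<noteq> \<alpha>"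
  using ab by (auto simp: \<alpha>_def \<beta>_def)

lemma wsize1: "wsize (top_len T) (top_row T) = 1" "wsize (bot_len T) (bot_row T) = 1"
  using wsize_UNIV[OF rows(1,2)] wsize_UNIV[OF rows(3,4)] sums by simp_all

lemma bounds: "0 \<le> top_left T a" "top_right T a \<le> 1" "0 \<le> bot_left T a" "bot_right T a \<le> 1"
  using left_end_nonneg[of "top_len T" "top_row T" a] left_end_nonneg[of "bot_len T" "bot_row T" a]
    right_end_le[of "top_len T" a "top_row T"] right_end_le[of "bot_len T" a "bot_row T"] pos rows wsize1
  by (auto simp: top_left_def bot_left_def top_right_def bot_right_def)

lemma lr: "top_left T a < top_right T a" "bot_left T a < bot_right T a"
  using left_less_right[OF tp] by auto

lemma last_right:
  shows "top_right T \<alpha> = 1" "bot_right T \<beta> = 1"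
proof -
  have *: "left_end xs len (last xs) + len $ last xs = wsize len xs" if "xs \<noteq> []" "distinct xs" for xs len
  proof -
    have "xs = butlast xs @ last xs # []" "last xs \<notin> set (butlast xs)"
      using that by (simp, metis append_butlast_last_id distinct_append disjoint_insert(1) list.simps(15))
    then have "left_end xs len (last xs) = wsize len (butlast xs)" by (metis left_end_split)
    moreover have "wsize len xs = wsize len (butlast xs) + len $ last xs"
      using that by (subst append_butlast_last_id[symmetric], simp, simp only: map_append sum_list.append) simp
    ultimately show ?thesis by simp
  qed
  have ne: "top_row T \<noteq> []" "bot_row T \<noteq> []" using rows by (metis UNIV_not_empty empty_set)+
  show "top_right T \<alpha> = 1" "bot_right T \<beta> = 1"
    using ne *[of "top_row T" "top_len T"] *[of "bot_row T" "bot_len T"] rows wsize1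
    by (auto simp: top_right_def bot_right_def top_left_def bot_left_def \<alpha>_def \<beta>_def)
qed

lemma left_eq: "top_left T \<alpha> = 1 - top_len T $ \<alpha>" "bot_left T \<beta> = 1 - bot_len T $ \<beta>"
  using last_right by (auto simp: top_right_def bot_right_def)

lemma other_le:
  shows "a \<noteq> \<alpha> \<Longrightarrow> top_right T a \<le> top_left T \<alpha>" "a \<noteq> \<beta> \<Longrightarrow> bot_right T a \<le> bot_left T \<beta>"
proof -
  show "a \<noteq> \<alpha> \<Longrightarrow> top_right T a \<le> top_left T \<alpha>"
  proof -
    assume "a \<noteq> \<alpha>"
    then have "top_right T a \<le> top_left T \<alpha> \<or> top_right T \<alpha> \<le> top_left T a"
      using cells_disjoint[of "top_len T" a "top_row T" \<alpha>] pos rows by (simp add: top_right_def top_left_def)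
    then show ?thesis using last_right bounds(2)[of a] lr(1)[of a] by auto
  qed
  show "a \<noteq> \<beta> \<Longrightarrow> bot_right T a \<le> bot_left T \<beta>"
  proof -
    assume "a \<noteq> \<beta>"
    then have "bot_right T a \<le> bot_left T \<beta> \<or> bot_right T \<beta> \<le> bot_left T a"
      using cells_disjoint[of "bot_len T" a "bot_row T" \<beta>] pos rows by (simp add: bot_right_def bot_left_def)
    then show ?thesis using last_right bounds(4)[of a] lr(2)[of a] by auto
  qed
qed

lemma L_cases:
  shows "top_wins T \<Longrightarrow> L = bot_left T \<beta>" "\<not> top_wins T \<Longrightarrow> L = top_left T \<alpha>"
    "top_wins T \<Longrightarrow> top_left T \<alpha> < L" "\<not> top_wins T \<Longrightarrow> bot_left T \<beta> < L" "0 < L" "L < 1"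
proof -
  show 1: "top_wins T \<Longrightarrow> L = bot_left T \<beta>" "\<not> top_wins T \<Longrightarrow> L = top_left T \<alpha>"
    "top_wins T \<Longrightarrow> top_left T \<alpha> < L" "\<not> top_wins T \<Longrightarrow> bot_left T \<beta> < L"
    using def left_eq by (auto simp: L_def rv_length_def rv_defined_def top_wins_def \<alpha>_def \<beta>_def)
  show "0 < L" using 1 bounds(1)[of \<alpha>] bounds(3)[of \<beta>] by (cases "top_wins T") auto
  show "L < 1" using pos by (auto simp: L_def rv_length_def min_def)
qed

lemma branch: "is_branch (branch T a) (top_left T a) (top_right T a) (bot_left T a) (bot_right T a)"
  and branch_gmap: "x \<in> top_int T a \<Longrightarrow> branch T a x = gmap T x"
  using is_giet_branch[OF giet] by auto

lemma branch_ends: "branch T a (top_left T a) = bot_left T a" "branch T a (top_right T a) = bot_right T a"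
  using branch[of a] by (auto simp: is_branch_def)

lemma branch_less: "x \<in> {top_left T a..top_right T a} \<Longrightarrow> y \<in> {top_left T a..top_right T a} \<Longrightarrow>
    x < y \<Longrightarrow> branch T a x < branch T a y"
  using branch[of a] by (auto simp: is_branch_def strict_mono_on_def)

lemma branch_le: "x \<in> {top_left T a..top_right T a} \<Longrightarrow> y \<in> {top_left T a..top_right T a} \<Longrightarrow>
    x \<le> y \<Longrightarrow> branch T a x \<le> branch T a y"
  using branch_less[of x a y] by (cases "x = y") auto

lemma top_int: "top_int T a = {top_left T a<..<top_right T a}"
  by (simp add: top_int_def top_right_def)

lemma gmap_bounds:
  assumes "x \<in> top_int T a"
  shows "bot_left T a < gmap T x" "gmap T x < bot_right T a"
  using branch_less[of "top_left T a" a x] branch_less[of x a "top_right T a"] branch_ends[of a]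
    assms lr(1)[of a] branch_gmap[OF assms] by (auto simp: top_int)

lemma cut:
  assumes "\<not> top_wins T"
  shows "top_left T \<beta> < z" "z < top_right T \<beta>" "branch T \<beta> z = L"
proof -
  have "L \<in> {bot_left T \<beta>..bot_right T \<beta>}" using L_cases assms last_right by auto
  then have "L \<in> branch T \<beta> ` {top_left T \<beta>..top_right T \<beta>}"
    using is_branch_image(1)[OF branch lr(1)] by (auto simp: bij_betw_def)
  then have z: "z \<in> {top_left T \<beta>..top_right T \<beta>}" "branch T \<beta> z = L"
    unfolding z_def cut_point_def Let_def L_def[symmetric] \<beta>_def[symmetric]
    by (auto intro: inv_into_into f_inv_into_f simp del: atLeastAtMost_iff)
  then show "branch T \<beta> z = L" by simp
  have "z \<noteq> top_left T \<beta>" "z \<noteq> top_right T \<beta>"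
    using z(2) branch_ends[of \<beta>] L_cases(4)[OF assms] last_right(2) L_cases(6) by auto
  then show "top_left T \<beta> < z" "z < top_right T \<beta>" using z(1) by auto
qed

abbreviation rt :: "real \<Rightarrow> nat" where "rt x \<equiv> return_time (gmap T) {0..L} x"
abbreviation rm :: "real \<Rightarrow> real" where "rm x \<equiv> return_map (gmap T) {0..L} x"

lemma return_once:
  assumes "x \<in> top_int T a" "gmap T x \<le> L"
  shows "rt x = 1" "rm x = branch T a x"
  using return_time_1[of "gmap T" x "{0..L}"] assms gmap_bounds[OF assms(1)] bounds(3)[of a]
    branch_gmap[OF assms(1)] by auto

lemma return_twice:
  assumes "x \<in> top_int T \<beta>" "L < gmap T x" "gmap T x \<in> top_int T \<alpha>"
  shows "rt x = 2" "rm x = branch T \<alpha> (branch T \<beta> x)"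
proof -
  have le: "gmap T (gmap T x) \<le> L"
  proof (cases "top_wins T")
    case True
    then show ?thesis using gmap_bounds[OF assms(3)] other_le(2)[of \<alpha>] L_cases(1) neq by auto
  next
    case False
    then show ?thesis using gmap_bounds[OF assms(3)] other_le(2)[of \<alpha>] L_cases(4) neq by auto
  qed
  moreover have "0 \<le> gmap T (gmap T x)" using gmap_bounds[OF assms(3)] bounds(3)[of \<alpha>] by auto
  ultimately show "rt x = 2" "rm x = branch T \<alpha> (branch T \<beta> x)"
    using return_time_2[of "gmap T" x "{0..L}"] assms(2) branch_gmap[OF assms(1)] branch_gmap[OF assms(3)]
    by auto
qed

lemma return_other:
  assumes "x \<in> top_int T a" "a \<noteq> \<beta>"
  shows "rt x = 1" "rm x = branch T a x"
proof -
  have "gmap T x \<le> L"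
    using gmap_bounds[OF assms(1)] other_le(2)[OF assms(2)] L_cases(1,4) by (cases "top_wins T") auto
  then show "rt x = 1" "rm x = branch T a x" using return_once[OF assms(1)] by auto
qed

lemma return_beta_top:
  assumes "top_wins T" "x \<in> top_int T \<beta>"
  shows "rt x = 2" "rm x = branch T \<alpha> (branch T \<beta> x)"
proof -
  have "L < gmap T x" "gmap T x < 1" using gmap_bounds[OF assms(2)] L_cases(1)[OF assms(1)] last_right by auto
  moreover then have "gmap T x \<in> top_int T \<alpha>" using L_cases(3)[OF assms(1)] last_right by (auto simp: top_int)
  ultimately show "rt x = 2" "rm x = branch T \<alpha> (branch T \<beta> x)" using return_twice assms(2) by auto
qed

lemma return_beta_bot:
  assumes "\<not> top_wins T" "x \<in> top_int T \<beta>"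
  shows "x \<le> z \<Longrightarrow> rt x = 1" "x \<le> z \<Longrightarrow> rm x = branch T \<beta> x"
    "z < x \<Longrightarrow> rt x = 2" "z < x \<Longrightarrow> rm x = branch T \<alpha> (branch T \<beta> x)"
proof -
  note c = cut[OF assms(1)]
  have x: "x \<in> {top_left T \<beta>..top_right T \<beta>}" using assms(2) by (auto simp: top_int)
  show "rt x = 1" "rm x = branch T \<beta> x" if "x \<le> z"
  proof -
    have "gmap T x \<le> L" using branch_le[OF x, of z] c that branch_gmap[OF assms(2)] by auto
    then show "rt x = 1" "rm x = branch T \<beta> x" using return_once[OF assms(2)] by auto
  qed
  show "rt x = 2" "rm x = branch T \<alpha> (branch T \<beta> x)" if "z < x"
  proof -
    have "L < gmap T x" using branch_less[of z \<beta> x] x c that branch_gmap[OF assms(2)] by auto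
    moreover have "gmap T x < 1" using gmap_bounds[OF assms(2)] last_right by auto
    ultimately have "gmap T x \<in> top_int T \<alpha>" using L_cases(2)[OF assms(1)] last_right by (auto simp: top_int)
    then show "rt x = 2" "rm x = branch T \<alpha> (branch T \<beta> x)"
      using return_twice assms(2) \<open>L < gmap T x\<close> by auto
  qed
qed

text \<open>\<open>nl\<close> and \<open>nr\<close> are the ends of the new interval before
  rescaling, \<open>nbl\<close> and \<open>nbr\<close> those of its image, and \<open>nF\<close> is
  the new branch.\<close>

definition nl :: "'n \<Rightarrow> real" where
  "nl a = (if \<not> top_wins T \<and> a = \<alpha> then z else top_left T a)"
definition nr :: "'n \<Rightarrow> real" where
  "nr a = (if top_wins T then (if a = \<alpha> then L else top_right T a)
     else if a = \<beta> then z else if a = \<alpha> then top_right T \<beta> else top_right T a)"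
definition nbl :: "'n \<Rightarrow> real" where
  "nbl a = (if top_wins T \<and> a = \<beta> then branch T \<alpha> L else bot_left T a)"
definition nbr :: "'n \<Rightarrow> real" where
  "nbr a = (if top_wins T then (if a = \<alpha> then branch T \<alpha> L else if a = \<beta> then bot_right T \<alpha> else bot_right T a)
     else if a = \<beta> then L else bot_right T a)"
definition nF :: "'n \<Rightarrow> real \<Rightarrow> real" where
  "nF a = (if a = (if top_wins T then \<beta> else \<alpha>) then (\<lambda>x. branch T \<alpha> (branch T \<beta> x)) else branch T a)"

lemma L_in: "top_wins T \<Longrightarrow> top_left T \<alpha> < L \<and> L < top_right T \<alpha>"
  using L_cases last_right by auto

lemma branch_comp:
  assumes "top_left T \<beta> \<le> u" "u < v" "v \<le> top_right T \<beta>" "top_left T \<alpha> \<le> branch T \<beta> u"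
    "branch T \<beta> v \<le> top_right T \<alpha>"
  shows "is_branch (\<lambda>x. branch T \<alpha> (branch T \<beta> x)) u v (branch T \<alpha> (branch T \<beta> u)) (branch T \<alpha> (branch T \<beta> v))"
proof -
  have im: "branch T \<beta> x \<in> {top_left T \<alpha>..top_right T \<alpha>}" if "x \<in> {u..v}" for x
    using branch_le[of u \<beta> x] branch_le[of x \<beta> v] that assms by auto
  have "continuous_on {u..v} (\<lambda>x. branch T \<alpha> (branch T \<beta> x))"
  proof (rule continuous_on_compose2[of "{top_left T \<alpha>..top_right T \<alpha>}" "branch T \<alpha>"])
    show "continuous_on {top_left T \<alpha>..top_right T \<alpha>} (branch T \<alpha>)"
      using branch[of \<alpha>] by (simp add: is_branch_def)
    show "continuous_on {u..v} (branch T \<beta>)"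
      using branch[of \<beta>] assms by (auto simp: is_branch_def intro: continuous_on_subset)
  qed (use im in auto)
  moreover have "strict_mono_on {u..v} (\<lambda>x. branch T \<alpha> (branch T \<beta> x))"
    unfolding strict_mono_on_def
  proof (intro allI impI)
    fix x y assume xy: "x \<in> {u..v} \<and> y \<in> {u..v} \<and> x < y"
    then have "branch T \<beta> x < branch T \<beta> y" using assms by (intro branch_less) auto
    then show "branch T \<alpha> (branch T \<beta> x) < branch T \<alpha> (branch T \<beta> y)"
      using im[of x] im[of y] xy by (intro branch_less[of _ \<alpha>]) auto
  qed
  ultimately show ?thesis by (simp add: is_branch_def)
qed

lemma branch_restrict:
  assumes "top_left T a \<le> u" "u < v" "v \<le> top_right T a"
  shows "is_branch (branch T a) u v (branch T a u) (branch T a v)"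
  using branch[of a] assms unfolding is_branch_def
  by (auto intro: continuous_on_subset monotone_on_subset)

lemma new_branch: "is_branch (nF a) (nl a) (nr a) (nbl a) (nbr a)" and new_less: "nl a < nr a"
proof -
  consider (t) "top_wins T" | (b) "\<not> top_wins T" by blast
  then have "is_branch (nF a) (nl a) (nr a) (nbl a) (nbr a) \<and> nl a < nr a"
  proof cases
    case t
    note L = L_in[OF t] L_cases(1)[OF t]
    consider "a = \<alpha>" | "a = \<beta>" | "a \<noteq> \<alpha>" "a \<noteq> \<beta>" by blast
    then show ?thesis
    proof cases
      case 1
      then show ?thesis
        using branch_restrict[of \<alpha> "top_left T \<alpha>" L] L t branch_ends neq
        by (auto simp: nF_def nl_def nr_def nbl_def nbr_def)
    next
      case 2
      then show ?thesis
        using branch_comp[of "top_left T \<beta>" "top_right T \<beta>"] L t branch_ends neq lr(1)[of \<beta>] last_right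
          branch_ends(2)[of \<alpha>]
        by (auto simp: nF_def nl_def nr_def nbl_def nbr_def)
    next
      case 3
      then show ?thesis using branch[of a] lr[of a] t by (auto simp: nF_def nl_def nr_def nbl_def nbr_def)
    qed
  next
    case b
    note c = cut[OF b] and L = L_cases(2)[OF b]
    consider "a = \<alpha>" | "a = \<beta>" | "a \<noteq> \<alpha>" "a \<noteq> \<beta>" by blast
    then show ?thesis
    proof cases
      case 1
      then show ?thesis
        using branch_comp[of z "top_right T \<beta>"] L c b branch_ends neq last_right branch_ends(2)[of \<alpha>]
          branch_ends(1)[of \<alpha>]
        by (auto simp: nF_def nl_def nr_def nbl_def nbr_def)
    next
      case 2
      then show ?thesis
        using branch_restrict[of \<beta> "top_left T \<beta>" z] L c b branch_ends neq
        by (auto simp: nF_def nl_def nr_def nbl_def nbr_def)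
    next
      case 3
      then show ?thesis using branch[of a] lr[of a] b by (auto simp: nF_def nl_def nr_def nbl_def nbr_def)
    qed
  qed
  then show "is_branch (nF a) (nl a) (nr a) (nbl a) (nbr a)" "nl a < nr a" by auto
qed

lemma new_return:
  assumes "x \<in> {nl a<..<nr a}"
  shows "rm x = nF a x"
    "if rt x = 2 then a = loser T else x \<in> top_int T a"
proof -
  have "rm x = nF a x \<and> (if rt x = 2 then a = loser T else x \<in> top_int T a)"
  proof (cases "top_wins T")
    case t: True
    have x: "x \<in> top_int T a" using assms L_in[OF t] t by (auto simp: nl_def nr_def top_int split: if_splits)
    then show ?thesis
      using return_other[OF x] return_beta_top[OF t, of x] t neq
      by (cases "a = \<beta>") (auto simp: nF_def loser_def \<beta>_def[symmetric])
  next
    case b: False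
    note c = cut[OF b]
    show ?thesis
    proof (cases "a = \<alpha>")
      case True
      then have "x \<in> top_int T \<beta>" "z < x" using assms c b neq by (auto simp: nl_def nr_def top_int)
      then show ?thesis using return_beta_bot[OF b, of x] True b
        by (auto simp: nF_def loser_def \<alpha>_def[symmetric])
    next
      case False
      then have x: "x \<in> top_int T a" using assms c b by (auto simp: nl_def nr_def top_int split: if_splits)
      show ?thesis
      proof (cases "a = \<beta>")
        case True
        then have "x \<le> z" using assms b by (auto simp: nr_def)
        then show ?thesis using return_beta_bot[OF b, of x] x True False b by (auto simp: nF_def)
      next
        case False
        then show ?thesis using return_other[OF x] \<open>a \<noteq> \<alpha>\<close> b x by (auto simp: nF_def)
      qed
    qed
  qed
  then show "rm x = nF a x" "if rt x = 2 then a = loser T else x \<in> top_int T a" by auto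
qed

text \<open>Conversely the label condition of \<open>is_rv_step\<close> confines each new interval, up to the
  finitely many points where \<open>T\<close> is arbitrary.\<close>

lemma label_confines:
  assumes "0 < x" "x < L" "if rt x = 2 then a = loser T else x \<in> top_int T a"
    and nt: "x \<notin> top_left T ` UNIV \<union> top_right T ` UNIV"
  shows "x \<in> {nl a..nr a}"
proof -
  have "x < wsize (top_len T) (top_row T)" using assms(2) L_cases(6) wsize1 by auto
  then obtain b where "top_left T b \<le> x" "x < top_right T b"
    using left_end_cover[OF rows(1), of x "top_len T"] assms(1) by (auto simp: top_left_def top_right_def)
  then have b: "x \<in> top_int T b" using nt by (cases "x = top_left T b") (auto simp: top_int)
  have disj: "b = c" if "x \<in> top_int T c" for c
    using cells_disjoint[of "top_len T" b "top_row T" c] pos rows that b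
    by (auto simp: top_int top_left_def top_right_def)
  show ?thesis
  proof (cases "top_wins T")
    case t: True
    have ab: "a = b"
    proof (cases "b = \<beta>")
      case True
      then show ?thesis using return_beta_top[OF t] b assms(3) t by (auto simp: loser_def \<beta>_def)
    next
      case False
      then show ?thesis using return_other(1)[OF b] assms(3) disj by auto
    qed
    then show ?thesis using b assms(2) t by (auto simp: nl_def nr_def top_int)
  next
    case bo: False
    note c = cut[OF bo] and L = L_cases(2)[OF bo]
    have ba: "b \<noteq> \<alpha>" using b assms(2) L by (auto simp: top_int)
    show ?thesis
    proof (cases "b = \<beta>")
      case True
      show ?thesis
      proof (cases "x \<le> z")
        case le: True
        then have "a = \<beta>" using return_beta_bot(1)[OF bo, of x] b True assms(3) disj by auto
        then show ?thesis using le b True bo neq by (auto simp: nl_def nr_def top_int)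
      next
        case False
        then have "a = \<alpha>" using return_beta_bot(3)[OF bo, of x] b True assms(3) bo
          by (auto simp: loser_def \<alpha>_def)
        then show ?thesis using False b True bo neq by (auto simp: nl_def nr_def top_int)
      qed
    next
      case False
      then have "a = b" using return_other(1)[OF b] assms(3) disj by auto
      then show ?thesis using b bo ba False by (auto simp: nl_def nr_def top_int)
    qed
  qed
qed

abbreviation S where "S \<equiv> rv_model T"

lemma S_rows:
  "top_wins T \<Longrightarrow> top_row S = top_row T" "top_wins T \<Longrightarrow> bot_row S = move_after \<alpha> \<beta> (bot_row T)"
  "\<not> top_wins T \<Longrightarrow> top_row S = move_after \<beta> \<alpha> (top_row T)" "\<not> top_wins T \<Longrightarrow> bot_row S = bot_row T"
  by (simp_all add: rv_model_def Let_def \<alpha>_def \<beta>_def)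

lemma S_gmap: "gmap S y = rm (L * y) / L"
  by (simp add: rv_model_def Let_def L_def)

lemma S_lens: "L * top_len S $ a = nr a - nl a" "L * bot_len S $ a = nbr a - nbl a"
proof -
  have "top_wins T \<Longrightarrow> L - top_left T \<alpha> = top_len T $ \<alpha> - bot_len T $ \<beta>"
    "\<not> top_wins T \<Longrightarrow> L - bot_left T \<beta> = bot_len T $ \<beta> - top_len T $ \<alpha>"
    using L_cases(1,2) left_eq by auto
  then show "L * top_len S $ a = nr a - nl a" "L * bot_len S $ a = nbr a - nbl a"
    using L_cases(5) neq
    by (auto simp: rv_model_def Let_def L_def[symmetric] z_def[symmetric] \<alpha>_def[symmetric] \<beta>_def[symmetric]
        nl_def nr_def nbl_def nbr_def top_right_def bot_right_def)
qed

lemma nb_less: "nbl a < nbr a"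
proof -
  have "nF a (nl a) < nF a (nr a)"
    by (rule strict_mono_onD[of "{nl a..nr a}"])
      (use new_branch[of a] new_less[of a] in \<open>auto simp: is_branch_def\<close>)
  then show ?thesis using new_branch[of a] by (simp add: is_branch_def)
qed

lemma S_pos: "0 < top_len S $ a" "0 < bot_len S $ a"
proof -
  have "0 < L * top_len S $ a" "0 < L * bot_len S $ a"
    using S_lens[of a] new_less[of a] nb_less[of a] by simp_all
  then show "0 < top_len S $ a" "0 < bot_len S $ a"
    using L_cases(5) zero_less_mult_pos by blast+
qed

end

lemma wsize_scale: "(\<And>b. b \<in> set us \<Longrightarrow> L * len' $ b = len $ b) \<Longrightarrow> L * wsize len' us = wsize len us"
  by (induction us) (auto simp: distrib_left)

lemma left_end_last_changed:
  fixes L :: real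
  assumes "distinct xs" "set xs = UNIV" "\<And>b. b \<noteq> last xs \<Longrightarrow> L * len' $ b = len $ b"
  shows "L * left_end xs len' a = left_end xs len a"
proof -
  obtain us vs where x: "xs = us @ a # vs" using assms(2) by (metis UNIV_I split_list)
  then have a: "a \<notin> set us" using assms(1) by auto
  have "last xs \<in> set (a # vs)" using x by (simp add: last_in_set)
  then have "last xs \<notin> set us" using assms(1) x by auto
  then have "L * wsize len' us = wsize len us" using assms(3) by (intro wsize_scale) metis
  then show ?thesis using left_end_split[OF a, of vs] x by simp
qed

text \<open>The free factor \<open>L\<close> lets the lemma serve twice: for the rescaled lengths of
  a step and, with \<open>L = 1\<close>, for the transposed incidence matrix in
  \<open>om_step\<close>.\<close>

lemma left_end_move_after:
  fixes L :: real
  assumes d: "distinct (us @ x # vs @ [y])" and a: "a \<in> set (us @ x # vs @ [y])"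
    and len: "\<And>b. b \<noteq> x \<Longrightarrow> b \<noteq> y \<Longrightarrow> L * len' $ b = len $ b" "L * (len' $ x + len' $ y) = len $ x"
  shows "L * left_end (us @ x # y # vs) len' a =
    (if a = y then left_end (us @ x # vs @ [y]) len x + L * len' $ x else left_end (us @ x # vs @ [y]) len a)"
proof -
  have U: "L * wsize len' u = wsize len u" if "x \<notin> set u" "y \<notin> set u" for u
    using len(1) that by (intro wsize_scale) metis
  have us: "x \<notin> set us" "y \<notin> set us" and vs: "x \<notin> set vs" "y \<notin> set vs" and xy: "x \<noteq> y" using d by auto
  consider "a = y" | "a = x" | "a \<in> set us" | "a \<in> set vs" using a by auto
  then show ?thesis
  proof cases
    case 1
    then show ?thesis
      using left_end_split[of y "us @ [x]" vs len'] left_end_split[of x us "vs @ [y]" len] U[OF us] us xy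
      by (simp add: distrib_left)
  next
    case 2
    then show ?thesis
      using left_end_split[of x us "y # vs" len'] left_end_split[of x us "vs @ [y]" len] U[OF us] us xy
      by simp
  next
    case 3
    then obtain u1 u2 where u: "us = u1 @ a # u2" by (meson split_list)
    then have "a \<notin> set u1" "a \<noteq> y" using d by auto
    then show ?thesis
      using left_end_split[of a u1 "u2 @ x # y # vs" len'] left_end_split[of a u1 "u2 @ x # vs @ [y]" len]
        U[of u1] us u by simp
  next
    case 4
    then obtain u1 u2 where u: "vs = u1 @ a # u2" by (meson split_list)
    then have "a \<notin> set (us @ x # y # u1)" "a \<noteq> y" "a \<notin> set (us @ x # u1)" using d by auto
    then show ?thesis
      using left_end_split[of a "us @ x # y # u1" u2 len'] left_end_split[of a "us @ x # u1" "u2 @ [y]" len]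
        U[of u1] U[OF us] vs u len(2) by (simp add: distrib_left)
  qed
qed

text \<open>A proper prefix of \<open>xs\<close> misses \<open>last xs\<close>. A prefix of the new
  row with the same labels must therefore end before \<open>last xs\<close>, where the old and the
  new row coincide.\<close>

lemma irreducible_move_after:
  fixes us vs xs :: "'n::finite list"
  assumes irr: "\<And>k. 1 \<le> k \<Longrightarrow> k < CARD('n) \<Longrightarrow> set (take k xs) \<noteq> set (take k (us @ last xs # vs @ [y]))"
    and d: "distinct xs" "set xs = UNIV" and k: "1 \<le> k" "k < CARD('n)"
  shows "set (take k xs) \<noteq> set (take k (us @ last xs # y # vs))"
proof
  assume e: "set (take k xs) = set (take k (us @ last xs # y # vs))"
  have lx: "length xs = CARD('n)" using distinct_card[OF d(1)] d(2) by simp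
  then have ne: "xs \<noteq> []" by auto
  have "last xs \<notin> set (take k xs)"
  proof
    assume "last xs \<in> set (take k xs)"
    then obtain i where "i < k" "i < length xs" "xs ! i = last xs" by (auto simp: in_set_conv_nth)
    then have "xs ! i = xs ! (length xs - 1)" using ne by (simp add: last_conv_nth)
    then have "i = length xs - 1" using d(1) \<open>i < length xs\<close> by (simp add: nth_eq_iff_index_eq)
    then show False using \<open>i < k\<close> k lx by simp
  qed
  then have "k \<le> length us" using e by (cases "k \<le> length us") (auto simp: take_Cons' not_le)
  then show False using irr[OF k] e by simp
qed

section \<open>The model satisfies the specification of a step\<close>

context rv_pre
begin

lemma ab_in: "\<beta> \<in> set (top_row T)" "\<alpha> \<in> set (bot_row T)" "\<beta> \<noteq> last (top_row T)" "\<alpha> \<noteq> last (bot_row T)"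
  using rows neq by (auto simp: \<alpha>_def \<beta>_def)

lemma bot_split: obtains us vs where "bot_row T = us @ \<alpha> # vs @ [\<beta>]"
  using split_at_last[OF ab_in(2,4)] by (auto simp: \<beta>_def)

lemma top_split: obtains us vs where "top_row T = us @ \<beta> # vs @ [\<alpha>]"
  using split_at_last[OF ab_in(1,3)] by (auto simp: \<alpha>_def)

lemma S_row_props: "distinct (top_row S)" "set (top_row S) = UNIV" "distinct (bot_row S)" "set (bot_row S) = UNIV"
proof -
  obtain us vs where b: "bot_row T = us @ \<alpha> # vs @ [\<beta>]" by (rule bot_split)
  obtain us' vs' where t: "top_row T = us' @ \<beta> # vs' @ [\<alpha>]" by (rule top_split)
  have B: "distinct (us @ \<alpha> # vs @ [\<beta>])" "set (us @ \<alpha> # vs @ [\<beta>]) = UNIV" using rows b by metis+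
  have T': "distinct (us' @ \<beta> # vs' @ [\<alpha>])" "set (us' @ \<beta> # vs' @ [\<alpha>]) = UNIV" using rows t by metis+
  have "distinct (top_row S) \<and> set (top_row S) = UNIV"
  proof (cases "top_wins T")
    case False
    then have "top_row S = us' @ \<beta> # \<alpha> # vs'" using S_rows(3) t move_after_split[OF T'(1)] by simp
    then show ?thesis using T' by auto
  qed (use S_rows(1) rows in simp)
  moreover have "distinct (bot_row S) \<and> set (bot_row S) = UNIV"
  proof (cases "top_wins T")
    case True
    then have "bot_row S = us @ \<alpha> # \<beta> # vs" using S_rows(2) b move_after_split[OF B(1)] by simp
    then show ?thesis using B by auto
  qed (use S_rows(4) rows in simp)
  ultimately show "distinct (top_row S)" "set (top_row S) = UNIV" "distinct (bot_row S)" "set (bot_row S) = UNIV"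
    by auto
qed

lemma S_left: "L * top_left S a = nl a" "L * bot_left S a = nbl a"
proof -
  obtain us vs where b: "bot_row T = us @ \<alpha> # vs @ [\<beta>]" by (rule bot_split)
  obtain us' vs' where t: "top_row T = us' @ \<beta> # vs' @ [\<alpha>]" by (rule top_split)
  have B: "distinct (us @ \<alpha> # vs @ [\<beta>])" "a \<in> set (us @ \<alpha> # vs @ [\<beta>])" using rows b by (metis UNIV_I)+
  have T': "distinct (us' @ \<beta> # vs' @ [\<alpha>])" "a \<in> set (us' @ \<beta> # vs' @ [\<alpha>])" using rows t by (metis UNIV_I)+
  have "L * top_left S a = nl a \<and> L * bot_left S a = nbl a"
  proof (cases "top_wins T")
    case tw: True
    have "bot_row S = us @ \<alpha> # \<beta> # vs" using tw S_rows(2) b move_after_split[OF B(1)] by simp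
    then have "L * bot_left S a = L * left_end (us @ \<alpha> # \<beta> # vs) (bot_len S) a" by (simp add: bot_left_def)
    also have "\<dots> = (if a = \<beta> then left_end (us @ \<alpha> # vs @ [\<beta>]) (bot_len T) \<alpha> + L * bot_len S $ \<alpha>
        else left_end (us @ \<alpha> # vs @ [\<beta>]) (bot_len T) a)"
      by (rule left_end_move_after[OF B])
        (use S_lens(2) tw neq in \<open>auto simp: distrib_left nbl_def nbr_def bot_right_def\<close>)
    also have "\<dots> = nbl a"
      using S_lens(2)[of \<alpha>] tw neq b by (simp add: nbl_def nbr_def bot_left_def)
    finally have "L * bot_left S a = nbl a" .
    moreover have "L * top_left S a = top_left T a"
      unfolding top_left_def S_rows(1)[OF tw]
      by (rule left_end_last_changed[OF rows(1,2)])
        (use S_lens(1) tw in \<open>auto simp: nl_def nr_def \<alpha>_def top_right_def\<close>)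
    ultimately show ?thesis using tw by (simp add: nl_def)
  next
    case tw: False
    have "top_row S = us' @ \<beta> # \<alpha> # vs'" using tw S_rows(3) t move_after_split[OF T'(1)] by simp
    then have "L * top_left S a = L * left_end (us' @ \<beta> # \<alpha> # vs') (top_len S) a" by (simp add: top_left_def)
    also have "\<dots> = (if a = \<alpha> then left_end (us' @ \<beta> # vs' @ [\<alpha>]) (top_len T) \<beta> + L * top_len S $ \<beta>
        else left_end (us' @ \<beta> # vs' @ [\<alpha>]) (top_len T) a)"
      by (rule left_end_move_after[OF T'])
        (use S_lens(1) tw neq in \<open>auto simp: distrib_left nl_def nr_def top_right_def\<close>)
    also have "\<dots> = nl a"
      using S_lens(1)[of \<beta>] tw neq t by (simp add: nl_def nr_def top_left_def)
    finally have "L * top_left S a = nl a" .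
    moreover have "L * bot_left S a = bot_left T a"
      unfolding bot_left_def S_rows(4)[OF tw]
      by (rule left_end_last_changed[OF rows(3,4)])
        (use S_lens(2) tw in \<open>auto simp: nbl_def nbr_def \<beta>_def bot_right_def\<close>)
    ultimately show ?thesis using tw by (simp add: nbl_def)
  qed
  then show "L * top_left S a = nl a" "L * bot_left S a = nbl a" by auto
qed

lemma S_right: "L * top_right S a = nr a" "L * bot_right S a = nbr a"
  using S_left[of a] S_lens[of a] by (simp_all add: top_right_def bot_right_def distrib_left)

lemma S_sums: "(\<Sum>a\<in>UNIV. top_len S $ a) = 1" "(\<Sum>a\<in>UNIV. bot_len S $ a) = 1"
proof -
  have "(\<Sum>a\<in>UNIV. nr a - nl a) = L"
  proof (cases "top_wins T")
    case True
    then have "nr a - nl a = top_len T $ a - (if a = \<alpha> then bot_len T $ \<beta> else 0)" for a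
      using L_cases(1)[OF True] left_eq by (auto simp: nr_def nl_def top_right_def)
    then show ?thesis using sums L_cases(1)[OF True] left_eq by (simp add: sum_subtractf)
  next
    case False
    then have "nr a - nl a = top_len T $ a + (if a = \<beta> then z - top_right T \<beta> else 0)
        + (if a = \<alpha> then top_right T \<beta> - z - top_len T $ \<alpha> else 0)" for a
      using neq by (auto simp: nr_def nl_def top_right_def)
    then show ?thesis using sums L_cases(2)[OF False] left_eq by (simp add: sum.distrib)
  qed
  then have "L * (\<Sum>a\<in>UNIV. top_len S $ a) = L * 1" by (simp add: sum_distrib_left S_lens)
  then show "(\<Sum>a\<in>UNIV. top_len S $ a) = 1" using L_cases(5) by simp
  have "(\<Sum>a\<in>UNIV. nbr a - nbl a) = L"
  proof (cases "top_wins T")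
    case True
    then have "nbr a - nbl a = bot_len T $ a + (if a = \<alpha> then branch T \<alpha> L - bot_right T \<alpha> else 0)
        + (if a = \<beta> then bot_right T \<alpha> - branch T \<alpha> L - bot_len T $ \<beta> else 0)" for a
      using neq by (auto simp: nbr_def nbl_def bot_right_def)
    then show ?thesis using sums L_cases(1)[OF True] left_eq by (simp add: sum.distrib)
  next
    case False
    then have "nbr a - nbl a = bot_len T $ a - (if a = \<beta> then top_len T $ \<alpha> else 0)" for a
      using L_cases(2)[OF False] left_eq by (auto simp: nbr_def nbl_def bot_right_def)
    then show ?thesis using sums L_cases(2)[OF False] left_eq by (simp add: sum_subtractf)
  qed
  then have "L * (\<Sum>a\<in>UNIV. bot_len S $ a) = L * 1" by (simp add: sum_distrib_left S_lens)
  then show "(\<Sum>a\<in>UNIV. bot_len S $ a) = 1" using L_cases(5) by simp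
qed

lemma S_tp: "two_partitions S"
  using S_row_props S_pos S_sums by (simp add: two_partitions_def)

lemma S_mem: "y \<in> top_int S a \<longleftrightarrow> L * y \<in> {nl a<..<nr a}"
proof -
  have "y \<in> top_int S a \<longleftrightarrow> L * top_left S a < L * y \<and> L * y < L * top_right S a"
    using L_cases(5) by (simp add: top_int_def top_right_def)
  then show ?thesis by (simp add: S_left S_right)
qed

lemma S_mem_closed: "y \<in> {top_left S a..top_right S a} \<longleftrightarrow> L * y \<in> {nl a..nr a}"
proof -
  have "y \<in> {top_left S a..top_right S a} \<longleftrightarrow> L * top_left S a \<le> L * y \<and> L * y \<le> L * top_right S a"
    using L_cases(5) by simp
  then show ?thesis by (simp add: S_left S_right)
qed

lemma S_F: "is_branch (\<lambda>y. nF a (L * y) / L) (top_left S a) (top_right S a) (bot_left S a) (bot_right S a)"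
  unfolding is_branch_def
proof (intro conjI)
  have c: "continuous_on {nl a..nr a} (nF a)" and m: "strict_mono_on {nl a..nr a} (nF a)"
    and e: "nF a (nl a) = nbl a" "nF a (nr a) = nbr a"
    using new_branch[of a] by (auto simp: is_branch_def)
  show "continuous_on {top_left S a..top_right S a} (\<lambda>y. nF a (L * y) / L)"
  proof (intro continuous_on_divide continuous_on_const continuous_on_compose2[OF c])
    show "(*) L ` {top_left S a..top_right S a} \<subseteq> {nl a..nr a}" using S_mem_closed by blast
  qed (use L_cases(5) in \<open>auto intro!: continuous_intros\<close>)
  show "strict_mono_on {top_left S a..top_right S a} (\<lambda>y. nF a (L * y) / L)"
    unfolding strict_mono_on_def
  proof (intro allI impI)
    fix x y assume xy: "x \<in> {top_left S a..top_right S a} \<and> y \<in> {top_left S a..top_right S a} \<and> x < y"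
    then have "L * x \<in> {nl a..nr a}" "L * y \<in> {nl a..nr a}" "L * x < L * y"
      using S_mem_closed[of x a] S_mem_closed[of y a] L_cases(5) by (blast, blast, simp)
    then have "nF a (L * x) < nF a (L * y)" by (rule strict_mono_onD[OF m])
    then show "nF a (L * x) / L < nF a (L * y) / L" using L_cases(5) by (simp add: divide_strict_right_mono)
  qed
  show "nF a (L * top_left S a) / L = bot_left S a" "nF a (L * top_right S a) / L = bot_right S a"
    using e S_left[of a] S_right[of a] L_cases(5) by (auto simp: nonzero_divide_eq_eq mult.commute)
qed

lemma S_gmap_F: "y \<in> top_int S a \<Longrightarrow> gmap S y = nF a (L * y) / L"
  using new_return(1)[of "L * y" a] by (simp add: S_gmap S_mem)

lemma S_giet: "is_giet 0 S"
  by (rule is_giet_0I[OF S_tp S_F S_gmap_F])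

lemma S_branch: "x \<in> {nl a..nr a} \<Longrightarrow> L * branch S a (x / L) = nF a x"
proof -
  assume x: "x \<in> {nl a..nr a}"
  note b = is_giet_branch(1)[OF S_giet, of a] is_giet_branch(2)[OF S_giet, where a = a]
  have eq: "branch S a y = nF a (L * y) / L" if y: "y \<in> {top_left S a..top_right S a}" for y
  proof (cases "y \<in> top_int S a")
    case True then show ?thesis using b(2) S_gmap_F by simp
  next
    case False
    then have "y = top_left S a \<or> y = top_right S a"
      using y by (auto simp: top_int_def top_right_def)
    then show ?thesis using b(1) S_F[of a] by (auto simp: is_branch_def)
  qed
  have "branch S a (x / L) = nF a (L * (x / L)) / L"
    by (rule eq) (use x S_mem_closed[of "x / L" a] L_cases(5) in simp)
  then show ?thesis using L_cases(5) by simp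
qed

lemma S_is_step: "is_rv_step T S"
  unfolding is_rv_step_def Let_def L_def[symmetric]
proof (intro conjI allI ballI)
  show "two_partitions S" by (rule S_tp)
  show "gmap S ` top_int S a = bot_int S a" for a
    using S_giet by (auto simp: is_giet_def bij_betw_def)
  fix a y assume y: "y \<in> top_int S a"
  show "gmap S y = rm (L * y) / L" by (simp add: S_gmap)
  show "if rt (L * y) = 2 then a = loser T else L * y \<in> top_int T a"
    using new_return(2)[of "L * y" a] y by (simp add: S_mem)
qed

end

definition giet_eq :: "'n::finite giet \<Rightarrow> 'n giet \<Rightarrow> bool" where
  "giet_eq T S \<longleftrightarrow> top_row T = top_row S \<and> bot_row T = bot_row S \<and> top_len T = top_len S \<and>
     bot_len T = bot_len S \<and> (\<forall>a. \<forall>x\<in>top_int S a. gmap T x = gmap S x)"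

section \<open>Uniqueness of the step, and transfer from the model to \<open>rv\<close>\<close>

context rv_pre
begin

text \<open>The label condition confines each top interval to that of the model. Both families have
  total length 1, so all inclusions are equalities; the rows and the bottom partition
  follow.\<close>

lemma step_unique:
  assumes "is_rv_step T S'"
  shows "giet_eq S' S"
proof -
  have tp': "two_partitions S'" and gm: "\<And>a. gmap S' ` top_int S' a = bot_int S' a"
    and st: "\<And>a y. y \<in> top_int S' a \<Longrightarrow> gmap S' y = rm (L * y) / L \<and>
       (if rt (L * y) = 2 then a = loser T else L * y \<in> top_int T a)"
    using assms unfolding is_rv_step_def Let_def L_def[symmetric] by blast+
  have pos': "0 < top_len S' $ a" "0 < bot_len S' $ a" for a using tp' by (auto simp: two_partitions_def)
  have r': "distinct (top_row S')" "set (top_row S') = UNIV" "distinct (bot_row S')" "set (bot_row S') = UNIV"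
    using tp' by (auto simp: two_partitions_def)
  have b': "0 \<le> top_left S' a" "top_right S' a \<le> 1" for a
    using left_end_nonneg[of "top_len S'" "top_row S'" a] right_end_le[of "top_len S'" a "top_row S'"]
      pos' r' wsize_UNIV[OF r'(1,2), of "top_len S'"] tp'
    by (auto simp: top_left_def top_right_def two_partitions_def)
  have conf: "top_left S a \<le> top_left S' a \<and> top_right S' a \<le> top_right S a" for a
  proof -
    \<comment> \<open>The finitely many ends, at which \<open>gmap T\<close> is arbitrary, are
      discarded; \<open>open_minus_finite_sub\<close> recovers the inclusion without them.\<close>
    let ?X = "(\<lambda>x. x / L) ` (top_left T ` UNIV \<union> top_right T ` UNIV)"
    have sub: "{top_left S' a<..<top_right S' a} - ?X \<subseteq> {top_left S a..top_right S a}"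
    proof
      fix y assume y: "y \<in> {top_left S' a<..<top_right S' a} - ?X"
      then have yi: "y \<in> top_int S' a" by (simp add: top_int_def top_right_def)
      have "0 < y" "y < 1" using y b'[of a] by auto
      then have "0 < L * y" "L * y < L" using L_cases(5) by auto
      moreover have "L * y \<notin> top_left T ` UNIV \<union> top_right T ` UNIV"
        using y L_cases(5) by (force simp: image_iff field_simps)
      ultimately have "L * y \<in> {nl a..nr a}" using label_confines[of "L * y" a] st[OF yi] by auto
      then show "y \<in> {top_left S a..top_right S a}" using S_mem_closed by blast
    qed
    have "top_left S' a < top_right S' a" using left_less_right[OF tp'] by auto
    then show ?thesis using open_minus_finite_sub[OF sub] by auto
  qed
  have le: "top_len S' $ a \<le> top_len S $ a" for a
    using conf[of a] unfolding top_right_def by linarith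
  have "(\<Sum>a\<in>UNIV. top_len S $ a - top_len S' $ a) = 0"
    using S_sums tp' by (simp add: sum_subtractf two_partitions_def)
  then have "top_len S $ a - top_len S' $ a = 0" for a
    using le by (subst (asm) sum_nonneg_eq_0_iff) auto
  then have tl: "top_len S' = top_len S" by (simp add: vec_eq_iff)
  have tleft: "top_left S' a = top_left S a" for a using conf[of a] tl by (auto simp: top_right_def)
  have trow: "top_row S' = top_row S"
    by (rule row_unique[of "top_len S"])
      (use tleft tl S_pos S_row_props r' in \<open>auto simp: top_left_def\<close>)
  have ti: "top_int S' a = top_int S a" for a by (simp add: top_int_def tleft tl)
  have g: "gmap S' x = gmap S x" if "x \<in> top_int S a" for a x
    using st[of x a] that by (simp add: ti S_gmap)
  have "bot_int S' a = bot_int S a" for a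
  proof -
    have "bot_int S' a = gmap S' ` top_int S a" using gm ti by metis
    also have "\<dots> = gmap S ` top_int S a" by (rule image_cong[OF refl]) (use g in auto)
    also have "\<dots> = bot_int S a" using S_giet by (auto simp: is_giet_def bij_betw_def)
    finally show ?thesis .
  qed
  then have bi: "{bot_left S' a<..<bot_right S' a} = {bot_left S a<..<bot_right S a}" for a
    by (simp add: bot_int_def bot_right_def)
  have bl: "bot_left S' a = bot_left S a \<and> bot_right S' a = bot_right S a" for a
    using bi[of a] left_less_right(2)[OF tp', of a] left_less_right(2)[OF S_tp, of a]
    by (metis cInf_greaterThanLessThan cSup_greaterThanLessThan)
  have "bot_len S' $ a = bot_len S $ a" for a
    using bl[of a] unfolding bot_right_def by linarith
  then have blen: "bot_len S' = bot_len S" by (simp add: vec_eq_iff)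
  have brow: "bot_row S' = bot_row S"
    by (rule row_unique[of "bot_len S"])
      (use bl blen S_pos S_row_props r' in \<open>auto simp: bot_left_def\<close>)
  show ?thesis unfolding giet_eq_def using trow brow tl blen g by auto
qed

lemma rv_eq: "giet_eq (rv T) S"
  unfolding rv_def using someI[of "is_rv_step T", OF S_is_step] by (rule step_unique)

lemma rv_left_right: "L * top_left (rv T) a = nl a" "L * top_right (rv T) a = nr a"
  using rv_eq S_left(1)[of a] S_right(1)[of a]
  by (simp_all add: giet_eq_def top_left_def top_right_def)

lemma rv_rows:
  "top_wins T \<Longrightarrow> top_row (rv T) = top_row T" "top_wins T \<Longrightarrow> bot_row (rv T) = move_after \<alpha> \<beta> (bot_row T)"
  "\<not> top_wins T \<Longrightarrow> top_row (rv T) = move_after \<beta> \<alpha> (top_row T)" "\<not> top_wins T \<Longrightarrow> bot_row (rv T) = bot_row T"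
  using rv_eq S_rows by (simp_all add: giet_eq_def)

lemma rv_branch_S:
  assumes "y \<in> {top_left S a..top_right S a}"
  shows "branch (rv T) a y = branch S a y"
proof -
  note e = rv_eq[unfolded giet_eq_def]
  have "gmap (rv T) y = gmap S y" if "y \<noteq> top_left S a" "y \<noteq> top_left S a + top_len S $ a"
  proof -
    have "y \<in> top_int S a" using assms that by (auto simp: top_int_def top_right_def)
    then show ?thesis using e by blast
  qed
  moreover have "top_left (rv T) a = top_left S a" "bot_left (rv T) a = bot_left S a"
    using e by (simp_all add: top_left_def bot_left_def)
  ultimately show ?thesis using e by (auto simp: branch_def)
qed

lemma rv_branch: "x \<in> {nl a..nr a} \<Longrightarrow> L * branch (rv T) a (x / L) = nF a x"
  using rv_branch_S[of "x / L" a] S_mem_closed[of "x / L" a] S_branch[of x a] L_cases(5) by simp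

lemma rv_giet: "is_giet 0 (rv T)"
proof (rule is_giet_0I[where F = "branch S"])
  note e = rv_eq[unfolded giet_eq_def]
  show "two_partitions (rv T)" using S_tp e by (simp add: two_partitions_def)
  show "is_branch (branch S a) (top_left (rv T) a) (top_right (rv T) a) (bot_left (rv T) a) (bot_right (rv T) a)" for a
    using is_giet_branch(1)[OF S_giet, of a] e
    by (simp add: top_left_def bot_left_def top_right_def bot_right_def)
  show "gmap (rv T) x = branch S a x" if "x \<in> top_int (rv T) a" for a x
  proof -
    have x: "x \<in> top_int S a" using that e by (simp add: top_int_def top_left_def)
    then show ?thesis using e is_giet_branch(2)[OF S_giet x] by auto
  qed
qed

lemma new_in:
  assumes "x \<in> {nl a..nr a}"
  shows "a \<noteq> (if top_wins T then \<beta> else \<alpha>) \<Longrightarrow> x \<in> {top_left T a..top_right T a}"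
    and "a = (if top_wins T then \<beta> else \<alpha>) \<Longrightarrow> x \<in> {top_left T \<beta>..top_right T \<beta>}"
    and "a = (if top_wins T then \<beta> else \<alpha>) \<Longrightarrow> branch T \<beta> x \<in> {top_left T \<alpha>..top_right T \<alpha>}"
proof -
  show "a \<noteq> (if top_wins T then \<beta> else \<alpha>) \<Longrightarrow> x \<in> {top_left T a..top_right T a}"
    using assms L_in cut by (cases "top_wins T") (auto simp: nl_def nr_def split: if_splits)
  assume a: "a = (if top_wins T then \<beta> else \<alpha>)"
  show x: "x \<in> {top_left T \<beta>..top_right T \<beta>}"
    using a assms cut neq by (cases "top_wins T") (auto simp: nl_def nr_def split: if_splits)
  show "branch T \<beta> x \<in> {top_left T \<alpha>..top_right T \<alpha>}"
  proof (cases "top_wins T")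
    case True
    then show ?thesis
      using x branch_le[of "top_left T \<beta>" \<beta> x] branch_le[of x \<beta> "top_right T \<beta>"] branch_ends[of \<beta>]
        L_in L_cases(1) last_right lr(1)[of \<beta>] by auto
  next
    case False
    then have "z \<le> x" using a assms by (auto simp: nl_def)
    then show ?thesis
      using x branch_le[of z \<beta> x] branch_le[of x \<beta> "top_right T \<beta>"] branch_ends[of \<beta>]
        cut[OF False] L_cases(2)[OF False] last_right lr(1)[of \<beta>] by auto
  qed
qed

lemma S_irreducible:
  assumes "irreducible_datum T"
  shows "irreducible_datum S"
proof -
  obtain us vs where b: "bot_row T = us @ \<alpha> # vs @ [\<beta>]" by (rule bot_split)
  obtain us' vs' where t: "top_row T = us' @ \<beta> # vs' @ [\<alpha>]" by (rule top_split)
  show ?thesis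
  proof (cases "top_wins T")
    case True
    have d: "distinct (us @ \<alpha> # vs @ [\<beta>])" using rows b by metis
    have "bot_row S = us @ last (top_row T) # \<beta> # vs"
      using True S_rows(2) b move_after_split[OF d] by (simp add: \<alpha>_def)
    then show ?thesis
      unfolding irreducible_datum_def S_rows(1)[OF True]
      using irreducible_move_after[of "top_row T" us vs \<beta>] assms b rows
      by (simp add: irreducible_datum_def \<alpha>_def)
  next
    case False
    have d: "distinct (us' @ \<beta> # vs' @ [\<alpha>])" using rows t by metis
    have "top_row S = us' @ last (bot_row T) # \<alpha> # vs'"
      using False S_rows(3) t move_after_split[OF d] by (simp add: \<beta>_def)
    then show ?thesis
      unfolding irreducible_datum_def S_rows(4)[OF False]
      using irreducible_move_after[of "bot_row T" us' vs' \<alpha>] assms t rows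
      by (simp add: irreducible_datum_def \<beta>_def) metis
  qed
qed

lemma rv_irreducible: "irreducible_datum T \<Longrightarrow> irreducible_datum (rv T)"
  using S_irreducible rv_eq by (simp add: irreducible_datum_def giet_eq_def)

end

section \<open>Iterated renormalization\<close>

abbreviation stage :: "'n::finite giet \<Rightarrow> nat \<Rightarrow> 'n giet" where
  "stage T n \<equiv> (rv ^^ n) T"

definition scale :: "'n::finite giet \<Rightarrow> nat \<Rightarrow> real" where
  "scale T n = (\<Prod>i<n. rv_length (stage T i))"

definition al :: "'n::finite giet \<Rightarrow> nat \<Rightarrow> 'n" where "al T n = last (top_row (stage T n))"
definition be :: "'n::finite giet \<Rightarrow> nat \<Rightarrow> 'n" where "be T n = last (bot_row (stage T n))"
definition tw :: "'n::finite giet \<Rightarrow> nat \<Rightarrow> bool" where "tw T n = top_wins (stage T n)"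
definition lo :: "'n::finite giet \<Rightarrow> nat \<Rightarrow> 'n \<Rightarrow> real" where
  "lo T n a = scale T n * top_left (stage T n) a"
definition hi :: "'n::finite giet \<Rightarrow> nat \<Rightarrow> 'n \<Rightarrow> real" where
  "hi T n a = scale T n * top_right (stage T n) a"
definition Rst :: "'n::finite giet \<Rightarrow> nat \<Rightarrow> 'n \<Rightarrow> real \<Rightarrow> real" where
  "Rst T n a = run (branch T) (return_word (al T) (be T) (tw T) 0 n a)"

lemma irreducible_last_neq:
  fixes T :: "'n::finite giet"
  assumes "two_partitions T" "irreducible_datum T" "CARD('n) \<ge> 2"
  shows "last (top_row T) \<noteq> last (bot_row T)"
proof
  assume e: "last (top_row T) = last (bot_row T)"
  have b: "set (take (CARD('n) - 1) xs) = UNIV - {last xs}" if "distinct xs" "set xs = (UNIV :: 'n set)" for xs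
  proof -
    have l: "length xs = CARD('n)" using distinct_card[OF that(1)] that(2) by simp
    then have ne: "xs \<noteq> []" by auto
    have "take (CARD('n) - 1) xs = butlast xs" using l by (simp add: butlast_conv_take)
    moreover have "distinct (butlast xs @ [last xs])" "set (butlast xs @ [last xs]) = UNIV"
      using that ne by simp_all
    ultimately show ?thesis by auto
  qed
  have "set (take (CARD('n) - 1) (top_row T)) = set (take (CARD('n) - 1) (bot_row T))"
    using b[of "top_row T"] b[of "bot_row T"] assms(1) e by (simp add: two_partitions_def)
  then show False using assms(2,3) unfolding irreducible_datum_def by auto
qed

text \<open>Only regularity 0 is assumed, so that the results apply both to the smooth GIET and to
  the standard exchange with the same rotation number.\<close>

locale renormalizable =
  fixes T :: "'n::finite giet"
  assumes giet: "is_giet 0 T" and irr: "irreducible_datum T" and card2: "CARD('n) \<ge> 2"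
    and inf: "infinitely_renormalizable T"
begin

text \<open>Irreducibility is carried along because it keeps the last labels of the two rows
  distinct, as each step requires.\<close>

lemma stage_pre: "is_giet 0 (stage T n) \<and> irreducible_datum (stage T n) \<and> rv_pre (stage T n)"
proof (induction n)
  case 0
  have "last (top_row T) \<noteq> last (bot_row T)"
    using irreducible_last_neq[OF _ irr card2] giet by (simp add: is_giet_def)
  then show ?case using giet irr inf by (auto simp: infinitely_renormalizable_def rv_pre_def dest: spec[of _ 0])
next
  case (Suc n)
  then interpret S: rv_pre "stage T n" "last (top_row (stage T n))" "last (bot_row (stage T n))"
    "rv_length (stage T n)" "cut_point (stage T n)" by auto
  have g: "is_giet 0 (stage T (Suc n))" "irreducible_datum (stage T (Suc n))"
    using S.rv_giet S.rv_irreducible Suc by auto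
  moreover have "last (top_row (stage T (Suc n))) \<noteq> last (bot_row (stage T (Suc n)))"
    using irreducible_last_neq[OF _ g(2) card2] g(1) by (simp add: is_giet_def)
  moreover have "rv_defined (stage T (Suc n))" using inf by (simp only: infinitely_renormalizable_def)
  ultimately show ?case by (simp add: rv_pre_def)
qed

lemma stage_giet: "is_giet 0 (stage T n)" and stage_irr: "irreducible_datum (stage T n)"
  and stage_rv_pre: "rv_pre (stage T n)"
  using stage_pre by auto

lemma stage_tp: "two_partitions (stage T n)"
  using stage_giet by (simp add: is_giet_def)

lemma scale_pos: "0 < scale T n"
  unfolding scale_def using rv_pre.L_cases(5)[OF stage_rv_pre] by (intro prod_pos) auto

lemma scale_Suc: "scale T (Suc n) = scale T n * rv_length (stage T n)"
  by (simp add: scale_def)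

lemma mem_scaled:
  "x \<in> {lo T n a..hi T n a} \<longleftrightarrow> x / scale T n \<in> {top_left (stage T n) a..top_right (stage T n) a}"
  using scale_pos[of n] by (auto simp: lo_def hi_def field_simps)

lemma lo_hi_Suc:
  "lo T (Suc n) a = scale T n * rv_pre.nl (stage T n) a"
  "hi T (Suc n) a = scale T n * rv_pre.nr (stage T n) a"
  using rv_pre.rv_left_right[OF stage_rv_pre, of n a] by (simp_all add: lo_def hi_def scale_Suc mult.assoc)

lemma mem_scaled_Suc:
  "x \<in> {lo T (Suc n) a..hi T (Suc n) a} \<longleftrightarrow>
    x / scale T n \<in> {rv_pre.nl (stage T n) a..rv_pre.nr (stage T n) a}"
  unfolding lo_hi_Suc using scale_pos[of n] by (auto simp: field_simps)

text \<open>Here the choice operator \<open>rv\<close> and the combinatorial words meet: composing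
  original branches along the return word gives the branch of the stage in unscaled
  coordinates.\<close>

lemma scaled_branch:
  assumes "x \<in> {lo T n a..hi T n a}"
  shows "Rst T n a x = scale T n * branch (stage T n) a (x / scale T n)"
  using assms
proof (induction n arbitrary: a x)
  case 0
  then show ?case by (simp add: Rst_def scale_def)
next
  case (Suc n)
  interpret S: rv_pre "stage T n" "al T n" "be T n" "rv_length (stage T n)" "cut_point (stage T n)"
    using stage_rv_pre by (simp_all add: al_def be_def)
  let ?c = "scale T n" and ?L = "rv_length (stage T n)"
  have c: "?c > 0" "?L > 0" using scale_pos S.L_cases(5) by auto
  have x: "x / ?c \<in> {S.nl a..S.nr a}" using Suc.prems mem_scaled_Suc by simp
  have "scale T (Suc n) * branch (stage T (Suc n)) a (x / scale T (Suc n))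
      = ?c * (?L * branch (rv (stage T n)) a (x / ?c / ?L))" by (simp add: scale_Suc mult.assoc)
  also have "\<dots> = ?c * S.nF a (x / ?c)" using S.rv_branch[OF x] by simp
  finally have e: "scale T (Suc n) * branch (stage T (Suc n)) a (x / scale T (Suc n)) = ?c * S.nF a (x / ?c)" .
  show ?case
  proof (cases "a = (if tw T n then be T n else al T n)")
    case True
    have a: "a = (if top_wins (stage T n) then be T n else al T n)" using True by (simp add: tw_def)
    have 1: "x \<in> {lo T n (be T n)..hi T n (be T n)}"
      using S.new_in(2)[OF x a] mem_scaled by blast
    have r1: "Rst T n (be T n) x = ?c * branch (stage T n) (be T n) (x / ?c)" by (rule Suc.IH[OF 1])
    have "branch (stage T n) (be T n) (x / ?c) \<in> {top_left (stage T n) (al T n)..top_right (stage T n) (al T n)}"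
      by (rule S.new_in(3)[OF x a])
    then have 2: "Rst T n (be T n) x \<in> {lo T n (al T n)..hi T n (al T n)}"
      unfolding mem_scaled r1 using c by simp
    have "Rst T (Suc n) a x = Rst T n (al T n) (Rst T n (be T n) x)"
      using True by (simp add: Rst_def rv_word_def run_append)
    also have "\<dots> = ?c * branch (stage T n) (al T n) (branch (stage T n) (be T n) (x / ?c))"
      using Suc.IH[OF 2] r1 c by simp
    finally show ?thesis using e a by (simp add: S.nF_def)
  next
    case False
    have a: "a \<noteq> (if top_wins (stage T n) then be T n else al T n)" using False by (simp add: tw_def)
    have 1: "x \<in> {lo T n a..hi T n a}" using S.new_in(1)[OF x a] mem_scaled by blast
    have "Rst T (Suc n) a x = Rst T n a x" using False by (simp add: Rst_def rv_word_def)
    then show ?thesis using Suc.IH[OF 1] e a by (simp add: S.nF_def)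
  qed
qed

sublocale rauzy_towers "al T" "be T" "tw T" "lo T" "hi T" "branch T" "Rst T"
proof unfold_locales
  have R: "run (branch T) (return_word (al T) (be T) (tw T) 0 n a) = Rst T n a" for n a
    by (simp add: Rst_def)
  note [simp] = R
  show "lo T n a < hi T n a" for n a
    using left_less_right(1)[OF stage_tp] scale_pos by (simp add: lo_def hi_def)
  note lh = this
  show "al T n \<noteq> be T n" for n
    using rv_pre.neq[OF stage_rv_pre] by (simp add: al_def be_def)
  have z: "lo T 0 a = top_left T a" "hi T 0 a = top_right T a" for a by (simp_all add: lo_def hi_def scale_def)
  show "continuous_on {lo T 0 a..hi T 0 a} (branch T a)"
    "strict_mono_on {lo T 0 a..hi T 0 a} (branch T a)" for a
    using is_giet_branch(1)[OF giet, of a] by (simp_all add: z is_branch_def)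
  fix n
  interpret S: rv_pre "stage T n" "al T n" "be T n" "rv_length (stage T n)" "cut_point (stage T n)"
    using stage_rv_pre by (simp_all add: al_def be_def)
  let ?c = "scale T n"
  have c: "?c > 0" using scale_pos .
  have ends: "Rst T n a (lo T n a) = ?c * bot_left (stage T n) a" "Rst T n a (hi T n a) = ?c * bot_right (stage T n) a" for a
    using scaled_branch[of "lo T n a" n a] scaled_branch[of "hi T n a" n a] lh[of n a] c S.branch_ends[of a]
    by (simp_all add: lo_def hi_def)
  note d = lo_hi_Suc S.nl_def S.nr_def tw_def
  show "lo T (Suc n) a = lo T n a" if "tw T n" for a using that unfolding d by (simp add: lo_def)
  show "hi T (Suc n) a = hi T n a" if "tw T n" "a \<noteq> al T n" for a using that unfolding d by (simp add: hi_def)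
  show "hi T (Suc n) (al T n) = run (branch T) (return_word (al T) (be T) (tw T) 0 n (be T n)) (lo T n (be T n))" if "tw T n"
    using that S.L_cases(1) ends by (simp add: d)
  show "hi T n (al T n) = run (branch T) (return_word (al T) (be T) (tw T) 0 n (be T n)) (hi T n (be T n))" if "tw T n"
    using that S.last_right ends by (simp add: hi_def)
  show "lo T (Suc n) a = lo T n a" if "\<not> tw T n" "a \<noteq> al T n" for a using that unfolding d by (simp add: lo_def)
  show "hi T (Suc n) a = hi T n a" if "\<not> tw T n" "a \<noteq> al T n" "a \<noteq> be T n" for a
    using that unfolding d by (simp add: hi_def)
  show "lo T (Suc n) (al T n) = hi T (Suc n) (be T n)" if "\<not> tw T n" using that by (simp add: d)
  show "hi T (Suc n) (al T n) = hi T n (be T n)" if "\<not> tw T n" using that S.neq unfolding d by (simp add: hi_def)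
  show "run (branch T) (return_word (al T) (be T) (tw T) 0 n (be T n)) (hi T (Suc n) (be T n)) = lo T n (al T n)" if b: "\<not> tw T n"
  proof -
    have nt: "\<not> top_wins (stage T n)" using b by (simp add: tw_def)
    note cut = S.cut[OF nt]
    have h: "hi T (Suc n) (be T n) = ?c * cut_point (stage T n)" using b by (simp add: d)
    have "hi T (Suc n) (be T n) \<in> {lo T n (be T n)..hi T n (be T n)}"
      unfolding mem_scaled h using c cut by simp
    from scaled_branch[OF this] show ?thesis
      unfolding h using c cut(3) S.L_cases(2)[OF nt] by (simp add: lo_def)
  qed
  show "run (branch T) (return_word (al T) (be T) (tw T) 0 n (be T n)) (hi T n (be T n)) = hi T n (al T n)" if "\<not> tw T n"
    using that S.last_right ends by (simp add: hi_def)
qed (rule eq_reflection, intro ext, simp add: Rst_def)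

lemma scale_top: "tw T n \<Longrightarrow> scale T (Suc n) = hi T (Suc n) (al T n)"
  using lo_hi_Suc(2)[of n "al T n"] rv_pre.nr_def[OF stage_rv_pre, of n "al T n"]
  by (simp add: scale_Suc tw_def al_def)

lemma scale_bot: "\<not> tw T n \<Longrightarrow> scale T (Suc n) = lo T n (al T n)"
  using rv_pre.L_cases(2)[OF stage_rv_pre, of n] by (simp add: scale_Suc tw_def al_def lo_def)

lemma scale_mono: "m \<le> n \<Longrightarrow> scale T n \<le> scale T m"
proof (induction n rule: dec_induct)
  case (step n)
  have "scale T (Suc n) \<le> scale T n"
    unfolding scale_Suc using rv_pre.L_cases(5,6)[OF stage_rv_pre, of n] scale_pos[of n] by simp
  then show ?case using step by simp
qed simp

end

text \<open>Letter counts of the return words, built from labels and types alone, so that GIETs with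
  the same rotation number share them.\<close>

definition incidence :: "(nat \<Rightarrow> 'n::finite) \<Rightarrow> (nat \<Rightarrow> 'n) \<Rightarrow> (nat \<Rightarrow> bool) \<Rightarrow> nat \<Rightarrow> nat \<Rightarrow> real ^ 'n ^ 'n" where
  "incidence a b t m n = (\<chi> i j. real (count_list (return_word a b t m n i) j))"

section \<open>Return words as first returns, and the cocycle as their letter count\<close>

context renormalizable
begin

text \<open>Open intervals, because \<open>gmap\<close> is arbitrary at the ends.\<close>

definition oJ :: "nat \<Rightarrow> 'n \<Rightarrow> real set" where
  "oJ n a = {lo T n a<..<hi T n a}"

lemma oJ_sub: "x \<in> oJ n a \<Longrightarrow> x \<in> J n a"
  by (auto simp: oJ_def J_iff)

lemma R_less: "x \<in> J n a \<Longrightarrow> y \<in> J n a \<Longrightarrow> x < y \<Longrightarrow> Rst T n a x < Rst T n a y"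
  using R_mono[of n a] by (auto simp: strict_mono_on_def)

lemma R_ends:
  "Rst T n a (lo T n a) = scale T n * bot_left (stage T n) a"
  "Rst T n a (hi T n a) = scale T n * bot_right (stage T n) a"
  using scaled_branch[of "lo T n a" n a] scaled_branch[of "hi T n a" n a] lo_hi[of n a] scale_pos[of n]
    rv_pre.branch_ends[OF stage_rv_pre, of n a]
  by (simp_all add: lo_def hi_def)

lemma R_range: "x \<in> oJ n a \<Longrightarrow> 0 < Rst T n a x \<and> Rst T n a x < scale T n"
proof -
  assume x: "x \<in> oJ n a"
  have "scale T n * bot_left (stage T n) a < Rst T n a x" "Rst T n a x < scale T n * bot_right (stage T n) a"
    using R_less[of "lo T n a" n a x] R_less[of x n a "hi T n a"] x oJ_sub[OF x]
    by (auto simp: R_ends[symmetric] oJ_def)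
  moreover have "0 \<le> scale T n * bot_left (stage T n) a" "scale T n * bot_right (stage T n) a \<le> scale T n"
    using rv_pre.bounds[OF stage_rv_pre, of n a] scale_pos[of n] by (simp_all add: mult_left_le)
  ultimately show ?thesis by linarith
qed

lemma step_open:
  assumes "x \<in> oJ (Suc n) a"
  shows "step_word n a = [a] \<Longrightarrow> x \<in> oJ n a"
    and "step_word n a \<noteq> [a] \<Longrightarrow> step_word n a = [be T n, al T n] \<and> x \<in> oJ n (be T n) \<and>
       Rst T n (be T n) x \<in> oJ n (al T n) \<and> scale T (Suc n) < Rst T n (be T n) x"
proof -
  have "(step_word n a = [a] \<longrightarrow> x \<in> oJ n a) \<and>
    (step_word n a \<noteq> [a] \<longrightarrow> step_word n a = [be T n, al T n] \<and> x \<in> oJ n (be T n) \<and>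
       Rst T n (be T n) x \<in> oJ n (al T n) \<and> scale T (Suc n) < Rst T n (be T n) x)"
  proof (cases "tw T n")
    case t: True
    note f = lo_top[OF t] hi_top[OF t] hi_top_al[OF t] hi_al_top[OF t] step_interval_top[OF t]
    have sub: "x \<in> oJ n a"
      using assms f by (cases "a = al T n") (auto simp: oJ_def)
    show ?thesis
    proof (cases "a = be T n")
      case True
      have x: "x \<in> J n (be T n)" "lo T n (be T n) < x" "x < hi T n (be T n)" using sub True oJ_sub by (auto simp: oJ_def)
      have "Rst T n (be T n) (lo T n (be T n)) < Rst T n (be T n) x" by (rule R_less) (use x in auto)
      moreover have "Rst T n (be T n) x < Rst T n (be T n) (hi T n (be T n))" by (rule R_less) (use x in auto)
      ultimately show ?thesis
        using sub True t f scale_top[OF t] by (auto simp: rv_word_def oJ_def)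
    next
      case False then show ?thesis using sub t by (auto simp: rv_word_def)
    qed
  next
    case b: False
    note f = lo_bot[OF b] hi_bot[OF b] lo_bot_al[OF b] hi_bot_al[OF b] R_cut_bot[OF b] R_hi_bot[OF b]
      step_interval_sub[OF b]
    show ?thesis
    proof (cases "a = al T n")
      case True
      let ?z = "hi T (Suc n) (be T n)"
      have x: "?z < x" "x < hi T n (be T n)" using assms True f by (auto simp: oJ_def)
      have zin: "?z \<in> J n (be T n)" "x \<in> J n (be T n)" using x f by (auto simp: J_iff)
      have "Rst T n (be T n) ?z < Rst T n (be T n) x" by (rule R_less) (use x zin in auto)
      moreover have "Rst T n (be T n) x < Rst T n (be T n) (hi T n (be T n))" by (rule R_less) (use x zin in auto)
      ultimately show ?thesis
        using x f True b scale_bot[OF b] by (auto simp: rv_word_def oJ_def)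
    next
      case False
      then have "x \<in> oJ n a" using assms f(1)[of a] f(2)[of a] f(7,8) al_be[of n]
        by (cases "a = be T n") (auto simp: oJ_def)
      then show ?thesis using False b by (auto simp: rv_word_def)
    qed
  qed
  then show "step_word n a = [a] \<Longrightarrow> x \<in> oJ n a"
    and "step_word n a \<noteq> [a] \<Longrightarrow> step_word n a = [be T n, al T n] \<and> x \<in> oJ n (be T n) \<and>
       Rst T n (be T n) x \<in> oJ n (al T n) \<and> scale T (Suc n) < Rst T n (be T n) x" by auto
qed

text \<open>The intermediate points land strictly beyond \<open>scale T n\<close>, outside the
  stage-\<open>n\<close> interval, so the end of the word is indeed the first return.\<close>

lemma open_orbit:
  assumes "m \<le> n" "x \<in> oJ n a" "s < length (w m n a)"
  shows "run (Rst T m) (take s (w m n a)) x \<in> oJ m (w m n a ! s) \<and>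
    (0 < s \<longrightarrow> scale T n < run (Rst T m) (take s (w m n a)) x)"
  using assms
proof (induction n arbitrary: a x s rule: dec_induct)
  case base
  then show ?case by (simp add: return_word_le)
next
  case (step n)
  have sc: "scale T (Suc n) \<le> scale T n" by (rule scale_mono) simp
  show ?case
  proof (cases "step_word n a = [a]")
    case True
    then have "w m (Suc n) a = w m n a" using step(1) by simp
    then show ?thesis using step.IH[OF step_open(1)[OF step.prems(1) True], of s] step.prems(2) sc by auto
  next
    case False
    note o = step_open(2)[OF step.prems(1) False]
    let ?u = "w m n (be T n)" and ?v = "w m n (al T n)"
    have W: "w m (Suc n) a = ?u @ ?v" using step(1) o by simp
    show ?thesis
    proof (cases "s < length ?u")
      case True
      then show ?thesis using step.IH[of x "be T n" s] step(1) o sc by (auto simp: W nth_append simp del: return_word.simps)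
    next
      case False
      let ?t = "s - length ?u"
      have t: "?t < length ?v" using False step.prems(2) unfolding W by simp
      have r: "run (Rst T m) (take s (w m (Suc n) a)) x = run (Rst T m) (take ?t ?v) (Rst T n (be T n) x)"
        using False unfolding W by (simp add: run_append R_run[OF step(1)])
      show ?thesis
        unfolding r using step.IH[of "Rst T n (be T n) x" "al T n" ?t] o sc t False
        by (cases "?t = 0") (auto simp: W nth_append simp del: return_word.simps)
    qed
  qed
qed

text \<open>\<open>f\<close> is any map that agrees with the stage-\<open>m\<close> branches, since
  the lemma is applied to \<open>gmap T\<close> as well as to \<open>zorich_return\<close>.\<close>

lemma first_return:
  assumes mn: "m \<le> n" and x: "x \<in> oJ n a" and f: "\<And>b y. y \<in> oJ m b \<Longrightarrow> f y = Rst T m b y"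
  shows "s \<le> length (w m n a) \<Longrightarrow> (f ^^ s) x = run (Rst T m) (take s (w m n a)) x"
    and "return_time f {0..scale T n} x = length (w m n a)"
    and "return_map f {0..scale T n} x = Rst T n a x"
proof -
  let ?W = "w m n a"
  show it: "(f ^^ s) x = run (Rst T m) (take s ?W) x" if "s \<le> length ?W" for s
    using that
  proof (induction s)
    case (Suc s)
    then have "run (Rst T m) (take s ?W) x \<in> oJ m (?W ! s)" using open_orbit[OF mn x, of s] by auto
    then show ?case using Suc f by (simp add: take_Suc_conv_app_nth run_append)
  qed simp
  show rt: "return_time f {0..scale T n} x = length ?W"
    unfolding return_time_def
  proof (rule Least_equality)
    have "(f ^^ length ?W) x = Rst T n a x" using it[of "length ?W"] by (simp add: R_run[OF mn])
    then show "0 < length ?W \<and> (f ^^ length ?W) x \<in> {0..scale T n}"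
      using R_range[OF x] return_word_nonempty[of "al T" "be T" "tw T" m n a] by auto
    fix k assume k: "0 < k \<and> (f ^^ k) x \<in> {0..scale T n}"
    show "length ?W \<le> k"
    proof (rule ccontr)
      assume "\<not> length ?W \<le> k"
      then show False using k open_orbit[OF mn x, of k] it[of k] by auto
    qed
  qed
  show "return_map f {0..scale T n} x = Rst T n a x"
    unfolding return_map_def rt using it[of "length ?W"] by (simp add: R_run[OF mn])
qed

lemma oJ_disjoint: "x \<in> oJ n a \<Longrightarrow> x \<in> oJ n b \<Longrightarrow> a = b"
proof (rule ccontr)
  assume x: "x \<in> oJ n a" "x \<in> oJ n b" "a \<noteq> b"
  interpret S: rv_pre "stage T n" "al T n" "be T n" "rv_length (stage T n)" "cut_point (stage T n)"
    using stage_rv_pre by (simp_all add: al_def be_def)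
  have "top_right (stage T n) a \<le> top_left (stage T n) b \<or> top_right (stage T n) b \<le> top_left (stage T n) a"
    using cells_disjoint[of "top_len (stage T n)" a "top_row (stage T n)" b] S.pos S.rows x(3)
    by (simp add: top_left_def top_right_def)
  then have "hi T n a \<le> lo T n b \<or> hi T n b \<le> lo T n a" using scale_pos[of n] by (simp add: lo_def hi_def)
  then show False using x by (auto simp: oJ_def)
qed

lemma oJ_0: "oJ 0 a = top_int T a"
  by (simp add: oJ_def lo_def hi_def scale_def top_int_def top_right_def)

lemma gmap_R0: "y \<in> oJ 0 b \<Longrightarrow> gmap T y = Rst T 0 b y"
  using is_giet_branch(2)[OF giet, of y b] by (simp add: oJ_0 Rst_def)

lemma zorich_interval_eq: "zorich_interval T n = {0..scale T (zorich_time T n)}"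
  by (simp add: zorich_interval_def zorich_length_def scale_def)

lemma zorich_piece_eq: "zorich_piece T n a = oJ (zorich_time T n) a"
proof -
  let ?c = "scale T (zorich_time T n)"
  have c: "?c > 0" by (rule scale_pos)
  have "zorich_piece T n a = (\<lambda>y. ?c * y) ` top_int (stage T (zorich_time T n)) a"
    by (simp add: zorich_piece_def zorich_def zorich_length_def scale_def)
  also have "\<dots> = oJ (zorich_time T n) a"
  proof
    show "(\<lambda>y. ?c * y) ` top_int (stage T (zorich_time T n)) a \<subseteq> oJ (zorich_time T n) a"
      using c by (auto simp: oJ_def lo_def hi_def top_int_def top_right_def)
    show "oJ (zorich_time T n) a \<subseteq> (\<lambda>y. ?c * y) ` top_int (stage T (zorich_time T n)) a"
    proof
      fix x assume "x \<in> oJ (zorich_time T n) a"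
      then show "x \<in> (\<lambda>y. ?c * y) ` top_int (stage T (zorich_time T n)) a"
        using c by (intro image_eqI[of _ _ "x / ?c"])
          (auto simp: oJ_def lo_def hi_def top_int_def top_right_def field_simps)
    qed
  qed
  finally show ?thesis .
qed

lemma zorich_return_R: "y \<in> oJ (zorich_time T m) b \<Longrightarrow> zorich_return T m y = Rst T (zorich_time T m) b y"
  unfolding zorich_return_def zorich_interval_eq
  by (rule first_return(3)[of 0]) (auto intro: gmap_R0)

text \<open>All points of an open piece follow the same word, so the count does not depend on the
  point chosen in the definition of \<open>cocycle\<close>.\<close>

lemma cocycle_eq:
  assumes "zorich_time T m \<le> zorich_time T n"
  shows "cocycle T m n = incidence (al T) (be T) (tw T) (zorich_time T m) (zorich_time T n)"
proof -
  let ?m = "zorich_time T m" and ?n = "zorich_time T n" and ?f = "zorich_return T m"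
  have "cocycle T m n $ i $ j = real (count_list (w ?m ?n i) j)" for i j
  proof -
    define x where "x = (SOME x. x \<in> zorich_piece T n i)"
    have "oJ ?n i \<noteq> {}" using lo_hi[of ?n i] by (auto simp: oJ_def intro: dense)
    then have x: "x \<in> oJ ?n i" unfolding x_def zorich_piece_eq by (metis ex_in_conv someI)
    have fr1: "(?f ^^ k) x = run (Rst T ?m) (take k (w ?m ?n i)) x" if "k \<le> length (w ?m ?n i)" for k
      by (rule first_return(1)[OF assms x zorich_return_R that])
    have fr2: "return_time ?f {0..scale T ?n} x = length (w ?m ?n i)"
      by (rule first_return(2)[OF assms x zorich_return_R])
    have "{k. k < return_time ?f (zorich_interval T n) x \<and> (?f ^^ k) x \<in> zorich_piece T m j}
        = {k. k < length (w ?m ?n i) \<and> w ?m ?n i ! k = j}"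
      unfolding zorich_interval_eq zorich_piece_eq fr2
    proof (intro Collect_cong conj_cong refl)
      fix k assume k: "k < length (w ?m ?n i)"
      have "run (Rst T ?m) (take k (w ?m ?n i)) x \<in> oJ ?m (w ?m ?n i ! k)"
        using open_orbit[OF assms x k] by simp
      then show "((?f ^^ k) x \<in> oJ ?m j) = (w ?m ?n i ! k = j)"
        using fr1[of k] k oJ_disjoint by auto
    qed
    then show ?thesis
      unfolding cocycle_def x_def[symmetric] Let_def
      by (simp add: x_def[symmetric] count_list_eq_length_filter length_filter_conv_card eq_commute[of j])
  qed
  then show ?thesis by (simp add: vec_eq_iff incidence_def)
qed

lemma rotation_eq: "rotation_number T n = ((top_row (stage T n), bot_row (stage T n)), tw T n)"
  by (simp add: rotation_number_def Let_def tw_def)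

lemma stage_rows:
  "tw T n \<Longrightarrow> top_row (stage T (Suc n)) = top_row (stage T n)"
  "\<not> tw T n \<Longrightarrow> bot_row (stage T (Suc n)) = bot_row (stage T n)"
  "tw T n \<Longrightarrow> bot_row (stage T (Suc n)) = move_after (al T n) (be T n) (bot_row (stage T n))"
  "\<not> tw T n \<Longrightarrow> top_row (stage T (Suc n)) = move_after (be T n) (al T n) (top_row (stage T n))"
  using rv_pre.rv_rows[OF stage_rv_pre, of n] by (simp_all add: tw_def al_def be_def)

text \<open>If the type were constant from some stage on, the row that ends with the winner would no
  longer change, and a single label would win forever.\<close>

lemma type_changes:
  assumes "irrational_rotation (rotation_number T)"
  shows "\<exists>m>n. tw T m \<noteq> tw T n"
proof (rule ccontr)
  assume "\<not> ?thesis"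
  then have c: "tw T m = tw T n" if "n \<le> m" for m using that by (cases "m = n") auto
  define a where "a = (if tw T n then al T n else be T n)"
  have win: "step_winner (rotation_number T m) = a" if "n \<le> m" for m
  proof (cases "tw T n")
    case True
    have "top_row (stage T m) = top_row (stage T n)"
      using that by (induction m rule: dec_induct) (use c True stage_rows(1) in auto)
    then show ?thesis using True c[OF that] by (simp add: rotation_eq a_def al_def)
  next
    case False
    have "bot_row (stage T m) = bot_row (stage T n)"
      using that by (induction m rule: dec_induct) (use c False stage_rows(2) in auto)
    then show ?thesis using False c[OF that] by (simp add: rotation_eq a_def be_def)
  qed
  have "\<exists>b. b \<noteq> a"
  proof (rule ccontr)
    assume "\<not> ?thesis"
    then have "(UNIV :: 'n set) = {a}" by auto
    then have "CARD('n) = 1" by (metis card_1_singleton_iff One_nat_def)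
    then show False using card2 by simp
  qed
  then obtain b where b: "b \<noteq> a" by blast
  have "\<exists>\<^sub>\<infinity>m. step_winner (rotation_number T m) = b"
    using assms by (auto simp: irrational_rotation_def)
  then obtain m where "m > n" "step_winner (rotation_number T m) = b"
    by (auto simp: INFM_nat)
  then show False using win[of m] b by auto
qed

lemma zorich_time_less:
  assumes "irrational_rotation (rotation_number T)"
  shows "zorich_time T n < zorich_time T (Suc n)"
  using LeastI_ex[OF type_changes[OF assms, of "zorich_time T n"]] by (simp add: tw_def)

lemma zorich_time_mono:
  assumes "irrational_rotation (rotation_number T)" "m \<le> n"
  shows "zorich_time T m \<le> zorich_time T n"
  using assms(2)
proof (induction n rule: dec_induct)
  case (step n)
  then show ?case using zorich_time_less[OF assms(1), of n] by linarith
qed simp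

end

lemma rotation_determines:
  assumes "rotation_number T = rotation_number S"
  shows "al T = al S" "be T = be S" "tw T = tw S" "zorich_time T = zorich_time S"
    "top_row (stage T n) = top_row (stage S n)" "bot_row (stage T n) = bot_row (stage S n)"
proof -
  have e: "top_row (stage T n) = top_row (stage S n) \<and> bot_row (stage T n) = bot_row (stage S n) \<and>
      top_wins (stage T n) = top_wins (stage S n)" for n
    using fun_cong[OF assms, of n] by (simp add: rotation_number_def Let_def)
  show "al T = al S" "be T = be S" "tw T = tw S"
    "top_row (stage T n) = top_row (stage S n)" "bot_row (stage T n) = bot_row (stage S n)"
    using e by (auto simp: al_def be_def tw_def)
  have "zorich_time T n = zorich_time S n" for n
    by (induction n) (use e in auto)
  then show "zorich_time T = zorich_time S" by auto
qed

section \<open>Boundary values along the renormalization\<close>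

text \<open>Values \<open>cl a\<close>, \<open>cr a\<close> at the two ends of the interval labelled \<open>a\<close> that come from a
  function on the cycles of \<open>bsigma\<close>.\<close>

definition consistent :: "'a list \<Rightarrow> 'a list \<Rightarrow> ('a \<Rightarrow> real) \<Rightarrow> ('a \<Rightarrow> real) \<Rightarrow> bool" where
  "consistent X Y cl cr \<longleftrightarrow> successively (\<lambda>a b. cr a = cl b) X \<and> successively (\<lambda>a b. cr a = cl b) Y \<and>
     cl (hd X) = cl (hd Y) \<and> cr (last X) = cr (last Y)"

lemma consistent_sym: "consistent X Y cl cr \<longleftrightarrow> consistent Y X cl cr"
  by (auto simp: consistent_def)

lemma successively_upd_last:
  assumes "distinct (X @ [a])"
  shows "successively (\<lambda>x y. (cr(a := t)) x = cl y) (X @ [a]) = successively (\<lambda>x y. cr x = cl y) (X @ [a])"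
  using assms
proof (induction X)
  case (Cons x X)
  then show ?case by (cases X) auto
qed simp

lemma successively_upd_notin:
  assumes "a \<notin> set X"
  shows "successively (\<lambda>x y. (cr(a := t)) x = cl y) X = successively (\<lambda>x y. cr x = cl y) X"
  using assms by (intro successively_cong) auto

lemma successively_ends:
  "successively P (us @ a # vs @ [b]) \<longleftrightarrow> successively P us \<and> (us \<noteq> [] \<longrightarrow> P (last us) a) \<and>
     (if vs = [] then P a b else P a (hd vs) \<and> successively P vs \<and> P (last vs) b)"
  "successively P (us @ a # b # vs) \<longleftrightarrow> successively P us \<and> (us \<noteq> [] \<longrightarrow> P (last us) a) \<and>
     P a b \<and> (vs \<noteq> [] \<longrightarrow> P b (hd vs) \<and> successively P vs)"
  by (cases vs; auto simp: successively_append_iff successively_Cons)+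

text \<open>After the move the right end of the winner meets the left end of the loser and must take
  its value. The other new adjacencies follow from \<open>cr a = cr b\<close>, which is the old
  condition at the ends of the rows.\<close>

lemma consistent_forward:
  assumes d: "distinct X" "X \<noteq> []" "last X = a" "distinct (us @ a # vs @ [b])"
    and c: "consistent X (us @ a # vs @ [b]) cl cr"
  shows "consistent X (us @ a # b # vs) cl (cr(a := cl b))" and "cr a = cr b"
proof -
  have X: "X = butlast X @ [a]" using d by (metis append_butlast_last_id)
  have ab: "a \<noteq> b" and us: "a \<notin> set us" and vs: "a \<notin> set vs" using d(4) by auto
  have l: "us \<noteq> [] \<Longrightarrow> last us \<noteq> a" "vs \<noteq> [] \<Longrightarrow> last vs \<noteq> a" using us vs last_in_set by metis+
  show crab: "cr a = cr b" using c d(3) by (simp add: consistent_def)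
  have sX: "successively (\<lambda>x y. (cr(a := cl b)) x = cl y) X"
    using c X d(1) successively_upd_last[of "butlast X" a cr "cl b" cl] by (metis consistent_def)
  have hd: "hd (us @ a # vs @ [b]) = hd (us @ a # b # vs)" by (cases us) auto
  note s = c[unfolded consistent_def successively_ends, folded hd]
  have "cl (hd X) = cl (hd (us @ a # b # vs))" using c hd by (simp add: consistent_def)
  moreover have "last (us @ a # b # vs) = (if vs = [] then b else last vs)" by simp
  ultimately show "consistent X (us @ a # b # vs) cl (cr(a := cl b))"
    unfolding consistent_def successively_ends
    using sX s ab l crab d(3) successively_upd_notin[OF us, of cr "cl b" cl]
      successively_upd_notin[OF vs, of cr "cl b" cl]
    by (cases "vs = []") auto
qed

lemma consistent_backward:
  assumes d: "distinct X" "X \<noteq> []" "last X = a" "distinct (us @ a # vs @ [b])"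
    and c: "consistent X (us @ a # b # vs) cl cr"
  shows "consistent X (us @ a # vs @ [b]) cl (cr(a := cr b))" and "cr a = cl b"
proof -
  have X: "X = butlast X @ [a]" using d by (metis append_butlast_last_id)
  have ab: "a \<noteq> b" and us: "a \<notin> set us" and vs: "a \<notin> set vs" using d(4) by auto
  have l: "us \<noteq> [] \<Longrightarrow> last us \<noteq> a" "vs \<noteq> [] \<Longrightarrow> last vs \<noteq> a" using us vs last_in_set by metis+
  show crab: "cr a = cl b" using c unfolding consistent_def successively_ends by simp
  have sX: "successively (\<lambda>x y. (cr(a := cr b)) x = cl y) X"
    using c X d(1) successively_upd_last[of "butlast X" a cr "cr b" cl] by (metis consistent_def)
  have hd: "hd (us @ a # vs @ [b]) = hd (us @ a # b # vs)" by (cases us) auto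
  have last: "last (us @ a # b # vs) = (if vs = [] then b else last vs)" by simp
  note s = c[unfolded consistent_def successively_ends last]
  have "cl (hd X) = cl (hd (us @ a # vs @ [b]))" using c hd by (simp add: consistent_def)
  then show "consistent X (us @ a # vs @ [b]) cl (cr(a := cr b))"
    unfolding consistent_def successively_ends
    using sX s ab l crab d(3) successively_upd_notin[OF us, of cr "cr b" cl]
      successively_upd_notin[OF vs, of cr "cr b" cl]
    by (cases "vs = []") auto
qed

context renormalizable
begin

abbreviation pt' :: "nat \<Rightarrow> 'n list" where "pt' n \<equiv> top_row (stage T n)"
abbreviation pb' :: "nat \<Rightarrow> 'n list" where "pb' n \<equiv> bot_row (stage T n)"

lemma row_props: "distinct (pt' n)" "set (pt' n) = UNIV" "distinct (pb' n)" "set (pb' n) = UNIV"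
  "pt' n \<noteq> []" "pb' n \<noteq> []"
proof -
  show "distinct (pt' n)" "set (pt' n) = UNIV" "distinct (pb' n)" "set (pb' n) = UNIV"
    using stage_tp[of n] by (auto simp: two_partitions_def)
  then show "pt' n \<noteq> []" "pb' n \<noteq> []" by (metis UNIV_not_empty empty_set)+
qed

definition cons_at :: "nat \<Rightarrow> ('n \<Rightarrow> real) \<Rightarrow> ('n \<Rightarrow> real) \<Rightarrow> bool" where
  "cons_at n cl cr \<longleftrightarrow> consistent (pt' n) (pb' n) cl cr"

definition winner :: "nat \<Rightarrow> 'n" where "winner n = (if tw T n then al T n else be T n)"
definition loser' :: "nat \<Rightarrow> 'n" where "loser' n = (if tw T n then be T n else al T n)"

lemma winner_neq_loser: "winner n \<noteq> loser' n"
  using al_be[of n] by (auto simp: winner_def loser'_def)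

text \<open>In both types of step one row is fixed and ends with the winner, while in the other one the
  loser moves from the end to the place after the winner.\<close>

lemma step_rows:
  obtains X us vs where "last X = winner n" "distinct X" "X \<noteq> []" "distinct (us @ winner n # vs @ [loser' n])"
    "\<And>cl cr. cons_at n cl cr \<longleftrightarrow> consistent X (us @ winner n # vs @ [loser' n]) cl cr"
    "\<And>cl cr. cons_at (Suc n) cl cr \<longleftrightarrow> consistent X (us @ winner n # loser' n # vs) cl cr"
proof (cases "tw T n")
  case t: True
  interpret S: rv_pre "stage T n" "al T n" "be T n" "rv_length (stage T n)" "cut_point (stage T n)"
    using stage_rv_pre by (simp_all add: al_def be_def)
  obtain us vs where b: "pb' n = us @ al T n # vs @ [be T n]" by (rule S.bot_split)
  then have d: "distinct (us @ al T n # vs @ [be T n])" using row_props(3)[of n] by simp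
  have "pb' (Suc n) = us @ al T n # be T n # vs"
    unfolding stage_rows(3)[OF t] b by (rule move_after_split[OF d])
  then show thesis
    using that[of "pt' n" us vs] t b d row_props[of n] stage_rows(1)[OF t]
    by (simp add: winner_def loser'_def cons_at_def al_def del: funpow.simps)
next
  case t: False
  interpret S: rv_pre "stage T n" "al T n" "be T n" "rv_length (stage T n)" "cut_point (stage T n)"
    using stage_rv_pre by (simp_all add: al_def be_def)
  obtain us vs where b: "pt' n = us @ be T n # vs @ [al T n]" by (rule S.top_split)
  then have d: "distinct (us @ be T n # vs @ [al T n])" using row_props(1)[of n] by simp
  have "pt' (Suc n) = us @ be T n # al T n # vs"
    unfolding stage_rows(4)[OF t] b by (rule move_after_split[OF d])
  moreover have "cons_at n cl cr \<longleftrightarrow> consistent (pb' n) (us @ be T n # vs @ [al T n]) cl cr" for cl cr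
    unfolding cons_at_def b[symmetric] by (rule consistent_sym)
  moreover have "cons_at (Suc n) cl cr \<longleftrightarrow> consistent (pb' (Suc n)) (us @ be T n # al T n # vs) cl cr" for cl cr
    unfolding cons_at_def calculation(1)[symmetric] by (rule consistent_sym)
  ultimately show thesis
    using that[of "pb' n" us vs] t d row_props[of n] stage_rows(2)[OF t]
    by (simp add: winner_def loser'_def be_def del: funpow.simps)
qed

text \<open>For a consistent pair, the pairing of a function on the cycles with the boundary of the
  stage-\<open>n\<close> Birkhoff sums of \<open>g\<close>.\<close>

definition bd :: "('n \<Rightarrow> real \<Rightarrow> real) \<Rightarrow> nat \<Rightarrow> ('n \<Rightarrow> real) \<Rightarrow> ('n \<Rightarrow> real) \<Rightarrow> real" where
  "bd g n cl cr = (\<Sum>a\<in>UNIV. cl a * bsum (branch T) g (w 0 n a) (lo T n a) - cr a * bsum (branch T) g (w 0 n a) (hi T n a))"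

lemma bsum_Suc:
  "bsum (branch T) g (w 0 (Suc n) a) x = (if a = loser' n
     then bsum (branch T) g (w 0 n (be T n)) x + bsum (branch T) g (w 0 n (al T n)) (Rst T n (be T n) x)
     else bsum (branch T) g (w 0 n a) x)"
  by (auto simp: rv_word_def loser'_def bsum_append Rst_def)

text \<open>The loser's Birkhoff sum splits into those over \<open>be\<close> and \<open>al\<close>.
  The end created by the cut occurs twice with the coefficient \<open>cl (loser' n)\<close> and
  opposite signs; the terms at the old right ends match by the hypothesis.\<close>

lemma bd_step:
  assumes "cr (winner n) = cr (loser' n)"
  shows "bd g (Suc n) cl (cr(winner n := cl (loser' n))) = bd g n cl cr"
proof -
  let ?a = "al T n" and ?b = "be T n"
  let ?B = "\<lambda>a x. bsum (branch T) g (w 0 n a) x"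
  let ?cr = "cr(winner n := cl (loser' n))"
  have split: "(\<Sum>a\<in>UNIV. F a) = F ?a + F ?b + (\<Sum>a\<in>UNIV - {?a, ?b}. F a)" for F :: "'n \<Rightarrow> real"
  proof -
    have "UNIV = insert ?a (insert ?b (UNIV - {?a, ?b}))" by auto
    then have "(\<Sum>a\<in>UNIV. F a) = (\<Sum>a\<in>insert ?a (insert ?b (UNIV - {?a, ?b})). F a)" by simp
    also have "\<dots> = F ?a + F ?b + (\<Sum>a\<in>UNIV - {?a, ?b}. F a)"
      using al_be[of n] by (subst sum.insert; simp)
    finally show ?thesis .
  qed
  have rest: "(\<Sum>a\<in>UNIV - {?a, ?b}. cl a * bsum (branch T) g (w 0 (Suc n) a) (lo T (Suc n) a)
      - ?cr a * bsum (branch T) g (w 0 (Suc n) a) (hi T (Suc n) a))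
      = (\<Sum>a\<in>UNIV - {?a, ?b}. cl a * ?B a (lo T n a) - cr a * ?B a (hi T n a))"
  proof (rule sum.cong[OF refl])
    fix a assume a: "a \<in> UNIV - {?a, ?b}"
    then have "a \<noteq> loser' n" "a \<noteq> winner n" by (auto simp: loser'_def winner_def)
    moreover have "lo T (Suc n) a = lo T n a" "hi T (Suc n) a = hi T n a"
      using a lo_top[of n a] lo_bot[of n a] hi_top[of n a] hi_bot[of n a] by (cases "tw T n"; simp)+
    ultimately show "cl a * bsum (branch T) g (w 0 (Suc n) a) (lo T (Suc n) a)
      - ?cr a * bsum (branch T) g (w 0 (Suc n) a) (hi T (Suc n) a) = cl a * ?B a (lo T n a) - cr a * ?B a (hi T n a)"
      unfolding bsum_Suc by simp
  qed
  show ?thesis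
  proof (cases "tw T n")
    case t: True
    have wl: "winner n = ?a" "loser' n = ?b" using t by (auto simp: winner_def loser'_def)
    have e: "lo T (Suc n) ?a = lo T n ?a" "lo T (Suc n) ?b = lo T n ?b" "hi T (Suc n) ?b = hi T n ?b"
      using lo_top[OF t] hi_top[OF t] al_be[of n] by auto
    have r: "Rst T n ?b (lo T n ?b) = hi T (Suc n) ?a" "Rst T n ?b (hi T n ?b) = hi T n ?a"
      using hi_top_al[OF t] hi_al_top[OF t] by auto
    show ?thesis
      unfolding bd_def split rest unfolding bsum_Suc
      using al_be[of n] assms by (simp add: wl e r algebra_simps)
  next
    case t: False
    have wl: "winner n = ?b" "loser' n = ?a" using t by (auto simp: winner_def loser'_def)
    have e: "lo T (Suc n) ?b = lo T n ?b" "hi T (Suc n) ?a = hi T n ?b" "lo T (Suc n) ?a = hi T (Suc n) ?b"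
      using lo_bot[OF t] hi_bot_al[OF t] lo_bot_al[OF t] al_be[of n] by auto
    have r: "Rst T n ?b (hi T (Suc n) ?b) = lo T n ?a" "Rst T n ?b (hi T n ?b) = hi T n ?a"
      using R_cut_bot[OF t] R_hi_bot[OF t] by auto
    show ?thesis
      unfolding bd_def split rest unfolding bsum_Suc
      using al_be[of n] assms by (simp add: wl e r algebra_simps)
  qed
qed

text \<open>A step only copies values from one end to another, so the bound \<open>M\<close>
  survives any number of steps.\<close>

lemma cons_forward:
  assumes "cons_at 0 cl cr" "\<And>a. \<bar>cl a\<bar> \<le> M \<and> \<bar>cr a\<bar> \<le> M"
  shows "\<exists>cl' cr'. cons_at n cl' cr' \<and> (\<forall>a. \<bar>cl' a\<bar> \<le> M \<and> \<bar>cr' a\<bar> \<le> M) \<and> (\<forall>g. bd g n cl' cr' = bd g 0 cl cr)"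
proof (induction n)
  case 0 then show ?case using assms by blast
next
  case (Suc n)
  then obtain cl' cr' where c: "cons_at n cl' cr'" "\<forall>a. \<bar>cl' a\<bar> \<le> M \<and> \<bar>cr' a\<bar> \<le> M"
    "\<forall>g. bd g n cl' cr' = bd g 0 cl cr" by blast
  obtain X us vs where X: "last X = winner n" "distinct X" "X \<noteq> []" "distinct (us @ winner n # vs @ [loser' n])"
    "\<And>cl cr. cons_at n cl cr \<longleftrightarrow> consistent X (us @ winner n # vs @ [loser' n]) cl cr"
    "\<And>cl cr. cons_at (Suc n) cl cr \<longleftrightarrow> consistent X (us @ winner n # loser' n # vs) cl cr"
    using step_rows by metis
  note f = consistent_forward[OF X(2,3,1,4) c(1)[unfolded X(5)]]
  let ?cr = "cr'(winner n := cl' (loser' n))"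
  have "cons_at (Suc n) cl' ?cr" using f(1) X(6) by simp
  moreover have "\<forall>a. \<bar>cl' a\<bar> \<le> M \<and> \<bar>?cr a\<bar> \<le> M" using c(2) by simp
  moreover have "\<forall>g. bd g (Suc n) cl' ?cr = bd g 0 cl cr" using bd_step[OF f(2)] c(3) by simp
  ultimately show ?case by blast
qed

text \<open>The copying of values can be undone, so every consistent pair at stage \<open>n\<close>
  comes from one at stage 0; a boundary that vanishes at stage 0 thus vanishes at all
  stages.\<close>

lemma cons_backward:
  assumes "cons_at n cl cr" "\<And>a. \<bar>cl a\<bar> \<le> M \<and> \<bar>cr a\<bar> \<le> M"
  shows "\<exists>cl' cr'. cons_at 0 cl' cr' \<and> (\<forall>a. \<bar>cl' a\<bar> \<le> M \<and> \<bar>cr' a\<bar> \<le> M) \<and> (\<forall>g. bd g n cl cr = bd g 0 cl' cr')"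
  using assms
proof (induction n arbitrary: cl cr)
  case 0 then show ?case by blast
next
  case (Suc n)
  obtain X us vs where X: "last X = winner n" "distinct X" "X \<noteq> []" "distinct (us @ winner n # vs @ [loser' n])"
    "\<And>cl cr. cons_at n cl cr \<longleftrightarrow> consistent X (us @ winner n # vs @ [loser' n]) cl cr"
    "\<And>cl cr. cons_at (Suc n) cl cr \<longleftrightarrow> consistent X (us @ winner n # loser' n # vs) cl cr"
    using step_rows by metis
  note b = consistent_backward[OF X(2,3,1,4) Suc.prems(1)[unfolded X(6)]]
  let ?cr = "cr(winner n := cr (loser' n))"
  have "?cr (winner n) = ?cr (loser' n)" using winner_neq_loser[of n] by simp
  \<comment> \<open>The forward update of \<open>?cr\<close> gives back \<open>cr\<close>, because
    \<open>consistent_backward\<close> yields \<open>cr (winner n) = cl (loser' n)\<close>.\<close>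
  from bd_step[OF this, of _ cl] have "bd g n cl ?cr = bd g (Suc n) cl cr" for g
    using b(2) by (metis fun_upd_triv fun_upd_upd)
  moreover have "cons_at n cl ?cr" using b(1) X(5) by simp
  moreover have "\<And>a. \<bar>cl a\<bar> \<le> M \<and> \<bar>?cr a\<bar> \<le> M" using Suc.prems(2) by simp
  ultimately show ?case using Suc.IH[of cl ?cr] by metis
qed

end

section \<open>Incidence matrices of return words\<close>

lemma incidence_mult:
  "(incidence a b t m n *v v) $ i = (\<Sum>j\<leftarrow>return_word a b t m n i. v $ j)"
proof -
  have "(\<Sum>j\<in>UNIV. real (count_list ws j) * v $ j) = (\<Sum>j\<leftarrow>ws. v $ j)" for ws
  proof (induction ws)
    case (Cons x ws)
    have "(\<Sum>j\<in>UNIV. real (count_list (x # ws) j) * v $ j)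
      = (\<Sum>j\<in>UNIV. (if j = x then v $ j else 0) + real (count_list ws j) * v $ j)"
      by (intro sum.cong refl) (auto simp: distrib_right)
    then show ?case using Cons by (simp add: sum.distrib)
  qed simp
  then show ?thesis by (simp add: matrix_vector_mult_def incidence_def)
qed

lemma bsum_const: "bsum R (\<lambda>b x. v $ b) ws x = (\<Sum>j\<leftarrow>ws. v $ j)"
  by (induction ws arbitrary: x) auto

lemma sum_list_concat_map: "(\<Sum>j\<leftarrow>concat (map f ws). (g j :: real)) = (\<Sum>b\<leftarrow>ws. \<Sum>j\<leftarrow>f b. g j)"
  by (induction ws) auto

lemma incidence_trans:
  assumes "m \<le> n" "n \<le> p"
  shows "incidence a b t m p = incidence a b t n p ** incidence a b t m n"
proof -
  have "incidence a b t m p *v v = (incidence a b t n p ** incidence a b t m n) *v v" for v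
    unfolding matrix_vector_mul_assoc[symmetric] vec_eq_iff incidence_mult
      return_word_trans[OF assms] sum_list_concat_map by simp
  then show ?thesis by (simp add: matrix_eq)
qed

lemma incidence_refl: "incidence a b t n n = mat 1"
proof -
  have "incidence a b t n n *v v = mat 1 *v v" for v
    by (simp add: vec_eq_iff incidence_mult return_word_le)
  then show ?thesis by (simp add: matrix_eq)
qed

lemma incidence_step_invertible:
  assumes "a n \<noteq> b n"
  shows "invertible (incidence a b t n (Suc n))"
proof -
  let ?E = "incidence a b t n (Suc n)"
  have "v = 0" if "?E *v v = 0" for v
  proof -
    have e: "(\<Sum>j\<leftarrow>rv_word (a n) (b n) (t n) i. v $ j) = 0" for i
    proof -
      have "(?E *v v) $ i = 0" using that by simp
      then show ?thesis unfolding incidence_mult by (simp add: return_word_le sum_list_concat_map)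
    qed
    define l where "l = (if t n then b n else a n)"
    have nl: "v $ i = 0" if "i \<noteq> l" for i using e[of i] that by (simp add: rv_word_def l_def)
    have "v $ b n + v $ a n = 0" using e[of l] by (simp add: rv_word_def l_def split: if_splits)
    then have "v $ l = 0" using nl[of "a n"] nl[of "b n"] assms by (auto simp: l_def split: if_splits)
    then have "v $ i = 0" for i using nl by (cases "i = l") auto
    then show "v = 0" by (simp add: vec_eq_iff)
  qed
  then have "inj ((*v) ?E)" by (intro injI) (metis eq_iff_diff_eq_0 matrix_vector_mult_diff_distrib)
  then show ?thesis by (simp add: invertible_left_inverse matrix_left_invertible_injective inj_def)
qed

lemma incidence_invertible:
  assumes "\<And>n. a n \<noteq> b n" "m \<le> n"
  shows "invertible (incidence a b t m n)"
  using assms(2)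
proof (induction n rule: dec_induct)
  case base show ?case unfolding incidence_refl invertible_def by (intro exI[of _ "mat 1"]) simp
next
  case (step n)
  then show ?case
    using incidence_trans[of m n "Suc n" a b t] incidence_step_invertible[of a n b t, OF assms(1)]
    by (simp add: invertible_mult)
qed

section \<open>The intersection form\<close>

lemma rank_nullity_on:
  fixes f :: "'a::euclidean_space \<Rightarrow> 'b::euclidean_space"
  assumes f: "linear f" and V: "subspace V"
  shows "dim (f ` V) + dim {x \<in> V. f x = 0} = dim V"
proof -
  let ?K = "{x \<in> V. f x = 0}"
  let ?C = "{y \<in> V. \<forall>x\<in>?K. orthogonal x y}"
  have K: "subspace ?K"
    using V f by (auto simp: subspace_def linear_add linear_scale linear_0)
  have C: "subspace ?C"
    using V by (auto simp: subspace_def orthogonal_def inner_right_distrib)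
  have d: "dim ?C + dim ?K = dim V"
    by (rule dim_subspace_orthogonal_to_vectors[OF K V]) auto
  have inj: "inj_on f (span ?C)"
  proof -
    have "x = 0" if "x \<in> ?C" "f x = 0" for x using that by (auto simp: orthogonal_def)
    then show ?thesis
      using linear_injective_on_subspace_0[OF f C] C by (simp add: span_eq_iff[THEN iffD2])
  qed
  have "f ` V \<subseteq> f ` ?C"
  proof
    fix y assume "y \<in> f ` V"
    then obtain x where x: "x \<in> V" "y = f x" by auto
    obtain u v where uv: "u \<in> span ?K" "\<And>z. z \<in> span ?K \<Longrightarrow> orthogonal v z" "x = u + v"
      using orthogonal_subspace_decomp_exists[of ?K x] by blast
    then have u: "u \<in> V" "f u = 0" using K by (auto simp: span_eq_iff[THEN iffD2])
    have "v = x - u" using uv by simp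
    then have "v \<in> V" using u x V by (simp add: subspace_diff)
    moreover have "orthogonal z v" if "z \<in> ?K" for z
      using uv(2)[of z] that span_base[of z ?K] by (simp add: orthogonal_commute)
    moreover have "y = f v" using x uv u f by (simp add: linear_add)
    ultimately show "y \<in> f ` ?C" by blast
  qed
  then have "f ` V = f ` ?C" by auto
  then show ?thesis using dim_image_eq[OF f inj] d by simp
qed

text \<open>The component of \<open>v\<close> orthogonal to the range is annihilated by
  \<open>A\<close>, by skewness, hence orthogonal to \<open>v\<close> and therefore zero.\<close>

lemma skew_range:
  fixes A :: "'a::euclidean_space \<Rightarrow> 'a"
  assumes A: "linear A" and skew: "\<And>x y. x \<bullet> A y = - (A x \<bullet> y)"
  shows "range A = {v. \<forall>x. A x = 0 \<longrightarrow> x \<bullet> v = 0}"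
proof
  show "range A \<subseteq> {v. \<forall>x. A x = 0 \<longrightarrow> x \<bullet> v = 0}" using skew by auto
  have R: "subspace (range A)" using linear_subspace_image[OF A subspace_UNIV] .
  show "{v. \<forall>x. A x = 0 \<longrightarrow> x \<bullet> v = 0} \<subseteq> range A"
  proof
    fix v assume v: "v \<in> {v. \<forall>x. A x = 0 \<longrightarrow> x \<bullet> v = 0}"
    obtain y z where yz: "y \<in> span (range A)" "\<And>u. u \<in> span (range A) \<Longrightarrow> orthogonal z u" "v = y + z"
      using orthogonal_subspace_decomp_exists[of "range A" v] by blast
    have "A z \<bullet> u = 0" for u
      using yz(2)[of "A u"] skew[of z u] by (simp add: span_base orthogonal_def)
    then have "A z = 0" by (metis inner_eq_zero_iff)
    then have "z \<bullet> v = 0" using v by simp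
    moreover have "z \<bullet> y = 0" using yz(1,2) by (simp add: orthogonal_def)
    ultimately have "z = 0" using yz(3) by (simp add: inner_right_distrib)
    then show "v \<in> range A" using yz R by (simp add: span_eq_iff[THEN iffD2])
  qed
qed

text \<open>A maximal isotropic subspace is its own symplectic complement.\<close>

lemma skew_rank_even:
  fixes A :: "'a::euclidean_space \<Rightarrow> 'a"
  assumes A: "linear A" and skew: "\<And>x y. x \<bullet> A y = - (A x \<bullet> y)"
  shows "even (DIM('a) - dim {x. A x = 0})"
proof -
  let ?iso = "\<lambda>L. subspace L \<and> {x. A x = 0} \<subseteq> L \<and> (\<forall>x\<in>L. \<forall>y\<in>L. x \<bullet> A y = 0)"
  have K: "subspace {x. A x = 0}" using A by (auto simp: subspace_def linear_add linear_scale linear_0)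
  have "\<exists>L. ?iso L \<and> (\<forall>L'. ?iso L' \<longrightarrow> dim L' \<le> dim L)"
  proof (rule ex_has_greatest_nat[of ?iso "{x. A x = 0}" dim "Suc DIM('a)"])
    show "?iso {x. A x = 0}" using K by simp
  qed (simp add: dim_subset_UNIV less_Suc_eq_le)
  then obtain L where L: "subspace L" "{x. A x = 0} \<subseteq> L" "\<And>x y. x \<in> L \<Longrightarrow> y \<in> L \<Longrightarrow> x \<bullet> A y = 0"
    and mx: "\<And>L'. ?iso L' \<Longrightarrow> dim L' \<le> dim L" by blast
  have sub: "{y \<in> UNIV. \<forall>x\<in>A ` L. orthogonal x y} \<subseteq> L"
  proof
    fix y assume "y \<in> {y \<in> UNIV. \<forall>x\<in>A ` L. orthogonal x y}"
    then have y: "A l \<bullet> y = 0" "y \<bullet> A l = 0" if "l \<in> L" for l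
      using that by (auto simp: orthogonal_def inner_commute)
    \<comment> \<open>Every vector is isotropic by itself, so adjoining \<open>y\<close> keeps
      \<open>L\<close> isotropic; maximality then forces \<open>y\<close> into
      \<open>L\<close>.\<close>
    have yy: "y \<bullet> A y = 0" using skew[of y y] by (simp add: inner_commute)
    have "?iso (span (insert y L))"
    proof (intro conjI ballI)
      show "subspace (span (insert y L))" by simp
      show "{x. A x = 0} \<subseteq> span (insert y L)" using L(2) span_superset[of "insert y L"] by blast
      fix u v assume uv: "u \<in> span (insert y L)" "v \<in> span (insert y L)"
      have sL: "span L = L" using L(1) by (simp add: span_eq_iff)
      obtain a where a: "u - a *\<^sub>R y \<in> L" using uv(1) span_breakdown_eq[of u y L] sL by auto
      obtain b where b: "v - b *\<^sub>R y \<in> L" using uv(2) span_breakdown_eq[of v y L] sL by auto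
      define u' v' where "u' = u - a *\<^sub>R y" and "v' = v - b *\<^sub>R y"
      have "u = u' + a *\<^sub>R y" "v = v' + b *\<^sub>R y" by (simp_all add: u'_def v'_def)
      moreover have "u' \<bullet> A v' = 0" "u' \<bullet> A y = 0" "y \<bullet> A v' = 0"
        using L(3)[of u' v'] a b y[of v'] y[of u'] skew[of u' y] by (auto simp: u'_def v'_def)
      ultimately show "u \<bullet> A v = 0"
        using A yy by (simp add: linear_add linear_scale inner_left_distrib inner_right_distrib)
    qed
    then have "dim (span (insert y L)) \<le> dim L" by (rule mx)
    then have "L = span (insert y L)"
      using L(1) span_superset[of "insert y L"] by (intro subspace_dim_equal) auto
    then show "y \<in> L" using span_superset[of "insert y L"] by blast
  qed
  moreover have "L \<subseteq> {y \<in> UNIV. \<forall>x\<in>A ` L. orthogonal x y}"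
    using L(3) by (auto simp: orthogonal_def inner_commute)
  ultimately have eq: "{y \<in> UNIV. \<forall>x\<in>A ` L. orthogonal x y} = L" by blast
  have "dim L + dim (A ` L) = DIM('a)"
    using dim_subspace_orthogonal_to_vectors[OF linear_subspace_image[OF A L(1)] subspace_UNIV] eq
    by (simp add: dim_UNIV)
  moreover have "{x \<in> L. A x = 0} = {x. A x = 0}" using L(2) by auto
  then have "dim (A ` L) + dim {x. A x = 0} = dim L" using rank_nullity_on[OF A L(1)] by simp
  ultimately have "DIM('a) - dim {x. A x = 0} = 2 * dim (A ` L)" by linarith
  then show ?thesis by simp
qed

text \<open>Isotropy puts \<open>G\<close> inside the orthogonal complement \<open>?P\<close> of the
  preimage \<open>?Y\<close> of \<open>G\<close>. Rank and nullity compute the dimension of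
  \<open>?P\<close>, and the hypothesis on dimensions leaves no room between the two.\<close>

lemma lagrangian_complement:
  fixes A :: "'a::euclidean_space \<Rightarrow> 'a"
  assumes A: "linear A" and skew: "\<And>x y. x \<bullet> A y = - (A x \<bullet> y)"
    and G: "subspace G" "G \<subseteq> range A" "\<And>x y. A x \<in> G \<Longrightarrow> A y \<in> G \<Longrightarrow> x \<bullet> A y = 0"
    and d: "DIM('a) \<le> dim {x. A x = 0} + 2 * dim G"
    and c: "\<And>y. A y \<in> G \<Longrightarrow> c \<bullet> y = 0"
  shows "c \<in> G"
proof -
  let ?Y = "{y. A y \<in> G}"
  let ?P = "{z \<in> UNIV. \<forall>y\<in>?Y. orthogonal y z}"
  have Y: "subspace ?Y" using A G(1) by (auto simp: subspace_def linear_add linear_scale linear_0)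
  have "A ` ?Y = G" using G(2) by auto
  moreover have "{x \<in> ?Y. A x = 0} = {x. A x = 0}" using G(1) by (auto simp: subspace_0)
  ultimately have dY: "dim G + dim {x. A x = 0} = dim ?Y" using rank_nullity_on[OF A Y] by simp
  have dP: "dim ?P + dim ?Y = DIM('a)"
    using dim_subspace_orthogonal_to_vectors[OF Y subspace_UNIV] by (simp add: dim_UNIV)
  have P: "subspace ?P" by (auto simp: subspace_def orthogonal_def inner_right_distrib)
  have "G \<subseteq> ?P"
  proof
    fix g assume g: "g \<in> G"
    then obtain x where x: "g = A x" using G(2) by auto
    have "y \<bullet> g = 0" if "A y \<in> G" for y
      using G(3)[of y x] that x g by simp
    then show "g \<in> ?P" by (auto simp: orthogonal_def)
  qed
  then have "G = ?P" using dY dP d by (intro subspace_dim_equal[OF G(1) P]) auto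
  moreover have "c \<in> ?P" using c by (auto simp: orthogonal_def inner_commute)
  ultimately show ?thesis by blast
qed

section \<open>The boundary operator and the cycles of \<open>bsigma\<close>\<close>

lemma pos_nth: "distinct xs \<Longrightarrow> i < length xs \<Longrightarrow> pos xs (xs ! i) = i"
proof -
  assume d: "distinct xs" "i < length xs"
  have "xs = take i xs @ xs ! i # drop (Suc i) xs" using d by (simp add: id_take_nth_drop[symmetric])
  moreover have "takeWhile (\<lambda>x. x \<noteq> xs ! i) (take i xs @ xs ! i # drop (Suc i) xs) = take i xs"
    using d by (subst takeWhile_append2) (auto simp: in_set_conv_nth nth_eq_iff_index_eq)
  ultimately show "pos xs (xs ! i) = i" using d unfolding pos_def by simp
qed

lemma nth_pos: "a \<in> set xs \<Longrightarrow> xs ! pos xs a = a \<and> pos xs a < length xs"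
proof -
  assume "a \<in> set xs"
  from split_list_first[OF this] obtain us vs where x: "xs = us @ a # vs" "a \<notin> set us" by blast
  have "takeWhile (\<lambda>x. x \<noteq> a) (us @ a # vs) = us" using x(2) by (induction us) auto
  then show ?thesis using x(1) by (simp add: pos_def)
qed

text \<open>A surjection of a finite set onto itself is a permutation, so its orbits are cycles and
  partition the set.\<close>

lemma orbit_partition:
  assumes fin: "finite X" and im: "f ` X = X" and x: "x \<in> X"
  shows "x \<in> orbit f x" "orbit f x \<subseteq> X" "y \<in> orbit f x \<Longrightarrow> orbit f y = orbit f x"
proof -
  define g where "g x = (if x \<in> X then f x else x)" for x
  have inj: "inj_on f X" using fin im by (simp add: eq_card_imp_inj_on)
  have "bij_betw g X X" unfolding g_def using inj im by (auto simp: bij_betw_def inj_on_def)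
  then have g: "g permutes X" by (intro bij_imp_permutes) (auto simp: g_def)
  have perm: "permutation g" using g fin permutation_permutes by blast
  have eq: "orbit f z = orbit g z" if "z \<in> X" for z
    by (rule orbit_cong0[of _ X]) (use that im in \<open>auto simp: g_def\<close>)
  show "x \<in> orbit f x" unfolding eq[OF x] by (rule permutation_self_in_orbit[OF perm])
  show sub: "orbit f x \<subseteq> X" unfolding eq[OF x] by (rule permutes_orbit_subset[OF g x])
  show "orbit f y = orbit f x" if "y \<in> orbit f x"
    using that sub eq[OF x] eq[of y] orbit_cyclic_eq3[OF cyclic_on_orbit[OF g fin]] by auto
qed

text \<open>The function on the symbols from which a consistent pair comes. \<open>SymU\<close> of
  the last index has no interval to its right and takes the right value of the last label.\<close>

definition sym_fun :: "'a list \<Rightarrow> 'a list \<Rightarrow> ('a \<Rightarrow> real) \<Rightarrow> ('a \<Rightarrow> real) \<Rightarrow> bsym \<Rightarrow> real" where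
  "sym_fun X Y cl cr x = (case x of
     SymU i \<Rightarrow> if i < length X then cl (X ! i) else cr (last X) | SymV j \<Rightarrow> cl (Y ! j))"

section \<open>The symbols of two rows, the cycles of \<open>bsigma\<close> and the functions
  constant on them\<close>

locale two_rows =
  fixes X Y :: "'n::finite list" and d :: nat
  assumes X: "distinct X" "set X = UNIV" and Y: "distinct Y" "set Y = UNIV" and d: "d = CARD('n)"
begin

lemma lens: "length X = d" "length Y = d" "d > 0" "X \<noteq> []" "Y \<noteq> []"
proof -
  show l: "length X = d" "length Y = d"
    using distinct_card[OF X(1)] X(2) distinct_card[OF Y(1)] Y(2) d by simp_all
  show p: "d > 0" by (simp add: d)
  show "X \<noteq> []" "Y \<noteq> []" using l p by (metis length_0_conv less_irrefl)+
qed

lemma posX: "X ! pos X a = a" "pos X a < d" and posY: "Y ! pos Y a = a" "pos Y a < d"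
  using nth_pos[of a X] nth_pos[of a Y] X Y lens by auto

lemma ends: "hd X = X ! 0" "last X = X ! (d - 1)" "hd Y = Y ! 0" "last Y = Y ! (d - 1)"
  using lens by (simp_all add: hd_conv_nth last_conv_nth)

lemma adjacent: "successively P X \<longleftrightarrow> (\<forall>i. Suc i < d \<longrightarrow> P (X ! i) (X ! Suc i))"
  "successively P Y \<longleftrightarrow> (\<forall>i. Suc i < d \<longrightarrow> P (Y ! i) (Y ! Suc i))"
  using lens by (simp_all add: successively_conv_nth)

abbreviation \<sigma> :: "bsym \<Rightarrow> bsym" where "\<sigma> \<equiv> bsigma X Y"

lemma symbols_iff: "x \<in> symbols d \<longleftrightarrow> (\<exists>i\<le>d. x = SymU i) \<or> (\<exists>j. 0 < j \<and> j < d \<and> x = SymV j)"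
  by (force simp: symbols_def symV_def image_iff)

lemma symbols_cases:
  assumes "x \<in> symbols d"
  obtains i where "i < d" "x = SymU i" | "x = SymU d" | j where "0 < j" "j < d" "x = SymV j"
  using assms unfolding symbols_iff by (metis le_neq_implies_less)

lemma finite_symbols: "finite (symbols d)"
  by (simp add: symbols_def)

lemma \<sigma>_U: "i < d \<Longrightarrow> \<sigma> (SymU i) = symV d (pos Y (X ! i))"
  and \<sigma>_d: "\<sigma> (SymU d) = SymU (Suc (pos X (Y ! (d - 1))))"
  and \<sigma>_V: "\<sigma> (SymV k) = SymU (Suc (pos X (Y ! (k - 1))))"
  using lens by simp_all

lemma \<sigma>_image: "\<sigma> ` symbols d = symbols d"
proof
  show "\<sigma> ` symbols d \<subseteq> symbols d"
  proof
    fix y assume "y \<in> \<sigma> ` symbols d"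
    then obtain x where x: "x \<in> symbols d" "y = \<sigma> x" by auto
    from x(1) show "y \<in> symbols d"
    proof (cases rule: symbols_cases)
      case (1 i)
      have "y = symV d (pos Y (X ! i))" using 1 x \<sigma>_U by simp
      then show ?thesis using posY(2)[of "X ! i"] by (auto simp: symbols_iff symV_def)
    next
      case 2
      then show ?thesis using x \<sigma>_d posX(2)[of "Y ! (d - 1)"] by (auto simp: symbols_iff)
    next
      case (3 j)
      then show ?thesis using x \<sigma>_V posX(2)[of "Y ! (j - 1)"] by (auto simp: symbols_iff)
    qed
  qed
  show "symbols d \<subseteq> \<sigma> ` symbols d"
  proof
    fix y assume y: "y \<in> symbols d"
    have U: "SymU i \<in> symbols d" if "i \<le> d" for i using that by (auto simp: symbols_iff)
    have V: "symV d j \<in> \<sigma> ` symbols d" if "j < d" for j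
    proof (rule image_eqI)
      have "pos Y (X ! pos X (Y ! j)) = j" using posX(1)[of "Y ! j"] pos_nth[OF Y(1), of j] lens that by metis
      then show "symV d j = \<sigma> (SymU (pos X (Y ! j)))" using \<sigma>_U[OF posX(2)] by metis
      show "SymU (pos X (Y ! j)) \<in> symbols d" using posX(2) by (intro U less_imp_le)
    qed
    have U': "SymU (Suc i) \<in> \<sigma> ` symbols d" if i: "i < d" for i
    proof -
      let ?p = "pos Y (X ! i)"
      have e: "Suc (pos X (Y ! ?p)) = Suc i" using posY(1)[of "X ! i"] pos_nth[OF X(1), of i] i lens by metis
      show ?thesis
      proof (cases "Suc ?p = d")
        case True
        then have "?p = d - 1" by simp
        then have "\<sigma> (SymU d) = SymU (Suc i)" using \<sigma>_d e by metis
        then show ?thesis using U[of d] by (metis image_eqI order_refl)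
      next
        case False
        then have "SymV (Suc ?p) \<in> symbols d" using posY(2)[of "X ! i"] by (auto simp: symbols_iff)
        moreover have "\<sigma> (SymV (Suc ?p)) = SymU (Suc i)" unfolding \<sigma>_V diff_Suc_1 e ..
        ultimately show ?thesis by (metis image_eqI)
      qed
    qed
    from y show "y \<in> \<sigma> ` symbols d"
    proof (cases rule: symbols_cases)
      case (3 j)
      then show ?thesis using V[of j] by (simp add: symV_def)
    next
      case (1 i)
      then show ?thesis using V[of 0] U'[of "i - 1"] lens(3) by (cases i) (auto simp: symV_def)
    next
      case 2
      then show ?thesis using U'[of "d - 1"] lens(3) by simp
    qed
  qed
qed

lemmas orbit_facts = orbit_partition[OF finite_symbols \<sigma>_image]

text \<open>Each case of \<open>bsigma\<close> moves between the rows around one label, and the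
  equality of values is one of the adjacency or end conditions of \<open>consistent\<close>.\<close>

lemma sym_fun_invariant:
  assumes c: "consistent X Y cl cr" and x: "x \<in> symbols d"
  shows "sym_fun X Y cl cr (\<sigma> x) = sym_fun X Y cl cr x"
proof -
  have aX: "cr (X ! i) = cl (X ! Suc i)" if "Suc i < d" for i using c that by (simp add: consistent_def adjacent)
  have aY: "cr (Y ! i) = cl (Y ! Suc i)" if "Suc i < d" for i using c that by (simp add: consistent_def adjacent)
  have h: "cl (X ! 0) = cl (Y ! 0)" "cr (X ! (d - 1)) = cr (Y ! (d - 1))"
    using c by (simp_all add: consistent_def ends)
  have Usuc: "sym_fun X Y cl cr (SymU (Suc (pos X a))) = cr a" for a
  proof (cases "Suc (pos X a) < d")
    case True
    then show ?thesis using aX[of "pos X a"] posX(1)[of a] lens(1) by (simp add: sym_fun_def)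
  next
    case False
    then have p: "d - 1 = pos X a" "Suc (pos X a) = d" using posX(2)[of a] by auto
    have "cr (last X) = cr a" using ends(2) p(1) posX(1)[of a] by simp
    then show ?thesis using p(2) lens(1) by (simp add: sym_fun_def)
  qed
  from x show ?thesis
  proof (cases rule: symbols_cases)
    case (1 i)
    then show ?thesis using posY[of "X ! i"] h lens
      by (cases "pos Y (X ! i) = 0") (auto simp: sym_fun_def symV_def)
  next
    case 2
    then show ?thesis using Usuc[of "Y ! (d - 1)"] h lens ends \<sigma>_d by (simp add: sym_fun_def)
  next
    case (3 j)
    then show ?thesis using Usuc[of "Y ! (j - 1)"] aY[of "j - 1"] \<sigma>_V by (simp add: sym_fun_def)
  qed
qed

lemma sym_fun_orbit:
  assumes c: "consistent X Y cl cr" and x: "x \<in> symbols d" and y: "y \<in> orbit \<sigma> x"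
  shows "sym_fun X Y cl cr y = sym_fun X Y cl cr x"
  using y
proof (induction rule: orbit.induct)
  case base then show ?case using sym_fun_invariant[OF c x] .
next
  case (step y)
  then have "y \<in> symbols d" using orbit_facts(2)[OF x] by auto
  then show ?case using sym_fun_invariant[OF c] step by simp
qed

definition cycles :: "bsym set set" where "cycles = orbit \<sigma> ` symbols d"

lemma finite_cycles: "finite cycles"
  using finite_symbols by (simp add: cycles_def)

lemma cycle_unique:
  assumes "x \<in> symbols d" "C \<in> cycles"
  shows "x \<in> C \<longleftrightarrow> C = orbit \<sigma> x"
proof -
  obtain z where z: "z \<in> symbols d" "C = orbit \<sigma> z" using assms(2) by (auto simp: cycles_def)
  show ?thesis using orbit_facts(1)[OF assms(1)] orbit_facts(3)[OF z(1), of x] z(2) by blast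
qed

text \<open>Regrouped by break points of the top row, the pairing is a sum of common value times
  jump. The value is constant on each cycle, and the jumps over a cycle add up to 0.\<close>

lemma consistent_pairing:
  assumes c: "consistent X Y cl cr"
    and B: "\<And>C. C \<in> cycles \<Longrightarrow> (\<Sum>i | i \<le> d \<and> SymU i \<in> C. r i - l i) = 0"
    and r: "r d = 0" "\<And>i. i < d \<Longrightarrow> r i = p (X ! i)"
    and l: "l 0 = 0" "\<And>i. i < d \<Longrightarrow> l (Suc i) = q (X ! i)"
  shows "(\<Sum>a\<in>UNIV. cl a * p a - cr a * q a) = (0::real)"
proof -
  let ?c = "\<lambda>i. sym_fun X Y cl cr (SymU i)"
  have U: "SymU i \<in> symbols d" if "i \<le> d" for i using that by (auto simp: symbols_iff)
  have bij: "bij_betw ((!) X) {..<d} UNIV" using bij_betw_nth[OF X(1), of "{..<d}" UNIV] lens X by auto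
  have cl: "cl (X ! i) = ?c i" if "i < d" for i using that lens by (simp add: sym_fun_def)
  have cr: "cr (X ! i) = ?c (Suc i)" if "i < d" for i
  proof (cases "Suc i < d")
    case True
    then show ?thesis using c lens by (simp add: sym_fun_def consistent_def adjacent)
  next
    case False
    then have "i = d - 1" using that by simp
    then show ?thesis using lens ends False by (simp add: sym_fun_def)
  qed
  have "(\<Sum>a\<in>UNIV. cl a * p a - cr a * q a) = (\<Sum>i<d. cl (X ! i) * p (X ! i) - cr (X ! i) * q (X ! i))"
    by (rule sum.reindex_bij_betw[OF bij, symmetric])
  also have "\<dots> = (\<Sum>i<d. ?c i * r i - ?c (Suc i) * l (Suc i))"
    using r l cl cr by (intro sum.cong) auto
  also have "\<dots> = (\<Sum>i<d. ?c i * r i) - (\<Sum>i<d. ?c (Suc i) * l (Suc i))" by (rule sum_subtractf)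
  \<comment> \<open>The conventions \<open>r d = 0\<close> and \<open>l 0 = 0\<close> let both sums
    run over all break points.\<close>
  also have "(\<Sum>i<d. ?c i * r i) = (\<Sum>i<Suc d. ?c i * r i)" using r by simp
  also have "(\<Sum>i<d. ?c (Suc i) * l (Suc i)) = (\<Sum>i<Suc d. ?c i * l i)"
    using l(1) by (subst sum.lessThan_Suc_shift) simp
  also have "(\<Sum>i<Suc d. ?c i * r i) - (\<Sum>i<Suc d. ?c i * l i) = (\<Sum>i\<le>d. ?c i * (r i - l i))"
    by (simp add: lessThan_Suc_atMost sum_subtractf right_diff_distrib)
  also have "\<dots> = (\<Sum>C\<in>cycles. \<Sum>i | i \<in> {..d} \<and> orbit \<sigma> (SymU i) = C. ?c i * (r i - l i))"
    using U finite_cycles by (intro sum.group[symmetric]) (auto simp: cycles_def)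
  also have "\<dots> = (\<Sum>C\<in>cycles. 0)"
  proof (rule sum.cong[OF refl])
    fix C assume C: "C \<in> cycles"
    then obtain x where x: "x \<in> symbols d" "C = orbit \<sigma> x" by (auto simp: cycles_def)
    have "(\<Sum>i | i \<in> {..d} \<and> orbit \<sigma> (SymU i) = C. ?c i * (r i - l i))
      = (\<Sum>i | i \<le> d \<and> SymU i \<in> C. sym_fun X Y cl cr x * (r i - l i))"
    proof (rule sum.cong)
      show "{i \<in> {..d}. orbit \<sigma> (SymU i) = C} = {i. i \<le> d \<and> SymU i \<in> C}"
        using cycle_unique[OF U C] by auto
      fix i assume "i \<in> {i. i \<le> d \<and> SymU i \<in> C}"
      then show "?c i * (r i - l i) = sym_fun X Y cl cr x * (r i - l i)"
        using sym_fun_orbit[OF c x(1)] x(2) by simp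
    qed
    then show "(\<Sum>i | i \<in> {..d} \<and> orbit \<sigma> (SymU i) = C. ?c i * (r i - l i)) = 0"
      using B[OF C] by (simp add: sum_distrib_left[symmetric])
  qed
  finally show ?thesis by simp
qed

end

lemma left_end_nth: "distinct xs \<Longrightarrow> i < length xs \<Longrightarrow> left_end xs len (xs ! i) = wsize len (take i xs)"
  by (simp add: left_end_def endpoint_def pos_nth)

lemma left_end_snoc:
  assumes "distinct (xs @ [z])"
  shows "a \<in> set xs \<Longrightarrow> left_end (xs @ [z]) len a = left_end xs len a"
    "left_end (xs @ [z]) len z = wsize len xs"
proof -
  show "left_end (xs @ [z]) len z = wsize len xs" using assms by (simp add: left_end_split)
  assume "a \<in> set xs"
  then obtain us vs where x: "xs = us @ a # vs" by (meson split_list)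
  then have "a \<notin> set us" using assms by auto
  then show "left_end (xs @ [z]) len a = left_end xs len a"
    using left_end_split[of a us "vs @ [z]" len] left_end_split[of a us vs len] x by simp
qed

text \<open>The symmetrized double sum runs over all pairs of distinct labels, whatever their order.
  That it agrees for the two rows is the skewness of \<open>\<Omega>\<close>.\<close>

lemma left_end_pairing:
  fixes x y :: "real ^ 'n::finite"
  assumes "distinct xs"
  shows "(\<Sum>a\<in>set xs. x $ a * left_end xs y a + y $ a * left_end xs x a)
    = wsize x xs * wsize y xs - (\<Sum>a\<in>set xs. x $ a * y $ a)"
  using assms
proof (induction xs rule: rev_induct)
  case (snoc z xs)
  have "(\<Sum>a\<in>set xs. x $ a * left_end (xs @ [z]) y a + y $ a * left_end (xs @ [z]) x a)
    = (\<Sum>a\<in>set xs. x $ a * left_end xs y a + y $ a * left_end xs x a)"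
    using left_end_snoc(1)[OF snoc.prems] by (intro sum.cong) auto
  then show ?case
    using snoc left_end_snoc(2)[OF snoc.prems, of x] left_end_snoc(2)[OF snoc.prems, of y]
    by (simp add: algebra_simps)
qed simp

section \<open>The intersection form, its kernel and the genus\<close>

context two_rows
begin

text \<open>The translation vector of the IET with rows \<open>X\<close>, \<open>Y\<close>, as a linear function of the lengths.\<close>

definition \<Omega> :: "real ^ 'n \<Rightarrow> real ^ 'n" where
  "\<Omega> v = (\<chi> a. left_end Y v a - left_end X v a)"

lemma \<Omega>_linear: "linear \<Omega>"
  by (rule linearI) (simp_all add: \<Omega>_def vec_eq_iff left_end_takeWhile sum_list_addf sum_list_const_mult algebra_simps)

lemma \<Omega>_skew: "x \<bullet> \<Omega> y = - (\<Omega> x \<bullet> y)"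
proof -
  have "(\<Sum>a\<in>UNIV. x $ a * left_end X y a + y $ a * left_end X x a)
     = (\<Sum>a\<in>UNIV. x $ a * left_end Y y a + y $ a * left_end Y x a)"
    using left_end_pairing[OF X(1), of x y] left_end_pairing[OF Y(1), of x y] X Y
      wsize_UNIV[OF X] wsize_UNIV[OF Y] by simp
  then show ?thesis
    by (simp add: \<Omega>_def inner_vec_def sum.distrib sum_subtractf algebra_simps)
qed

text \<open>For a kernel vector the partial sums along the two rows agree at each label, so they
  define a function on the break points that is compatible with both rows.\<close>

lemma kernel_consistent:
  assumes "\<Omega> v = 0"
  shows "consistent X Y (left_end X v) (\<lambda>a. left_end X v a + v $ a)"
proof -
  have e: "left_end Y v a = left_end X v a" for a
    using assms by (simp add: \<Omega>_def vec_eq_iff)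
  have adj: "left_end xs v (xs ! Suc i) = left_end xs v (xs ! i) + v $ (xs ! i)"
    if "distinct xs" "Suc i < length xs" for xs i
    using that by (simp add: left_end_nth take_Suc_conv_app_nth)
  have h: "left_end xs v (xs ! 0) = 0" if "distinct xs" "xs \<noteq> []" for xs
    using that left_end_nth[of xs 0 v] by simp
  have last: "left_end xs v (last xs) + v $ last xs = wsize v xs" if "distinct xs" "xs \<noteq> []" for xs
  proof -
    have "last xs \<notin> set (butlast xs)"
      using that by (metis append_butlast_last_id distinct_append disjoint_insert(1) list.simps(15))
    then have "left_end (butlast xs @ last xs # []) v (last xs) = wsize v (butlast xs)" by (rule left_end_split)
    moreover have "wsize v (butlast xs @ [last xs]) = wsize v (butlast xs) + v $ last xs" by simp
    ultimately show ?thesis using that by (metis append_butlast_last_id)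
  qed
  show ?thesis
    unfolding consistent_def adjacent
    using adj[OF X(1)] adj[OF Y(1)] lens h[OF X(1)] h[OF Y(1)] last[OF X(1)] last[OF Y(1)] e
      wsize_UNIV[OF X, of v] wsize_UNIV[OF Y, of v]
    by (simp add: hd_conv_nth)
qed

lemma consistent_kernel:
  assumes c: "consistent X Y cl cr"
  shows "\<Omega> (\<chi> a. cr a - cl a) = 0"
proof -
  let ?v = "\<chi> a. cr a - cl a"
  have t: "left_end xs ?v (xs ! i) = cl (xs ! i) - cl (hd xs)"
    if "distinct xs" "successively (\<lambda>a b. cr a = cl b) xs" "i < length xs" for xs i
    using that(3)
  proof (induction i)
    case 0 then show ?case using that left_end_nth[of xs 0 ?v] by (simp add: hd_conv_nth)
  next
    case (Suc i)
    then have "cr (xs ! i) = cl (xs ! Suc i)" using that(2) by (simp add: successively_conv_nth)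
    then show ?case using Suc that by (simp add: left_end_nth take_Suc_conv_app_nth)
  qed
  have "left_end X ?v a = cl a - cl (hd X)" "left_end Y ?v a = cl a - cl (hd Y)" for a
    using t[OF X(1), of "pos X a"] t[OF Y(1), of "pos Y a"] c posX posY lens by (auto simp: consistent_def)
  then show ?thesis using c by (simp add: \<Omega>_def vec_eq_iff consistent_def)
qed

lemma invariant_consistent:
  assumes inv: "\<And>x. x \<in> symbols d \<Longrightarrow> c (\<sigma> x) = c x"
  shows "consistent X Y (\<lambda>a. c (SymU (pos X a))) (\<lambda>a. c (SymU (Suc (pos X a))))"
proof -
  have pX: "pos X (X ! i) = i" if "i < d" for i using pos_nth[OF X(1)] that lens by simp
  have pY: "pos Y (Y ! i) = i" if "i < d" for i using pos_nth[OF Y(1)] that lens by simp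
  have U: "c (symV d j) = c (SymU (pos X (Y ! j)))" if "j < d" for j
    using inv[of "SymU (pos X (Y ! j))"] \<sigma>_U[OF posX(2), of "Y ! j"] posX[of "Y ! j"] pY[OF that]
    by (auto simp: symbols_iff)
  have "c (SymU (Suc (pos X (Y ! i)))) = c (SymU (pos X (Y ! Suc i)))" if "Suc i < d" for i
    using inv[of "SymV (Suc i)"] \<sigma>_V[of "Suc i"] U[OF that] that by (auto simp: symbols_iff symV_def)
  moreover have "c (SymU (Suc (pos X (X ! i)))) = c (SymU (pos X (X ! Suc i)))" if "Suc i < d" for i
    using pX[of i] pX[of "Suc i"] that by simp
  moreover have "c (SymU (pos X (X ! 0))) = c (SymU (pos X (Y ! 0)))"
    using U[of 0] pX[of 0] lens by (simp add: symV_def)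
  moreover have "c (SymU (Suc (pos X (X ! (d - 1))))) = c (SymU (Suc (pos X (Y ! (d - 1)))))"
    using inv[of "SymU d"] \<sigma>_d pX[of "d - 1"] lens by (auto simp: symbols_iff)
  ultimately show ?thesis unfolding consistent_def adjacent ends by blast
qed

lemma cycle_has_U:
  assumes "C \<in> cycles"
  obtains i where "i \<le> d" "SymU i \<in> C"
proof -
  obtain z where z: "z \<in> symbols d" "C = orbit \<sigma> z" using assms by (auto simp: cycles_def)
  from z(1) show thesis
  proof (cases rule: symbols_cases)
    case (1 i) then show thesis using that[of i] z orbit_facts(1)[OF z(1)] by auto
  next
    case 2 then show thesis using that[of d] z orbit_facts(1)[OF z(1)] by auto
  next
    case (3 j)
    have "\<sigma> z \<in> C" unfolding z(2) by (rule orbit.base)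
    then show thesis using that[of "Suc (pos X (Y ! (j - 1)))"] 3 \<sigma>_V[of j] posX(2)[of "Y ! (j - 1)"] by simp
  qed
qed

text \<open>The indicator of a cycle yields a kernel vector by taking differences across the top
  intervals. A linear relation is a function on the cycles with the same value at all symbols
  \<open>SymU i\<close>. Leaving out the cycle of \<open>SymU 0\<close> makes that value 0, and
  every cycle contains some \<open>SymU i\<close>.\<close>

lemma dim_kernel_ge: "card cycles - 1 \<le> dim {v. \<Omega> v = 0}"
proof -
  define ind where "ind C x = (if x \<in> C then 1 else 0 :: real)" for C :: "bsym set" and x
  define lam where "lam C = (\<chi> a. ind C (SymU (Suc (pos X a))) - ind C (SymU (pos X a)))" for C
  have U: "SymU i \<in> symbols d" if "i \<le> d" for i using that by (auto simp: symbols_iff)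
  let ?C0 = "orbit \<sigma> (SymU 0)"
  let ?S = "cycles - {?C0}"
  have inv: "ind C (\<sigma> x) = ind C x" if "C \<in> cycles" "x \<in> symbols d" for C x
  proof -
    have "\<sigma> x \<in> symbols d" using \<sigma>_image that(2) by auto
    moreover have "orbit \<sigma> (\<sigma> x) = orbit \<sigma> x" by (rule orbit_facts(3)[OF that(2) orbit.base])
    ultimately show ?thesis using cycle_unique that by (simp add: ind_def)
  qed
  have ker: "lam C \<in> {v. \<Omega> v = 0}" if "C \<in> cycles" for C
    using consistent_kernel[OF invariant_consistent[of "ind C"]] inv[OF that] by (simp add: lam_def)
  have zero: "t C = 0" if t: "(\<Sum>C\<in>?S. t C *\<^sub>R lam C) = 0" and C: "C \<in> ?S" for t C
  proof -
    define c where "c x = (\<Sum>C\<in>?S. t C * ind C x)" for x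
    have "(\<Sum>C\<in>?S. t C *\<^sub>R lam C) $ a = c (SymU (Suc (pos X a))) - c (SymU (pos X a))" for a
      by (simp add: c_def lam_def right_diff_distrib sum_subtractf)
    then have eq: "c (SymU (Suc (pos X a))) = c (SymU (pos X a))" for a using t by simp
    have const: "c (SymU i) = c (SymU 0)" if "i \<le> d" for i
      using that
    proof (induction i)
      case (Suc i)
      then have "pos X (X ! i) = i" using pos_nth[OF X(1)] lens by simp
      then show ?case using eq[of "X ! i"] Suc by simp
    qed simp
    have val: "c x = t C'" if "x \<in> C'" "C' \<in> ?S" "x \<in> symbols d" for x C'
    proof -
      have "ind C'' x = (if C'' = C' then 1 else 0)" if "C'' \<in> ?S" for C''
        using cycle_unique[OF \<open>x \<in> symbols d\<close>] \<open>x \<in> C'\<close> \<open>C' \<in> ?S\<close> that by (auto simp: ind_def)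
      then have "c x = (\<Sum>C''\<in>?S. if C'' = C' then t C'' else 0)"
        unfolding c_def by (intro sum.cong) auto
      then show ?thesis using that(2) finite_cycles by simp
    qed
    have "c (SymU 0) = 0"
      unfolding c_def
    proof (rule sum.neutral, rule ballI)
      fix C' assume "C' \<in> ?S"
      then have "SymU 0 \<notin> C'" using cycle_unique[OF U[of 0], of C'] by auto
      then show "t C' * ind C' (SymU 0) = 0" by (simp add: ind_def)
    qed
    moreover obtain i where "i \<le> d" "SymU i \<in> C" using cycle_has_U C by blast
    ultimately show "t C = 0" using val[of "SymU i" C] const[of i] U C by simp
  qed
  have inj: "inj_on lam ?S"
  proof (rule inj_onI, rule ccontr)
    fix C C' assume C: "C \<in> ?S" "C' \<in> ?S" "lam C = lam C'" "C \<noteq> C'"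
    let ?t = "\<lambda>D. if D = C then 1 else if D = C' then -1 else 0 :: real"
    have "(\<Sum>D\<in>?S. ?t D *\<^sub>R lam D) = (\<Sum>D\<in>{C, C'}. ?t D *\<^sub>R lam D)"
      using C finite_cycles by (intro sum.mono_neutral_right) auto
    also have "\<dots> = 0" using C by simp
    finally show False using zero[of ?t C] C by simp
  qed
  have "independent (lam ` ?S)"
    unfolding independent_explicit
  proof (intro conjI allI impI ballI)
    show "finite (lam ` ?S)" using finite_cycles by simp
    fix u v assume u: "(\<Sum>v\<in>lam ` ?S. u v *\<^sub>R v) = 0" and v: "v \<in> lam ` ?S"
    then show "u v = 0" using zero[of "\<lambda>C. u (lam C)"] by (auto simp: sum.reindex[OF inj])
  qed
  moreover have "lam ` ?S \<subseteq> {v. \<Omega> v = 0}" using ker by auto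
  ultimately have "card (lam ` ?S) \<le> dim {v. \<Omega> v = 0}" by (rule independent_card_le_dim[rotated])
  moreover have "card ?S \<ge> card cycles - 1" by (simp add: card_Diff_singleton_if)
  ultimately show ?thesis using card_image[OF inj] by linarith
qed

text \<open>The rank of a skew form is even, so rounding down in the genus does no harm.\<close>

lemma dim_kernel_genus: "d \<le> dim {v. \<Omega> v = 0} + 2 * ((d + 1 - card cycles) div 2)"
proof -
  have "even (DIM(real ^ 'n) - dim {v. \<Omega> v = 0})" by (rule skew_rank_even[OF \<Omega>_linear \<Omega>_skew])
  then have "even (d - dim {v. \<Omega> v = 0})" using d by simp
  then obtain r where r: "d - dim {v. \<Omega> v = 0} = 2 * r" by (rule evenE)
  then have "2 * r \<le> d + 1 - card cycles" using dim_kernel_ge by linarith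
  then have "r \<le> (d + 1 - card cycles) div 2" by linarith
  then show ?thesis using r by linarith
qed

lemma \<Omega>_bounded_preimage: "\<exists>C>0. \<forall>v\<in>range \<Omega>. \<exists>y. \<Omega> y = v \<and> norm y \<le> C * norm v"
proof -
  obtain g where g: "linear g" "\<forall>v\<in>\<Omega> ` UNIV. \<Omega> (g v) = v"
    using linear_exists_right_inverse_on[OF \<Omega>_linear subspace_UNIV] by blast
  obtain C where "C > 0" "\<And>v. norm (g v) \<le> C * norm v" using linear_bounded_pos[OF g(1)] by blast
  then show ?thesis using g(2) by blast
qed

end

context renormalizable
begin

lemma two_rows_stage: "two_rows (pt' n) (pb' n) CARD('n)"
  using row_props by unfold_locales auto

definition om :: "nat \<Rightarrow> real ^ 'n \<Rightarrow> real ^ 'n" where "om n = two_rows.\<Omega> (pt' n) (pb' n)"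

lemma om_eq: "om n v $ a = left_end (pb' n) v a - left_end (pt' n) v a"
  by (simp add: om_def two_rows.\<Omega>_def[OF two_rows_stage])

abbreviation inc :: "nat \<Rightarrow> nat \<Rightarrow> real ^ 'n ^ 'n" where "inc \<equiv> incidence (al T) (be T) (tw T)"

lemma inc_step_mult:
  "(inc n (Suc n) *v v) $ i = (if i = loser' n then v $ al T n + v $ be T n else v $ i)"
  by (simp add: incidence_mult return_word_le rv_word_def loser'_def)

lemma inc_step_transpose:
  "(transpose (inc n (Suc n)) *v v) $ j = v $ j + (if j = winner n then v $ loser' n else 0)"
proof -
  have "inc n (Suc n) $ i $ j = (if i = j then 1 else 0) + (if i = loser' n \<and> j = winner n then 1 else 0)" for i
    using al_be[of n] by (auto simp: incidence_def return_word_le rv_word_def loser'_def winner_def)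
  then have "(transpose (inc n (Suc n)) *v v) $ j
      = (\<Sum>i\<in>UNIV. (if i = j then v $ i else 0) + (if i = loser' n then (if j = winner n then v $ i else 0) else 0))"
    unfolding matrix_vector_mult_def transpose_def by (auto intro!: sum.cong)
  then show ?thesis by (simp add: sum.distrib)
qed

lemma left_end_last: "distinct xs \<Longrightarrow> set xs = (UNIV :: 'n set) \<Longrightarrow>
    left_end xs v (last xs) = (\<Sum>a\<in>UNIV. v $ a) - v $ last xs"
proof -
  assume xs: "distinct xs" "set xs = (UNIV :: 'n set)"
  then have ne: "xs \<noteq> []" by auto
  have "distinct (butlast xs @ [last xs])" using xs ne by simp
  then have "left_end (butlast xs @ [last xs]) v (last xs) = wsize v (butlast xs)" by (rule left_end_snoc(2))
  moreover have "wsize v (butlast xs @ [last xs]) = wsize v (butlast xs) + v $ last xs" by simp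
  ultimately show ?thesis using ne wsize_UNIV[OF xs, of v] by simp
qed

text \<open>Invariance of the intersection form. The moved row is treated by
  \<open>left_end_move_after\<close> for the vector \<open>?u\<close>; in the fixed row only the
  last entry changes, and it enters no left end.\<close>

lemma om_step: "om (Suc n) v = inc n (Suc n) *v om n (transpose (inc n (Suc n)) *v v)"
proof -
  interpret S: rv_pre "stage T n" "al T n" "be T n" "rv_length (stage T n)" "cut_point (stage T n)"
    using stage_rv_pre by (simp_all add: al_def be_def)
  let ?u = "transpose (inc n (Suc n)) *v v"
  note u = inc_step_transpose[of n v]
  have last: "left_end (pt' n) ?u (al T n) = (\<Sum>a\<in>UNIV. ?u $ a) - ?u $ al T n"
    "left_end (pb' n) ?u (be T n) = (\<Sum>a\<in>UNIV. ?u $ a) - ?u $ be T n"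
    using left_end_last[OF row_props(1,2)] left_end_last[OF row_props(3,4)] by (simp_all add: al_def be_def)
  have "om (Suc n) v $ a = (inc n (Suc n) *v om n ?u) $ a" for a
  proof (cases "tw T n")
    case t: True
    have wl: "winner n = al T n" "loser' n = be T n" using t by (simp_all add: winner_def loser'_def)
    obtain us vs where b: "pb' n = us @ al T n # vs @ [be T n]" by (rule S.bot_split)
    then have d: "distinct (us @ al T n # vs @ [be T n])" "a \<in> set (us @ al T n # vs @ [be T n])"
      using row_props(3,4)[of n] by (metis, metis UNIV_I)
    have pb: "pb' (Suc n) = us @ al T n # be T n # vs"
      unfolding stage_rows(3)[OF t] b by (rule move_after_split[OF d(1)])
    have L: "1 * left_end (us @ al T n # be T n # vs) v a =
      (if a = be T n then left_end (us @ al T n # vs @ [be T n]) ?u (al T n) + 1 * v $ al T n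
       else left_end (us @ al T n # vs @ [be T n]) ?u a)"
      by (rule left_end_move_after[OF d]) (use u wl al_be[of n] in auto)
    have R: "1 * left_end (pt' n) v a = left_end (pt' n) ?u a"
      by (rule left_end_last_changed[OF row_props(1,2)]) (use u wl in \<open>auto simp: al_def\<close>)
    show ?thesis
      using L R last u al_be[of n] unfolding om_eq inc_step_mult wl pb stage_rows(1)[OF t] b[symmetric]
      by simp
  next
    case t: False
    have wl: "winner n = be T n" "loser' n = al T n" using t by (simp_all add: winner_def loser'_def)
    obtain us vs where b: "pt' n = us @ be T n # vs @ [al T n]" by (rule S.top_split)
    then have d: "distinct (us @ be T n # vs @ [al T n])" "a \<in> set (us @ be T n # vs @ [al T n])"
      using row_props(1,2)[of n] by (metis, metis UNIV_I)
    have pb: "pt' (Suc n) = us @ be T n # al T n # vs"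
      unfolding stage_rows(4)[OF t] b by (rule move_after_split[OF d(1)])
    have L: "1 * left_end (us @ be T n # al T n # vs) v a =
      (if a = al T n then left_end (us @ be T n # vs @ [al T n]) ?u (be T n) + 1 * v $ be T n
       else left_end (us @ be T n # vs @ [al T n]) ?u a)"
      by (rule left_end_move_after[OF d]) (use u wl al_be[of n] in auto)
    have R: "1 * left_end (pb' n) v a = left_end (pb' n) ?u a"
      by (rule left_end_last_changed[OF row_props(3,4)]) (use u wl in \<open>auto simp: be_def\<close>)
    show ?thesis
      using L R last u al_be[of n] unfolding om_eq inc_step_mult wl pb stage_rows(2)[OF t] b[symmetric]
      by simp
  qed
  then show ?thesis by (simp add: vec_eq_iff)
qed

lemma om_inc: "om n v = inc 0 n *v om 0 (transpose (inc 0 n) *v v)"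
proof (induction n arbitrary: v)
  case 0
  then show ?case by (simp add: incidence_refl transpose_mat)
next
  case (Suc n)
  have e: "inc 0 (Suc n) = inc n (Suc n) ** inc 0 n" by (rule incidence_trans) auto
  show ?case
    unfolding e matrix_transpose_mul matrix_vector_mul_assoc[symmetric] om_step
    by (simp only: Suc[of "transpose (inc n (Suc n)) *v v"])
qed

text \<open>Only finitely many pairs of rows occur, which makes the constant uniform in
  \<open>n\<close>.\<close>

lemma om_bounded_preimage: "\<exists>C>0. \<forall>n. \<forall>v\<in>range (om n). \<exists>y. om n y = v \<and> norm y \<le> C * norm v"
proof -
  let ?rows = "{xs :: 'n list. distinct xs \<and> set xs = UNIV}"
  have fin: "finite (?rows \<times> ?rows)"
  proof -
    have "length xs = CARD('n)" if "xs \<in> ?rows" for xs using that distinct_card[of xs] by auto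
    then have "?rows \<subseteq> {xs. set xs \<subseteq> UNIV \<and> length xs = CARD('n)}" by blast
    then have "finite ?rows" using finite_lists_length_eq[OF finite, of UNIV "CARD('n)"] finite_subset by blast
    then show ?thesis by simp
  qed
  have "\<forall>p\<in>?rows \<times> ?rows. \<exists>C>0. \<forall>v\<in>range (two_rows.\<Omega> (fst p) (snd p)).
      \<exists>y. two_rows.\<Omega> (fst p) (snd p) y = v \<and> norm y \<le> C * norm v"
    by (intro ballI two_rows.\<Omega>_bounded_preimage[of _ _ "CARD('n)"]) (auto simp: two_rows_def)
  from bchoice[OF this] obtain C where "\<forall>p\<in>?rows \<times> ?rows. C p > 0 \<and>
      (\<forall>v\<in>range (two_rows.\<Omega> (fst p) (snd p)). \<exists>y. two_rows.\<Omega> (fst p) (snd p) y = v \<and> norm y \<le> C p * norm v)" ..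
  then have C: "C p > 0 \<and> (\<forall>v\<in>range (two_rows.\<Omega> (fst p) (snd p)).
      \<exists>y. two_rows.\<Omega> (fst p) (snd p) y = v \<and> norm y \<le> C p * norm v)" if "p \<in> ?rows \<times> ?rows" for p
    using that by (rule bspec)
  define K where "K = (\<Sum>p\<in>?rows \<times> ?rows. C p)"
  have in_rows: "(pt' n, pb' n) \<in> ?rows \<times> ?rows" for n using row_props by auto
  have le: "C p \<le> K" if "p \<in> ?rows \<times> ?rows" for p
    unfolding K_def by (rule member_le_sum) (use C fin that in \<open>auto simp: less_imp_le\<close>)
  have "K > 0" using C[OF in_rows[of 0]] le[OF in_rows[of 0]] by linarith
  moreover have "\<exists>y. om n y = v \<and> norm y \<le> K * norm v" if v: "v \<in> range (om n)" for n v
  proof -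
    obtain y where y: "om n y = v" "norm y \<le> C (pt' n, pb' n) * norm v"
      using C[OF in_rows[of n]] v by (auto simp: om_def)
    then show ?thesis using mult_right_mono[OF le[OF in_rows[of n]], of "norm v"] by force
  qed
  ultimately show ?thesis by blast
qed

lemma inc_transpose_surj: "\<exists>y. transpose (inc 0 n) *v y = x"
proof -
  have "invertible (transpose (inc 0 n))"
    by (simp add: transpose_invertible incidence_invertible al_be)
  then obtain B where "transpose (inc 0 n) ** B = mat 1" by (auto simp: invertible_def)
  then have "transpose (inc 0 n) *v (B *v x) = x" by (simp add: matrix_vector_mul_assoc)
  then show ?thesis by blast
qed

lemma bd_const: "bd (\<lambda>b x. v $ b) n cl cr = (\<Sum>a\<in>UNIV. (cl a - cr a) * (inc 0 n *v v) $ a)"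
  by (simp add: bd_def bsum_const incidence_mult left_diff_distrib)

text \<open>Vectors that contract lie in the symplectic subspace and are isotropic, because the form is
  invariant; a vector of that subspace that does not expand is orthogonal to all of them.\<close>

theorem central_transversal:
  fixes \<tau> :: "nat \<Rightarrow> nat"
  assumes G: "subspace G" "dim G = genus T"
    and s: "\<And>s. s \<in> G \<Longrightarrow> (\<lambda>i. norm (inc 0 (\<tau> i) *v s)) \<longlonglongrightarrow> 0"
    and c: "\<And>s. s \<in> G \<Longrightarrow> (\<lambda>i. norm (inc 0 (\<tau> i) *v c) * norm (inc 0 (\<tau> i) *v s)) \<longlonglongrightarrow> 0"
    and ker: "\<And>v. om 0 v = 0 \<Longrightarrow> v \<bullet> c = 0"
  shows "c \<in> G"
proof -
  interpret two_rows "pt' 0" "pb' 0" "CARD('n)" by (rule two_rows_stage)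
  have O: "om 0 = \<Omega>" by (simp add: om_def)
  have skew: "x \<bullet> om n y = - (om n x \<bullet> y)" for n x y
    unfolding om_def by (rule two_rows.\<Omega>_skew[OF two_rows_stage])
  obtain C where C: "C > 0" "\<And>n v. v \<in> range (om n) \<Longrightarrow> \<exists>y. om n y = v \<and> norm y \<le> C * norm v"
    using om_bounded_preimage by blast
  have range: "range (om 0) = {v. \<forall>x. om 0 x = 0 \<longrightarrow> x \<bullet> v = 0}"
    unfolding O by (rule skew_range[OF \<Omega>_linear \<Omega>_skew])
  \<comment> \<open>The pairing of \<open>v\<close> with a kernel vector is a boundary value, which
    may be computed at stage \<open>\<tau> i\<close> with coefficients still bounded by
    \<open>M\<close>; there the contraction of \<open>v\<close> makes it small.\<close>
  have sub: "G \<subseteq> range (om 0)"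
    unfolding range
  proof (intro subsetI CollectI allI impI)
    fix v x assume v: "v \<in> G" and x: "om 0 x = 0"
    let ?cl = "left_end (pt' 0) x" and ?cr = "\<lambda>a. left_end (pt' 0) x a + x $ a"
    have cons: "cons_at 0 ?cl ?cr" unfolding cons_at_def using kernel_consistent x O by simp
    define M where "M = (\<Sum>a\<in>UNIV. \<bar>?cl a\<bar> + \<bar>?cr a\<bar>)"
    have M: "\<bar>?cl a\<bar> \<le> M \<and> \<bar>?cr a\<bar> \<le> M" for a
      using member_le_sum[of a UNIV "\<lambda>a. \<bar>?cl a\<bar> + \<bar>?cr a\<bar>"] unfolding M_def
      by (smt (verit) UNIV_I abs_ge_zero finite)
    have base: "bd (\<lambda>b y. v $ b) 0 ?cl ?cr = - (x \<bullet> v)"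
      by (simp add: bd_const incidence_refl inner_vec_def sum_negf)
    have M0: "M \<ge> 0" using M[of undefined] by linarith
    have "\<bar>x \<bullet> v\<bar> \<le> (2 * M * CARD('n)) * norm (inc 0 (\<tau> i) *v v)" for i
    proof -
      obtain cl' cr' where c': "\<And>a. \<bar>cl' a\<bar> \<le> M \<and> \<bar>cr' a\<bar> \<le> M" "bd (\<lambda>b y. v $ b) (\<tau> i) cl' cr' = - (x \<bullet> v)"
        using cons_forward[OF cons M, of "\<tau> i"] base by metis
      have "\<bar>x \<bullet> v\<bar> = \<bar>\<Sum>a\<in>UNIV. (cl' a - cr' a) * (inc 0 (\<tau> i) *v v) $ a\<bar>" using c'(2) bd_const[of v] by simp
      also have "\<dots> \<le> (\<Sum>a\<in>UNIV. \<bar>(cl' a - cr' a) * (inc 0 (\<tau> i) *v v) $ a\<bar>)" by (rule sum_abs)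
      also have "\<dots> \<le> (\<Sum>a\<in>(UNIV :: 'n set). (2 * M) * norm (inc 0 (\<tau> i) *v v))"
      proof (rule sum_mono)
        fix a
        have "\<bar>cl' a - cr' a\<bar> \<le> 2 * M" using c'(1)[of a] by linarith
        then show "\<bar>(cl' a - cr' a) * (inc 0 (\<tau> i) *v v) $ a\<bar> \<le> (2 * M) * norm (inc 0 (\<tau> i) *v v)"
          unfolding abs_mult using component_le_norm_cart[of "inc 0 (\<tau> i) *v v" a] M0 by (intro mult_mono) auto
      qed
      finally show ?thesis by (simp add: mult_ac)
    qed
    moreover have "(\<lambda>i. (2 * M * CARD('n)) * norm (inc 0 (\<tau> i) *v v)) \<longlonglongrightarrow> (2 * M * CARD('n)) * 0"
      using s[OF v] by (intro tendsto_mult tendsto_const)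
    ultimately have "\<bar>x \<bullet> v\<bar> \<le> (2 * M * CARD('n)) * 0"
      by (intro LIMSEQ_le_const) auto
    then show "x \<bullet> v = 0" by simp
  qed
  \<comment> \<open>Invariance moves the pairing to stage \<open>\<tau> i\<close>, where skewness
    and a preimage \<open>z\<close> of bounded norm turn it into a product of the two transported
    norms.\<close>
  have pair: "x \<bullet> om 0 y = 0"
    if l: "(\<lambda>i. norm (inc 0 (\<tau> i) *v om 0 x) * norm (inc 0 (\<tau> i) *v om 0 y)) \<longlonglongrightarrow> 0" for x y
  proof -
    have "\<bar>x \<bullet> om 0 y\<bar> \<le> C * (norm (inc 0 (\<tau> i) *v om 0 x) * norm (inc 0 (\<tau> i) *v om 0 y))" for i
    proof -
      let ?Q = "inc 0 (\<tau> i)"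
      obtain x' where x': "transpose ?Q *v x' = x" using inc_transpose_surj by blast
      obtain y' where y': "transpose ?Q *v y' = y" using inc_transpose_surj by blast
      have ox: "om (\<tau> i) x' = ?Q *v om 0 x" "om (\<tau> i) y' = ?Q *v om 0 y"
        using om_inc[of "\<tau> i" x', unfolded x'] om_inc[of "\<tau> i" y', unfolded y'] by blast+
      then have "?Q *v om 0 y \<in> range (om (\<tau> i))" by (metis rangeI)
      then obtain z where z: "om (\<tau> i) z = ?Q *v om 0 y" "norm z \<le> C * norm (?Q *v om 0 y)" using C(2) by blast
      have "x \<bullet> om 0 y = x' \<bullet> (?Q *v om 0 y)"
        unfolding x'[symmetric] by (simp add: transpose_matrix_vector dot_lmul_matrix)
      also have "\<dots> = - ((?Q *v om 0 x) \<bullet> z)" unfolding z(1)[symmetric] ox(1)[symmetric] by (rule skew)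
      finally have "\<bar>x \<bullet> om 0 y\<bar> \<le> norm (?Q *v om 0 x) * norm z" using Cauchy_Schwarz_ineq2 by simp
      also have "\<dots> \<le> norm (?Q *v om 0 x) * (C * norm (?Q *v om 0 y))" using z(2) by (intro mult_left_mono) auto
      finally show ?thesis by (simp add: mult_ac)
    qed
    moreover have "(\<lambda>i. C * (norm (inc 0 (\<tau> i) *v om 0 x) * norm (inc 0 (\<tau> i) *v om 0 y))) \<longlonglongrightarrow> C * 0"
      using l by (intro tendsto_mult tendsto_const)
    ultimately have "\<bar>x \<bullet> om 0 y\<bar> \<le> C * 0"
      by (intro LIMSEQ_le_const) auto
    then show ?thesis by simp
  qed
  show ?thesis
  proof (rule lagrangian_complement[OF \<Omega>_linear \<Omega>_skew G(1) sub[unfolded O]])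
    show "x \<bullet> \<Omega> y = 0" if "\<Omega> x \<in> G" "\<Omega> y \<in> G" for x y
      using pair[of x y] tendsto_mult[OF s[OF that(1)] s[OF that(2)]] by (simp add: O)
    have "bcycles T = cycles" unfolding bcycles_def cycles_def by simp
    then have "genus T = (CARD('n) + 1 - card cycles) div 2" unfolding genus_def by (rule arg_cong)
    then show "DIM(real ^ 'n) \<le> dim {x. \<Omega> x = 0} + 2 * dim G" using dim_kernel_genus G(2) by simp
    show "c \<bullet> y = 0" if y: "\<Omega> y \<in> G" for y
    proof -
      have "c \<in> range (om 0)" unfolding range using ker by simp
      then obtain x where x: "c = om 0 x" by auto
      have "x \<bullet> om 0 y = 0" by (rule pair) (use c[OF y] x in \<open>simp add: O\<close>)
      then show ?thesis using skew[of x 0 y] x by simp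
    qed
  qed
qed

end

section \<open>Smooth branches\<close>

lemma mono_deriv_nonneg:
  fixes f :: "real \<Rightarrow> real"
  assumes "strict_mono_on {l..r} f" "x \<in> {l..r}" "l < r" "(f has_real_derivative D) (at x within {l..r})"
  shows "0 \<le> D"
proof (rule ccontr)
  assume "\<not> 0 \<le> D"
  then have D: "D < 0" by simp
  show False
  proof (cases "x < r")
    case True
    obtain e where e: "e > 0" "\<And>h. 0 < h \<Longrightarrow> x + h \<in> {l..r} \<Longrightarrow> h < e \<Longrightarrow> f x > f (x + h)"
      using has_real_derivative_neg_dec_right[OF assms(4) D] by blast
    define h where "h = min (e / 2) (r - x)"
    have "0 < h" "h < e" "x + h \<in> {l..r}" using e(1) True assms(2) by (auto simp: h_def min_def)
    moreover then have "f x < f (x + h)" using assms(1,2) by (auto simp: strict_mono_on_def)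
    ultimately show False using e(2) by force
  next
    case False
    then have x: "x = r" using assms(2) by auto
    obtain e where e: "e > 0" "\<And>h. 0 < h \<Longrightarrow> x - h \<in> {l..r} \<Longrightarrow> h < e \<Longrightarrow> f x < f (x - h)"
      using has_real_derivative_neg_dec_left[OF assms(4) D] by blast
    define h where "h = min (e / 2) (r - l)"
    have "0 < h" "h < e" "x - h \<in> {l..r}" using e(1) x assms(3) by (auto simp: h_def min_def)
    moreover then have "f (x - h) < f x" using assms(1,2) by (auto simp: strict_mono_on_def)
    ultimately show False using e(2) by force
  qed
qed

text \<open>The chain rule with the differentiable inverse excludes a zero derivative, and
  monotonicity fixes its sign.\<close>

lemma Cr_diffeo_pos_deriv:
  assumes f: "Cr_diffeo_pos 3 f {l..r} {p..q}" and lr: "l < r"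
  obtains F1 F2 F3 where
    "\<And>x. x \<in> {l..r} \<Longrightarrow> (f has_real_derivative F1 x) (at x within {l..r})"
    "\<And>x. x \<in> {l..r} \<Longrightarrow> (F1 has_real_derivative F2 x) (at x within {l..r})"
    "\<And>x. x \<in> {l..r} \<Longrightarrow> (F2 has_real_derivative F3 x) (at x within {l..r})"
    "continuous_on {l..r} F3" "\<And>x. x \<in> {l..r} \<Longrightarrow> 0 < F1 x"
proof -
  obtain F :: "nat \<Rightarrow> real \<Rightarrow> real" where F: "\<forall>x\<in>{l..r}. F 0 x = f x"
    "\<forall>i<3. \<forall>x\<in>{l..r}. (F i has_real_derivative F (Suc i) x) (at x within {l..r})"
    "continuous_on {l..r} (F 3)" using f unfolding Cr_diffeo_pos_def Cr_on_def by blast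
  obtain G :: "nat \<Rightarrow> real \<Rightarrow> real" where G: "\<forall>x\<in>{p..q}. G 0 x = inv_into {l..r} f x"
    "\<forall>i<3. \<forall>x\<in>{p..q}. (G i has_real_derivative G (Suc i) x) (at x within {p..q})"
    using f unfolding Cr_diffeo_pos_def Cr_on_def by blast
  have m: "strict_mono_on {l..r} f" and bij: "bij_betw f {l..r} {p..q}" using f by (auto simp: Cr_diffeo_pos_def)
  have d1: "(f has_real_derivative F 1 x) (at x within {l..r})" if x: "x \<in> {l..r}" for x
  proof -
    have "(F 0 has_real_derivative F 1 x) (at x within {l..r})" using F(2) x by auto
    then show ?thesis
      by (rule has_field_derivative_transform_within[OF _ zero_less_one x]) (use F(1) in auto)
  qed
  have "0 < F 1 x" if x: "x \<in> {l..r}" for x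
  proof -
    have im: "f ` {l..r} = {p..q}" using bij by (simp add: bij_betw_def)
    have fx: "f x \<in> {p..q}" using im x by blast
    have "(G 0 has_real_derivative G 1 (f x)) (at (f x) within f ` {l..r})" using G(2) fx im by auto
    from DERIV_image_chain[OF this d1[OF x]]
    have 1: "(G 0 \<circ> f has_real_derivative G 1 (f x) * F 1 x) (at x within {l..r})" .
    have id: "(G 0 \<circ> f) y = y" if y: "y \<in> {l..r}" for y
    proof -
      have "f y \<in> {p..q}" using im y by blast
      then show ?thesis using G(1) bij y by (simp add: bij_betw_def inv_into_f_f)
    qed
    have "((\<lambda>y. y) has_real_derivative G 1 (f x) * F 1 x) (at x within {l..r})"
      by (rule has_field_derivative_transform_within[OF 1 zero_less_one x]) (use id in auto)
    moreover have "((\<lambda>y. y) has_real_derivative 1) (at x within {l..r})" by (rule DERIV_ident)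
    ultimately have "G 1 (f x) * F 1 x = 1"
      using vector_derivative_unique_within_closed_interval[of l r x "\<lambda>y. y"] lr x
      by (simp add: has_real_derivative_iff_has_vector_derivative)
    then have "F 1 x \<noteq> 0" by auto
    moreover have "0 \<le> F 1 x" by (rule mono_deriv_nonneg[OF m x lr d1[OF x]])
    ultimately show ?thesis by simp
  qed
  then show thesis
    using that[of "F 1" "F 2" "F 3"] d1 F(2,3) by (auto simp: numeral_2_eq_2 numeral_3_eq_3)
qed

text \<open>The third derivative makes the nonlinearity \<open>F2 / F1\<close> differentiable with
  bounded derivative, hence Lipschitz.\<close>

lemma GIET3_branch:
  fixes T :: "'n::finite giet"
  assumes "is_giet 3 T"
  obtains F eta :: "real \<Rightarrow> real" and K where
    "\<And>x. x \<in> {top_left T a..top_right T a} \<Longrightarrow>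
       (branch T a has_real_derivative exp (F x)) (at x within {top_left T a..top_right T a})"
    "\<And>x. x \<in> {top_left T a..top_right T a} \<Longrightarrow>
       (F has_real_derivative eta x) (at x within {top_left T a..top_right T a})"
    "\<And>x y. x \<in> {top_left T a..top_right T a} \<Longrightarrow> y \<in> {top_left T a..top_right T a} \<Longrightarrow>
       \<bar>eta x - eta y\<bar> \<le> K * \<bar>x - y\<bar>" "0 \<le> K"
proof -
  have tp: "two_partitions T" using assms by (simp add: is_giet_def)
  let ?I = "{top_left T a..top_right T a}"
  note lr = left_less_right[OF tp, of a]
  obtain f where f: "\<forall>x\<in>top_int T a. f x = gmap T x"
    "Cr_diffeo_pos 3 f ?I {bot_left T a..bot_right T a}"
    using assms closure_ints[OF tp] unfolding is_giet_def by metis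
  have b: "bij_betw f ?I {bot_left T a..bot_right T a}" and m: "strict_mono_on ?I f"
    using f(2) unfolding Cr_diffeo_pos_def by auto
  have e: "f (top_left T a) = bot_left T a" "f (top_right T a) = bot_right T a"
    using bij_mono_endpoints[OF b m lr(1)] by auto
  have eq: "f x = branch T a x" if "x \<in> ?I" for x
    using that e f(1) by (auto simp: branch_def top_right_def[symmetric] bot_right_def[symmetric] top_int_def)
  obtain F1 F2 F3 where F: "\<And>x. x \<in> ?I \<Longrightarrow> (f has_real_derivative F1 x) (at x within ?I)"
    "\<And>x. x \<in> ?I \<Longrightarrow> (F1 has_real_derivative F2 x) (at x within ?I)"
    "\<And>x. x \<in> ?I \<Longrightarrow> (F2 has_real_derivative F3 x) (at x within ?I)"
    "continuous_on ?I F3" "\<And>x. x \<in> ?I \<Longrightarrow> 0 < F1 x"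
    using Cr_diffeo_pos_deriv[OF f(2) lr(1)] by blast
  let ?F = "\<lambda>x. ln (F1 x)" and ?eta = "\<lambda>x. F2 x / F1 x"
  let ?g = "\<lambda>x. (F3 x * F1 x - F2 x * F2 x) / (F1 x * F1 x)"
  have 1: "(branch T a has_real_derivative exp (?F x)) (at x within ?I)" if x: "x \<in> ?I" for x
    using has_field_derivative_transform_within[OF F(1)[OF x] zero_less_one x, of "branch T a"] eq F(5)[OF x]
    by simp
  have 2: "(?F has_real_derivative ?eta x) (at x within ?I)" if x: "x \<in> ?I" for x
    using F(2)[OF x] F(5)[OF x] by (auto intro!: derivative_eq_intros)
  have 3: "(?eta has_real_derivative ?g x) (at x within ?I)" if x: "x \<in> ?I" for x
    using F(2,3)[OF x] F(5)[OF x] by (auto intro!: derivative_eq_intros)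
  have "continuous_on ?I F1" "continuous_on ?I F2" using F(2,3) DERIV_continuous_on by blast+
  then have "continuous_on ?I ?g" using F(4,5) by (auto intro!: continuous_intros simp: less_imp_neq[symmetric])
  then have "compact (?g ` ?I)" by (intro compact_continuous_image) auto
  then obtain K where "\<forall>y\<in>?g ` ?I. norm y \<le> K" using compact_imp_bounded bounded_iff by metis
  then have K: "norm (?g x) \<le> K" if "x \<in> ?I" for x using that by blast
  have "\<bar>?eta x - ?eta y\<bar> \<le> K * \<bar>x - y\<bar>" if "x \<in> ?I" "y \<in> ?I" for x y
    using field_differentiable_bound[of ?I ?eta ?g K x y] 3 K that by simp
  moreover have "0 \<le> K" using K[of "top_left T a"] lr(1) norm_ge_zero by (smt (verit) atLeastAtMost_iff)
  ultimately show thesis using that[of ?F ?eta K] 1 2 by blast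
qed

context renormalizable
begin

text \<open>The one-sided limits in \<open>boundary\<close> are end values of the continuous
  \<open>f0\<close>, so the vanishing boundary becomes a statement about \<open>bd\<close>, first at
  stage 0 and then at all stages.\<close>

lemma smooth_data:
  assumes T3: "is_giet 3 T" and B: "\<forall>C \<in> bcycles T. boundary T C = 0"
  obtains f0 eta K where
    "smooth_towers (al T) (be T) (tw T) (lo T) (hi T) (branch T) f0 eta K"
    "\<And>n cl cr. cons_at n cl cr \<Longrightarrow> bd f0 n cl cr = 0"
proof -
  let ?I = "\<lambda>a. {top_left T a..top_right T a}"
  have "\<forall>a. \<exists>F eta K. (\<forall>x\<in>?I a. (branch T a has_real_derivative exp (F x)) (at x within ?I a)) \<and>
    (\<forall>x\<in>?I a. (F has_real_derivative eta x) (at x within ?I a)) \<and>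
    (\<forall>x\<in>?I a. \<forall>y\<in>?I a. \<bar>eta x - eta y\<bar> \<le> K * \<bar>x - y\<bar>) \<and> 0 \<le> K"
  proof
    fix a
    from GIET3_branch[OF T3, of a] show "\<exists>F eta K. (\<forall>x\<in>?I a. (branch T a has_real_derivative exp (F x)) (at x within ?I a)) \<and>
      (\<forall>x\<in>?I a. (F has_real_derivative eta x) (at x within ?I a)) \<and>
      (\<forall>x\<in>?I a. \<forall>y\<in>?I a. \<bar>eta x - eta y\<bar> \<le> K * \<bar>x - y\<bar>) \<and> 0 \<le> K" by metis
  qed
  then obtain f0 eta Ka where F: "\<And>a x. x \<in> ?I a \<Longrightarrow> (branch T a has_real_derivative exp (f0 a x)) (at x within ?I a)"
    "\<And>a x. x \<in> ?I a \<Longrightarrow> (f0 a has_real_derivative eta a x) (at x within ?I a)"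
    "\<And>a x y. x \<in> ?I a \<Longrightarrow> y \<in> ?I a \<Longrightarrow> \<bar>eta a x - eta a y\<bar> \<le> Ka a * \<bar>x - y\<bar>" "\<And>a. 0 \<le> Ka a" by metis
  define K where "K = (\<Sum>a\<in>UNIV. Ka a)"
  have KK: "Ka a \<le> K" for a unfolding K_def by (rule member_le_sum) (use F in auto)
  have z: "lo T 0 a = top_left T a" "hi T 0 a = top_right T a" for a by (simp_all add: lo_def hi_def scale_def)
  interpret two_rows "pt' 0" "pb' 0" "CARD('n)" by (rule two_rows_stage)
  have tp: "two_partitions T" using stage_tp[of 0] by simp
  note lr = left_less_right(1)[OF tp]
  \<comment> \<open>\<open>deriv\<close> is two-sided and \<open>gmap T\<close> is arbitrary at the
    ends, so \<open>g\<close> is compared with \<open>f0\<close> on the open intervals, which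
    determine the limits.\<close>
  define g where "g x = ln (deriv (gmap T) x)" for x
  have g_eq: "g x = f0 a x" if x: "x \<in> {top_left T a<..<top_right T a}" for a x
  proof -
    have "at x within ?I a = at x" using x by (intro at_within_interior) (auto simp: interior_atLeastAtMost_real)
    then have "(branch T a has_real_derivative exp (f0 a x)) (at x)" using F(1)[of x a] x by auto
    then have "(gmap T has_real_derivative exp (f0 a x)) (at x)"
    proof (rule has_field_derivative_transform_within_open)
      show "open (top_int T a)" "x \<in> top_int T a" using x by (auto simp: top_int_def top_right_def)
      show "branch T a y = gmap T y" if "y \<in> top_int T a" for y using is_giet_branch(2)[OF giet that] by simp
    qed
    then show ?thesis by (simp add: g_def DERIV_imp_deriv)
  qed
  have fc: "continuous_on (?I a) (f0 a)" for a using F(2) DERIV_continuous_on by blast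
  have right: "Lim (at_right (top_left T a)) g = f0 a (top_left T a)" for a
  proof (rule tendsto_Lim)
    have "(f0 a \<longlongrightarrow> f0 a (top_left T a)) (at_right (top_left T a))"
      using fc[of a] lr[of a] by (simp add: continuous_on_Icc_at_rightD)
    moreover have "eventually (\<lambda>x. f0 a x = g x) (at_right (top_left T a))"
      using eventually_at_right_real[OF lr[of a]] g_eq by (auto elim: eventually_mono)
    ultimately show "(g \<longlongrightarrow> f0 a (top_left T a)) (at_right (top_left T a))" by (rule Lim_transform_eventually)
  qed simp
  have left: "Lim (at_left (top_right T a)) g = f0 a (top_right T a)" for a
  proof (rule tendsto_Lim)
    have "(f0 a \<longlongrightarrow> f0 a (top_right T a)) (at_left (top_right T a))"
      using fc[of a] lr[of a] by (simp add: continuous_on_Icc_at_leftD)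
    moreover have "eventually (\<lambda>x. f0 a x = g x) (at_left (top_right T a))"
      using eventually_at_left_real[OF lr[of a]] g_eq by (auto elim: eventually_mono)
    ultimately show "(g \<longlongrightarrow> f0 a (top_right T a)) (at_left (top_right T a))" by (rule Lim_transform_eventually)
  qed simp
  have te: "top_endpoint T i = top_left T (top_row T ! i)" "top_endpoint T (Suc i) = top_right T (top_row T ! i)"
    if "i < CARD('n)" for i
    using that row_props(1)[of 0] lens(1)
    by (simp_all add: top_endpoint_def top_left_def top_right_def left_end_nth endpoint_def take_Suc_conv_app_nth)
  have pair: "(\<Sum>a\<in>UNIV. cl a * f0 a (top_left T a) - cr a * f0 a (top_right T a)) = 0"
    if c: "cons_at 0 cl cr" for cl cr
  proof (rule consistent_pairing[where r = "right_limit T g" and l = "left_limit T g"])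
    show "consistent (pt' 0) (pb' 0) cl cr" using c by (simp add: cons_at_def)
    fix C assume "C \<in> cycles"
    then have "C \<in> bcycles T" unfolding bcycles_def cycles_def by simp
    then show "(\<Sum>i | i \<le> CARD('n) \<and> SymU i \<in> C. right_limit T g i - left_limit T g i) = 0"
      using B by (simp add: boundary_def boundary_op_def g_def[abs_def])
  next
    show "right_limit T g CARD('n) = 0" "left_limit T g 0 = 0" by (simp_all add: right_limit_def left_limit_def)
    show "right_limit T g i = f0 (pt' 0 ! i) (top_left T (pt' 0 ! i))" if "i < CARD('n)" for i
      using that te right by (simp add: right_limit_def)
    show "left_limit T g (Suc i) = f0 (pt' 0 ! i) (top_right T (pt' 0 ! i))" if "i < CARD('n)" for i
      using that te left by (simp add: left_limit_def)
  qed
  have bd0: "bd f0 0 cl cr = 0" if "cons_at 0 cl cr" for cl cr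
    using pair[OF that] by (simp add: bd_def z)
  show thesis
  proof (rule that)
    show "smooth_towers (al T) (be T) (tw T) (lo T) (hi T) (branch T) f0 eta K"
    proof unfold_locales
      fix b
      show "(branch T b has_real_derivative exp (f0 b x)) (at x within {lo T 0 b..hi T 0 b})"
        if "x \<in> {lo T 0 b..hi T 0 b}" for x using F(1)[of x b] that by (simp add: z)
      show "(f0 b has_real_derivative eta b x) (at x within {lo T 0 b..hi T 0 b})"
        if "x \<in> {lo T 0 b..hi T 0 b}" for x using F(2)[of x b] that by (simp add: z)
      show "\<bar>eta b x - eta b y\<bar> \<le> K * \<bar>x - y\<bar>"
        if "x \<in> {lo T 0 b..hi T 0 b}" "y \<in> {lo T 0 b..hi T 0 b}" for x y
        using F(3)[of x b y] that mult_right_mono[OF KK[of b], of "\<bar>x - y\<bar>"] by (simp add: z)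
      show "(\<Sum>b\<in>UNIV. hi T 0 b - lo T 0 b) = 1"
        using tp by (simp add: z top_right_def two_partitions_def)
      \<comment> \<open>The constant 1 is a function on the cycles; pairing with it gives the mean
        nonlinearity.\<close>
      have "cons_at 0 (\<lambda>a. 1) (\<lambda>a. 1)"
        unfolding cons_at_def consistent_def adjacent by simp
      from pair[OF this] show "(\<Sum>b\<in>UNIV. f0 b (hi T 0 b) - f0 b (lo T 0 b)) = 0"
        by (simp add: z sum_subtractf)
    qed
    show "bd f0 n cl cr = 0" if c: "cons_at n cl cr" for n cl cr
    proof -
      let ?M = "\<Sum>a\<in>UNIV. \<bar>cl a\<bar> + \<bar>cr a\<bar>"
      have "\<bar>cl a\<bar> + \<bar>cr a\<bar> \<le> ?M" for a by (rule member_le_sum) auto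
      then have "\<And>a. \<bar>cl a\<bar> \<le> ?M \<and> \<bar>cr a\<bar> \<le> ?M" by (smt (verit) abs_ge_zero)
      from cons_backward[OF c this] bd0 show ?thesis by metis
    qed
  qed
qed

end

section \<open>Stable and unstable components\<close>

text \<open>Datko's argument.\<close>

lemma summable_submultiplicative_halving:
  fixes a :: "nat \<Rightarrow> nat \<Rightarrow> real"
  assumes nn: "\<And>l m. 0 \<le> a l m"
    and sub: "\<And>l j m. 1 \<le> l \<Longrightarrow> l \<le> j \<Longrightarrow> j \<le> m \<Longrightarrow> a l m \<le> a l j * a j m"
    and bd: "\<And>m. (\<Sum>j=1..m. a j m) \<le> K"
  obtains M where "M \<ge> 1" "\<And>l. l \<ge> 1 \<Longrightarrow> a l (l + M) \<le> 1 / 2"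
proof -
  obtain M :: nat where M: "2 * K\<^sup>2 < real M" using reals_Archimedean2 by blast
  have le: "a j m \<le> K" if "1 \<le> j" "j \<le> m" for j m
    using order_trans[OF member_le_sum[of j "{1..m}" "\<lambda>j. a j m"] bd[of m]] that nn by auto
  have K: "K \<ge> 0" using bd[of 0] by simp
  have "a l (l + M) \<le> 1 / 2" if l: "l \<ge> 1" for l
  proof -
    \<comment> \<open>Each intermediate \<open>j\<close> gives a factorization with first factor at
      most \<open>K\<close>. Adding these up bounds \<open>M\<close> copies of
      \<open>a l (l + M)\<close> by \<open>K\<close> times a sum that is itself at most
      \<open>K\<close>.\<close>
    have "real M * a l (l + M) \<le> (\<Sum>j\<in>{l..l + M}. a l (l + M))" using nn by (simp add: algebra_simps)
    also have "\<dots> \<le> (\<Sum>j\<in>{l..l + M}. K * a j (l + M))"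
    proof (rule sum_mono)
      fix j assume j: "j \<in> {l..l + M}"
      have "a l (l + M) \<le> a l j * a j (l + M)" using sub[OF l] j by auto
      also have "\<dots> \<le> K * a j (l + M)" using le[OF l] j nn by (intro mult_right_mono) auto
      finally show "a l (l + M) \<le> K * a j (l + M)" .
    qed
    also have "\<dots> \<le> (\<Sum>j=1..l + M. K * a j (l + M))" using l nn K by (intro sum_mono2) auto
    also have "\<dots> \<le> K * K" unfolding sum_distrib_left[symmetric] using bd K by (intro mult_left_mono) auto
    finally have 1: "real M * a l (l + M) \<le> K\<^sup>2" by (simp add: power2_eq_square)
    have M0: "real M > 0" using M zero_le_power2[of K] by linarith
    have "real M * a l (l + M) \<le> real M * (1 / 2)" using 1 M by linarith
    then show ?thesis using M0 by simp
  qed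
  moreover have "M \<ge> 1" using M zero_le_power2[of K] by (cases M) auto
  ultimately show thesis using that by blast
qed

text \<open>The rate is at least \<open>\<alpha>\<close> and satisfies
  \<open>3 / 4 \<le> \<beta> ^ M\<close>. One half of the bound covers the halved term, and one
  quarter covers the error because \<open>C'\<close> is at least \<open>4 * C\<close>.\<close>

lemma halving_decay:
  fixes s :: "nat \<Rightarrow> real"
  assumes nn: "\<And>l. 0 \<le> s l" and M: "M \<ge> 1" and al: "0 < \<alpha>" "\<alpha> < 1" and C: "C \<ge> 0"
    and step: "\<And>l. l \<ge> 1 \<Longrightarrow> s (l + M) \<le> s l / 2 + C * \<alpha> ^ l"
  obtains C' \<beta> where "C' > 0" "0 < \<beta>" "\<beta> < 1" "\<And>l. l \<ge> 1 \<Longrightarrow> s l \<le> C' * \<beta> ^ l"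
proof -
  define \<beta> where "\<beta> = max \<alpha> (root M (3 / 4))"
  have r: "0 < root M (3 / 4)" "root M (3 / 4) < 1" using M by auto
  have be: "0 < \<beta>" "\<beta> < 1" "\<alpha> \<le> \<beta>" using al r by (auto simp: \<beta>_def)
  have "root M (3 / 4) ^ M \<le> \<beta> ^ M" using r by (intro power_mono) (auto simp: \<beta>_def)
  then have b34: "3 / 4 \<le> \<beta> ^ M" using M by simp
  define C' where "C' = 4 * C + 1 + (\<Sum>j\<le>M. s j / \<beta> ^ j)"
  have sums: "0 \<le> (\<Sum>j\<le>M. s j / \<beta> ^ j)" using nn be by (intro sum_nonneg) auto
  have C'0: "C' > 0" "C' \<ge> 4 * C" using C sums by (auto simp: C'_def)
  have "s l \<le> C' * \<beta> ^ l" if "l \<ge> 1" for l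
    using that
  proof (induction l rule: less_induct)
    case (less l)
    show ?case
    proof (cases "l \<le> M")
      case True
      have "s l / \<beta> ^ l \<le> (\<Sum>j\<le>M. s j / \<beta> ^ j)"
        by (rule member_le_sum) (use True nn be in auto)
      then have "s l / \<beta> ^ l \<le> C'" using C by (simp add: C'_def)
      then show ?thesis using be by (simp add: pos_divide_le_eq)
    next
      case False
      define k where "k = l - M"
      have k: "l = k + M" "k \<ge> 1" "k < l" using False M by (auto simp: k_def)
      have p: "0 \<le> \<beta> ^ k" using be by simp
      have "s l \<le> s k / 2 + C * \<alpha> ^ k" using step[OF k(2)] k(1) by simp
      also have "\<dots> \<le> C' * \<beta> ^ k / 2 + C * \<beta> ^ k"
        using less.IH[OF k(3,2)] C al be by (intro add_mono mult_left_mono power_mono divide_right_mono) auto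
      also have "\<dots> \<le> C' * \<beta> ^ k * (3 / 4)" using mult_right_mono[OF C'0(2) p] by (simp add: algebra_simps)
      also have "\<dots> \<le> C' * \<beta> ^ k * \<beta> ^ M" using b34 C'0 be by (intro mult_left_mono) auto
      finally show ?thesis by (simp add: k(1) power_add mult.assoc)
    qed
  qed
  then show thesis using that C'0(1) be(1,2) by blast
qed

section \<open>Norms of matrices on subspaces, and projections of a splitting\<close>

lemma matrix_norm_bound: "norm (A *v v) \<le> matrix_norm A * norm v" for A :: "real ^ 'n::finite ^ 'n"
  unfolding matrix_norm_def by (rule onorm[OF matrix_vector_mul_bounded_linear])

lemma matrix_norm_nonneg: "0 \<le> matrix_norm A" for A :: "real ^ 'n::finite ^ 'n"
  unfolding matrix_norm_def by (rule onorm_pos_le[OF matrix_vector_mul_bounded_linear])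

lemma matrix_norm_on_bdd: "bdd_above ((\<lambda>v. norm (A *v v)) ` {v \<in> X. norm v \<le> 1})"
  for A :: "real ^ 'n::finite ^ 'n"
proof (rule bdd_aboveI)
  fix y assume "y \<in> (\<lambda>v. norm (A *v v)) ` {v \<in> X. norm v \<le> 1}"
  then obtain v where v: "y = norm (A *v v)" "norm v \<le> 1" by auto
  then show "y \<le> matrix_norm A"
    using matrix_norm_bound[of A v] mult_left_mono[OF v(2) matrix_norm_nonneg[of A]] by simp
qed

lemma matrix_norm_on_bound:
  fixes A :: "real ^ 'n::finite ^ 'n"
  assumes "subspace X" "v \<in> X"
  shows "norm (A *v v) \<le> matrix_norm_on A X * norm v"
proof (cases "v = 0")
  case False
  let ?u = "(1 / norm v) *\<^sub>R v"
  have "?u \<in> {v \<in> X. norm v \<le> 1}" using assms False by (simp add: subspace_scale)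
  then have "norm (A *v ?u) \<le> matrix_norm_on A X"
    unfolding matrix_norm_on_def by (rule cSUP_upper[OF _ matrix_norm_on_bdd])
  then have "norm (A *v v) / norm v \<le> matrix_norm_on A X" by (simp add: matrix_vector_mult_scaleR)
  then show ?thesis using False by (simp add: pos_divide_le_eq)
qed simp

lemma matrix_norm_on_nonneg: "subspace X \<Longrightarrow> 0 \<le> matrix_norm_on A X" for A :: "real ^ 'n::finite ^ 'n"
proof -
  assume "subspace X"
  then have "0 \<in> {v \<in> X. norm v \<le> 1}" by (simp add: subspace_0)
  then have "norm (A *v 0) \<le> matrix_norm_on A X"
    unfolding matrix_norm_on_def by (rule cSUP_upper[OF _ matrix_norm_on_bdd])
  then show ?thesis by simp
qed

lemma matrix_norm_on_le:
  fixes A :: "real ^ 'n::finite ^ 'n"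
  assumes "subspace X" "\<And>v. v \<in> X \<Longrightarrow> norm (A *v v) \<le> c * norm v" "0 \<le> c"
  shows "matrix_norm_on A X \<le> c"
  unfolding matrix_norm_on_def
proof (rule cSUP_least)
  have "0 \<in> {v \<in> X. norm v \<le> 1}" using assms(1) by (simp add: subspace_0)
  then show "{v \<in> X. norm v \<le> 1} \<noteq> {}" by blast
  fix v assume v: "v \<in> {v \<in> X. norm v \<le> 1}"
  then have "norm (A *v v) \<le> c * norm v" using assms(2) by auto
  also have "\<dots> \<le> c * 1" using v assms(3) by (intro mult_left_mono) auto
  finally show "norm (A *v v) \<le> c" by simp
qed

locale splitting_at =
  fixes G :: "'n::finite splitting" and n :: nat
  assumes sub: "\<And>x. subspace (G x n)" and ex1: "\<And>v. \<exists>!f. splits G n v f"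
begin

lemma splits_proj: "splits G n v (\<lambda>x. split_proj G x n v)"
proof -
  have "(\<lambda>x. split_proj G x n v) = (THE f. splits G n v f)" by (simp add: split_proj_def)
  then show ?thesis using theI'[OF ex1[of v]] by simp
qed

lemma proj_in: "split_proj G x n v \<in> G x n"
  and proj_sum: "v = split_proj G Stable n v + split_proj G Central n v + split_proj G Unstable n v"
  using splits_proj[of v] by (auto simp: splits_def)

lemma proj_eqI: "splits G n v f \<Longrightarrow> split_proj G x n v = f x"
  using ex1[of v] splits_proj[of v] by metis

lemma proj_linear: "linear (split_proj G x n)"
proof (rule linearI)
  fix v v' :: "real ^ 'n" and c :: real
  have "splits G n (v + v') (\<lambda>x. split_proj G x n v + split_proj G x n v')"
    using proj_in proj_sum[of v] proj_sum[of v'] sub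
    by (auto simp: splits_def subspace_add algebra_simps) (metis (no_types, lifting) add.assoc add.commute)
  then show "split_proj G x n (v + v') = split_proj G x n v + split_proj G x n v'" by (rule proj_eqI)
  have "c *\<^sub>R v = c *\<^sub>R (split_proj G Stable n v + split_proj G Central n v + split_proj G Unstable n v)"
    using proj_sum[of v] by simp
  then have "splits G n (c *\<^sub>R v) (\<lambda>x. c *\<^sub>R split_proj G x n v)"
    using proj_in sub by (auto simp: splits_def subspace_scale scaleR_add_right)
  then show "split_proj G x n (c *\<^sub>R v) = c *\<^sub>R split_proj G x n v" by (rule proj_eqI)
qed

lemma proj_bounded: "bounded_linear (split_proj G x n)"
  using proj_linear by (simp add: linear_conv_bounded_linear)

lemma proj_norm: "norm (split_proj G x n v) \<le> onorm (split_proj G x n) * norm v"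
  by (rule onorm[OF proj_bounded])

lemma onorm_proj_nonneg: "0 \<le> onorm (split_proj G x n)"
  by (rule onorm_pos_le[OF proj_bounded])

lemma proj_id: "v \<in> G x n \<Longrightarrow> split_proj G x n v = v"
proof -
  assume v: "v \<in> G x n"
  have "splits G n v (\<lambda>y. if y = x then v else 0)"
    using v sub by (cases x) (auto simp: splits_def subspace_0)
  from proj_eqI[OF this, of x] show ?thesis by simp
qed

lemma onorm_proj_ge_1: "v \<in> G x n \<Longrightarrow> v \<noteq> 0 \<Longrightarrow> 1 \<le> onorm (split_proj G x n)"
  using proj_norm[of x v] proj_id[of v x] by simp

lemma proj_transport:
  assumes B: "splitting_at G n'" and map: "\<And>x. (\<lambda>v. A *v v) ` G x n = G x n'"
  shows "split_proj G x n' (A *v v) = A *v split_proj G x n v"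
proof -
  have "splits G n' (A *v v) (\<lambda>x. A *v split_proj G x n v)"
    unfolding splits_def
  proof (intro conjI allI)
    show "A *v split_proj G x n v \<in> G x n'" for x using map[of x] proj_in by blast
    have "A *v v = A *v (split_proj G Stable n v + split_proj G Central n v + split_proj G Unstable n v)"
      using proj_sum[of v] by simp
    then show "A *v v = A *v split_proj G Stable n v + A *v split_proj G Central n v + A *v split_proj G Unstable n v"
      by (simp add: matrix_vector_right_distrib)
  qed
  then show ?thesis by (rule splitting_at.proj_eqI[OF B])
qed

end

text \<open>The linear part, free of interval exchanges: \<open>u\<close> follows the cocycle up to
  errors proportional to the norm of the step matrix, exactly the factor that the terms of [B] and
  [F] contain.\<close>

locale rdc_linear =
  fixes G :: "'n::finite splitting" and n k :: "nat \<Rightarrow> nat" and Q :: "nat \<Rightarrow> nat \<Rightarrow> real ^ 'n ^ 'n"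
    and u :: "nat \<Rightarrow> real ^ 'n" and eps :: "nat \<Rightarrow> real" and c Km Kp C \<alpha> U :: real
  assumes split: "\<And>i. splitting_at G (n i)"
    and Qinv: "\<And>i j. i \<le> j \<Longrightarrow> invertible (Q i j)"
    and Qtrans: "\<And>i j l. i \<le> j \<Longrightarrow> j \<le> l \<Longrightarrow> Q i l = Q j l ** Q i j"
    and Qrefl: "\<And>i. Q i i = mat 1"
    and Qmap: "\<And>i j x. i \<le> j \<Longrightarrow> (\<lambda>v. Q i j *v v) ` G x (n i) = G x (n j)"
    and Z1: "\<And>j. 1 \<le> matrix_norm (Q j (Suc j))"
    and kmono: "strict_mono k"
    and back_sum: "\<And>m. (\<Sum>j = 1..k m. matrix_norm_on (Q j (k m)) (G Stable (n j))
                    * onorm (split_proj G Stable (n j)) * matrix_norm (Q (j - 1) (Suc (j - 1)))) \<le> Km"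
    and forw_summable: "\<And>m. summable (\<lambda>i. matrix_norm_on (matrix_inv (Q (k m) (k m + 1 + i))) (G Unstable (n (k m + 1 + i)))
                    * onorm (split_proj G Unstable (n (k m + 1 + i))) * matrix_norm (Q (k m + 1 + i - 1) (Suc (k m + 1 + i - 1))))"
    and forw_sum: "\<And>m. (\<Sum>i. matrix_norm_on (matrix_inv (Q (k m) (k m + 1 + i))) (G Unstable (n (k m + 1 + i)))
                    * onorm (split_proj G Unstable (n (k m + 1 + i))) * matrix_norm (Q (k m + 1 + i - 1) (Suc (k m + 1 + i - 1)))) \<le> Kp"
    and err: "\<And>j. norm (u (Suc j) - Q j (Suc j) *v u j) \<le> c * matrix_norm (Q j (Suc j)) * eps j"
    and c0: "0 \<le> c" and eps0: "\<And>j. 0 \<le> eps j" and eps_mono: "\<And>i j. i \<le> j \<Longrightarrow> eps j \<le> eps i"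
    and eps_exp: "\<And>m. eps (k m) \<le> C * \<alpha> ^ m" and al: "0 < \<alpha>" "\<alpha> < 1"
    and ubd: "\<And>m. norm (u (k m)) \<le> U"
begin

abbreviation P :: "osel \<Rightarrow> nat \<Rightarrow> real ^ 'n \<Rightarrow> real ^ 'n" where "P x j \<equiv> split_proj G x (n j)"

definition e :: "nat \<Rightarrow> real ^ 'n" where "e j = u j - Q (j - 1) j *v u (j - 1)"

lemma P_Q: "i \<le> j \<Longrightarrow> P x j (Q i j *v v) = Q i j *v P x i v"
  by (rule splitting_at.proj_transport[OF split split Qmap])

lemma subG: "subspace (G x (n j))"
  using splitting_at.sub[OF split] .

lemma e_bound: "j \<ge> 1 \<Longrightarrow> norm (e j) \<le> c * matrix_norm (Q (j - 1) (Suc (j - 1))) * eps (j - 1)"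
  using err[of "j - 1"] by (simp add: e_def)

lemma P_step: "P x (Suc j) (u (Suc j)) = Q j (Suc j) *v P x j (u j) + P x (Suc j) (e (Suc j))"
proof -
  have "P x (Suc j) (u (Suc j)) = P x (Suc j) (Q j (Suc j) *v u j + e (Suc j))" by (simp add: e_def)
  then show ?thesis using splitting_at.proj_linear[OF split, of x "Suc j"] P_Q[of j "Suc j" x "u j"]
    by (simp add: linear_add)
qed

lemma C0: "C \<ge> 0"
  using eps_exp[of 0] eps0[of "k 0"] by simp

definition sn :: "nat \<Rightarrow> nat \<Rightarrow> real" where "sn i j = matrix_norm_on (Q i j) (G Stable (n i))"

lemma sn_nonneg: "0 \<le> sn i j"
  unfolding sn_def by (rule matrix_norm_on_nonneg[OF subG])

text \<open>The projection onto a nonzero stable space has norm at least 1, and so has the step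
  matrix; thus [B] bounds the sum of the bare norms \<open>sn\<close>, to which Datko's argument
  applies.\<close>

lemma sn_le_term:
  "sn j m \<le> sn j m * onorm (P Stable j) * matrix_norm (Q (j - 1) (Suc (j - 1)))"
proof (cases "\<exists>v\<in>G Stable (n j). v \<noteq> 0")
  case True
  then have "1 \<le> onorm (P Stable j)" using splitting_at.onorm_proj_ge_1[OF split] by blast
  then have "1 * 1 \<le> onorm (P Stable j) * matrix_norm (Q (j - 1) (Suc (j - 1)))"
    using Z1[of "j - 1"] by (intro mult_mono) auto
  then have "sn j m * 1 \<le> sn j m * (onorm (P Stable j) * matrix_norm (Q (j - 1) (Suc (j - 1))))"
    using sn_nonneg by (intro mult_left_mono) auto
  then show ?thesis by (simp add: mult.assoc)
next
  case False
  then have "sn j m \<le> 0" unfolding sn_def by (intro matrix_norm_on_le[OF subG]) auto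
  then show ?thesis using sn_nonneg[of j m] by simp
qed

lemma stable_term_nonneg:
  "0 \<le> sn j m * onorm (P Stable j) * matrix_norm (Q (j - 1) (Suc (j - 1)))"
  using sn_nonneg[of j m] splitting_at.onorm_proj_nonneg[OF split, of Stable j] matrix_norm_nonneg
  by (intro mult_nonneg_nonneg) auto

lemma k_ge: "m \<le> k m"
  using kmono by (rule strict_mono_imp_increasing)

lemma k_mono: "l \<le> m \<Longrightarrow> k l \<le> k m"
  using kmono by (simp add: strict_mono_less_eq)

lemma sn_sum: "(\<Sum>l=1..m. sn (k l) (k m)) \<le> Km"
proof -
  have inj: "inj_on k {1..m}" using strict_mono_imp_inj_on[OF kmono] inj_on_subset by blast
  have "(\<Sum>l=1..m. sn (k l) (k m)) = (\<Sum>j\<in>k ` {1..m}. sn j (k m))" by (simp add: sum.reindex[OF inj] del: One_nat_def)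
  also have "\<dots> \<le> (\<Sum>j=1..k m. sn j (k m))"
  proof (rule sum_mono2)
    show "k ` {1..m} \<subseteq> {1..k m}" using k_mono order_trans[OF _ k_ge] by auto
  qed (auto simp: sn_nonneg)
  also have "\<dots> \<le> (\<Sum>j=1..k m. sn j (k m) * onorm (P Stable j) * matrix_norm (Q (j - 1) (Suc (j - 1))))"
    by (intro sum_mono sn_le_term)
  also have "\<dots> \<le> Km" using back_sum[of m] by (simp add: sn_def)
  finally show ?thesis .
qed

lemma sn_sub:
  assumes "i \<le> j" "j \<le> l"
  shows "sn i l \<le> sn i j * sn j l"
  unfolding sn_def[of i l]
proof (rule matrix_norm_on_le[OF subG])
  fix v assume v: "v \<in> G Stable (n i)"
  have w: "Q i j *v v \<in> G Stable (n j)" using Qmap[OF assms(1), of Stable] v by blast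
  have "norm (Q i l *v v) = norm (Q j l *v (Q i j *v v))" by (simp add: Qtrans[OF assms] matrix_vector_mul_assoc)
  also have "\<dots> \<le> sn j l * norm (Q i j *v v)" unfolding sn_def by (rule matrix_norm_on_bound[OF subG w])
  also have "\<dots> \<le> sn j l * (sn i j * norm v)"
    unfolding sn_def[of i j] by (intro mult_left_mono matrix_norm_on_bound[OF subG v] sn_nonneg)
  finally show "norm (Q i l *v v) \<le> sn i j * sn j l * norm v" by (simp add: mult_ac)
qed (simp add: sn_nonneg)

text \<open>Variation of constants: the projections commute with the cocycle, so each component
  satisfies the same perturbed recursion.\<close>

lemma component_formula:
  assumes "i \<le> j"
  shows "P x j (u j) = Q i j *v P x i (u i) + (\<Sum>l=Suc i..j. Q l j *v P x l (e l))"
  using assms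
proof (induction j rule: dec_induct)
  case base then show ?case by (simp add: Qrefl)
next
  case (step j)
  have comp: "Q j (Suc j) *v (Q l j *v v) = Q l (Suc j) *v v" if "l \<le> j" for l v
    using Qtrans[of l j "Suc j"] that by (simp add: matrix_vector_mul_assoc)
  have "Q j (Suc j) *v P x j (u j) = Q i (Suc j) *v P x i (u i) + (\<Sum>l=Suc i..j. Q l (Suc j) *v P x l (e l))"
    unfolding step.IH matrix_vector_right_distrib linear_sum[OF matrix_vector_mul_linear] comp[OF step(1)]
    by (simp add: comp)
  then show ?case using P_step[of x j] step(1) by (simp add: Qrefl add.assoc)
qed

lemma Km0: "Km \<ge> 0"
  using sn_sum[of 0] by simp

text \<open>Every error after \<open>k l\<close> is at most \<open>c * eps (k l)\<close> times the
  corresponding term of [B], and these terms sum to at most \<open>Km\<close>.\<close>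

lemma stable_bound:
  assumes lm: "l \<le> m"
  shows "norm (P Stable (k m) (u (k m)))
    \<le> sn (k l) (k m) * norm (P Stable (k l) (u (k l))) + c * Km * eps (k l)"
proof -
  let ?t = "\<lambda>j. sn j (k m) * onorm (P Stable j) * matrix_norm (Q (j - 1) (Suc (j - 1)))"
  have le: "norm (Q j (k m) *v P Stable j (e j)) \<le> c * eps (k l) * ?t j" if j: "j \<in> {Suc (k l)..k m}" for j
  proof -
    have Z: "0 \<le> matrix_norm (Q (j - 1) (Suc (j - 1)))" by (rule matrix_norm_nonneg)
    have "norm (Q j (k m) *v P Stable j (e j)) \<le> sn j (k m) * norm (P Stable j (e j))"
      unfolding sn_def by (rule matrix_norm_on_bound[OF subG splitting_at.proj_in[OF split]])
    also have "\<dots> \<le> sn j (k m) * (onorm (P Stable j) * norm (e j))"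
      by (intro mult_left_mono splitting_at.proj_norm[OF split] sn_nonneg)
    also have "\<dots> \<le> sn j (k m) * (onorm (P Stable j) * (c * matrix_norm (Q (j - 1) (Suc (j - 1))) * eps (k l)))"
    proof (intro mult_left_mono sn_nonneg splitting_at.onorm_proj_nonneg[OF split])
      have "norm (e j) \<le> c * matrix_norm (Q (j - 1) (Suc (j - 1))) * eps (j - 1)" using j by (intro e_bound) auto
      also have "\<dots> \<le> c * matrix_norm (Q (j - 1) (Suc (j - 1))) * eps (k l)"
        using j c0 Z by (intro mult_left_mono eps_mono mult_nonneg_nonneg) auto
      finally show "norm (e j) \<le> c * matrix_norm (Q (j - 1) (Suc (j - 1))) * eps (k l)" .
    qed
    finally show ?thesis by (simp only: mult_ac)
  qed
  have "norm (\<Sum>j=Suc (k l)..k m. Q j (k m) *v P Stable j (e j)) \<le> (\<Sum>j=Suc (k l)..k m. c * eps (k l) * ?t j)"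
    by (rule sum_norm_le) (use le in blast)
  also have "\<dots> = c * eps (k l) * (\<Sum>j=Suc (k l)..k m. ?t j)" by (simp only: sum_distrib_left)
  also have "\<dots> \<le> c * eps (k l) * (\<Sum>j=1..k m. ?t j)"
    by (intro mult_left_mono sum_mono2 mult_nonneg_nonneg c0 eps0 stable_term_nonneg) auto
  also have "\<dots> \<le> c * eps (k l) * Km"
    using back_sum[of m] unfolding sn_def by (intro mult_left_mono mult_nonneg_nonneg c0 eps0)
  finally have 1: "norm (\<Sum>j=Suc (k l)..k m. Q j (k m) *v P Stable j (e j)) \<le> c * Km * eps (k l)"
    by (simp only: mult_ac)
  have 2: "norm (Q (k l) (k m) *v P Stable (k l) (u (k l))) \<le> sn (k l) (k m) * norm (P Stable (k l) (u (k l)))"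
    unfolding sn_def by (rule matrix_norm_on_bound[OF subG splitting_at.proj_in[OF split]])
  show ?thesis
    unfolding component_formula[OF k_mono[OF lm], of Stable]
    by (rule order_trans[OF norm_triangle_ineq add_mono[OF 2 1]])
qed

lemma stable_decay:
  obtains C' \<beta> where "C' > 0" "0 < \<beta>" "\<beta> < 1"
    "\<And>m. m \<ge> 1 \<Longrightarrow> norm (P Stable (k m) (u (k m))) \<le> C' * \<beta> ^ m"
proof -
  obtain M where M: "M \<ge> 1" "\<And>l. l \<ge> 1 \<Longrightarrow> sn (k l) (k (l + M)) \<le> 1 / 2"
    using summable_submultiplicative_halving[of "\<lambda>l m. sn (k l) (k m)" Km] sn_nonneg sn_sub k_mono sn_sum
    by metis
  have st: "norm (P Stable (k (l + M)) (u (k (l + M)))) \<le> norm (P Stable (k l) (u (k l))) / 2 + c * Km * C * \<alpha> ^ l"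
    if l: "l \<ge> 1" for l
  proof -
    have "norm (P Stable (k (l + M)) (u (k (l + M))))
      \<le> sn (k l) (k (l + M)) * norm (P Stable (k l) (u (k l))) + c * Km * eps (k l)"
      by (rule stable_bound) simp
    also have "\<dots> \<le> 1 / 2 * norm (P Stable (k l) (u (k l))) + c * Km * (C * \<alpha> ^ l)"
      by (intro add_mono mult_right_mono mult_left_mono M l eps_exp mult_nonneg_nonneg c0 Km0) auto
    finally show ?thesis by (simp add: mult.assoc)
  qed
  show thesis
    by (rule halving_decay[OF _ M(1) al _ st]) (use that C0 c0 Km0 in auto)
qed

lemma matrix_inv_left: "invertible A \<Longrightarrow> matrix_inv A ** A = mat 1"
  and matrix_inv_right: "invertible A \<Longrightarrow> A ** matrix_inv A = mat 1"
  for A :: "real ^ 'm ^ 'm"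
  unfolding invertible_def matrix_inv_def by (rule someI2_ex; simp)+

lemma matrix_inv_cancel: "i \<le> j \<Longrightarrow> matrix_inv (Q i j) *v (Q i j *v v) = v"
  using matrix_inv_left[OF Qinv] by (simp add: matrix_vector_mul_assoc)

lemma matrix_inv_partial:
  assumes "i \<le> l" "l \<le> j" shows "matrix_inv (Q i j) *v (Q l j *v v) = matrix_inv (Q i l) *v v"
proof -
  have "Q l j *v v = Q i j *v (matrix_inv (Q i l) *v v)"
    using Qtrans[OF assms] matrix_inv_right[OF Qinv[OF assms(1)]]
    by (simp add: matrix_vector_mul_assoc matrix_mul_assoc[symmetric])
  then show ?thesis using matrix_inv_cancel[of i j] assms by simp
qed

definition uterm :: "nat \<Rightarrow> nat \<Rightarrow> real" where
  "uterm i j = matrix_norm_on (matrix_inv (Q i j)) (G Unstable (n j)) * onorm (P Unstable j)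
     * matrix_norm (Q (j - 1) (Suc (j - 1)))"

text \<open>The matrix norm is kept on the left so that it cancels against the same factor in
  \<open>e_bound\<close>.\<close>

lemma uterm_bound: "norm (matrix_inv (Q i j) *v P Unstable j v) * matrix_norm (Q (j - 1) (Suc (j - 1))) \<le> uterm i j * norm v"
proof -
  have "norm (matrix_inv (Q i j) *v P Unstable j v)
    \<le> matrix_norm_on (matrix_inv (Q i j)) (G Unstable (n j)) * norm (P Unstable j v)"
    by (rule matrix_norm_on_bound[OF subG splitting_at.proj_in[OF split]])
  also have "\<dots> \<le> matrix_norm_on (matrix_inv (Q i j)) (G Unstable (n j)) * (onorm (P Unstable j) * norm v)"
    by (intro mult_left_mono splitting_at.proj_norm[OF split] matrix_norm_on_nonneg[OF subG])
  finally have "norm (matrix_inv (Q i j) *v P Unstable j v)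
    \<le> matrix_norm_on (matrix_inv (Q i j)) (G Unstable (n j)) * (onorm (P Unstable j) * norm v)" .
  from mult_right_mono[OF this matrix_norm_nonneg, of "Q (j - 1) (Suc (j - 1))"]
  show ?thesis unfolding uterm_def by (simp only: mult_ac)
qed

lemma uterm_nonneg: "0 \<le> uterm i j"
  unfolding uterm_def
  by (intro mult_nonneg_nonneg matrix_norm_on_nonneg[OF subG] splitting_at.onorm_proj_nonneg[OF split] matrix_norm_nonneg)

lemma uterm_bound': "norm (matrix_inv (Q i j) *v P Unstable j v) \<le> uterm i j * norm v"
proof -
  have "norm (matrix_inv (Q i j) *v P Unstable j v) * 1
    \<le> norm (matrix_inv (Q i j) *v P Unstable j v) * matrix_norm (Q (j - 1) (Suc (j - 1)))"
    by (intro mult_left_mono Z1) auto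
  then show ?thesis using uterm_bound[of i j v] by simp
qed

lemma unstable_error:
  assumes j: "k m < j"
  shows "norm (matrix_inv (Q (k m) j) *v P Unstable j (e j)) \<le> c * eps (k m) * uterm (k m) j"
proof -
  let ?Z = "matrix_norm (Q (j - 1) (Suc (j - 1)))"
  have Z: "?Z \<ge> 1" by (rule Z1)
  have "norm (e j) \<le> c * ?Z * eps (j - 1)" using j by (intro e_bound) auto
  also have "\<dots> \<le> c * ?Z * eps (k m)"
    using j c0 Z by (intro mult_left_mono eps_mono mult_nonneg_nonneg) auto
  finally have "norm (e j) \<le> c * eps (k m) * ?Z" by (simp only: mult_ac)
  then have "uterm (k m) j * norm (e j) \<le> uterm (k m) j * (c * eps (k m) * ?Z)"
    by (rule mult_left_mono[OF _ uterm_nonneg])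
  with uterm_bound[of "k m" j "e j"]
  have "norm (matrix_inv (Q (k m) j) *v P Unstable j (e j)) * ?Z \<le> (c * eps (k m) * uterm (k m) j) * ?Z"
    by (simp add: mult_ac)
  then show ?thesis using Z by simp
qed

text \<open>The recursion is solved backward: the component is the pulled-back component at a later
  time minus pulled-back errors. Along later times of the form \<open>k m'\<close> the vector is
  bounded while the terms of [F] tend to 0, so only the errors survive.\<close>

lemma unstable_bound: "norm (P Unstable (k m) (u (k m))) \<le> c * Kp * eps (k m)"
proof -
  let ?F = "\<lambda>i. uterm (k m) (k m + 1 + i)"
  have sF: "summable ?F" unfolding uterm_def by (rule forw_summable)
  have sK: "suminf ?F \<le> Kp" unfolding uterm_def by (rule forw_sum)
  have lim: "?F \<longlonglongrightarrow> 0" using sF by (rule summable_LIMSEQ_zero)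
  \<comment> \<open>Selects from the tail of [F] the indices at which \<open>u\<close> is known to
    be bounded.\<close>
  define r where "r l = k (m + 1 + l) - (k m + 1)" for l
  have r: "k (m + 1 + l) = k m + 1 + r l" for l
    using strict_monoD[OF kmono, of m "m + 1 + l"] by (simp add: r_def)
  have "strict_mono r"
  proof (rule strict_monoI_Suc)
    fix l show "r l < r (Suc l)" using r[of l] r[of "Suc l"] strict_monoD[OF kmono, of "m + 1 + l" "m + 1 + Suc l"] by simp
  qed
  then have lim': "(\<lambda>l. ?F (r l)) \<longlonglongrightarrow> 0" using LIMSEQ_subseq_LIMSEQ[OF lim] by (simp add: o_def)
  have "norm (P Unstable (k m) (u (k m))) \<le> ?F (r l) * U + c * Kp * eps (k m)" for l
  proof -
    define j where "j = k (m + 1 + l)"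
    have j: "k m \<le> j" "j = k m + 1 + r l" unfolding j_def r by simp_all
    have "P Unstable j (u j) = Q (k m) j *v P Unstable (k m) (u (k m)) + (\<Sum>l=Suc (k m)..j. Q l j *v P Unstable l (e l))"
      by (rule component_formula[OF j(1)])
    then have "matrix_inv (Q (k m) j) *v P Unstable j (u j)
      = P Unstable (k m) (u (k m)) + (\<Sum>l=Suc (k m)..j. matrix_inv (Q (k m) j) *v (Q l j *v P Unstable l (e l)))"
      by (simp add: matrix_vector_right_distrib linear_sum[OF matrix_vector_mul_linear] matrix_inv_cancel[OF j(1)])
    also have "(\<Sum>l=Suc (k m)..j. matrix_inv (Q (k m) j) *v (Q l j *v P Unstable l (e l)))
      = (\<Sum>l=Suc (k m)..j. matrix_inv (Q (k m) l) *v P Unstable l (e l))"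
      by (intro sum.cong refl matrix_inv_partial) auto
    finally have eq: "P Unstable (k m) (u (k m)) = matrix_inv (Q (k m) j) *v P Unstable j (u j)
      - (\<Sum>l=Suc (k m)..j. matrix_inv (Q (k m) l) *v P Unstable l (e l))" by simp
    have 1: "norm (matrix_inv (Q (k m) j) *v P Unstable j (u j)) \<le> ?F (r l) * U"
    proof -
      have "norm (matrix_inv (Q (k m) j) *v P Unstable j (u j)) \<le> uterm (k m) j * norm (u j)" by (rule uterm_bound')
      also have "\<dots> \<le> uterm (k m) j * U" unfolding j_def by (intro mult_left_mono ubd uterm_nonneg)
      finally show ?thesis by (simp add: j(2))
    qed
    have "norm (\<Sum>l=Suc (k m)..j. matrix_inv (Q (k m) l) *v P Unstable l (e l))
      \<le> (\<Sum>l=Suc (k m)..j. c * eps (k m) * uterm (k m) l)"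
      by (rule sum_norm_le) (auto intro: unstable_error)
    also have "\<dots> = c * eps (k m) * (\<Sum>l=Suc (k m)..j. uterm (k m) l)" by (simp only: sum_distrib_left)
    also have "(\<Sum>l=Suc (k m)..j. uterm (k m) l) = (\<Sum>i<Suc (r l). ?F i)"
    proof (rule sum.reindex_bij_witness[of _ "\<lambda>i. k m + 1 + i" "\<lambda>l. l - (k m + 1)"])
    qed (auto simp: j(2))
    also have "\<dots> \<le> Kp" using sum_le_suminf[OF sF, of "{..<Suc (r l)}"] sK uterm_nonneg by fastforce
    finally have 2: "norm (\<Sum>l=Suc (k m)..j. matrix_inv (Q (k m) l) *v P Unstable l (e l)) \<le> c * eps (k m) * Kp"
      using c0 eps0 by (simp add: mult_left_mono)
    show ?thesis unfolding eq
      using norm_triangle_ineq4 [THEN order_trans, OF add_mono[OF 1 2]] by (simp add: mult_ac)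
  qed
  moreover have "(\<lambda>l. ?F (r l) * U + c * Kp * eps (k m)) \<longlonglongrightarrow> 0 * U + c * Kp * eps (k m)"
    by (intro tendsto_intros lim')
  ultimately show ?thesis using LIMSEQ_le_const[of "\<lambda>l. ?F (r l) * U + c * Kp * eps (k m)"] by simp
qed

lemma hyperbolic_decay:
  obtains C' \<beta> where "C' > 0" "0 < \<beta>" "\<beta> < 1"
    "\<And>m. m \<ge> 1 \<Longrightarrow> norm (P Stable (k m) (u (k m))) \<le> C' * \<beta> ^ m"
    "\<And>m. m \<ge> 1 \<Longrightarrow> norm (P Unstable (k m) (u (k m))) \<le> C' * \<beta> ^ m"
proof -
  obtain C1 b where C1: "C1 > 0" "0 < b" "b < 1"
    "\<And>m. m \<ge> 1 \<Longrightarrow> norm (P Stable (k m) (u (k m))) \<le> C1 * b ^ m"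
    using stable_decay by metis
  define C' \<beta> where "C' = max C1 (c * \<bar>Kp\<bar> * C)" and "\<beta> = max b \<alpha>"
  show thesis
  proof (rule that[of C' \<beta>])
    show "C' > 0" "0 < \<beta>" "\<beta> < 1" using C1 al by (auto simp: C'_def \<beta>_def)
    fix m :: nat assume m: "m \<ge> 1"
    have "C1 * b ^ m \<le> C' * \<beta> ^ m"
      using C1 C0 c0 by (intro mult_mono power_mono) (auto simp: C'_def \<beta>_def)
    then show "norm (P Stable (k m) (u (k m))) \<le> C' * \<beta> ^ m" using C1(4)[OF m] by linarith
    have "norm (P Unstable (k m) (u (k m))) \<le> c * Kp * eps (k m)" by (rule unstable_bound)
    also have "\<dots> \<le> c * \<bar>Kp\<bar> * (C * \<alpha> ^ m)"
      using c0 eps0 eps_exp by (intro mult_mono mult_left_mono mult_nonneg_nonneg) auto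
    also have "\<dots> = (c * \<bar>Kp\<bar> * C) * \<alpha> ^ m" by simp
    also have "\<dots> \<le> C' * \<beta> ^ m"
      using C1 C0 c0 al by (intro mult_mono power_mono) (auto simp: C'_def \<beta>_def)
    finally show "norm (P Unstable (k m) (u (k m))) \<le> C' * \<beta> ^ m" .
  qed
qed

end

section \<open>The central component\<close>

lemma orthonormal_expansion:
  assumes "subspace (V :: 'v::euclidean_space set)"
  shows "\<exists>B. finite B \<and> B \<subseteq> V \<and> (\<forall>b\<in>B. norm b = 1) \<and> (\<forall>v\<in>V. v = (\<Sum>b\<in>B. (b \<bullet> v) *\<^sub>R b))"
proof -
  obtain B where B: "B \<subseteq> V" "pairwise orthogonal B" "\<And>x. x \<in> B \<Longrightarrow> norm x = 1" "independent B" "span B = V"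
    using orthonormal_basis_subspace[OF assms] by metis
  have "finite B" using B(4) independent_imp_finite by blast
  moreover have "v = (\<Sum>b\<in>B. (b \<bullet> v) *\<^sub>R b)" if "v \<in> V" for v
    using orthonormal_basis_expand[OF B(2,3), of v] that B(5) \<open>finite B\<close> by (simp add: inner_commute)
  ultimately show ?thesis using B by blast
qed

text \<open>The growth is known vector by vector; a finite orthonormal basis makes the constant
  uniform on the subspace.\<close>

lemma subexponential_uniform:
  fixes Q :: "nat \<Rightarrow> real ^ 'n::finite ^ 'n"
  assumes V: "subspace V" and lim: "\<And>v. v \<in> V \<Longrightarrow> v \<noteq> 0 \<Longrightarrow> (\<lambda>n. ln (norm (Q n *v v)) / real n) \<longlonglongrightarrow> 0"
    and e: "\<epsilon> > 0"
  obtains C where "C > 0" "\<And>n v. v \<in> V \<Longrightarrow> norm (Q n *v v) \<le> C * exp (\<epsilon> * real n) * norm v"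
proof -
  obtain B where B: "finite B" "B \<subseteq> V" "\<forall>b\<in>B. norm b = 1"
    "\<forall>v\<in>V. v = (\<Sum>b\<in>B. (b \<bullet> v) *\<^sub>R b)"
    using orthonormal_expansion[OF V] by blast
  have "\<exists>C\<ge>0. \<forall>n. norm (Q n *v b) \<le> C * exp (\<epsilon> * real n)" if b: "b \<in> B" for b
  proof -
    have "\<forall>\<^sub>F n in sequentially. ln (norm (Q n *v b)) / real n < \<epsilon>"
      using order_tendstoD(2)[OF lim e] B(2,3) b by force
    then obtain n0 where n0: "\<And>n. n \<ge> n0 \<Longrightarrow> ln (norm (Q n *v b)) / real n < \<epsilon>"
      by (auto simp: eventually_sequentially)
    have le: "norm (Q n *v b) \<le> exp (\<epsilon> * real n)" if "n > n0" for n
    proof (cases "Q n *v b = 0")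
      case False
      then have "norm (Q n *v b) = exp (ln (norm (Q n *v b)))" by simp
      also have "\<dots> \<le> exp (\<epsilon> * real n)" using n0[of n] that by (simp add: pos_divide_less_eq)
      finally show ?thesis .
    qed simp
    define C where "C = 1 + (\<Sum>n\<le>n0. norm (Q n *v b))"
    have C1: "C \<ge> 1" by (simp add: C_def sum_nonneg)
    have "norm (Q n *v b) \<le> C * exp (\<epsilon> * real n)" for n
    proof (cases "n > n0")
      case True
      then show ?thesis using le[OF True] mult_right_mono[OF C1, of "exp (\<epsilon> * real n)"] exp_ge_zero[of "\<epsilon> * real n"] by linarith
    next
      case False
      then have "norm (Q n *v b) \<le> C" using member_le_sum[of n "{..n0}" "\<lambda>n. norm (Q n *v b)"] by (simp add: C_def)
      also have "C * 1 \<le> C * exp (\<epsilon> * real n)" using C1 e by (intro mult_left_mono) auto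
      finally show ?thesis by simp
    qed
    then show ?thesis using C1 by (intro exI[of _ C]) auto
  qed
  then have "\<forall>b\<in>B. \<exists>C\<ge>0. \<forall>n. norm (Q n *v b) \<le> C * exp (\<epsilon> * real n)" by blast
  from bchoice[OF this] obtain C where C: "\<forall>b\<in>B. 0 \<le> C b \<and> (\<forall>n. norm (Q n *v b) \<le> C b * exp (\<epsilon> * real n))" ..
  show thesis
  proof (rule that[of "1 + sum C B"])
    show "1 + sum C B > 0" using C by (intro add_pos_nonneg sum_nonneg) auto
    fix n v assume v: "v \<in> V"
    have "norm (Q n *v v) = norm (\<Sum>b\<in>B. (b \<bullet> v) *\<^sub>R (Q n *v b))"
      by (subst bspec[OF B(4) v]) (simp add: linear_sum[OF matrix_vector_mul_linear] matrix_vector_mult_scaleR)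
    also have "\<dots> \<le> (\<Sum>b\<in>B. norm v * (C b * exp (\<epsilon> * real n)))"
    proof (rule sum_norm_le)
      fix b assume b: "b \<in> B"
      have "\<bar>b \<bullet> v\<bar> \<le> norm v" using Cauchy_Schwarz_ineq2[of b v] bspec[OF B(3) b] by simp
      then show "norm ((b \<bullet> v) *\<^sub>R (Q n *v b)) \<le> norm v * (C b * exp (\<epsilon> * real n))"
        using C b by (auto intro!: mult_mono)
    qed
    also have "\<dots> = sum C B * exp (\<epsilon> * real n) * norm v" by (simp add: sum_distrib_left sum_distrib_right mult_ac)
    also have "\<dots> \<le> (1 + sum C B) * exp (\<epsilon> * real n) * norm v" by (intro mult_right_mono) auto
    finally show "norm (Q n *v v) \<le> (1 + sum C B) * exp (\<epsilon> * real n) * norm v" .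
  qed
qed

context renormalizable
begin

text \<open>A functional \<open>v \<mapsto> x \<bullet> v\<close> with \<open>om 0 x = 0\<close> reads off a boundary value, which can be
  computed at any stage.\<close>

lemma kernel_bound:
  assumes V: "subspace V" and inj: "\<And>c. c \<in> V \<Longrightarrow> (\<And>x. om 0 x = 0 \<Longrightarrow> x \<bullet> c = 0) \<Longrightarrow> c = 0"
  obtains C where "C > 0"
    "\<And>c n \<delta>. c \<in> V \<Longrightarrow> (\<And>cl cr M. cons_at n cl cr \<Longrightarrow> (\<And>a. \<bar>cl a\<bar> \<le> M \<and> \<bar>cr a\<bar> \<le> M) \<Longrightarrow>
        \<bar>\<Sum>a\<in>UNIV. (cl a - cr a) * (inc 0 n *v c) $ a\<bar> \<le> M * \<delta>) \<Longrightarrow> norm c \<le> C * \<delta>"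
proof -
  have lin: "linear (om 0)" unfolding om_def by (rule two_rows.\<Omega>_linear[OF two_rows_stage])
  define W where "W = {x. om 0 x = 0}"
  have W: "subspace W" unfolding W_def by (rule linear_subspace_kernel[OF lin])
  obtain B where B: "finite B" "B \<subseteq> W" "\<forall>b\<in>B. norm b = 1"
    "\<forall>v\<in>W. v = (\<Sum>b\<in>B. (b \<bullet> v) *\<^sub>R b)"
    using orthonormal_expansion[OF W] by blast
  \<comment> \<open>The orthogonal projection onto the kernel of \<open>om 0\<close>. The hypothesis
    makes it injective on \<open>V\<close>, hence bounded below there.\<close>
  define L where "L c = (\<Sum>b\<in>B. (b \<bullet> c) *\<^sub>R b)" for c
  have L: "bounded_linear L"
    unfolding L_def[abs_def] linear_conv_bounded_linear[symmetric]
    by (rule linearI) (simp_all add: inner_add_right scaleR_add_left sum.distrib scaleR_sum_right)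
  have L0: "c = 0" if c: "c \<in> V" "L c = 0" for c
  proof (rule inj[OF c(1)])
    fix x assume x: "om 0 x = 0"
    have e: "x = (\<Sum>b\<in>B. (b \<bullet> x) *\<^sub>R b)" using bspec[OF B(4), of x] x by (simp add: W_def)
    have "x \<bullet> c = (\<Sum>b\<in>B. (b \<bullet> x) * (b \<bullet> c))" by (subst e) (simp add: inner_sum_left)
    also have "\<dots> = x \<bullet> L c" by (simp add: L_def inner_sum_right inner_commute mult.commute)
    finally show "x \<bullet> c = 0" using c by simp
  qed
  obtain \<kappa> where \<kappa>: "\<kappa> > 0" "\<And>c. c \<in> V \<Longrightarrow> \<kappa> * norm c \<le> norm (L c)"
    using injective_imp_isometric[OF closed_subspace[OF V] V L] L0 by (metis mult.commute)
  let ?cl = "\<lambda>x. left_end (pt' 0) x" and ?cr = "\<lambda>x a. left_end (pt' 0) x a + x $ a"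
  define M where "M x = (\<Sum>a\<in>UNIV. \<bar>?cl x a\<bar> + \<bar>?cr x a\<bar>)" for x
  have M: "\<bar>?cl x a\<bar> \<le> M x \<and> \<bar>?cr x a\<bar> \<le> M x" for x a
    using member_le_sum[of a UNIV "\<lambda>a. \<bar>?cl x a\<bar> + \<bar>?cr x a\<bar>"] unfolding M_def
    by (smt (verit) UNIV_I abs_ge_zero finite)
  have M0: "M x \<ge> 0" for x using M[of x undefined] by linarith
  show thesis
  proof (rule that[of "(1 + sum M B) / \<kappa>"])
    show "(1 + sum M B) / \<kappa> > 0" using M0 \<kappa> by (intro divide_pos_pos add_pos_nonneg sum_nonneg) auto
    fix c n \<delta> assume c: "c \<in> V" and bd: "\<And>cl cr M. cons_at n cl cr \<Longrightarrow> (\<And>a. \<bar>cl a\<bar> \<le> M \<and> \<bar>cr a\<bar> \<le> M) \<Longrightarrow>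
        \<bar>\<Sum>a\<in>UNIV. (cl a - cr a) * (inc 0 n *v c) $ a\<bar> \<le> M * \<delta>"
    have le: "\<bar>x \<bullet> c\<bar> \<le> M x * \<delta>" if x: "om 0 x = 0" for x
    proof -
      have cons: "cons_at 0 (?cl x) (?cr x)"
        unfolding cons_at_def by (rule two_rows.kernel_consistent[OF two_rows_stage x[unfolded om_def]])
      have base: "bd (\<lambda>b y. c $ b) 0 (?cl x) (?cr x) = - (x \<bullet> c)"
        by (simp add: bd_const incidence_refl inner_vec_def sum_negf)
      obtain cl' cr' where c': "cons_at n cl' cr'" "\<And>a. \<bar>cl' a\<bar> \<le> M x \<and> \<bar>cr' a\<bar> \<le> M x"
          "bd (\<lambda>b y. c $ b) n cl' cr' = - (x \<bullet> c)"
        using cons_forward[OF cons M, of n] base by metis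
      then show ?thesis using bd[OF c'(1,2)] bd_const[of c n cl' cr'] by simp
    qed
    \<comment> \<open>The zero pair is consistent and, with bound 1, shows that
      \<open>\<delta>\<close> is nonnegative.\<close>
    have \<delta>: "\<delta> \<ge> 0" using bd[of "\<lambda>a. 0" "\<lambda>a. 0" 1]
      by (simp add: cons_at_def consistent_def successively_conv_nth)
    have "\<kappa> * norm c \<le> norm (L c)" by (rule \<kappa>(2)[OF c])
    also have "\<dots> \<le> (\<Sum>b\<in>B. M b * \<delta>)" unfolding L_def
      by (rule sum_norm_le) (use B(2,3) le in \<open>auto simp: W_def\<close>)
    also have "\<dots> \<le> (1 + sum M B) * \<delta>" using \<delta> by (simp add: sum_distrib_right distrib_right)
    finally show "norm c \<le> (1 + sum M B) / \<kappa> * \<delta>" using \<kappa>(1) by (simp add: field_simps)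
  qed
qed

end

locale smooth_renormalizable = renormalizable T
  for T :: "'n::finite giet" +
  fixes f0 eta :: "'n \<Rightarrow> real \<Rightarrow> real" and K :: real
  assumes smooth: "smooth_towers (al T) (be T) (tw T) (lo T) (hi T) (branch T) f0 eta K"
    and bd0: "\<And>n cl cr. cons_at n cl cr \<Longrightarrow> bd f0 n cl cr = 0"
begin

definition D :: "nat \<Rightarrow> 'n \<Rightarrow> real \<Rightarrow> real" where
  "D = (\<lambda>n a. dchain (branch T) (\<lambda>b x. exp (f0 b x)) (return_word (al T) (be T) (tw T) 0 n a))"

definition f :: "nat \<Rightarrow> 'n \<Rightarrow> real \<Rightarrow> real" where
  "f = (\<lambda>n a. bsum (branch T) f0 (return_word (al T) (be T) (tw T) 0 n a))"

sublocale smooth_towers "al T" "be T" "tw T" "lo T" "hi T" "branch T" "Rst T" f0 eta K D f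
  by (rule smooth) (simp_all add: D_def f_def Rst_def[abs_def])

lemma bd_f: "bd f0 n cl cr = (\<Sum>a\<in>UNIV. cl a * f n a (lo T n a) - cr a * f n a (hi T n a))"
  by (simp add: bd_def f_def)

text \<open>Adding the vanishing pairing of \<open>f\<close> replaces \<open>v\<close> by its
  deviations from the end values of \<open>f\<close>, each at most \<open>\<epsilon>\<close>, and
  leaves the pairing with \<open>s\<close>. In the application \<open>s\<close> is the stable plus
  unstable part, so that \<open>v - s\<close> is central.\<close>

lemma central_functional:
  assumes cons: "cons_at n cl cr" and M: "\<And>a. \<bar>cl a\<bar> \<le> M \<and> \<bar>cr a\<bar> \<le> M"
    and osc: "\<And>a x y. x \<in> J n a \<Longrightarrow> y \<in> J n a \<Longrightarrow> \<bar>f n a x - f n a y\<bar> \<le> \<epsilon>"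
    and v: "\<And>a. \<exists>x\<in>J n a. f n a x = v $ a"
  shows "\<bar>\<Sum>a\<in>UNIV. (cl a - cr a) * (v - s) $ a\<bar> \<le> M * (2 * CARD('n) * (\<epsilon> + norm s))"
proof -
  have "(\<Sum>a\<in>UNIV. (cl a - cr a) * (v - s) $ a)
    = (\<Sum>a\<in>UNIV. cl a * (v $ a - f n a (lo T n a)) - cr a * (v $ a - f n a (hi T n a)) - (cl a - cr a) * s $ a)
      + bd f0 n cl cr"
    unfolding bd_f sum.distrib[symmetric] by (intro sum.cong) (auto simp: algebra_simps)
  also have "\<dots> = (\<Sum>a\<in>UNIV. cl a * (v $ a - f n a (lo T n a)) - cr a * (v $ a - f n a (hi T n a)) - (cl a - cr a) * s $ a)"
    using bd0[OF cons] by simp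
  also have "\<bar>\<dots>\<bar> \<le> (\<Sum>a\<in>(UNIV :: 'n set). 2 * M * (\<epsilon> + norm s))"
  proof (rule order_trans[OF sum_abs], rule sum_mono)
    fix a
    obtain x where x: "x \<in> J n a" "f n a x = v $ a" using v by blast
    have 1: "\<bar>cl a * (v $ a - f n a (lo T n a))\<bar> \<le> M * \<epsilon>"
      unfolding abs_mult x(2)[symmetric] using M[of a] osc[OF x(1) lo_in] by (intro mult_mono) auto
    have 2: "\<bar>cr a * (v $ a - f n a (hi T n a))\<bar> \<le> M * \<epsilon>"
      unfolding abs_mult x(2)[symmetric] using M[of a] osc[OF x(1) hi_in] by (intro mult_mono) auto
    have 3: "\<bar>(cl a - cr a) * s $ a\<bar> \<le> 2 * M * norm s"
      unfolding abs_mult using M[of a] component_le_norm_cart[of s a] by (intro mult_mono) auto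
    show "\<bar>cl a * (v $ a - f n a (lo T n a)) - cr a * (v $ a - f n a (hi T n a)) - (cl a - cr a) * s $ a\<bar>
      \<le> 2 * M * (\<epsilon> + norm s)" using 1 2 3 by (simp add: algebra_simps)
  qed
  finally show ?thesis by (simp add: mult_ac)
qed

end

section \<open>Decay of the logarithm of the derivative\<close>

lemma return_word_length_mono:
  assumes "m \<le> n" "n \<le> p"
  shows "length (return_word a b t m n c) \<le> length (return_word a b t m p c)"
proof -
  have "c \<in> set (return_word a b t n p c)"
    by (induction p) (auto simp: rv_word_def)
  then obtain us vs where "return_word a b t n p c = us @ c # vs" by (auto dest: split_list)
  then show ?thesis by (simp add: return_word_trans[OF assms, of a b t c])
qed

section \<open>Log-slopes as an approximate orbit of the cocycle\<close>

context smooth_renormalizable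
begin

lemma osc_weaken: "osc_le m c \<Longrightarrow> c \<le> c' \<Longrightarrow> osc_le m c'"
  unfolding osc_le_def by (meson order_trans)

text \<open>The mean value theorem: the mean slope of an interval is attained as a derivative, so
  log-slopes are values of \<open>f\<close>.\<close>

lemma slope_point: "\<exists>x\<in>J i a. f i a x = log_slopes (stage T i) $ a"
proof -
  have lh: "lo T i a < hi T i a" by (rule lo_hi)
  obtain z where z: "z \<in> {lo T i a..hi T i a}" "Rst T i a (hi T i a) - Rst T i a (lo T i a) = D i a z * (hi T i a - lo T i a)"
    using mvt_within[of "lo T i a" "hi T i a" "Rst T i a" "D i a"] R_deriv[of _ i a] lh unfolding J_def by (metis less_imp_le)
  have "scale T i * bot_len (stage T i) $ a = D i a z * (scale T i * top_len (stage T i) $ a)"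
    using z(2) unfolding R_ends by (simp add: lo_def hi_def top_right_def bot_right_def algebra_simps)
  then have "bot_len (stage T i) $ a / top_len (stage T i) $ a = D i a z"
    using scale_pos[of i] stage_tp[of i] by (simp add: two_partitions_def field_simps less_imp_neq[symmetric])
  then show ?thesis using z(1) by (intro bexI[of _ z]) (simp_all add: log_slopes_def D_exp J_def)
qed

lemma f_distortion: "x \<in> J i a \<Longrightarrow> y \<in> J i a \<Longrightarrow> \<bar>f i a x - f i a y\<bar> \<le> N"
  using prefix_distortion[of i a "w 0 i a" "[]" x y] by (simp add: f_def)

lemma f_le_slopes: "x \<in> J i a \<Longrightarrow> \<bar>f i a x\<bar> \<le> norm (log_slopes (stage T i)) + N"
  using slope_point[of i a] f_distortion[of x i a] component_le_norm_cart[of "log_slopes (stage T i)" a] by force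

lemma word_length: "real (length (w m i a)) = (inc m i *v (\<chi> a. 1)) $ a"
  by (simp add: incidence_mult sum_list_triv)

lemma word_length_norm: "real (length (w m i a)) \<le> matrix_norm (inc m i) * norm (\<chi> a::'n. (1::real))"
  using component_le_norm_cart[of "inc m i *v (\<chi> a. 1)" a] matrix_norm_bound[of "inc m i" "\<chi> a. 1"]
  unfolding word_length by linarith

lemma norm_ones_pos: "norm (\<chi> a::'n. (1::real)) > 0"
  by (simp add: vec_eq_iff)

text \<open>The vector of ones is sent to the word lengths, all at least 1.\<close>

lemma matrix_norm_inc_ge_1: "1 \<le> matrix_norm (inc m i)"
proof -
  have "norm (\<chi> a::'n. (1::real)) \<le> norm (inc m i *v (\<chi> a. 1))"
  proof (rule norm_le_componentwise_cart)
    fix a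
    have "1 \<le> length (w m i a)" using return_word_nonempty[of "al T" "be T" "tw T" m i a] by (cases "w m i a") auto
    then show "norm ((\<chi> a::'n. (1::real)) $ a) \<le> norm ((inc m i *v (\<chi> a. 1)) $ a)"
      unfolding word_length[symmetric] by simp
  qed
  also have "\<dots> \<le> matrix_norm (inc m i) * norm (\<chi> a::'n. (1::real))" by (rule matrix_norm_bound)
  finally show ?thesis using norm_ones_pos by simp
qed

lemma f_sum: "m \<le> i \<Longrightarrow> x \<in> J i a \<Longrightarrow>
  f i a x = (\<Sum>s<length (w m i a). f m (w m i a ! s) (pt m i a s x))"
  by (simp add: f_run[of m i] bsum_eq_sum)

lemma f_propagate:
  fixes E :: real
  assumes m: "m \<le> i" and x: "x \<in> J i a" and E: "\<And>b y. y \<in> J m b \<Longrightarrow> \<bar>f m b y\<bar> \<le> E"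
  shows "\<bar>f i a x\<bar> \<le> length (w m i a) * E"
proof -
  have "\<bar>f i a x\<bar> \<le> (\<Sum>s<length (w m i a). E)"
    unfolding f_sum[OF m x]
    by (rule order_trans[OF sum_abs]) (intro sum_mono E pt_in[OF m x], simp)
  then show ?thesis by simp
qed

text \<open>Each entry of \<open>v'\<close> is a Birkhoff sum of \<open>f m\<close>. Replacing a
  summand by the log-slope of its interval costs at most \<open>\<epsilon>\<close>, once per letter
  of the word.\<close>

lemma slope_cocycle_error:
  assumes m: "m \<le> i" and v: "\<And>a. \<exists>x\<in>J m a. f m a x = v $ a" and v': "\<And>a. \<exists>x\<in>J i a. f i a x = v' $ a"
    and osc: "\<And>a x y. x \<in> J m a \<Longrightarrow> y \<in> J m a \<Longrightarrow> \<bar>f m a x - f m a y\<bar> \<le> \<epsilon>"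
  shows "norm (v' - inc m i *v v) \<le> CARD('n) * norm (\<chi> a::'n. (1::real)) * matrix_norm (inc m i) * \<epsilon>"
proof -
  have e0: "\<epsilon> \<ge> 0" using osc[OF lo_in lo_in] by auto
  have c: "\<bar>(v' - inc m i *v v) $ a\<bar> \<le> matrix_norm (inc m i) * norm (\<chi> a::'n. (1::real)) * \<epsilon>" for a
  proof -
    obtain x where x: "x \<in> J i a" "f i a x = v' $ a" using v' by blast
    have "(inc m i *v v) $ a = (\<Sum>s<length (w m i a). v $ (w m i a ! s))"
      by (simp add: incidence_mult sum_list_sum_nth atLeast0LessThan)
    then have "\<bar>(v' - inc m i *v v) $ a\<bar> = \<bar>\<Sum>s<length (w m i a). f m (w m i a ! s) (pt m i a s x) - v $ (w m i a ! s)\<bar>"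
      using x(2) f_sum[OF m x(1)] by (simp add: sum_subtractf)
    also have "\<dots> \<le> (\<Sum>s<length (w m i a). \<epsilon>)"
    proof (rule order_trans[OF sum_abs], rule sum_mono)
      fix s assume s: "s \<in> {..<length (w m i a)}"
      have p: "pt m i a s x \<in> J m (w m i a ! s)" using s by (intro pt_in[OF m x(1)]) auto
      obtain y where y: "y \<in> J m (w m i a ! s)" "f m (w m i a ! s) y = v $ (w m i a ! s)" using v by blast
      show "\<bar>f m (w m i a ! s) (pt m i a s x) - v $ (w m i a ! s)\<bar> \<le> \<epsilon>" using osc[OF p y(1)] y(2) by simp
    qed
    also have "\<dots> \<le> matrix_norm (inc m i) * norm (\<chi> a::'n. (1::real)) * \<epsilon>"
      using mult_right_mono[OF word_length_norm e0] by simp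
    finally show ?thesis .
  qed
  have "norm (v' - inc m i *v v) \<le> (\<Sum>a\<in>UNIV. \<bar>(v' - inc m i *v v) $ a\<bar>)" by (rule norm_le_l1_cart)
  also have "\<dots> \<le> (\<Sum>a\<in>(UNIV :: 'n set). matrix_norm (inc m i) * norm (\<chi> a::'n. (1::real)) * \<epsilon>)"
    by (intro sum_mono c)
  finally show ?thesis by (simp add: mult_ac)
qed

end

text \<open>\<open>back_sum\<close>, \<open>forw_sum\<close> and \<open>S_lim\<close> are the conditions [B], [F] and [S].\<close>

locale rdc_towers = smooth_renormalizable T f0 eta K
  for T :: "'n::finite giet" and f0 eta K +
  fixes G :: "'n splitting" and n k :: "nat \<Rightarrow> nat" and z :: "nat \<Rightarrow> nat" and p :: nat and A :: "real ^ 'n ^ 'n"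
    and U \<theta> C\<theta> Km Kp an bk :: real
  defines "z \<equiv> zorich_time T"
  assumes irrational: "irrational_rotation (rotation_number T)"
    and n_0: "n 0 = 0" and p1: "p \<ge> 1" and A1: "\<And>i j. A $ i $ j \<ge> 1"
    and AA: "\<And>j. j \<ge> 1 \<Longrightarrow> inc (z (n j)) (z (n j + 2 * p)) = A ** A"
    and n_gap: "\<And>j. j \<ge> 1 \<Longrightarrow> n j + 2 * p \<le> n (Suc j)"
    and n_lin: "\<And>j. real (n j) \<le> an * real j" and k_lin: "\<And>m. m \<ge> 1 \<Longrightarrow> real (k m) \<le> bk * real m"
    and k_mono: "strict_mono k"
    and split: "\<And>i. splitting_at G i"
    and dims: "dim (G Stable 0) = genus T"
    and Gmap: "\<And>i j x. i \<le> j \<Longrightarrow> (\<lambda>v. inc (z i) (z j) *v v) ` G x i = G x j"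
    and \<theta>: "\<theta> > 0" and stable: "\<And>i v. v \<in> G Stable 0 \<Longrightarrow> norm (inc (z 0) (z i) *v v) \<le> C\<theta> * exp (- \<theta> * real i) * norm v"
    and central: "\<And>v. v \<in> G Central 0 \<Longrightarrow> v \<noteq> 0 \<Longrightarrow> (\<lambda>i. ln (norm (inc (z 0) (z i) *v v)) / real i) \<longlonglongrightarrow> 0"
    and back_sum: "\<And>m. (\<Sum>j = 1..k m. matrix_norm_on (inc (z (n j)) (z (n (k m)))) (G Stable (n j))
                    * onorm (split_proj G Stable (n j)) * matrix_norm (inc (z (n (j - 1))) (z (n (Suc (j - 1)))))) \<le> Km"
    and forw_summable: "\<And>m. summable (\<lambda>i. matrix_norm_on (matrix_inv (inc (z (n (k m))) (z (n (k m + 1 + i))))) (G Unstable (n (k m + 1 + i)))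
                    * onorm (split_proj G Unstable (n (k m + 1 + i))) * matrix_norm (inc (z (n (k m + 1 + i - 1))) (z (n (Suc (k m + 1 + i - 1))))))"
    and forw_sum: "\<And>m. (\<Sum>i. matrix_norm_on (matrix_inv (inc (z (n (k m))) (z (n (k m + 1 + i))))) (G Unstable (n (k m + 1 + i)))
                    * onorm (split_proj G Unstable (n (k m + 1 + i))) * matrix_norm (inc (z (n (k m + 1 + i - 1))) (z (n (Suc (k m + 1 + i - 1)))))) \<le> Kp"
    and S_lim: "(\<lambda>m. ln (matrix_norm (inc (z (n (k m))) (z (n (k (Suc m)))))) / real m) \<longlonglongrightarrow> 0"
    and slopes_bd: "\<And>m. norm (log_slopes (stage T (z (n (k m))))) \<le> U"
begin

lemma z_mono: "i \<le> j \<Longrightarrow> z i \<le> z j"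
  unfolding z_def by (rule zorich_time_mono[OF irrational])

lemma n_Suc: "n j \<le> n (Suc j)"
  using n_gap[of j] n_0 by (cases j) auto

lemma n_mono: "i \<le> j \<Longrightarrow> n i \<le> n j"
  by (rule lift_Suc_mono_le[of n, OF n_Suc])

lemma k_ge: "m \<le> k m"
  using k_mono by (rule strict_mono_imp_increasing)

lemma zn_mono: "i \<le> j \<Longrightarrow> z (n i) \<le> z (n j)"
  by (intro z_mono n_mono)

lemma f_bounded: "x \<in> J (z (n (k m))) a \<Longrightarrow> \<bar>f (z (n (k m))) a x\<bar> \<le> U + N"
  using f_le_slopes[of x "z (n (k m))" a] slopes_bd[of m] by linarith

lemma osc_good_times:
  obtains C \<alpha> where "C > 0" "0 < \<alpha>" "\<alpha> < 1" "\<And>l. osc_le (z (n (k (Suc l)))) (C * \<alpha> ^ l)"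
proof -
  \<comment> \<open>The index is shifted because good times are the \<open>n j\<close> with
    \<open>j\<close> at least 1, and \<open>k 0\<close> may be 0.\<close>
  let ?\<tau> = "\<lambda>l. z (n (k (Suc l)))" and ?\<sigma> = "\<lambda>l. z (n (k (Suc l)) + 2 * p)"
  define q where "q = nat \<lceil>\<Sum>a\<in>UNIV. ((A ** A) *v (\<chi> a. 1)) $ a\<rceil>"
  have k1: "k (Suc l) \<ge> 1" for l using k_ge[of "Suc l"] by simp
  have inc: "inc (?\<tau> l) (?\<sigma> l) = A ** A" for l by (rule AA[OF k1])
  have pos: "((A ** A) *v (\<chi> a. 1)) $ a \<ge> 0" for a
    unfolding inc[of 0, symmetric] word_length[symmetric] by simp
  have ts1: "?\<tau> l \<le> ?\<sigma> l" for l by (intro z_mono) simp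
  have ts2: "?\<sigma> l \<le> ?\<tau> (Suc l)" for l
  proof (intro z_mono)
    have "n (k (Suc l)) + 2 * p \<le> n (Suc (k (Suc l)))" by (rule n_gap[OF k1])
    also have "\<dots> \<le> n (k (Suc (Suc l)))" using strict_monoD[OF k_mono, of "Suc l" "Suc (Suc l)"] by (intro n_mono) simp
    finally show "n (k (Suc l)) + 2 * p \<le> n (k (Suc (Suc l)))" .
  qed
  have cnt: "count_list (w (?\<tau> l) (?\<sigma> l) a) j \<ge> 2" for l a j
  proof -
    have "real (count_list (w (?\<tau> l) (?\<sigma> l) a) j) = (A ** A) $ a $ j"
      unfolding inc[of l, symmetric] by (simp add: incidence_def)
    also have "\<dots> = (\<Sum>i\<in>UNIV. A $ a $ i * A $ i $ j)" by (simp add: matrix_matrix_mult_def)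
    also have "\<dots> \<ge> (\<Sum>i\<in>(UNIV :: 'n set). 1)"
    proof (rule sum_mono)
      fix i show "1 \<le> A $ a $ i * A $ i $ j" using mult_mono[OF A1[of a i] A1[of i j]] A1[of a i] by simp
    qed
    finally show ?thesis using card2 by simp
  qed
  have q: "length (w (?\<tau> l) (?\<sigma> l) a) \<le> q" for l a
  proof -
    have "real (length (w (?\<tau> l) (?\<sigma> l) a)) = ((A ** A) *v (\<chi> a. 1)) $ a" by (simp add: word_length inc)
    also have "\<dots> \<le> (\<Sum>a\<in>UNIV. ((A ** A) *v (\<chi> a. 1)) $ a)" using pos by (intro member_le_sum) auto
    also have "\<dots> \<le> real q" unfolding q_def by (rule real_nat_ceiling_ge)
    finally show ?thesis by simp
  qed
  show thesis
    by (rule osc_exponential[of ?\<tau> ?\<sigma> "U + N" q, OF ts1 ts2 f_bounded cnt q]) (assumption, rule that)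
qed

text \<open>Decay is known along the sequence \<open>k\<close>. Counting how many of its members lie
  below \<open>j\<close> extends it to a bound for every \<open>j\<close> that is monotone, as the
  summation of errors requires.\<close>

lemma oscillation_bound:
  obtains eps C \<alpha> where "\<And>j. 0 \<le> (eps j :: real)" "\<And>i j. i \<le> j \<Longrightarrow> eps j \<le> eps i"
    "\<And>m. eps (k m) \<le> C * \<alpha> ^ m" "0 < \<alpha>" "\<alpha> < 1"
    "\<And>j a x y. x \<in> J (z (n j)) a \<Longrightarrow> y \<in> J (z (n j)) a \<Longrightarrow> \<bar>f (z (n j)) a x - f (z (n j)) a y\<bar> \<le> eps j"
proof -
  obtain C \<alpha> where C: "C > 0" "0 < \<alpha>" "\<alpha> < 1" "\<And>l. osc_le (z (n (k (Suc l)))) (C * \<alpha> ^ l)"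
    using osc_good_times by metis
  define C' where "C' = max (2 * H) (C / \<alpha>)"
  define L where "L j = card {l. k (Suc l) \<le> j}" for j
  have fin: "finite {l. k (Suc l) \<le> j}" for j
    by (rule finite_subset[of _ "{..j}"]) (use k_ge order_trans Suc_leD in blast, simp)
  have L_mono: "L i \<le> L j" if "i \<le> j" for i j unfolding L_def by (rule card_mono[OF fin]) (use that in auto)
  have L_k: "L (k m) = m" for m
  proof -
    have "{l. k (Suc l) \<le> k m} = {..<m}" using k_mono by (auto simp: strict_mono_less_eq)
    then show ?thesis by (simp add: L_def)
  qed
  have C': "C' > 0" "C' \<ge> 2 * H" "C' \<ge> C / \<alpha>" using C(1,2) by (auto simp: C'_def less_max_iff_disj)
  have osc: "osc_le (z (n j)) (C' * \<alpha> ^ L j)" for j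
  proof (cases "L j")
    case 0
    have "osc_le (z (n j)) (2 * H)" by (rule osc_mono[OF le0 initial_bounds(1)])
    then show ?thesis by (rule osc_weaken) (use 0 C'(2) in simp)
  next
    case (Suc l)
    have "k (Suc l) \<le> j"
    proof (rule ccontr)
      assume "\<not> k (Suc l) \<le> j"
      then have "l' < l" if "k (Suc l') \<le> j" for l'
        using that strict_mono_less[OF k_mono, of "Suc l'" "Suc l"] by linarith
      then have "{l. k (Suc l) \<le> j} \<subseteq> {..<l}" by blast
      then have "L j \<le> card {..<l}" unfolding L_def by (intro card_mono) auto
      then show False using Suc by simp
    qed
    then have "osc_le (z (n j)) (C * \<alpha> ^ l)" by (intro osc_mono[OF zn_mono C(4)])
    moreover have "C * \<alpha> ^ l \<le> C' * \<alpha> ^ L j"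
      using mult_right_mono[OF C'(3), of "\<alpha> ^ Suc l"] C(2) Suc by simp
    ultimately show ?thesis by (rule osc_weaken)
  qed
  show thesis
  proof (rule that[of "\<lambda>j. exp N * (C' * \<alpha> ^ L j)" "exp N * C'" \<alpha>])
    show "0 \<le> exp N * (C' * \<alpha> ^ L j)" for j using C'(1) C(2) by simp
    show "exp N * (C' * \<alpha> ^ L j) \<le> exp N * (C' * \<alpha> ^ L i)" if "i \<le> j" for i j
      using L_mono[OF that] C'(1) C(2,3) by (intro mult_left_mono power_decreasing) auto
    show "exp N * (C' * \<alpha> ^ L (k m)) \<le> exp N * C' * \<alpha> ^ m" for m by (simp add: L_k)
  qed (use C(2,3) f_osc[OF osc] in auto)
qed

end

text \<open>Half of the exponent is traded: growth by \<open>exp (\<epsilon> * c)\<close> per step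
  still leaves the rate \<open>sqrt \<beta>\<close>.\<close>

lemma geometric_subsequence:
  assumes "c > 0" "0 < (\<beta>::real)" "\<beta> < 1"
  obtains \<epsilon> where "\<epsilon> > 0" "exp (\<epsilon> * c) * \<beta> \<le> sqrt \<beta>"
proof
  show "- ln \<beta> / (2 * c) > 0" using assms by (simp add: divide_neg_pos)
  have e: "exp (- ln \<beta> / (2 * c) * c + ln \<beta>) = exp (ln \<beta> / 2)" using assms(1) by (simp add: field_simps)
  have "sqrt \<beta> = exp (ln \<beta> / 2)" using assms by (simp add: ln_sqrt[symmetric])
  then show "exp (- ln \<beta> / (2 * c) * c) * \<beta> \<le> sqrt \<beta>"
    unfolding e[symmetric] exp_add using assms(2) by simp
qed

context rdc_towers
begin

lemma z0: "z 0 = 0"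
  by (simp add: z_def)

text \<open>Exchanges rates: exponential decay in \<open>m\<close> becomes exponential decay in
  Zorich time, and slow growth in Zorich time becomes slow growth in \<open>m\<close>.\<close>

lemma nk_lin: "m \<ge> 1 \<Longrightarrow> real (n (k m)) \<le> max 1 (\<bar>an\<bar> * \<bar>bk\<bar>) * real m"
proof -
  assume m: "m \<ge> 1"
  have "real (n (k m)) \<le> \<bar>an\<bar> * real (k m)" using n_lin[of "k m"] by (rule order_trans) (intro mult_right_mono, auto)
  also have "\<dots> \<le> \<bar>an\<bar> * (\<bar>bk\<bar> * real m)"
    using k_lin[OF m] by (intro mult_left_mono) (auto intro: order_trans[OF _ mult_right_mono[OF abs_ge_self]])
  also have "\<dots> \<le> max 1 (\<bar>an\<bar> * \<bar>bk\<bar>) * real m" unfolding mult.assoc[symmetric] by (intro mult_right_mono) auto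
  finally show ?thesis .
qed

lemma subG: "subspace (G x i)"
  by (rule splitting_at.sub[OF split])

text \<open>Central growth at rate \<open>\<theta> / 2\<close> loses against stable contraction at
  rate \<open>\<theta>\<close>, so \<open>central_transversal\<close> places \<open>c\<close> in the
  stable space, which meets the central space only in 0.\<close>

lemma central_injective:
  assumes c: "c \<in> G Central 0" and ker: "\<And>x. om 0 x = 0 \<Longrightarrow> x \<bullet> c = 0"
  shows "c = 0"
proof -
  obtain Cc where Cc: "Cc > 0" "\<And>i v. v \<in> G Central 0 \<Longrightarrow> norm (inc (z 0) (z i) *v v) \<le> Cc * exp (\<theta> / 2 * real i) * norm v"
    using subexponential_uniform[OF subG[of Central 0] central, of "\<theta> / 2"] \<theta> by (metis half_gt_zero)
  have e: "(\<lambda>i. exp (- (t * real i))) \<longlonglongrightarrow> 0" if "t > 0" for t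
    using that by real_asymp
  have st: "(\<lambda>i. norm (inc 0 (z i) *v s)) \<longlonglongrightarrow> 0" if s: "s \<in> G Stable 0" for s
  proof (rule Lim_null_comparison)
    show "\<forall>\<^sub>F i in sequentially. norm (norm (inc 0 (z i) *v s)) \<le> C\<theta> * norm s * exp (- (\<theta> * real i))"
      using stable[OF s] by (simp add: z0 mult_ac)
    show "(\<lambda>i. C\<theta> * norm s * exp (- (\<theta> * real i))) \<longlonglongrightarrow> 0"
      using tendsto_mult_right_zero[OF e[OF \<theta>]] .
  qed
  have pr: "(\<lambda>i. norm (inc 0 (z i) *v c) * norm (inc 0 (z i) *v s)) \<longlonglongrightarrow> 0" if s: "s \<in> G Stable 0" for s
  proof (rule Lim_null_comparison)
    show "\<forall>\<^sub>F i in sequentially. norm (norm (inc 0 (z i) *v c) * norm (inc 0 (z i) *v s))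
        \<le> Cc * norm c * C\<theta> * norm s * exp (- (\<theta> / 2 * real i))"
    proof (rule always_eventually, intro allI)
      fix i
      have "norm (inc 0 (z i) *v c) * norm (inc 0 (z i) *v s)
        \<le> (Cc * exp (\<theta> / 2 * real i) * norm c) * (C\<theta> * exp (- \<theta> * real i) * norm s)"
        using Cc(1) Cc(2)[OF c, of i] stable[OF s, of i] by (intro mult_mono) (auto simp: z0)
      also have "\<dots> = Cc * norm c * C\<theta> * norm s * (exp (\<theta> / 2 * real i) * exp (- \<theta> * real i))" by (simp only: mult_ac)
      also have "exp (\<theta> / 2 * real i) * exp (- \<theta> * real i) = exp (- (\<theta> / 2 * real i))"
        unfolding exp_add[symmetric] by (simp add: field_simps)
      finally show "norm (norm (inc 0 (z i) *v c) * norm (inc 0 (z i) *v s))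
        \<le> Cc * norm c * C\<theta> * norm s * exp (- (\<theta> / 2 * real i))" by simp
    qed
    show "(\<lambda>i. Cc * norm c * C\<theta> * norm s * exp (- (\<theta> / 2 * real i))) \<longlonglongrightarrow> 0"
      using tendsto_mult_right_zero[OF e[of "\<theta> / 2"]] \<theta> by simp
  qed
  have "c \<in> G Stable 0"
    by (rule central_transversal[of "G Stable 0" z c, OF subG dims st pr ker])
  then have "splits G 0 c (\<lambda>x. if x = Stable then c else 0)" "splits G 0 c (\<lambda>x. if x = Central then c else 0)"
    using c subG by (auto simp: splits_def subspace_0)
  then have "(\<lambda>x. if x = Stable then c else 0) = (\<lambda>x. if x = Central then c else 0)"
    using splitting_at.ex1[OF split, of 0 c] by (metis (no_types, lifting))
  from fun_cong[OF this, of Stable] show ?thesis by simp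
qed

lemma good_time_decay:
  obtains C \<gamma> where "C > 0" "0 < \<gamma>" "\<gamma> < 1"
    "\<And>m a x. m \<ge> 1 \<Longrightarrow> x \<in> J (z (n (k m))) a \<Longrightarrow> \<bar>f (z (n (k m))) a x\<bar> \<le> C * \<gamma> ^ m"
proof -
  obtain eps Ce \<alpha> where eps: "\<And>j. 0 \<le> (eps j :: real)" "\<And>i j. i \<le> j \<Longrightarrow> eps j \<le> eps i"
    "\<And>m. eps (k m) \<le> Ce * \<alpha> ^ m" "0 < \<alpha>" "\<alpha> < 1"
    and osc: "\<And>j a x y. x \<in> J (z (n j)) a \<Longrightarrow> y \<in> J (z (n j)) a \<Longrightarrow> \<bar>f (z (n j)) a x - f (z (n j)) a y\<bar> \<le> eps j"
    by (rule oscillation_bound) blast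
  define u where "u j = log_slopes (stage T (z (n j)))" for j
  define c where "c = CARD('n) * norm (\<chi> a::'n. (1::real))"
  have upt: "\<exists>x\<in>J (z (n j)) a. f (z (n j)) a x = u j $ a" for j a
    unfolding u_def by (rule slope_point)
  interpret L: rdc_linear G n k "\<lambda>i j. inc (z (n i)) (z (n j))" u eps c Km Kp Ce \<alpha> U
  proof (rule rdc_linear.intro)
    show "splitting_at G (n i)" for i by (rule split)
    show "invertible (inc (z (n i)) (z (n j)))" if "i \<le> j" for i j
      by (rule incidence_invertible[OF al_be zn_mono[OF that]])
    show "inc (z (n i)) (z (n l)) = inc (z (n j)) (z (n l)) ** inc (z (n i)) (z (n j))" if "i \<le> j" "j \<le> l" for i j l
      by (rule incidence_trans[OF zn_mono[OF that(1)] zn_mono[OF that(2)]])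
    show "inc (z (n i)) (z (n i)) = mat 1" for i by (rule incidence_refl)
    show "(\<lambda>v. inc (z (n i)) (z (n j)) *v v) ` G x (n i) = G x (n j)" if "i \<le> j" for i j x
      by (rule Gmap[OF n_mono[OF that]])
    show "1 \<le> matrix_norm (inc (z (n j)) (z (n (Suc j))))" for j by (rule matrix_norm_inc_ge_1)
    show "norm (u (Suc j) - inc (z (n j)) (z (n (Suc j))) *v u j) \<le> c * matrix_norm (inc (z (n j)) (z (n (Suc j)))) * eps j" for j
      unfolding c_def using slope_cocycle_error[OF zn_mono upt upt osc, of j "Suc j"] by simp
    show "norm (u (k m)) \<le> U" for m unfolding u_def by (rule slopes_bd)
    show "0 \<le> c" by (simp add: c_def)
  qed (fact k_mono back_sum forw_summable forw_sum eps)+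
  obtain C1 \<beta> where C1: "C1 > 0" "0 < \<beta>" "\<beta> < 1"
    "\<And>m. m \<ge> 1 \<Longrightarrow> norm (split_proj G Stable (n (k m)) (u (k m))) \<le> C1 * \<beta> ^ m"
    "\<And>m. m \<ge> 1 \<Longrightarrow> norm (split_proj G Unstable (n (k m)) (u (k m))) \<le> C1 * \<beta> ^ m"
    using L.hyperbolic_decay by metis
  obtain Ck where Ck: "Ck > 0"
    "\<And>c i \<delta>. c \<in> G Central 0 \<Longrightarrow> (\<And>cl cr M. cons_at i cl cr \<Longrightarrow> (\<And>a. \<bar>cl a\<bar> \<le> M \<and> \<bar>cr a\<bar> \<le> M) \<Longrightarrow>
        \<bar>\<Sum>a\<in>UNIV. (cl a - cr a) * (inc 0 i *v c) $ a\<bar> \<le> M * \<delta>) \<Longrightarrow> norm c \<le> Ck * \<delta>"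
    by (rule kernel_bound[OF subG central_injective]) blast+
  define ab where "ab = max 1 (\<bar>an\<bar> * \<bar>bk\<bar>)"
  have nk: "real (n (k m)) \<le> ab * real m" if "m \<ge> 1" for m
    unfolding ab_def by (rule nk_lin[OF that])
  have ab: "ab > 0" by (simp add: ab_def)
  define b where "b = max \<alpha> \<beta>"
  have b: "0 < b" "b < 1" "\<alpha> \<le> b" "\<beta> \<le> b" using C1 eps by (auto simp: b_def)
  \<comment> \<open>Pushing the central part forward costs at most
    \<open>exp (\<epsilon> * ab)\<close> per index \<open>m\<close>; this \<open>\<epsilon>\<close>
    leaves the rate \<open>g = sqrt b\<close>.\<close>
  obtain \<epsilon> where \<epsilon>: "\<epsilon> > 0" "exp (\<epsilon> * ab) * b \<le> sqrt b" using geometric_subsequence[OF ab b(1,2)] by metis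
  define g where "g = sqrt b"
  have g: "0 < g" "g < 1" "b \<le> g" using b real_le_rsqrt[of b b] by (auto simp: g_def power2_eq_square mult_left_le)
  obtain Cc where Cc: "Cc > 0" "\<And>i v. v \<in> G Central 0 \<Longrightarrow> norm (inc (z 0) (z i) *v v) \<le> Cc * exp (\<epsilon> * real i) * norm v"
    using subexponential_uniform[OF subG[of Central 0] central \<epsilon>(1)] by metis
  have Ce0: "Ce \<ge> 0" using eps(1)[of "k 0"] eps(3)[of 0] by simp
  define C2 where "C2 = Cc * (Ck * (2 * CARD('n) * (Ce + 2 * C1)))"
  have C20: "C2 \<ge> 0" using Cc Ck Ce0 C1 by (simp add: C2_def)
  have main: "norm (u (k m)) \<le> (C2 + 2 * C1) * g ^ m" if m: "m \<ge> 1" for m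
  proof -
    let ?i = "n (k m)"
    let ?P = "\<lambda>x. split_proj G x ?i (u (k m))"
    define s where "s = ?P Stable + ?P Unstable"
    have dec: "u (k m) = ?P Stable + ?P Central + ?P Unstable" by (rule splitting_at.proj_sum[OF split])
    have pc: "?P Central = u (k m) - s" unfolding s_def using dec by (simp add: algebra_simps)
    have "?P Central \<in> G Central ?i" by (rule splitting_at.proj_in[OF split])
    then obtain c0 where c0: "c0 \<in> G Central 0" "?P Central = inc (z 0) (z ?i) *v c0"
      using Gmap[of 0 ?i Central] by blast
    have "norm s \<le> C1 * \<beta> ^ m + C1 * \<beta> ^ m" unfolding s_def
      by (rule order_trans[OF norm_triangle_ineq add_mono[OF C1(4)[OF m] C1(5)[OF m]]])
    also have "\<dots> \<le> 2 * C1 * b ^ m" using power_mono[OF b(4), of m] C1 by simp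
    finally have s: "norm s \<le> 2 * C1 * b ^ m" .
    have "eps (k m) \<le> Ce * b ^ m"
      using eps(3)[of m] mult_left_mono[OF power_mono[OF b(3), of m] Ce0] eps(4) by linarith
    then have es: "eps (k m) + norm s \<le> (Ce + 2 * C1) * b ^ m" using s by (simp add: algebra_simps)
    \<comment> \<open>\<open>central_functional\<close>, with the stable plus unstable part as
      \<open>s\<close>, supplies the hypothesis of \<open>kernel_bound\<close> at stage
      \<open>z ?i\<close>, while the conclusion concerns time 0.\<close>
    have "norm c0 \<le> Ck * (2 * CARD('n) * (eps (k m) + norm s))"
    proof (rule Ck(2)[OF c0(1), of "z ?i"])
      fix cl cr M assume cons: "cons_at (z ?i) cl cr" and M: "\<And>a. \<bar>cl a\<bar> \<le> M \<and> \<bar>cr a\<bar> \<le> M"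
      have "inc 0 (z ?i) *v c0 = u (k m) - s" using c0(2) pc by (simp add: z0)
      then show "\<bar>\<Sum>a\<in>UNIV. (cl a - cr a) * (inc 0 (z ?i) *v c0) $ a\<bar> \<le> M * (2 * CARD('n) * (eps (k m) + norm s))"
        using central_functional[OF cons M osc upt] by simp
    qed
    also have "\<dots> \<le> Ck * (2 * CARD('n) * ((Ce + 2 * C1) * b ^ m))"
      using es Ck by (intro mult_left_mono) auto
    finally have n0: "norm c0 \<le> Ck * (2 * CARD('n) * ((Ce + 2 * C1) * b ^ m))" .
    have "norm (?P Central) \<le> Cc * exp (\<epsilon> * real ?i) * norm c0" unfolding c0(2) by (rule Cc(2)[OF c0(1)])
    also have "\<dots> \<le> Cc * exp (\<epsilon> * (ab * real m)) * (Ck * (2 * CARD('n) * ((Ce + 2 * C1) * b ^ m)))"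
      using n0 nk[OF m] \<epsilon>(1) Cc(1) by (intro mult_mono mult_left_mono) auto
    also have "\<dots> = C2 * (exp (\<epsilon> * ab) ^ m * b ^ m)"
      by (simp add: C2_def exp_of_nat_mult[symmetric] mult_ac)
    also have "\<dots> = C2 * (exp (\<epsilon> * ab) * b) ^ m" by (simp add: power_mult_distrib)
    also have "\<dots> \<le> C2 * g ^ m" unfolding g_def using \<epsilon>(2) b C20 by (intro mult_left_mono power_mono) auto
    finally have 1: "norm (?P Central) \<le> C2 * g ^ m" .
    have "2 * C1 * b ^ m \<le> 2 * C1 * g ^ m" using b(1) C1(1) g(3) by (intro mult_left_mono power_mono) auto
    with s have 2: "norm s \<le> 2 * C1 * g ^ m" by linarith
    have "norm (u (k m)) = norm (?P Central + s)" using pc by simp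
    also have "\<dots> \<le> (C2 + 2 * C1) * g ^ m" using norm_triangle_ineq[of "?P Central" s] 1 2 by (simp add: algebra_simps)
    finally show ?thesis .
  qed
  show thesis
  proof (rule that[of "C2 + 2 * C1 + Ce" g])
    show "C2 + 2 * C1 + Ce > 0" using C20 C1 Ce0 by simp
    fix m a x assume m: "m \<ge> 1" and x: "x \<in> J (z (n (k m))) a"
    obtain y where y: "y \<in> J (z (n (k m))) a" "f (z (n (k m))) a y = u (k m) $ a" using upt by blast
    have "\<bar>f (z (n (k m))) a x\<bar> \<le> norm (u (k m)) + eps (k m)"
      using osc[OF x y(1)] y(2) component_le_norm_cart[of "u (k m)" a] by simp
    also have "\<dots> \<le> (C2 + 2 * C1) * g ^ m + Ce * g ^ m"
    proof (rule add_mono[OF main[OF m]])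
      have "\<alpha> ^ m \<le> g ^ m" using eps(4) b g by (intro power_mono) auto
      then show "eps (k m) \<le> Ce * g ^ m" using eps(3)[of m] mult_left_mono[OF _ Ce0] by fastforce
    qed
    finally show "\<bar>f (z (n (k m))) a x\<bar> \<le> (C2 + 2 * C1 + Ce) * g ^ m" by (simp add: algebra_simps)
  qed (use g in auto)
qed

end

context rdc_towers
begin

text \<open>There is no gap between \<open>n 0\<close> and \<open>n 1\<close>, which may both be 0;
  hence the successor.\<close>

lemma n_ge: "j \<ge> 1 \<Longrightarrow> j \<le> Suc (n j)"
proof (induction j rule: dec_induct)
  case (step j)
  then show ?case using n_gap[of j] p1 by simp
qed simp

text \<open>Between two good times the derivative is controlled by the subexponential growth [S].\<close>

lemma log_derivative_decay:
  obtains C \<gamma> where "C > 0" "0 < \<gamma>" "\<gamma> < 1" "\<And>i a x. x \<in> J (z i) a \<Longrightarrow> \<bar>f (z i) a x\<bar> \<le> C * \<gamma> ^ i"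
proof -
  obtain C g where C: "C > 0" "0 < g" "g < 1"
    "\<And>m a x. m \<ge> 1 \<Longrightarrow> x \<in> J (z (n (k m))) a \<Longrightarrow> \<bar>f (z (n (k m))) a x\<bar> \<le> C * g ^ m"
    using good_time_decay by metis
  define c where "c = norm (\<chi> a::'n. (1::real))"
  have c0: "c > 0" unfolding c_def by (rule norm_ones_pos)
  obtain \<epsilon> where \<epsilon>: "\<epsilon> > 0" "exp (\<epsilon> * 1) * g \<le> sqrt g" using geometric_subsequence[OF zero_less_one C(2,3)] by metis
  define g' where "g' = sqrt g"
  have g': "0 < g'" "g' < 1" using C by (auto simp: g'_def)
  let ?Q = "\<lambda>m. matrix_norm (inc (z (n (k m))) (z (n (k (Suc m)))))"
  obtain m0 where m0: "\<And>m. m \<ge> m0 \<Longrightarrow> ln (?Q m) / real m < \<epsilon>"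
    using order_tendstoD(2)[OF S_lim \<epsilon>(1)] by (auto simp: eventually_sequentially)
  have Q: "?Q m \<le> exp (\<epsilon> * real m)" if "m \<ge> m0" "m \<ge> 1" for m
  proof -
    have "?Q m = exp (ln (?Q m))" using matrix_norm_inc_ge_1[of "z (n (k m))" "z (n (k (Suc m)))"] by simp
    also have "\<dots> \<le> exp (\<epsilon> * real m)" using m0[OF that(1)] that(2) by (simp add: pos_divide_less_eq)
    finally show ?thesis .
  qed
  define m1 where "m1 = max m0 1"
  define ab where "ab = max 1 (\<bar>an\<bar> * \<bar>bk\<bar>)"
  have ab: "ab \<ge> 1" by (simp add: ab_def)
  \<comment> \<open>\<open>ab\<close> bounds the Zorich time spent per index \<open>m\<close>, so
    the rate \<open>g'\<close> in \<open>m\<close> becomes this rate in Zorich time.\<close>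
  define \<gamma> where "\<gamma> = g' powr (1 / ab)"
  have ga: "0 < \<gamma>" "\<gamma> < 1" using g' ab powr_less_mono2[of "1 / ab" g' 1] by (auto simp: \<gamma>_def)
  have ga_pow: "g' ^ Suc m \<le> \<gamma> ^ i" if "real i \<le> ab * real (Suc m)" for i m
  proof -
    have "real i * (1 / ab) \<le> real (Suc m)" using that ab by (simp add: field_simps)
    then have "g' powr real (Suc m) \<le> g' powr (1 / ab * real i)" using g' by (intro powr_mono') (auto simp: mult.commute)
    also have "\<dots> = \<gamma> powr real i" by (simp add: \<gamma>_def powr_powr)
    also have "\<dots> = \<gamma> ^ i" by (rule powr_realpow[OF ga(1)])
    finally show ?thesis using g'(1) by (simp only: powr_realpow)
  qed
  define i0 where "i0 = n (k m1)"
  have late: "\<bar>f (z i) a x\<bar> \<le> (c * C / g') * \<gamma> ^ i" if i: "i \<ge> i0" and x: "x \<in> J (z i) a" for i a x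
  proof -
    have ex: "\<exists>m. m \<ge> m1 \<and> n (k m) \<le> i" using i by (auto simp: i0_def)
    have bd: "m \<le> Suc i" if "m \<ge> m1 \<and> n (k m) \<le> i" for m
    proof -
      have "m \<ge> 1" using that by (simp add: m1_def)
      then have "k m \<le> Suc (n (k m))" using k_ge[of m] by (intro n_ge) simp
      then show ?thesis using that k_ge[of m] by linarith
    qed
    \<comment> \<open>The index of the last time \<open>n (k m)\<close> not after \<open>i\<close>;
      the bound \<open>Suc i\<close> guarantees that it exists.\<close>
    define m where "m = (GREATEST m. m \<ge> m1 \<and> n (k m) \<le> i)"
    have m: "m \<ge> m1" "n (k m) \<le> i"
      using GreatestI_ex_nat[OF ex, of "Suc i"] bd by (auto simp: m_def)
    have m': "i < n (k (Suc m))"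
    proof (rule ccontr)
      assume "\<not> i < n (k (Suc m))"
      then have "Suc m \<le> m" unfolding m_def
        using m(1) by (intro Greatest_le_nat[of _ _ "Suc i"]) (auto simp: m_def[symmetric] bd)
      then show False by simp
    qed
    have mm: "m \<ge> m0" "m \<ge> 1" using m(1) by (auto simp: m1_def)
    have "real (length (w (z (n (k m))) (z i) a)) \<le> real (length (w (z (n (k m))) (z (n (k (Suc m)))) a))"
      using m m' by (intro of_nat_mono return_word_length_mono z_mono) auto
    also have "\<dots> \<le> ?Q m * c" unfolding c_def by (rule word_length_norm)
    also have "\<dots> \<le> exp (\<epsilon> * real m) * c" using Q[OF mm] c0 by (intro mult_right_mono) auto
    finally have len: "real (length (w (z (n (k m))) (z i) a)) \<le> exp (\<epsilon> * real m) * c" .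
    have "\<bar>f (z i) a x\<bar> \<le> length (w (z (n (k m))) (z i) a) * (C * g ^ m)"
      by (rule f_propagate[OF z_mono[OF m(2)] x C(4)[OF mm(2)]])
    also have "\<dots> \<le> (exp (\<epsilon> * real m) * c) * (C * g ^ m)" using len C by (intro mult_right_mono) auto
    also have "\<dots> = c * C * (exp (\<epsilon> * 1) * g) ^ m" by (simp add: power_mult_distrib exp_of_nat_mult[symmetric] mult_ac)
    also have "\<dots> \<le> c * C * g' ^ m" unfolding g'_def using \<epsilon>(2) C c0 by (intro mult_left_mono power_mono) auto
    also have "\<dots> = (c * C / g') * g' ^ Suc m" using g'(1) by simp
    also have "\<dots> \<le> (c * C / g') * \<gamma> ^ i"
    proof (intro mult_left_mono ga_pow)
      have "real i \<le> real (n (k (Suc m)))" using m' by simp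
      also have "\<dots> \<le> ab * real (Suc m)" unfolding ab_def by (rule nk_lin) simp
      finally show "real i \<le> ab * real (Suc m)" .
    qed (use C c0 g' in auto)
    finally show ?thesis .
  qed
  define b where "b i = norm (log_slopes (stage T (z i))) + N" for i
  have b: "\<bar>f (z i) a x\<bar> \<le> b i" if "x \<in> J (z i) a" for i a x unfolding b_def by (rule f_le_slopes[OF that])
  have b0: "b i \<ge> 0" for i unfolding b_def using N_nonneg by simp
  \<comment> \<open>The sum covers the finitely many stages before \<open>i0\<close>.\<close>
  define C' where "C' = c * C / g' + (\<Sum>i\<le>i0. b i / \<gamma> ^ i)"
  have C': "c * C / g' > 0" "(\<Sum>i\<le>i0. b i / \<gamma> ^ i) \<ge> 0" using C c0 g' b0 ga by (auto intro!: sum_nonneg)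
  show thesis
  proof (rule that[of C' \<gamma>])
    show "C' > 0" using C' by (simp add: C'_def)
    fix i a x assume x: "x \<in> J (z i) a"
    show "\<bar>f (z i) a x\<bar> \<le> C' * \<gamma> ^ i"
    proof (cases "i \<ge> i0")
      case True
      have "(c * C / g') * \<gamma> ^ i \<le> C' * \<gamma> ^ i" using C' ga unfolding C'_def by (intro mult_right_mono) auto
      then show ?thesis using late[OF True x] by linarith
    next
      case False
      have "b i / \<gamma> ^ i \<le> (\<Sum>i\<le>i0. b i / \<gamma> ^ i)" by (rule member_le_sum) (use False b0 ga in auto)
      also have "\<dots> \<le> C'" unfolding C'_def using C'(1) by linarith
      finally have "b i \<le> C' * \<gamma> ^ i" using ga by (simp add: pos_divide_le_eq)
      then show ?thesis using b[OF x] by linarith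
    qed
  qed (use ga in auto)
qed

end

section \<open>Distance to the standard exchanges\<close>

lemma exp_minus_one_le: "exp t - 1 \<le> t * exp t" for t :: real
proof -
  have "1 - t \<le> exp (- t)" using exp_ge_add_one_self[of "- t"] by simp
  then have "(1 - t) * exp t \<le> exp (- t) * exp t" by (intro mult_right_mono) auto
  then show ?thesis by (simp add: exp_minus algebra_simps)
qed

lemma abs_exp_minus_one_le:
  assumes "\<bar>t\<bar> \<le> s" shows "\<bar>exp t - 1\<bar> \<le> s * exp (s::real)"
proof -
  have s: "0 \<le> s" using assms by linarith
  have "exp t - 1 \<le> s * exp s"
    using exp_minus_one_le[of s] exp_le_cancel_iff[of t s] assms by linarith
  moreover have "- (s * exp s) \<le> exp t - 1"
  proof -
    have "s * 1 \<le> s * exp s" using s by (intro mult_left_mono) auto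
    then show ?thesis using exp_ge_add_one_self[of t] assms by linarith
  qed
  ultimately show ?thesis by linarith
qed

lemma translate_Ioo: "(\<lambda>x. x + c) ` {l<..<r} = {l + c<..<r + c}" for c l r :: real
proof -
  have "x \<in> (\<lambda>x. x + c) ` {l<..<r}" if "x \<in> {l + c<..<r + c}" for x
    by (rule image_eqI[of _ _ "x - c"]) (use that in auto)
  then show ?thesis by auto
qed

lemma standard_branch:
  assumes "S \<in> standard_IETs"
  obtains c where "\<And>x. x \<in> {top_left S a..top_right S a} \<Longrightarrow> branch S a x = x + c"
    "bot_left S a = top_left S a + c" "bot_len S $ a = top_len S $ a" "top_len S $ a > 0"
proof -
  have g: "is_giet 1 S" using assms by (simp add: standard_IETs_def GIETs_def)
  then have tp: "two_partitions S" by (simp add: is_giet_def)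
  note lr = left_less_right[OF tp, of a]
  have "\<exists>c. \<forall>x\<in>top_int S a. gmap S x = x + c" using assms by (simp add: standard_IETs_def)
  then obtain c where c: "\<And>x. x \<in> top_int S a \<Longrightarrow> gmap S x = x + c" by blast
  have "bot_int S a = gmap S ` top_int S a" using g by (simp add: is_giet_def bij_betw_def)
  also have "\<dots> = (\<lambda>x. x + c) ` top_int S a" by (intro image_cong refl c)
  finally have "{bot_left S a<..<bot_right S a} = (\<lambda>x. x + c) ` {top_left S a<..<top_right S a}"
    by (simp add: bot_int_def top_int_def bot_right_def top_right_def)
  also have "\<dots> = {top_left S a + c<..<top_right S a + c}"
    by (rule translate_Ioo)
  finally have "closure {bot_left S a<..<bot_right S a} = closure {top_left S a + c<..<top_right S a + c}" by simp
  then have e: "bot_left S a = top_left S a + c" "bot_right S a = top_right S a + c"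
    using lr by (simp_all add: closure_greaterThanLessThan Icc_eq_Icc)
  have "branch S a x = x + c" if "x \<in> {top_left S a..top_right S a}" for x
    using that e c[of x] by (auto simp: branch_def top_right_def bot_right_def top_int_def)
  moreover have "bot_len S $ a = top_len S $ a" using e by (simp add: bot_right_def top_right_def)
  ultimately show thesis using that[of c] e(1) tp by (simp add: two_partitions_def)
qed

lemma standard_profile:
  assumes S: "S \<in> standard_IETs" and s: "s \<in> {0..1}"
  shows "profile S a s = s"
proof -
  obtain c where c: "\<And>x. x \<in> {top_left S a..top_right S a} \<Longrightarrow> branch S a x = x + c"
    "bot_left S a = top_left S a + c" "bot_len S $ a = top_len S $ a" "top_len S $ a > 0"
    using standard_branch[OF S] by blast
  have "s * top_len S $ a \<le> 1 * top_len S $ a" using s c(4) by (intro mult_right_mono) auto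
  then have "top_left S a + s * top_len S $ a \<in> {top_left S a..top_right S a}"
    using s c(4) by (simp add: top_right_def)
  from c(1)[OF this] show ?thesis using c(4) by (simp add: profile_def c(2,3))
qed

lemma unit_deriv_eq:
  assumes "(g has_real_derivative g') (at x within {0..1})" "x \<in> {0..1}"
  shows "unit_deriv g x = g'"
  unfolding unit_deriv_def
  using assms by (intro vector_derivative_within_cbox[of 0 1, simplified])
    (auto simp: has_real_derivative_iff_has_vector_derivative)

lemma standard_unit_deriv:
  assumes S: "S \<in> standard_IETs" and s: "s \<in> {0..1}"
  shows "unit_deriv (profile S a) s = 1"
proof (rule unit_deriv_eq[OF _ s])
  have "((\<lambda>x. x) has_real_derivative 1) (at s within {0..1})" by (rule DERIV_ident)
  then show "(profile S a has_real_derivative 1) (at s within {0..1})"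
    using has_field_derivative_transform_within[OF _ zero_less_one s, of "\<lambda>x. x" 1 "profile S a"]
      standard_profile[OF S] by simp
qed

lemma unit_sup_cong: "(\<And>x. x \<in> {0..1} \<Longrightarrow> g x = h x) \<Longrightarrow> unit_sup g = unit_sup h"
  unfolding unit_sup_def by (intro SUP_cong refl) simp

lemma unit_sup_le: "(\<And>x. x \<in> {0..1} \<Longrightarrow> \<bar>g x\<bar> \<le> c) \<Longrightarrow> unit_sup g \<le> c"
  unfolding unit_sup_def by (intro cSUP_least) auto

text \<open>The infimum can be bounded by a member only if the distances are bounded below. All
  standard exchanges have the identity as profile, so their profile term is one and the same number
  \<open>B\<close>, which serves as a lower bound.\<close>

lemma dist_C1_standard_le:
  assumes S: "S \<in> standard_IETs"
  shows "dist_C1_standard T \<le> dist_C1 T S"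
proof -
  define B where "B = (\<Sum>a\<in>UNIV. unit_sup (\<lambda>x. profile T a x - x) + unit_sup (\<lambda>x. unit_deriv (profile T a) x - 1))"
  have "B \<le> dist_C1 T S" if S: "S \<in> standard_IETs" for S
  proof -
    have "B = (\<Sum>a\<in>UNIV. unit_sup (\<lambda>x. profile T a x - profile S a x)
                  + unit_sup (\<lambda>x. unit_deriv (profile T a) x - unit_deriv (profile S a) x))"
      unfolding B_def
      by (intro sum.cong arg_cong2[of _ _ _ _ "(+)"] unit_sup_cong refl)
        (simp_all add: standard_profile[OF S] standard_unit_deriv[OF S])
    then show ?thesis unfolding dist_C1_def by simp
  qed
  then have "bdd_below (dist_C1 T ` standard_IETs)" by (intro bdd_belowI2)
  then show ?thesis unfolding dist_C1_standard_def using S by (intro cINF_lower)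
qed

lemma Cr_diffeo_pos_translation:
  fixes l r c :: real
  shows "Cr_diffeo_pos 1 (\<lambda>x. x + c) {l..r} {l + c..r + c}"
proof -
  have im: "(\<lambda>x. x + c) ` {l..r} = {l + c..r + c}" by (simp add: add.commute)
  have inj: "inj_on (\<lambda>x. x + c) {l..r}" by (simp add: inj_on_def)
  have tr: "Cr_on 1 g A" if "\<And>x. x \<in> A \<Longrightarrow> g x = x + d" for g A d
    unfolding Cr_on_def
    by (rule exI[of _ "\<lambda>i x. if i = 0 then x + d else 1"]) (use that in \<open>auto intro!: derivative_eq_intros\<close>)
  have "inv_into {l..r} (\<lambda>x. x + c) y = y + (- c)" if "y \<in> {l + c..r + c}" for y
    by (rule inv_into_f_eq[OF inj]) (use that in auto)
  then have "Cr_on 1 (inv_into {l..r} (\<lambda>x. x + c)) {l + c..r + c}" by (rule tr)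
  moreover have "Cr_on 1 (\<lambda>x. x + c) {l..r}" by (rule tr[of _ _ c]) simp
  ultimately show ?thesis
    unfolding Cr_diffeo_pos_def bij_betw_def using inj im by (simp add: strict_mono_on_def)
qed

context renormalizable
begin

text \<open>The bottom row is laid out again with the top lengths, which turns every branch into a
  translation.\<close>

lemma standardization:
  obtains S where "S \<in> standard_IETs" "top_row S = top_row (stage T i)" "bot_row S = bot_row (stage T i)"
    "top_len S = top_len (stage T i)" "bot_len S = top_len (stage T i)"
proof -
  let ?X = "stage T i"
  define S0 where "S0 = ?X\<lparr>bot_len := top_len ?X\<rparr>"
  \<comment> \<open>At most one term is nonzero, as the open top intervals are disjoint.\<close>
  define S where "S = S0\<lparr>gmap := \<lambda>x. \<Sum>a\<in>UNIV. if x \<in> top_int ?X a then x + (bot_left S0 a - top_left ?X a) else 0\<rparr>"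
  have sel: "top_row S = top_row ?X" "bot_row S = bot_row ?X" "top_len S = top_len ?X" "bot_len S = top_len ?X"
    by (simp_all add: S_def S0_def)
  have ti: "top_int S a = top_int ?X a" "top_left S a = top_left ?X a" "bot_left S a = bot_left S0 a" for a
    using sel by (simp_all add: top_int_def top_left_def bot_left_def S0_def)
  have disj: "a = b" if "x \<in> top_int ?X a" "x \<in> top_int ?X b" for a b x
    using oJ_disjoint[of "scale T i * x" i a b] that scale_pos[of i]
    by (auto simp: oJ_def top_int_def lo_def hi_def top_right_def)
  have g: "gmap S x = x + (bot_left S a - top_left S a)" if x: "x \<in> top_int S a" for a x
  proof -
    have gm: "gmap S x = (\<Sum>b\<in>UNIV. if x \<in> top_int ?X b then x + (bot_left S0 b - top_left ?X b) else 0)"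
      by (simp add: S_def)
    have "x \<in> top_int ?X b \<longleftrightarrow> b = a" for b using x disj unfolding ti(1) by blast
    then have "gmap S x = (\<Sum>b\<in>UNIV. if b = a then x + (bot_left S0 b - top_left ?X b) else 0)"
      unfolding gm by (intro sum.cong) auto
    then show ?thesis by (simp add: ti)
  qed
  have tp: "two_partitions S" using stage_tp[of i] by (simp add: two_partitions_def sel)
  have "is_giet 1 S"
    unfolding is_giet_def
  proof (intro conjI allI tp)
    fix a
    let ?c = "bot_left S a - top_left S a"
    have e: "bot_left S a = top_left S a + ?c" "bot_right S a = top_right S a + ?c"
      by (simp_all add: bot_right_def top_right_def sel)
    have o: "top_int S a = {top_left S a<..<top_right S a}" "bot_int S a = {bot_left S a<..<bot_right S a}"
      by (simp_all add: top_int_def bot_int_def top_right_def bot_right_def)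
    have "bij_betw (\<lambda>x. x + ?c) (top_int S a) (bot_int S a)"
    proof -
      have "(\<lambda>x. x + ?c) ` top_int S a = bot_int S a"
        unfolding o translate_Ioo e[symmetric] ..
      then show ?thesis by (simp add: bij_betw_def inj_on_def)
    qed
    then show "bij_betw (gmap S) (top_int S a) (bot_int S a)"
      using g[of _ a] by (subst bij_betw_cong[of _ _ "\<lambda>x. x + ?c"]) auto
    show "\<exists>f. (\<forall>x\<in>top_int S a. f x = gmap S x) \<and>
        Cr_diffeo_pos 1 f (closure (top_int S a)) (closure (bot_int S a))"
      using g[of _ a] Cr_diffeo_pos_translation[of ?c "top_left S a" "top_right S a"] e
      unfolding closure_ints[OF tp] by (intro exI[of _ "\<lambda>x. x + ?c"]) simp
  qed
  moreover have "irreducible_datum S" using stage_irr[of i] by (simp add: irreducible_datum_def sel)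
  ultimately have "S \<in> standard_IETs" using g by (auto simp: standard_IETs_def GIETs_def)
  then show thesis using that sel by blast
qed

end

context smooth_renormalizable
begin

text \<open>The profile is the unscaled branch between affine maps, so its derivative is that of the
  branch divided by the mean slope.\<close>

lemma profile_deriv:
  assumes s: "s \<in> {0..1}"
  obtains x where "x \<in> J i a" "(profile (stage T i) a has_real_derivative
    exp (f i a x - log_slopes (stage T i) $ a)) (at s within {0..1})"
proof -
  let ?X = "stage T i" and ?g = "\<lambda>s. lo T i a + s * (hi T i a - lo T i a)"
  have lh: "lo T i a < hi T i a" by (rule lo_hi)
  have pos: "top_len ?X $ a > 0" "bot_len ?X $ a > 0" using stage_tp[of i] by (auto simp: two_partitions_def)
  have sc: "scale T i > 0" by (rule scale_pos)
  have len: "hi T i a - lo T i a = scale T i * top_len ?X $ a"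
    by (simp add: lo_def hi_def top_right_def algebra_simps)
  have gJ: "?g t \<in> J i a" if "t \<in> {0..1}" for t
  proof -
    have "0 \<le> t * (hi T i a - lo T i a)" "t * (hi T i a - lo T i a) \<le> hi T i a - lo T i a"
      using that lh by (auto intro!: mult_nonneg_nonneg mult_left_le_one_le)
    then show ?thesis unfolding J_iff by auto
  qed
  have prof: "profile ?X a t = (Rst T i a (?g t) / scale T i - bot_left ?X a) / bot_len ?X $ a" if t: "t \<in> {0..1}" for t
  proof -
    have "?g t / scale T i = top_left ?X a + t * top_len ?X $ a"
      unfolding len using sc by (simp add: lo_def field_simps)
    then show ?thesis using scaled_branch[of "?g t" i a] gJ[OF t] sc by (simp add: profile_def J_def)
  qed
  have "(?g has_real_derivative (hi T i a - lo T i a)) (at s within {0..1})"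
    by (auto intro!: derivative_eq_intros)
  moreover have "(Rst T i a has_real_derivative D i a (?g s)) (at (?g s) within ?g ` {0..1})"
    by (rule has_field_derivative_subset[OF R_deriv[OF gJ[OF s]]]) (use gJ in blast)
  ultimately have "((Rst T i a \<circ> ?g) has_real_derivative D i a (?g s) * (hi T i a - lo T i a)) (at s within {0..1})"
    by (intro DERIV_image_chain)
  then have "((\<lambda>t. (Rst T i a (?g t) / scale T i - bot_left ?X a) / bot_len ?X $ a) has_real_derivative
    (D i a (?g s) * (hi T i a - lo T i a) / scale T i - 0) / bot_len ?X $ a) (at s within {0..1})"
    unfolding o_def by (intro DERIV_cdivide DERIV_diff DERIV_const)
  also have "(D i a (?g s) * (hi T i a - lo T i a) / scale T i - 0) / bot_len ?X $ a
    = exp (f i a (?g s) - log_slopes ?X $ a)"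
    using pos sc unfolding len by (simp add: D_exp exp_diff log_slopes_def)
  finally have "(profile ?X a has_real_derivative exp (f i a (?g s) - log_slopes ?X $ a)) (at s within {0..1})"
    by (rule has_field_derivative_transform_within[OF _ zero_less_one s]) (use prof in auto)
  then show thesis using that gJ[OF s] by blast
qed

text \<open>With equal rows and top lengths only slopes and profiles contribute. Per label, the
  slopes give one term \<open>E * exp (2 * E)\<close> and the profile and its derivative two such
  terms each, whence the 5.\<close>

lemma dist_standard_bound:
  assumes E: "\<And>a x. x \<in> J i a \<Longrightarrow> \<bar>f i a x\<bar> \<le> E"
  shows "dist_C1_standard (stage T i) \<le> 5 * CARD('n) * exp (2 * E) * E"
proof -
  let ?X = "stage T i"
  define e where "e = 2 * E * exp (2 * E)"
  obtain S where S: "S \<in> standard_IETs" "top_row S = top_row ?X" "bot_row S = bot_row ?X"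
    "top_len S = top_len ?X" "bot_len S = top_len ?X"
    using standardization by blast
  have E0: "E \<ge> 0" using E[OF lo_in] by force
  have ls: "\<bar>log_slopes ?X $ a\<bar> \<le> E" for a using slope_point[of i a] E by metis
  have pos: "top_len ?X $ a > 0" "bot_len ?X $ a > 0" for a using stage_tp[of i] by (auto simp: two_partitions_def)
  have d: "\<exists>g'. (profile ?X a has_real_derivative g') (at s within {0..1}) \<and> \<bar>g' - 1\<bar> \<le> e" if s: "s \<in> {0..1}" for a s
  proof -
    obtain x where x: "x \<in> J i a" "(profile ?X a has_real_derivative exp (f i a x - log_slopes ?X $ a)) (at s within {0..1})"
      using profile_deriv[OF s] by blast
    have "\<bar>f i a x - log_slopes ?X $ a\<bar> \<le> 2 * E" using E[OF x(1)] ls[of a] by linarith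
    from abs_exp_minus_one_le[OF this] show ?thesis using x(2) by (auto simp: e_def)
  qed
  have ud: "\<bar>unit_deriv (profile ?X a) s - unit_deriv (profile S a) s\<bar> \<le> e" if s: "s \<in> {0..1}" for a s
    using d[OF s, of a] unit_deriv_eq[OF _ s, of "profile ?X a"] standard_unit_deriv[OF S(1) s] by auto
  have p0: "profile ?X a 0 = 0" for a using pos by (simp add: profile_def branch_def)
  have pr: "\<bar>profile ?X a s - profile S a s\<bar> \<le> e" if s: "s \<in> {0..1}" for a s
  proof -
    have "\<forall>t\<in>{0..1}. \<exists>g'. (profile ?X a has_real_derivative g') (at t within {0..1}) \<and> \<bar>g' - 1\<bar> \<le> e"
      using d by blast
    from bchoice[OF this] obtain g' where g':
      "\<forall>t\<in>{0..1}. (profile ?X a has_real_derivative g' t) (at t within {0..1}) \<and> \<bar>g' t - 1\<bar> \<le> e" ..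
    have "norm ((profile ?X a s - s) - (profile ?X a 0 - 0)) \<le> e * norm (s - 0)"
      by (rule field_differentiable_bound[of "{0..1}" "\<lambda>t. profile ?X a t - t" "\<lambda>t. g' t - 1"])
        (use g' s in \<open>auto intro: DERIV_diff DERIV_ident\<close>)
    also have "\<dots> \<le> e * 1" using s E0 by (intro mult_left_mono) (auto simp: e_def)
    finally show ?thesis using standard_profile[OF S(1) s] p0 by simp
  qed
  have "dist (slopes ?X) (slopes S) \<le> (\<Sum>a\<in>UNIV. \<bar>(slopes ?X - slopes S) $ a\<bar>)"
    unfolding dist_norm by (rule norm_le_l1_cart)
  also have "\<dots> \<le> (\<Sum>a\<in>(UNIV :: 'n set). E * exp E)"
  proof (rule sum_mono)
    fix a
    have "slopes ?X $ a = exp (log_slopes ?X $ a)" using pos[of a] by (simp add: slopes_def log_slopes_def)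
    moreover have "slopes S $ a = 1" using pos(1)[of a] S by (simp add: slopes_def)
    ultimately show "\<bar>(slopes ?X - slopes S) $ a\<bar> \<le> E * exp E" using abs_exp_minus_one_le[OF ls[of a]] by simp
  qed
  also have "\<dots> \<le> (\<Sum>a\<in>(UNIV :: 'n set). E * exp (2 * E))" using E0 by (intro sum_mono mult_left_mono) auto
  finally have sl: "dist (slopes ?X) (slopes S) \<le> CARD('n) * (E * exp (2 * E))" by simp
  have "dist_C1_standard ?X \<le> dist_C1 ?X S" by (rule dist_C1_standard_le[OF S(1)])
  also have "\<dots> = dist (slopes ?X) (slopes S) + (\<Sum>a\<in>UNIV. unit_sup (\<lambda>x. profile ?X a x - profile S a x)
      + unit_sup (\<lambda>x. unit_deriv (profile ?X a) x - unit_deriv (profile S a) x))"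
    by (simp add: dist_C1_def S dist_Pair_Pair)
  also have "\<dots> \<le> CARD('n) * (E * exp (2 * E)) + (\<Sum>a\<in>(UNIV :: 'n set). e + e)"
    by (intro add_mono sl sum_mono unit_sup_le pr ud)
  also have "\<dots> = 5 * CARD('n) * exp (2 * E) * E" by (simp add: e_def)
  finally show ?thesis .
qed

end

lemma limsup_ratio_linear:
  fixes k :: "nat \<Rightarrow> nat"
  assumes "limsup (\<lambda>m. ereal (real (k m) / real m)) < \<infinity>"
  obtains b where "\<And>m. m \<ge> 1 \<Longrightarrow> real (k m) \<le> b * real m"
proof -
  obtain c where c: "limsup (\<lambda>m. ereal (real (k m) / real m)) < ereal c"
    using ereal_dense2[OF assms] by blast
  have "\<forall>\<^sub>F m in sequentially. ereal (real (k m) / real m) < ereal c" by (rule Limsup_lessD[OF c])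
  then obtain m0 where m0: "\<And>m. m \<ge> m0 \<Longrightarrow> real (k m) / real m < c" by (auto simp: eventually_sequentially)
  have "real (k m) \<le> (\<bar>c\<bar> + (\<Sum>i\<le>m0. real (k i))) * real m" if m: "m \<ge> 1" for m
  proof (cases "m \<ge> m0")
    case True
    have "real (k m) \<le> c * real m" using m0[OF True] m by (simp add: pos_divide_less_eq)
    also have "\<dots> \<le> (\<bar>c\<bar> + (\<Sum>i\<le>m0. real (k i))) * real m"
    proof (rule mult_right_mono)
      have "0 \<le> (\<Sum>i\<le>m0. real (k i))" by (intro sum_nonneg) auto
      then show "c \<le> \<bar>c\<bar> + (\<Sum>i\<le>m0. real (k i))" by linarith
    qed simp
    finally show ?thesis .
  next
    case False
    have "real (k m) \<le> (\<Sum>i\<le>m0. real (k i))" by (rule member_le_sum) (use False in auto)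
    also have "\<dots> \<le> \<bar>c\<bar> + (\<Sum>i\<le>m0. real (k i))" by simp
    also have "\<dots> \<le> (\<bar>c\<bar> + (\<Sum>i\<le>m0. real (k i))) * real m"
      using m mult_left_mono[of 1 "real m" "\<bar>c\<bar> + (\<Sum>i\<le>m0. real (k i))"] by (simp add: sum_nonneg)
    finally show ?thesis .
  qed
  then show thesis by (rule that)
qed

lemma convergent_ratio_linear:
  fixes n :: "nat \<Rightarrow> nat"
  assumes "convergent (\<lambda>j. real (n j) / real j)" "n 0 = 0"
  obtains a where "\<And>j. real (n j) \<le> a * real j"
proof -
  obtain a where a: "\<And>j. norm (real (n j) / real j) \<le> a"
    using convergent_imp_Bseq[OF assms(1)] by (auto simp: Bseq_def)
  have "real (n j) \<le> a * real j" for j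
    using a[of j] assms(2) by (cases "j = 0") (auto simp: pos_divide_le_eq)
  then show thesis by (rule that)
qed

text \<open>Entries are cardinalities.\<close>

lemma cocycle_pos_ge_1: "cocycle S i j $ a $ b > 0 \<Longrightarrow> cocycle S i j $ a $ b \<ge> 1"
  by (simp add: cocycle_def Let_def)

theorem theoremE:
  fixes T :: "'n::finite giet" and n k :: "nat \<Rightarrow> nat"
  assumes "CARD('n) \<ge> 2"
    and "T \<in> GIETs 3"
    and "GIET_RDC T n k"
    and "bounded (range (\<lambda>m. log_slopes (zorich (n (k m)) T)))"
    and "\<forall>C \<in> bcycles T. boundary T C = 0"
  shows "\<exists>K\<^sub>1 > 0. \<exists>\<alpha>. 0 < \<alpha> \<and> \<alpha> < 1 \<and>
           (\<forall>N. dist_C1_standard (zorich N T) \<le> K\<^sub>1 * \<alpha> ^ N)"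
proof -
  have T: "is_giet 3 T" "irreducible_datum T" using assms(2) by (auto simp: GIETs_def)
  have rdc: "infinitely_renormalizable T" "irrational_rotation (rotation_number T)"
    "rotation_RDC (rotation_number T) n k"
    using assms(3) by (auto simp: GIET_RDC_def)
  \<comment> \<open>The RDC speaks about a standard exchange \<open>S\<close> with the rotation
    number of \<open>T\<close>. Matrices, Zorich times and genus are transferred to \<open>T\<close>
    through the common rows and return words.\<close>
  obtain S where S: "S \<in> standard_IETs" "infinitely_renormalizable S" "rotation_number S = rotation_number T"
    "IET_RDC S n k"
    using rdc(3) by (auto simp: rotation_RDC_def)
  interpret X: renormalizable T
    by unfold_locales (use is_giet_mono[OF T(1)] T(2) assms(1) rdc(1) in auto)
  interpret Y: renormalizable S
    by unfold_locales (use S(1,2) is_giet_mono[of 1 S 0] assms(1) in \<open>auto simp: standard_IETs_def GIETs_def\<close>)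
  obtain f0 eta K where smooth: "smooth_towers (al T) (be T) (tw T) (lo T) (hi T) (branch T) f0 eta K"
    "\<And>n cl cr. X.cons_at n cl cr \<Longrightarrow> X.bd f0 n cl cr = 0"
    using X.smooth_data[OF T(1) assms(5)] by metis
  let ?z = "zorich_time T"
  note det = rotation_determines[OF S(3)]
  have z_mono: "?z i \<le> ?z j" if "i \<le> j" for i j by (rule X.zorich_time_mono[OF rdc(2) that])
  have coc: "cocycle S i j = X.inc (?z i) (?z j)" if "i \<le> j" for i j
    using Y.cocycle_eq[of i j] z_mono[OF that] by (simp add: det(1-4))
  have "bcycles S = bcycles T" using det(5,6)[of 0] by (simp add: bcycles_def)
  then have genus: "genus S = genus T" by (simp add: genus_def)
  obtain G where G: "oseledets_extension S G" "good_return_times S n"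
    "convergent (\<lambda>j. real (n j) / real j)" "strict_mono k"
    "limsup (\<lambda>m. ereal (real (k m) / real m)) < \<infinity>"
    and KS: "\<exists>Kminus>0. \<exists>Kplus>0. \<exists>\<delta>>0.
           (\<forall>m. (\<Sum>j = 1..k m. matrix_norm_on (cocycle S (n j) (n (k m))) (G Stable (n j))
                    * onorm (split_proj G Stable (n j)) * matrix_norm (cocycle S (n (j - 1)) (n (Suc (j - 1))))) \<le> Kminus) \<and>
           (\<forall>m. summable (\<lambda>i. matrix_norm_on (matrix_inv (cocycle S (n (k m)) (n (k m + 1 + i)))) (G Unstable (n (k m + 1 + i)))
                    * onorm (split_proj G Unstable (n (k m + 1 + i)))
                    * matrix_norm (cocycle S (n (k m + 1 + i - 1)) (n (Suc (k m + 1 + i - 1))))) \<and>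
                (\<Sum>i. matrix_norm_on (matrix_inv (cocycle S (n (k m)) (n (k m + 1 + i)))) (G Unstable (n (k m + 1 + i)))
                    * onorm (split_proj G Unstable (n (k m + 1 + i)))
                    * matrix_norm (cocycle S (n (k m + 1 + i - 1)) (n (Suc (k m + 1 + i - 1))))) \<le> Kplus) \<and>
           ((\<lambda>m. ln (matrix_norm (cocycle S (n (k m)) (n (k (Suc m))))) / real m) \<longlonglongrightarrow> 0) \<and>
           (\<forall>m x y. x \<noteq> y \<and> G x (n (k m)) \<noteq> {0} \<and> G y (n (k m)) \<noteq> {0} \<longrightarrow>
              min_angle (G x (n (k m))) (G y (n (k m))) > \<delta>)"
    using S(4) unfolding IET_RDC_def Let_def by blast
  obtain Km Kp where Km: "\<forall>m. (\<Sum>j = 1..k m. matrix_norm_on (cocycle S (n j) (n (k m))) (G Stable (n j))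
                    * onorm (split_proj G Stable (n j)) * matrix_norm (cocycle S (n (j - 1)) (n (Suc (j - 1))))) \<le> Km"
    and Kp: "\<forall>m. summable (\<lambda>i. matrix_norm_on (matrix_inv (cocycle S (n (k m)) (n (k m + 1 + i)))) (G Unstable (n (k m + 1 + i)))
                    * onorm (split_proj G Unstable (n (k m + 1 + i)))
                    * matrix_norm (cocycle S (n (k m + 1 + i - 1)) (n (Suc (k m + 1 + i - 1))))) \<and>
      (\<Sum>i. matrix_norm_on (matrix_inv (cocycle S (n (k m)) (n (k m + 1 + i)))) (G Unstable (n (k m + 1 + i)))
                    * onorm (split_proj G Unstable (n (k m + 1 + i)))
                    * matrix_norm (cocycle S (n (k m + 1 + i - 1)) (n (Suc (k m + 1 + i - 1))))) \<le> Kp"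
    and Slim: "(\<lambda>m. ln (matrix_norm (cocycle S (n (k m)) (n (k (Suc m))))) / real m) \<longlonglongrightarrow> 0"
    using KS by (elim exE conjE) (rule that)
  obtain p A S' where n0: "n 0 = 0" and p: "p \<ge> 1" "\<forall>i j. A $ i $ j > 0" "A = cocycle S' 0 p"
    "\<forall>k\<ge>1. cocycle S (n k) (n k + 2 * p) = A ** A \<and> n k + 2 * p \<le> n (Suc k)"
    using G(2) unfolding good_return_times_def by blast
  have n_Suc: "n j \<le> n (Suc j)" for j using p(4)[rule_format, of j] n0 by (cases j) auto
  have n_mono: "n i \<le> n j" if "i \<le> j" for i j by (rule lift_Suc_mono_le[of n, OF n_Suc that])
  have k_mono: "k i \<le> k j" if "i \<le> j" for i j using G(4) that by (simp add: strict_mono_less_eq)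
  obtain an where an: "\<And>j. real (n j) \<le> an * real j" using convergent_ratio_linear[OF G(3) n0] by blast
  obtain bk where bk: "\<And>m. m \<ge> 1 \<Longrightarrow> real (k m) \<le> bk * real m" using limsup_ratio_linear[OF G(5)] by blast
  obtain U where U: "\<And>m. norm (log_slopes (zorich (n (k m)) T)) \<le> U"
    using assms(4) by (auto simp: bounded_iff)
  note O = G(1)[unfolded oseledets_extension_def]
  note O1 = conjunct1[OF O] and O2 = conjunct1[OF conjunct2[OF O]]
    and O3 = conjunct1[OF conjunct2[OF conjunct2[OF O]]] and O4 = conjunct1[OF conjunct2[OF conjunct2[OF conjunct2[OF O]]]]
  obtain \<theta> C\<theta> where \<theta>: "\<theta> > 0" "\<And>i v. v \<in> G Stable 0 \<Longrightarrow> norm (cocycle S 0 i *v v) \<le> C\<theta> * exp (- \<theta> * real i) * norm v"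
    using O3 by blast
  have ose: "splitting_at G i" "dim (G Stable i) = genus S" for i
    using O1 by (auto simp: splitting_at_def)
  have map: "(\<lambda>v. cocycle S i j *v v) ` G x i = G x j" if "i \<le> j" for i j x using O2 that by blast
  have cen: "(\<lambda>n. ln (norm (cocycle S 0 n *v v)) / real n) \<longlonglongrightarrow> 0" if "v \<in> G Central 0" "v \<noteq> 0" for v
    using O4 that by blast
  have cb: "cocycle S (n i) (n j) = X.inc (?z (n i)) (?z (n j))" if "i \<le> j" for i j
    by (rule coc[OF n_mono[OF that]])
  interpret R: rdc_towers T f0 eta K G n k ?z p A U \<theta> C\<theta> Km Kp an bk
  proof (intro rdc_towers.intro rdc_towers_axioms.intro)
    show "smooth_renormalizable T f0 eta K"
      by (intro smooth_renormalizable.intro smooth_renormalizable_axioms.intro X.renormalizable_axioms smooth)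
    show "1 \<le> A $ i $ j" for i j using p(2,3) cocycle_pos_ge_1 by metis
    show "X.inc (?z (n j)) (?z (n j + 2 * p)) = A ** A" if "j \<ge> 1" for j
      using p(4) that coc[of "n j" "n j + 2 * p"] by simp
    show "dim (G Stable 0) = genus T" using ose(2) genus by simp
    show "(\<lambda>v. X.inc (?z i) (?z j) *v v) ` G x i = G x j" if "i \<le> j" for i j x
      using map[OF that] coc[OF that] by simp
    show "norm (X.inc (?z 0) (?z i) *v v) \<le> C\<theta> * exp (- \<theta> * real i) * norm v" if "v \<in> G Stable 0" for i v
      using \<theta>(2)[OF that, of i] coc[of 0 i] by simp
    show "(\<lambda>i. ln (norm (X.inc (?z 0) (?z i) *v v)) / real i) \<longlonglongrightarrow> 0" if "v \<in> G Central 0" "v \<noteq> 0" for v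
      using cen[OF that] coc[of 0] by simp
    show "(\<Sum>j = 1..k m. matrix_norm_on (X.inc (?z (n j)) (?z (n (k m)))) (G Stable (n j))
                    * onorm (split_proj G Stable (n j)) * matrix_norm (X.inc (?z (n (j - 1))) (?z (n (Suc (j - 1)))))) \<le> Km" for m
      using Km[rule_format, of m] by (simp add: cb cong: sum.cong_simp)
    show "norm (log_slopes (stage T (?z (n (k m))))) \<le> U" for m using U[of m] by (simp add: zorich_def)
    show "(\<lambda>m. ln (matrix_norm (X.inc (?z (n (k m))) (?z (n (k (Suc m)))))) / real m) \<longlonglongrightarrow> 0"
      using Slim by (simp add: cb k_mono)
  qed (use rdc(2) n0 p an bk G(4) ose(1) \<theta>(1) Kp in \<open>simp_all add: cb\<close>)
  obtain C \<gamma> where C: "C > 0" "0 < \<gamma>" "\<gamma> < 1" "\<And>i a x. x \<in> X.J (?z i) a \<Longrightarrow> \<bar>R.f (?z i) a x\<bar> \<le> C * \<gamma> ^ i"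
    using R.log_derivative_decay by metis
  show ?thesis
  proof (intro exI conjI allI)
    show "5 * CARD('n) * exp (2 * C) * C > 0" using C(1) by simp
    show "0 < \<gamma>" "\<gamma> < 1" by (rule C)+
    fix i
    \<comment> \<open>This makes the factor \<open>exp (2 * E)\<close> uniform in \<open>i\<close>,
      so only the linear factor carries the decay.\<close>
    have le: "C * \<gamma> ^ i \<le> C" using C by (simp add: power_le_one mult_left_le)
    have "dist_C1_standard (zorich i T) \<le> 5 * CARD('n) * exp (2 * (C * \<gamma> ^ i)) * (C * \<gamma> ^ i)"
      unfolding zorich_def by (rule R.dist_standard_bound[OF C(4)])
    also have "\<dots> \<le> 5 * CARD('n) * exp (2 * C) * (C * \<gamma> ^ i)"
      using le C by (intro mult_right_mono mult_left_mono) auto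
    finally show "dist_C1_standard (zorich i T) \<le> 5 * CARD('n) * exp (2 * C) * C * \<gamma> ^ i" by (simp add: mult.assoc)
  qed
qed

end
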